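(* The following hold. (i) Let $n=ab\ge 6$ with $a,b>1$. Then $$[n-2,2]\cdot[a^b]=[a^b]+\chi_{(a>2)}[a^{b-1},a-1,1]+[a^{b-2},(a-1)^2,1^2]+\chi_{(b>3)}[(a+1)^2,a^{b-4},(a-1)^2]$$ $$+\chi_{(b>2)}[a+1,a^{b-2},a-1]+\chi_{(b>2)}[a+1,a^{b-3},(a-1)^2,1]+[a+2,a^{b-2},a-2]$$ $$+\chi_{(a>2)}[a+1,a^{b-2},a-2,1]+\chi_{(a>3)}[a^{b-1},a-2,2].$$ (ii) Let $n=ab$ with $a\ge b>1$. Then $$[n-2,1^2]\cdot[a^b]=\chi_{(b>2)}[a+2,a^{b-3},(a-1)^2]+[a+1,a^{b-2},a-1]+[a+1,a^{b-2},a-2,1]+[a^{b-2},(a-1)^2,2]$$ $$+\chi_{(b>2)}[a+1,a^{b-3},(a-1)^2,1]+\chi_{(b>2)}[(a+1)^2,a^{b-3},a-2]+[a^{b-1},a-2,1^2]+[a^{b-1},a-1,1].$$ (iii) Let $n=2k>16$. Then $$[n-3,3]\cdot[k,k]=[k+1,k-1]+[k+1,k-2,1]+[k,k-1,1]+[k,k-2,1^2]+[k,k-2,2]+[k,k-3,3]$$ $$+[k-1,k-1,2]+[k-1,k-2,2,1]+[k+3,k-3]+[k+2,k-3,1]+[k+1,k-3,2].$$ Moreover, for $6\le n\le 16$, the remaining multiplicity-free products of the form $[n-3,3]\cdot[\lambda]$ with $\lambda\vdash n$, i.e. those for which $\lambda$ is not one of $(n)$, $(n-1,1)$, or $(k,k)$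 (where $n=2k$) up to conjugation, are precisely those with $\lambda\in\{(4,2),(4,1^2),(4,3),(3^3)\}$ up to conjugation, for the corresponding $n$.
   Context: For a partition $\lambda$ of $n$, $[\lambda]$ denotes the irreducible complex character of the symmetric group $\mathfrak{S}_n$ labelled by $\lambda$; by convention $[\lambda]=0$ if the sequence $\lambda$ is not a partition. The product $\cdot$ is the pointwise (inner tensor, Kronecker) product of characters. Exponents in partitions denote repeated parts. For a condition such as $x>y$, $\chi_{(x>y)}$ equals $1$ if $x>y$ and $0$ otherwise (terms with coefficient $0$ are omitted, even if the corresponding sequence is not defined). A character is multiplicity-free if each irreducible character occurs in it with multiplicity at most $1$. "Up to conjugation" refers to replacing $\lambda$ by its conjugate (transpose) partition. *)

theory Defs
  imports
    Complex_Main
    "HOL-Library.Function_Algebras"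
    "HOL-Combinatorics.Permutations"
    "HOL-Algebra.Sym_Groups"
begin

section \<open>Complex representations and characters\<close>

text \<open>
  Representation spaces are finite-dimensional subspaces of a function space
  \<open>'x \<Rightarrow> complex\<close>. Up to isomorphism this covers every finite-dimensional complex
  vector space as soon as \<open>'x\<close> is infinite. Sums and products of functions are the pointwise ones
  of \<^theory>\<open>HOL-Library.Function_Algebras\<close>.
\<close>

definition cscale :: "complex \<Rightarrow> ('x \<Rightarrow> complex) \<Rightarrow> 'x \<Rightarrow> complex"
  where "cscale c f = (\<lambda>x. c * f x)"

global_interpretation cfun: vector_space cscale
  by standard (simp_all add: cscale_def fun_eq_iff algebra_simps)

definition rep_on ::
    "('g, 'm) monoid_scheme \<Rightarrow> ('x \<Rightarrow> complex) set \<Rightarrow> ('g \<Rightarrow> ('x \<Rightarrow> complex) \<Rightarrow> ('x \<Rightarrow> complex)) \<Rightarrow> bool"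
  where "rep_on G W \<rho> \<longleftrightarrow>
    (\<exists>B. finite B \<and> cfun.span B = W) \<and>
    (\<forall>g\<in>carrier G. \<forall>u\<in>W. \<rho> g u \<in> W) \<and>
    (\<forall>g\<in>carrier G. \<forall>u\<in>W. \<forall>v\<in>W. \<rho> g (u + v) = \<rho> g u + \<rho> g v) \<and>
    (\<forall>g\<in>carrier G. \<forall>c. \<forall>u\<in>W. \<rho> g (cscale c u) = cscale c (\<rho> g u)) \<and>
    (\<forall>u\<in>W. \<rho> \<one>\<^bsub>G\<^esub> u = u) \<and>
    (\<forall>g\<in>carrier G. \<forall>h\<in>carrier G. \<forall>u\<in>W. \<rho> (g \<otimes>\<^bsub>G\<^esub> h) u = \<rho> g (\<rho> h u))"

definition irreducible_rep_on ::
    "('g, 'm) monoid_scheme \<Rightarrow> ('x \<Rightarrow> complex) set \<Rightarrow> ('g \<Rightarrow> ('x \<Rightarrow> complex) \<Rightarrow> ('x \<Rightarrow> complex)) \<Rightarrow> bool"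
  where "irreducible_rep_on G W \<rho> \<longleftrightarrow>
    rep_on G W \<rho> \<and> W \<noteq> {0} \<and>
    (\<forall>U. cfun.subspace U \<and> U \<subseteq> W \<and> (\<forall>g\<in>carrier G. \<forall>u\<in>U. \<rho> g u \<in> U) \<longrightarrow> U = {0} \<or> U = W)"

text \<open>The trace is computed in some basis of \<open>W\<close>; it does not depend on the choice.\<close>

definition trace_on :: "('x \<Rightarrow> complex) set \<Rightarrow> (('x \<Rightarrow> complex) \<Rightarrow> ('x \<Rightarrow> complex)) \<Rightarrow> complex"
  where "trace_on W f =
    (let B = (SOME B. cfun.independent B \<and> cfun.span B = W)
     in \<Sum>b\<in>B. cfun.representation B (f b) b)"

text \<open>
  Characters are extended by 0 outside the carrier, so that equality of characters of \<open>G\<close> as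
  functions is the same as equality on the elements of \<open>G\<close>.
\<close>

definition rep_char ::
    "('g, 'm) monoid_scheme \<Rightarrow> ('x \<Rightarrow> complex) set \<Rightarrow> ('g \<Rightarrow> ('x \<Rightarrow> complex) \<Rightarrow> ('x \<Rightarrow> complex))
      \<Rightarrow> 'g \<Rightarrow> complex"
  where "rep_char G W \<rho> = (\<lambda>g. if g \<in> carrier G then trace_on W (\<rho> g) else 0)"

definition irr_chars :: "('g, 'm) monoid_scheme \<Rightarrow> ('g \<Rightarrow> complex) set"
  where "irr_chars G =
    {rep_char G W \<rho> | (W :: (nat \<Rightarrow> complex) set) \<rho>. irreducible_rep_on G W \<rho>}"

definition char_inner :: "('g, 'm) monoid_scheme \<Rightarrow> ('g \<Rightarrow> complex) \<Rightarrow> ('g \<Rightarrow> complex) \<Rightarrow> complex"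
  where "char_inner G \<phi> \<psi> = (\<Sum>g\<in>carrier G. \<phi> g * cnj (\<psi> g)) / of_nat (order G)"

text \<open>
  The multiplicity of an irreducible \<open>\<psi>\<close> in a character \<open>\<phi>\<close> of a finite group is the natural
  number \<open>char_inner G \<phi> \<psi>\<close>.
\<close>

definition multiplicity_free :: "('g, 'm) monoid_scheme \<Rightarrow> ('g \<Rightarrow> complex) \<Rightarrow> bool"
  where "multiplicity_free G \<phi> \<longleftrightarrow>
    (\<forall>\<psi>\<in>irr_chars G. \<exists>m::nat. m \<le> 1 \<and> char_inner G \<phi> \<psi> = of_nat m)"


section \<open>Partitions\<close>

definition partition_of :: "nat list \<Rightarrow> nat \<Rightarrow> bool"  (infix \<open>\<turnstile>\<close> 50)
  where "\<mu> \<turnstile> n \<longleftrightarrow> sorted_wrt (\<ge>) \<mu> \<and> 0 \<notin> set \<mu> \<and> sum_list \<mu> = n"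

definition conjugate :: "nat list \<Rightarrow> nat list"
  where "conjugate \<mu> =
    map (\<lambda>c. length (filter (\<lambda>p. c < p) \<mu>)) [0..<(if \<mu> = [] then 0 else hd \<mu>)]"

definition up_to_conjugation :: "nat list \<Rightarrow> nat list set \<Rightarrow> bool"
  where "up_to_conjugation \<mu> S \<longleftrightarrow> \<mu> \<in> S \<or> conjugate \<mu> \<in> S"


section \<open>Specht modules and the characters they afford\<close>

text \<open>
  Rows and columns are numbered from 0. A tableau assigns to each cell of the diagram of \<open>\<mu>\<close> an
  entry in \<open>{1..n}\<close>; its tabloid is the list of its row sets.
\<close>

definition cells :: "nat list \<Rightarrow> (nat \<times> nat) set"
  where "cells \<mu> = {(r, c). r < length \<mu> \<and> c < \<mu> ! r}"

definition tableau :: "nat list \<Rightarrow> (nat \<times> nat \<Rightarrow> nat) \<Rightarrow> bool"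
  where "tableau \<mu> t \<longleftrightarrow> bij_betw t (cells \<mu>) {1..sum_list \<mu>}"

definition row_set :: "nat list \<Rightarrow> (nat \<times> nat \<Rightarrow> nat) \<Rightarrow> nat \<Rightarrow> nat set"
  where "row_set \<mu> t r = {t (r, c) | c. (r, c) \<in> cells \<mu>}"

definition column_set :: "nat list \<Rightarrow> (nat \<times> nat \<Rightarrow> nat) \<Rightarrow> nat \<Rightarrow> nat set"
  where "column_set \<mu> t c = {t (r, c) | r. (r, c) \<in> cells \<mu>}"

definition tabloid :: "nat list \<Rightarrow> (nat \<times> nat \<Rightarrow> nat) \<Rightarrow> nat set list"
  where "tabloid \<mu> t = map (row_set \<mu> t) [0..<length \<mu>]"

definition column_stabilizer :: "nat list \<Rightarrow> (nat \<times> nat \<Rightarrow> nat) \<Rightarrow> (nat \<Rightarrow> nat) set"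
  where "column_stabilizer \<mu> t =
    {\<pi>. \<pi> permutes {1..sum_list \<mu>} \<and> (\<forall>c. \<pi> ` column_set \<mu> t c = column_set \<mu> t c)}"

text \<open>
  A tabloid \<open>T\<close> is identified with its indicator function \<open>tabloid_vec T\<close>; then
  \<open>perm_act \<sigma> (tabloid_vec T) = tabloid_vec (map ((`) \<sigma>) T)\<close> for every permutation \<open>\<sigma>\<close>.
\<close>

definition tabloid_vec :: "nat set list \<Rightarrow> nat set list \<Rightarrow> complex"
  where "tabloid_vec T = (\<lambda>T'. if T' = T then 1 else 0)"

definition perm_act :: "(nat \<Rightarrow> nat) \<Rightarrow> (nat set list \<Rightarrow> complex) \<Rightarrow> nat set list \<Rightarrow> complex"
  where "perm_act \<sigma> f = (\<lambda>T. f (map ((`) (inv' \<sigma>)) T))"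

definition polytabloid :: "nat list \<Rightarrow> (nat \<times> nat \<Rightarrow> nat) \<Rightarrow> nat set list \<Rightarrow> complex"
  where "polytabloid \<mu> t =
    (\<Sum>\<pi>\<in>column_stabilizer \<mu> t. cscale (of_int (sign \<pi>)) (perm_act \<pi> (tabloid_vec (tabloid \<mu> t))))"

definition specht_module :: "nat list \<Rightarrow> (nat set list \<Rightarrow> complex) set"
  where "specht_module \<mu> = cfun.span {polytabloid \<mu> t | t. tableau \<mu> t}"

text \<open>
  The irreducible character \<open>[\<mu>]\<close>. It is 0 if the sequence \<open>\<mu>\<close> is not weakly decreasing.
  Trailing zeros are allowed and harmless: they only append empty rows.
\<close>

definition irr_char :: "nat list \<Rightarrow> (nat \<Rightarrow> nat) \<Rightarrow> complex"
  where "irr_char \<mu> =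
    (if sorted_wrt (\<ge>) \<mu>
     then rep_char (sym_group (sum_list \<mu>)) (specht_module \<mu>) perm_act else 0)"

end

theory Submission
  imports Defs "HOL-Combinatorics.Orbits"
begin

text \<open>
  Every character \<open>[\<mu>]\<close> is computed by the Murnaghan-Nakayama recursion on strictly decreasing beta
  sequences: James' theory of polytabloids gives irreducibility of the Specht modules, and comparing
  inner products with permutation characters identifies their traces with the recursively defined
  alternating functions. In these terms, multiplying \<open>[\<mu>]\<close> by a falling product of cycle counts
  \<open>m\<^sub>i\<close> removes and then adds ribbons of the corresponding lengths. Since \<open>[n-2,2]\<close>, \<open>[n-2,1,1]\<close> and
  \<open>[n-3,3]\<close> are polynomials in \<open>m\<^sub>1, m\<^sub>2, m\<^sub>3\<close>, their products with \<open>[a^b]\<close> only involve the corners of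
  the rectangle and can be evaluated symbolically in \<open>a\<close> and \<open>b\<close>. For the small cases, six times the
  multiplicity of \<open>[\<nu>]\<close> in \<open>[n-3,3] \<cdot> [\<mu>]\<close> is a combination of numbers of common ribbon removals from
  \<open>\<mu>\<close> and \<open>\<nu>\<close>; a multiplicity of at least 2 is almost always found at \<open>\<nu> = \<mu>\<close>, and otherwise at a
  neighbour of \<open>\<mu>\<close> that differs by moving one box.
\<close>

section \<open>Alternating functions and the Murnaghan-Nakayama recursion\<close>

text \<open>Orthonormality of the recursive functions comes from cutting off the cycle through one
  point: induction handles the rest, and the cycle lengths are summed by an Euler identity that
  reflects antisymmetry under exchanging two entries. Let X be the recursive function and psi the
  trace. Then (X,X) = (X,psi) = (psi,psi) = 1 with real values, so psi - X has norm 0; for (X,psi),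
  X is expanded into permutation characters, and dominance leaves only one that receives a nonzero
  map from the Specht module. Adding an i-ribbon in all ways produces the factor i m_i, and in these
  factors twice \<open>[n-2,2]\<close> and \<open>[n-2,1,1]\<close> and six times
  \<open>[n-3,3]\<close> become integral combinations. The height of the rectangle is symbolic
  because changing an inner row creates two equal beta numbers, so a block of inner rows of any
  length contributes nothing. Multiplicity-freeness quantifies over all irreducible representations,
  not only Specht modules: by Schur's lemma a character that is no \<open>[\<nu>]\<close> is
  orthogonal to all of them, while the product lies in their span.\<close>

definition shift :: "(nat \<Rightarrow> int) \<Rightarrow> nat \<Rightarrow> int \<Rightarrow> nat \<Rightarrow> int"
  where "shift v j r = v(j := v j + r)"

text \<open>The second clause lets a function on all of \<open>nat\<close> stand for a function of
  \<open>l\<close> variables, so vectors that differ beyond \<open>l\<close> are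
  interchangeable.\<close>

definition alternating :: "nat \<Rightarrow> ((nat \<Rightarrow> int) \<Rightarrow> int) \<Rightarrow> bool"
  where "alternating l f \<longleftrightarrow>
    (\<forall>v p q. p < l \<and> q < l \<and> p \<noteq> q \<longrightarrow> f (v \<circ> transpose p q) = - f v) \<and>
    (\<forall>v w. (\<forall>i<l. v i = w i) \<longrightarrow> f v = f w)"

lemma alternating_swap:
  assumes "alternating l f" "p < l" "q < l" "p \<noteq> q"
  shows "f (v \<circ> transpose p q) = - f v"
  using assms by (auto simp: alternating_def)

lemma alternating_cong:
  assumes "alternating l f" "\<And>i. i < l \<Longrightarrow> v i = w i"
  shows "f v = f w"
  using assms by (auto simp: alternating_def)

lemma alternating_repeat:
  assumes "alternating l f" "p < l" "q < l" "p \<noteq> q" "v p = v q"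
  shows "f v = 0"
proof -
  have "v \<circ> transpose p q = v"
    using assms(5) by (auto simp: fun_eq_iff transpose_def)
  then show ?thesis using alternating_swap[OF assms(1-4), of v] by simp
qed

lemma alternating_swap':
  assumes "alternating l f" "p < l" "q < l" "p \<noteq> q" "w p = v q" "w q = v p"
    "\<And>i. i < l \<Longrightarrow> i \<noteq> p \<Longrightarrow> i \<noteq> q \<Longrightarrow> w i = v i"
  shows "f w = - f v"
proof -
  have "f w = f (v \<circ> transpose p q)"
    by (rule alternating_cong[OF assms(1)]) (use assms in \<open>auto simp: transpose_def\<close>)
  then show ?thesis using alternating_swap[OF assms(1-4)] by simp
qed

lemma alternating_inj_on:
  assumes "alternating l f" "f v \<noteq> 0"
  shows "inj_on v {..<l}"
  using alternating_repeat[OF assms(1)] assms(2) by (auto simp: inj_on_def)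

text \<open>Shifting an entry other than \<open>p\<close> and \<open>q\<close> leaves the repetition
  in place, and the two remaining terms are exchanged by swapping \<open>p\<close> and
  \<open>q\<close>.\<close>

lemma alternating_sum_shift_repeat:
  assumes f: "alternating l f" and pq: "p < l" "q < l" "p \<noteq> q" "v p = v q"
  shows "(\<Sum>k<l. f (shift v k r)) = 0"
proof -
  have "(\<Sum>k<l. f (shift v k r)) = (\<Sum>k\<in>{p, q}. f (shift v k r))"
    by (rule sum.mono_neutral_right)
      (use pq alternating_repeat[OF f pq(1-3)] in \<open>auto simp: shift_def\<close>)
  also have "\<dots> = f (shift v p r) + f (shift v q r)" using pq by simp
  also have "f (shift v p r) = - f (shift v q r)"
    by (rule alternating_swap'[OF f pq(1-3)]) (use pq in \<open>auto simp: shift_def\<close>)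
  finally show ?thesis by simp
qed

lemma shift_shift_same [simp]: "shift (shift v j r) j s = shift v j (r + s)"
  by (simp add: shift_def add.assoc)

lemma shift_0 [simp]: "shift v j 0 = v" by (simp add: shift_def)

lemma shift_commute: "shift (shift v j r) k s = shift (shift v k s) j r"
  by (auto simp: shift_def fun_eq_iff)

lemma alternating_shift_sum:
  assumes f: "alternating l f"
  shows "alternating l (\<lambda>v. \<Sum>j<l. f (shift v j r))"
  unfolding alternating_def
proof safe
  fix v and p q :: nat assume pq: "p < l" "q < l" "p \<noteq> q"
  have "(\<Sum>j<l. f (shift (v \<circ> transpose p q) j r))
      = (\<Sum>j<l. f (shift (v \<circ> transpose p q) (transpose p q j) r))"
    by (rule sum.reindex_bij_betw[symmetric], rule permutes_imp_bij)
      (use pq in \<open>simp add: permutes_swap_id\<close>)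
  also have "\<dots> = (\<Sum>j<l. - f (shift v j r))"
  proof (rule sum.cong[OF refl])
    fix j assume "j \<in> {..<l}"
    have "shift (v \<circ> transpose p q) (transpose p q j) r = shift v j r \<circ> transpose p q"
      by (auto simp: shift_def fun_eq_iff)
    then show "f (shift (v \<circ> transpose p q) (transpose p q j) r) = - f (shift v j r)"
      using alternating_swap[OF f pq] by simp
  qed
  finally show "(\<Sum>j<l. f (shift (v \<circ> transpose p q) j r)) = - (\<Sum>j<l. f (shift v j r))"
    by (simp add: sum_negf)
next
  fix v w :: "nat \<Rightarrow> int" assume "\<forall>i<l. v i = w i"
  then show "(\<Sum>j<l. f (shift v j r)) = (\<Sum>j<l. f (shift w j r))"
    by (intro sum.cong alternating_cong[OF f]) (auto simp: shift_def)
qed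

text \<open>All vectors involved keep the sum \<open>s\<close> of the two entries, so they are
  listed by the value \<open>x\<close> in place \<open>j\<close>, running from 0 to
  \<open>s\<close>. Reflecting \<open>x\<close> to \<open>s - x\<close> is a swap, so the sum over
  all \<open>x\<close> is 0; the left side omits exactly \<open>x = v j\<close>.\<close>

lemma exchange_pair:
  assumes f: "alternating l f" and jk: "j < l" "k < l" "j \<noteq> k"
    and pos: "0 \<le> v j" "0 \<le> v k"
  shows "(\<Sum>i\<in>{1..v j}. f (shift (shift v j (-i)) k i))
       + (\<Sum>i\<in>{1..v k}. f (shift (shift v k (-i)) j i)) = - f v"
proof -
  define s where "s = v j + v k"
  define h where "h x = f (v(j := x, k := s - x))" for x
  have anti: "h (s - x) = - h x" for x
    unfolding h_def by (rule alternating_swap'[OF f jk]) (use jk in auto)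
  have "(\<Sum>x\<in>{0..s}. h x) = (\<Sum>x\<in>{0..s}. h (s - x))"
    by (rule sum.reindex_bij_witness[of _ "\<lambda>x. s - x" "\<lambda>x. s - x"]) auto
  then have zero: "(\<Sum>x\<in>{0..s}. h x) = 0" by (simp add: anti sum_negf)
  have split: "{0..s} = {0..<v j} \<union> {v j} \<union> {v j<..s}" using pos by (auto simp: s_def)
  have "(\<Sum>x\<in>{0..s}. h x) = (\<Sum>x\<in>{0..<v j}. h x) + h (v j) + (\<Sum>x\<in>{v j<..s}. h x)"
    unfolding split by (subst sum.union_disjoint, simp, simp, force)+ simp
  moreover have "h (v j) = f v" by (simp add: h_def s_def)
  moreover have "(\<Sum>i\<in>{1..v j}. f (shift (shift v j (-i)) k i)) = (\<Sum>x\<in>{0..<v j}. h x)"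
    by (rule sum.reindex_bij_witness[of _ "\<lambda>x. v j - x" "\<lambda>i. v j - i"])
      (use jk in \<open>auto simp: h_def shift_def s_def algebra_simps\<close>)
  moreover have "(\<Sum>i\<in>{1..v k}. f (shift (shift v k (-i)) j i)) = (\<Sum>x\<in>{v j<..s}. h x)"
    by (rule sum.reindex_bij_witness[of _ "\<lambda>x. x - v j" "\<lambda>i. v j + i"])
      (use jk in \<open>auto simp: h_def shift_def s_def algebra_simps fun_upd_twist\<close>)
  ultimately show ?thesis using zero by linarith
qed

text \<open>This is the degree operator: removing an \<open>i\<close>-ribbon and adding one again,
  summed over \<open>i\<close>, multiplies by the size. For a beta sequence the factor on the right
  is twice the size of the partition. The pairs \<open>(j, k)\<close> and \<open>(k, j)\<close> off
  the diagonal are combined by \<open>exchange_pair\<close>; on the diagonal \<open>v\<close> itself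
  returns \<open>v j\<close> times.\<close>

lemma alternating_euler:
  assumes f: "alternating l f" and pos: "\<And>j. j < l \<Longrightarrow> 0 \<le> v j"
  shows "2 * (\<Sum>j<l. \<Sum>i\<in>{1..v j}. \<Sum>k<l. f (shift (shift v j (-i)) k i))
    = (2 * (\<Sum>j<l. v j) - int l * (int l - 1)) * f v"
proof -
  define S where "S j k = (\<Sum>i\<in>{1..v j}. f (shift (shift v j (-i)) k i))" for j k
  have L: "(\<Sum>j<l. \<Sum>i\<in>{1..v j}. \<Sum>k<l. f (shift (shift v j (-i)) k i)) = (\<Sum>j<l. \<Sum>k<l. S j k)"
    unfolding S_def by (intro sum.cong refl, rule sum.swap)
  have sw: "(\<Sum>j<l. \<Sum>k<l. S j k) = (\<Sum>j<l. \<Sum>k<l. S k j)" by (rule sum.swap)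
  have "2 * (\<Sum>j<l. \<Sum>k<l. S j k) = (\<Sum>j<l. \<Sum>k<l. S j k + S k j)"
    by (simp add: sum.distrib sw[symmetric])
  \<comment> \<open>The value \<open>- f v\<close> of the pairs off the diagonal is subtracted
    everywhere, and the diagonal gets it back as a correction.\<close>
  also have "\<dots> = (\<Sum>j<l. \<Sum>k<l. (if k = j then 2 * v j * f v + f v else 0) - f v)"
  proof (intro sum.cong refl)
    fix j k assume jk: "j \<in> {..<l}" "k \<in> {..<l}"
    show "S j k + S k j = (if k = j then 2 * v j * f v + f v else 0) - f v"
    proof (cases "k = j")
      case True
      then show ?thesis using pos[of j] jk by (simp add: S_def)
    next
      case False
      then show ?thesis using exchange_pair[OF f, of j k v] jk pos by (simp add: S_def)
    qed
  qed
  also have "\<dots> = (\<Sum>j<l. (2 * v j * f v + f v) - int l * f v)"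
    by (rule sum.cong[OF refl]) (simp add: sum_subtractf)
  also have "\<dots> = (2 * (\<Sum>j<l. v j) - int l * (int l - 1)) * f v"
    by (simp add: sum_subtractf sum.distrib sum_distrib_left sum_distrib_right algebra_simps)
  finally show ?thesis by (simp add: L)
qed

text \<open>The determinant of the matrix with entries \<open>of_bool (v i = w j)\<close>, that is,
  the scalar product of the alternants with exponents \<open>v\<close> and \<open>w\<close>.\<close>

definition pairing :: "nat \<Rightarrow> (nat \<Rightarrow> int) \<Rightarrow> (nat \<Rightarrow> int) \<Rightarrow> int"
  where "pairing l v w = (\<Sum>\<pi> | \<pi> permutes {..<l}. sign \<pi> * of_bool (\<forall>i<l. v i = w (\<pi> i)))"

lemma alternating_pairing: "alternating l (\<lambda>v. pairing l v w)"
  unfolding alternating_def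
proof safe
  fix v and p q :: nat assume pq: "p < l" "q < l" "p \<noteq> q"
  let ?t = "transpose p q"
  have t: "?t permutes {..<l}" using pq by (simp add: permutes_swap_id)
  have "pairing l (v \<circ> ?t) w = (\<Sum>\<pi> | \<pi> permutes {..<l}. sign (\<pi> \<circ> ?t) * of_bool (\<forall>i<l. (v \<circ> ?t) i = w ((\<pi> \<circ> ?t) i)))"
    unfolding pairing_def
    by (rule sum.reindex_bij_witness[of _ "\<lambda>\<pi>. \<pi> \<circ> ?t" "\<lambda>\<pi>. \<pi> \<circ> ?t"])
      (auto intro: permutes_compose[OF t] simp: comp_assoc)
  also have "\<dots> = (\<Sum>\<pi> | \<pi> permutes {..<l}. - (sign \<pi> * of_bool (\<forall>i<l. v i = w (\<pi> i))))"
  proof (rule sum.cong[OF refl])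
    fix \<pi> assume "\<pi> \<in> {\<pi>. \<pi> permutes {..<l}}"
    then have pi: "\<pi> permutes {..<l}" by simp
    have "permutation \<pi>" "permutation ?t" using pi t permutation_permutes by blast+
    then have "sign (\<pi> \<circ> ?t) = - sign \<pi>" using pq by (simp add: sign_compose sign_swap_id)
    moreover have "(\<forall>i<l. (v \<circ> ?t) i = w ((\<pi> \<circ> ?t) i)) \<longleftrightarrow> (\<forall>i<l. v i = w (\<pi> i))"
      by (metis comp_apply permutes_in_image[OF t] lessThan_iff transpose_involutory)
    ultimately show "sign (\<pi> \<circ> ?t) * of_bool (\<forall>i<l. (v \<circ> ?t) i = w ((\<pi> \<circ> ?t) i))
        = - (sign \<pi> * of_bool (\<forall>i<l. v i = w (\<pi> i)))" by simp
  qed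
  finally show "pairing l (v \<circ> ?t) w = - pairing l v w" by (simp add: pairing_def sum_negf)
next
  fix v v' :: "nat \<Rightarrow> int" assume "\<forall>i<l. v i = v' i"
  then show "pairing l v w = pairing l v' w" by (simp add: pairing_def)
qed

lemma pairing_commute: "pairing l v w = pairing l w v"
  unfolding pairing_def
proof (rule sum.reindex_bij_witness[of _ "Hilbert_Choice.inv" "Hilbert_Choice.inv"])
  fix \<pi> assume "\<pi> \<in> {\<pi>. \<pi> permutes {..<l}}"
  then have pi: "\<pi> permutes {..<l}" by simp
  have "(\<forall>i<l. w i = v (inv' \<pi> i)) = (\<forall>i<l. v i = w (\<pi> i))"
  proof safe
    fix i assume "\<forall>i<l. w i = v (inv' \<pi> i)" "i < l"
    then show "v i = w (\<pi> i)"
      using permutes_in_image[OF pi, of i] permutes_inverses(2)[OF pi, of i] by simp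
  next
    fix i assume "\<forall>i<l. v i = w (\<pi> i)" "i < l"
    then show "w i = v (inv' \<pi> i)"
      using permutes_in_image[OF permutes_inv[OF pi], of i] permutes_inverses(1)[OF pi, of i] by simp
  qed
  then show "sign (inv' \<pi>) * of_bool (\<forall>i<l. w i = v (inv' \<pi> i)) = sign \<pi> * of_bool (\<forall>i<l. v i = w (\<pi> i))"
    using pi permutation_permutes[of \<pi>] by (auto simp: sign_inverse)
qed (auto simp: permutes_inv permutes_inv_inv)

text \<open>Within the term of one permutation \<open>\<pi>\<close>, raising entry \<open>k\<close>
  of \<open>v\<close> has the same effect as lowering entry \<open>\<pi> k\<close> of
  \<open>w\<close>.\<close>

lemma pairing_adjoint: "(\<Sum>k<l. pairing l (shift v k r) w) = (\<Sum>k<l. pairing l v (shift w k (-r)))"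
proof -
  have "(\<Sum>k<l. pairing l (shift v k r) w)
     = (\<Sum>\<pi> | \<pi> permutes {..<l}. \<Sum>k<l. sign \<pi> * of_bool (\<forall>i<l. shift v k r i = w (\<pi> i)))"
    unfolding pairing_def by (rule sum.swap)
  also have "\<dots> = (\<Sum>\<pi> | \<pi> permutes {..<l}. \<Sum>k<l. sign \<pi> * of_bool (\<forall>i<l. v i = shift w k (-r) (\<pi> i)))"
  proof (rule sum.cong[OF refl])
    fix \<pi> assume "\<pi> \<in> {\<pi>. \<pi> permutes {..<l}}"
    then have pi: "\<pi> permutes {..<l}" by simp
    have "(\<Sum>k<l. sign \<pi> * of_bool (\<forall>i<l. v i = shift w k (-r) (\<pi> i)))
       = (\<Sum>k<l. sign \<pi> * of_bool (\<forall>i<l. v i = shift w (\<pi> k) (-r) (\<pi> i)))"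
      by (rule sum.reindex_bij_betw[symmetric], rule permutes_imp_bij[OF pi])
    also have "\<dots> = (\<Sum>k<l. sign \<pi> * of_bool (\<forall>i<l. shift v k r i = w (\<pi> i)))"
    proof (rule sum.cong[OF refl])
      fix k
      have "\<pi> i = \<pi> k \<longleftrightarrow> i = k" for i using permutes_inj[OF pi] by (auto simp: inj_def)
      then have "v i = shift w (\<pi> k) (-r) (\<pi> i) \<longleftrightarrow> shift v k r i = w (\<pi> i)" for i
        by (auto simp: shift_def)
      then show "sign \<pi> * of_bool (\<forall>i<l. v i = shift w (\<pi> k) (-r) (\<pi> i))
          = sign \<pi> * of_bool (\<forall>i<l. shift v k r i = w (\<pi> i))" by simp
    qed
    finally show "(\<Sum>k<l. sign \<pi> * of_bool (\<forall>i<l. shift v k r i = w (\<pi> i)))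
        = (\<Sum>k<l. sign \<pi> * of_bool (\<forall>i<l. v i = shift w k (-r) (\<pi> i)))" by simp
  qed
  also have "\<dots> = (\<Sum>k<l. pairing l v (shift w k (-r)))"
    unfolding pairing_def by (rule sum.swap)
  finally show ?thesis .
qed

section \<open>Characters by ribbon removal on beta sequences\<close>

definition staircase :: "nat \<Rightarrow> nat \<Rightarrow> int"
  where "staircase l i = int l - 1 - int i"

text \<open>The Murnaghan-Nakayama rule without explicit leg lengths. Lowering a beta number by
  \<open>r\<close> removes an \<open>r\<close>-ribbon; the sign appears when the final vector is
  sorted into the staircase, the beta sequence of the empty partition. Impossible removals produce
  repeated or negative entries and count as 0.\<close>

fun xchar :: "nat \<Rightarrow> nat list \<Rightarrow> (nat \<Rightarrow> int) \<Rightarrow> int" where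
  "xchar l [] v = pairing l v (staircase l)"
| "xchar l (r # rs) v = (\<Sum>j<l. xchar l rs (shift v j (- int r)))"

lemma alternating_xchar: "alternating l (xchar l rs)"
proof (induction rs)
  case Nil
  then show ?case using alternating_pairing by simp
next
  case (Cons r rs)
  then show ?case using alternating_shift_sum[of l "xchar l rs" "- int r"] by simp
qed

lemma xchar_negative: "j < l \<Longrightarrow> v j < 0 \<Longrightarrow> xchar l rs v = 0"
proof (induction rs arbitrary: v)
  case Nil
  have "of_bool (\<forall>i<l. v i = staircase l (\<pi> i)) = (0::int)" if "\<pi> permutes {..<l}" for \<pi>
    using Nil permutes_in_image[OF that, of j] by (force simp: staircase_def)
  then show ?case by (auto simp: pairing_def intro!: sum.neutral)
next
  case (Cons r rs)
  then show ?case by (auto intro!: sum.neutral Cons.IH simp: shift_def)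
qed

lemma xchar_swap: "xchar l (r # s # rs) v = xchar l (s # r # rs) v"
  by (simp add: shift_commute[of v _ "- int r" _ "- int s"], rule sum.swap)

lemma xchar_remove1: "r \<in> set rs \<Longrightarrow> xchar l rs v = xchar l (r # remove1 r rs) v"
proof (induction rs arbitrary: v)
  case (Cons s rs)
  show ?case
  proof (cases "r = s")
    case False
    then have "xchar l (s # rs) v = xchar l (s # r # remove1 r rs) v" using Cons by simp
    then show ?thesis using False xchar_swap[of l s r] by simp
  qed simp
qed simp

lemma xchar_mset: "mset rs = mset rs' \<Longrightarrow> xchar l rs v = xchar l rs' v"
proof (induction rs arbitrary: rs' v)
  case (Cons r rs)
  have r: "r \<in> set rs'" using Cons.prems by (metis list.set_intros(1) mset_eq_setD)
  have eq: "mset rs = mset (remove1 r rs')" using Cons.prems by (simp flip: Cons.prems)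
  then have "xchar l (r # rs) v = xchar l (r # remove1 r rs') v"
    by (simp add: Cons.IH[OF eq] del: mset_remove1)
  then show ?case using xchar_remove1[OF r] by simp
qed simp

lemma xchar_repeat: "p < l \<Longrightarrow> q < l \<Longrightarrow> p \<noteq> q \<Longrightarrow> v p = v q \<Longrightarrow> xchar l rs v = 0"
  using alternating_repeat[OF alternating_xchar] .

text \<open>A nonzero term would make the raised vector a rearrangement of the staircase, with the
  values 0 to \<open>l - 1\<close> once each. If \<open>u k\<close> is negative, its new value lies
  below \<open>i\<close> and is already taken by hypothesis; otherwise \<open>u\<close> itself fills
  these values, and the raised one is again taken.\<close>

lemma xchar_sum_shift_nil:
  assumes i: "0 < i" and low: "\<forall>c<i. \<exists>j<l. u j = int c"
  shows "(\<Sum>k<l. xchar l [] (shift u k (int i))) = 0"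
proof (cases "inj_on u {..<l}")
  case False
  then obtain p q where "p < l" "q < l" "p \<noteq> q" "u p = u q" by (auto simp: inj_on_def)
  then show ?thesis using alternating_sum_shift_repeat[OF alternating_xchar] by blast
next
  case inj: True
  show ?thesis
  proof (rule sum.neutral, rule ballI, rule ccontr)
    fix k assume k: "k \<in> {..<l}" and nz: "xchar l [] (shift u k (int i)) \<noteq> 0"
    define x where "x = shift u k (int i)"
    have x: "x k = u k + int i" "\<And>j. j \<noteq> k \<Longrightarrow> x j = u j" by (auto simp: x_def shift_def)
    have nn: "0 \<le> x j" if "j < l" for j
      using xchar_negative[OF that] nz unfolding x_def by (meson not_le)
    have injx: "inj_on x {..<l}" using alternating_inj_on[OF alternating_xchar nz] by (simp add: x_def)
    obtain \<pi> where pi: "\<pi> permutes {..<l}" "\<forall>j<l. x j = staircase l (\<pi> j)"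
    proof -
      have "\<exists>\<pi>. \<pi> permutes {..<l} \<and> (\<forall>j<l. x j = staircase l (\<pi> j))"
      proof (rule ccontr)
        assume "\<not> ?thesis"
        then have "pairing l x (staircase l) = 0" unfolding pairing_def by (intro sum.neutral) auto
        then show False using nz by (simp add: x_def)
      qed
      then show thesis using that by blast
    qed
    have ub: "x j < int l" if "j < l" for j using pi that by (auto simp: staircase_def)
    show False
    proof (cases "u k < 0")
      case True
      then have "nat (x k) < i" using x nn[of k] k by auto
      then obtain j where j: "j < l" "u j = x k" using low nn[of k] k by force
      then have ne: "j \<noteq> k" using x i by auto
      have "x j = x k" using x(2)[OF ne] j by simp
      then show False using inj_onD[OF injx, of j k] ne j k by simp
    next
      case False
      have "u j \<in> {0..<int l}" if "j < l" for j
        using that False ub[OF that] nn[OF that] x i k by (cases "j = k") auto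
      then have sub: "u ` {..<l} \<subseteq> {0..<int l}" by auto
      have "card (u ` {..<l}) = l" using inj by (simp add: card_image)
      then have "u ` {..<l} = {0..<int l}" using sub by (intro card_subset_eq) auto
      moreover have "x k \<in> {0..<int l}" using ub[of k] nn[of k] k by auto
      ultimately have "x k \<in> u ` {..<l}" by simp
      then obtain j where j: "j < l" "x k = u j" by auto
      then have ne: "j \<noteq> k" using x i by auto
      have "x j = x k" using x(2)[OF ne] j by simp
      then show False using inj_onD[OF injx, of j k] ne j k by simp
    qed
  qed
qed

text \<open>Lowering a small entry \<open>u j\<close> by \<open>r\<close> hits another small entry
  or becomes negative. In the negative case only raising the same entry can repair it, and the
  outcome \<open>u j + i - r\<close> is again negative or taken unless \<open>r = i\<close>.\<close>

lemma xchar_sum_shift_low: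
  assumes i: "0 < i" and r: "0 < r" and low: "\<forall>c<i. \<exists>j<l. u j = int c"
    and j: "j < l" "0 \<le> u j" "u j < int i"
  shows "(\<Sum>k<l. xchar l rs (shift (shift u j (- int r)) k (int i)))
     = (if r = i then xchar l rs u else 0)"
    and "xchar l rs (shift u j (- int r)) = 0"
proof -
  let ?u = "shift u j (- int r)"
  have rep: "\<exists>p<l. p \<noteq> j \<and> u p = x" if "0 \<le> x" "x < int i" "x \<noteq> u j" for x
  proof -
    have "nat x < i" using that by auto
    then show ?thesis using low[rule_format, of "nat x"] that by auto
  qed
  have "(\<Sum>k<l. xchar l rs (shift ?u k (int i))) = (if r = i then xchar l rs u else 0)
      \<and> xchar l rs ?u = 0"
  proof (cases "int r \<le> u j")
    case True
    then obtain p where p: "p < l" "p \<noteq> j" "u p = u j - int r"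
      using rep[of "u j - int r"] j r by auto
    then have "?u p = ?u j" by (simp add: shift_def)
    moreover have "r \<noteq> i" using True j by auto
    ultimately show ?thesis
      using alternating_sum_shift_repeat[OF alternating_xchar p(1) j(1) p(2)]
        xchar_repeat[OF p(1) j(1) p(2)] by simp
  next
    case False
    then have neg: "?u j < 0" by (simp add: shift_def)
    have "(\<Sum>k<l. xchar l rs (shift ?u k (int i))) = (\<Sum>k\<in>{j}. xchar l rs (shift ?u k (int i)))"
    proof (rule sum.mono_neutral_right)
      show "\<forall>k\<in>{..<l} - {j}. xchar l rs (shift ?u k (int i)) = 0"
        using neg j by (auto intro!: xchar_negative[of j] simp: shift_def)
    qed (use j in auto)
    also have "\<dots> = xchar l rs (shift u j (int i - int r))" by (simp add: algebra_simps)
    also have "\<dots> = (if r = i then xchar l rs u else 0)"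
    proof (cases "r = i")
      case ne: False
      let ?x = "u j + int i - int r"
      show ?thesis
      proof (cases "?x < 0")
        case True
        then show ?thesis using ne j by (auto intro!: xchar_negative[of j] simp: shift_def)
      next
        case nn: False
        have "?x < int i" using False by simp
        then obtain p where "p < l" "p \<noteq> j" "u p = ?x" using rep[of ?x] nn ne by auto
        then show ?thesis using ne j by (auto intro!: xchar_repeat[of p _ j] simp: shift_def)
      qed
    qed simp
    finally show ?thesis using xchar_negative[OF j(1), of ?u] neg by auto
  qed
  then show "(\<Sum>k<l. xchar l rs (shift ?u k (int i))) = (if r = i then xchar l rs u else 0)"
    "xchar l rs ?u = 0" by auto
qed

text \<open>A nonzero value forces distinct entries, so each of the values 0 to \<open>i - 1\<close>
  is taken exactly once.\<close>

lemma xchar_count_low: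
  assumes "\<forall>c<i. \<exists>j<l. u j = int c"
  shows "(\<Sum>j<l. if 0 \<le> u j \<and> u j < int i then xchar l rs u else 0) = int i * xchar l rs u"
proof (cases "xchar l rs u = 0")
  case False
  then have inj: "inj_on u {..<l}" using alternating_inj_on[OF alternating_xchar] by blast
  have "u ` {j\<in>{..<l}. 0 \<le> u j \<and> u j < int i} = {0..<int i}"
  proof -
    have "x \<in> u ` {j\<in>{..<l}. 0 \<le> u j \<and> u j < int i}" if "x \<in> {0..<int i}" for x
      using assms[rule_format, of "nat x"] that by force
    then show ?thesis by auto
  qed
  moreover have "inj_on u {j\<in>{..<l}. 0 \<le> u j \<and> u j < int i}"
    using inj by (rule inj_on_subset) auto
  ultimately have "card {j\<in>{..<l}. 0 \<le> u j \<and> u j < int i} = card {0..<int i}"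
    by (metis card_image)
  then have c: "card {j\<in>{..<l}. 0 \<le> u j \<and> u j < int i} = i" by simp
  have "(\<Sum>j<l. if 0 \<le> u j \<and> u j < int i then xchar l rs u else 0)
      = (\<Sum>j\<in>{j\<in>{..<l}. 0 \<le> u j \<and> u j < int i}. xchar l rs u)"
    by (rule sum.inter_filter[symmetric]) simp
  then show ?thesis using c by simp
qed (auto intro!: sum.neutral)

text \<open>
  Adding an \<open>i\<close>-ribbon is adjoint to removing one; the hypothesis says that there are
  enough empty rows at the bottom for the added ribbon.
\<close>

lemma xchar_sum_shift:
  assumes i: "0 < i" and "0 \<notin> set rs" and "\<forall>c<i. \<exists>j<l. u j = int c"
  shows "(\<Sum>k<l. xchar l rs (shift u k (int i))) = int i * int (count_list rs i) * xchar l (remove1 i rs) u"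
  using assms(2-)
proof (induction rs arbitrary: u)
  case Nil
  then show ?case using xchar_sum_shift_nil[OF i, of l u] by (simp del: xchar.simps)
next
  case (Cons r rs)
  have r: "0 < r" "0 \<notin> set rs" using Cons.prems by auto
  let ?m = "int i * int (count_list rs i)"
  have "(\<Sum>k<l. xchar l (r # rs) (shift u k (int i)))
      = (\<Sum>k<l. \<Sum>j<l. xchar l rs (shift (shift u j (- int r)) k (int i)))"
    by (simp add: shift_commute[of _ _ "int i"])
  also have "\<dots> = (\<Sum>j<l. \<Sum>k<l. xchar l rs (shift (shift u j (- int r)) k (int i)))" by (rule sum.swap)
  \<comment> \<open>An entry below \<open>i\<close> contributes only for \<open>r = i\<close>, which
    accounts for the new occurrence of \<open>i\<close> in the list. For every other entry the low
    values survive the lowering, and the induction hypothesis applies.\<close>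
  also have "\<dots> = (\<Sum>j<l. ?m * xchar l (remove1 i rs) (shift u j (- int r))
      + (if r = i then (if 0 \<le> u j \<and> u j < int i then xchar l rs u else 0) else 0))"
  proof (rule sum.cong[OF refl])
    fix j assume "j \<in> {..<l}"
    then have j: "j < l" by simp
    show "(\<Sum>k<l. xchar l rs (shift (shift u j (- int r)) k (int i))) = ?m * xchar l (remove1 i rs) (shift u j (- int r))
      + (if r = i then (if 0 \<le> u j \<and> u j < int i then xchar l rs u else 0) else 0)"
    proof (cases "0 \<le> u j \<and> u j < int i")
      case True
      then show ?thesis
        using xchar_sum_shift_low[OF i r(1) Cons.prems(2) j, of rs]
          xchar_sum_shift_low(2)[OF i r(1) Cons.prems(2) j, of "remove1 i rs"] by simp
    next
      case False
      have "\<forall>c<i. \<exists>p<l. shift u j (- int r) p = int c"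
      proof safe
        fix c assume "c < i"
        then obtain p where "p < l" "u p = int c" using Cons.prems by blast
        moreover from this have "p \<noteq> j" using False \<open>c < i\<close> by auto
        ultimately show "\<exists>p<l. shift u j (- int r) p = int c" by (auto simp: shift_def)
      qed
      then show ?thesis using Cons.IH[OF r(2)] False by auto
    qed
  qed
  also have "\<dots> = ?m * xchar l (r # remove1 i rs) u + (if r = i then int i * xchar l rs u else 0)"
    using xchar_count_low[OF Cons.prems(2), of rs] by (simp add: sum.distrib sum_distrib_left)
  also have "\<dots> = int i * int (count_list (r # rs) i) * xchar l (remove1 i (r # rs)) u"
  proof (cases "r = i")
    case True
    have "count_list rs i = 0 \<or> xchar l (i # remove1 i rs) u = xchar l rs u"
      using xchar_remove1[of i rs l u] by (metis count_list_0_iff)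
    then have "?m * xchar l (i # remove1 i rs) u = ?m * xchar l rs u" by auto
    then show ?thesis using True by (simp add: algebra_simps del: xchar.simps)
  next
    case False
    then show ?thesis by (simp del: xchar.simps)
  qed
  finally show ?case .
qed

section \<open>Cycle types of permutations\<close>

inductive cycle_list :: "('a \<Rightarrow> 'a) \<Rightarrow> 'a set \<Rightarrow> nat list \<Rightarrow> bool" for g where
  Nil: "cycle_list g {} []"
| Cons: "cyclic_on g S \<Longrightarrow> finite S \<Longrightarrow> S \<inter> A = {} \<Longrightarrow> cycle_list g A rs \<Longrightarrow> cycle_list g (S \<union> A) (card S # rs)"

lemma cyclic_on_nonempty: "cyclic_on g S \<Longrightarrow> S \<noteq> {}"
  by (auto simp: cyclic_on_def)

lemma cycle_list_finite: "cycle_list g A rs \<Longrightarrow> finite A"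
  by (induction rule: cycle_list.induct) auto

lemma cycle_list_nonzero: "cycle_list g A rs \<Longrightarrow> 0 \<notin> set rs"
  by (induction rule: cycle_list.induct) (auto dest: cyclic_on_nonempty)

lemma cycle_list_sum: "cycle_list g A rs \<Longrightarrow> sum_list rs = card A"
  by (induction rule: cycle_list.induct) (auto simp: card_Un_disjoint dest: cycle_list_finite)

lemma cycle_list_cong:
  "cycle_list g A rs \<Longrightarrow> (\<And>x. x \<in> A \<Longrightarrow> h x = g x) \<Longrightarrow> cycle_list h A rs"
proof (induction rule: cycle_list.induct)
  case (Cons S A rs)
  have "cyclic_on h S" using Cons(1) cyclic_cong[of S g h] Cons.prems by auto
  then show ?case using Cons by (intro cycle_list.Cons) auto
qed (rule cycle_list.Nil)

lemma orbit_subset_invariant: "a \<in> A \<Longrightarrow> (\<And>x. x \<in> A \<Longrightarrow> g x \<in> A) \<Longrightarrow> orbit g a \<subseteq> A"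
proof
  fix x assume "x \<in> orbit g a" "a \<in> A" "\<And>x. x \<in> A \<Longrightarrow> g x \<in> A"
  then show "x \<in> A" by (induction rule: orbit.induct) auto
qed

lemma permutation_orbit_eq_iff:
  assumes "permutation g" shows "g x \<in> orbit g a \<longleftrightarrow> x \<in> orbit g a"
proof
  assume "g x \<in> orbit g a"
  moreover have "x \<in> orbit g (g x)"
    using permutation_orbit_step[OF assms, of x] permutation_self_in_orbit[OF assms, of x] by simp
  ultimately show "x \<in> orbit g a" by (rule orbit_trans[rotated])
qed (rule orbit.step)

lemma cycle_list_exists:
  "finite A \<Longrightarrow> permutation g \<Longrightarrow> (\<And>x. x \<in> A \<Longrightarrow> g x \<in> A) \<Longrightarrow> \<exists>rs. cycle_list g A rs"
proof (induction "card A" arbitrary: A rule: less_induct)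
  case less
  show ?case
  proof (cases "A = {}")
    case True
    then show ?thesis using cycle_list.Nil by blast
  next
    case False
    then obtain a where a: "a \<in> A" by blast
    let ?S = "orbit g a"
    have S: "?S \<subseteq> A" by (rule orbit_subset_invariant) (use a less in auto)
    have aS: "a \<in> ?S" using permutation_self_in_orbit[OF less(3)] .
    have "card (A - ?S) < card A" using a aS less(2) by (intro psubset_card_mono) auto
    then have "\<exists>rs. cycle_list g (A - ?S) rs"
      using less by (intro less(1)) (auto simp: permutation_orbit_eq_iff)
    then obtain rs where "cycle_list g (A - ?S) rs" by blast
    moreover have "cyclic_on g ?S" using aS by (auto simp: cyclic_on_def)
    moreover have "finite ?S" using S less(2) finite_subset by blast
    ultimately have "cycle_list g (?S \<union> (A - ?S)) (card ?S # rs)"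
      by (intro cycle_list.Cons) auto
    moreover have "?S \<union> (A - ?S) = A" using S by auto
    ultimately show ?thesis by auto
  qed
qed

text \<open>An arbitrary listing of the cycle lengths, with fixed points as cycles of length 1. That
  the choice does not affect character values is \<open>xchar_cycle_list\<close>.\<close>

definition cycle_type :: "('a \<Rightarrow> 'a) \<Rightarrow> 'a set \<Rightarrow> nat list"
  where "cycle_type g A = (SOME rs. cycle_list g A rs)"

lemma cycle_list_cycle_type:
  assumes "g permutes A" "finite A"
  shows "cycle_list g A (cycle_type g A)"
proof -
  have "\<exists>rs. cycle_list g A rs"
    using assms by (intro cycle_list_exists) (auto simp: permutes_in_image permutation_permutes)
  then show ?thesis unfolding cycle_type_def by (rule someI_ex)
qed

lemma cycle_type_cong:
  assumes "\<And>x. x \<in> A \<Longrightarrow> h x = g x" shows "cycle_type h A = cycle_type g A"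
proof -
  have "cycle_list h A = cycle_list g A"
    using cycle_list_cong[of g A _ h] cycle_list_cong[of h A _ g] assms by (intro ext) metis
  then show ?thesis by (simp add: cycle_type_def)
qed

section \<open>Tabloids fixed by a permutation\<close>

definition tabloids :: "nat \<Rightarrow> (nat \<Rightarrow> int) \<Rightarrow> 'a set \<Rightarrow> 'a set list set"
  where "tabloids l \<alpha> A = {T. length T = l \<and> (\<forall>i<l. int (card (T ! i)) = \<alpha> i) \<and>
    (\<forall>i<l. \<forall>j<l. i \<noteq> j \<longrightarrow> T ! i \<inter> T ! j = {}) \<and> (\<Union>i<l. T ! i) = A}"

lemma finite_tabloids: "finite A \<Longrightarrow> finite (tabloids l \<alpha> A)"
proof -
  assume "finite A"
  then have "finite {T. set T \<subseteq> Pow A \<and> length T = l}" by (intro finite_lists_length_eq) auto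
  moreover have "tabloids l \<alpha> A \<subseteq> {T. set T \<subseteq> Pow A \<and> length T = l}"
    by (auto simp: tabloids_def in_set_conv_nth)
  ultimately show ?thesis by (rule finite_subset[rotated])
qed

text \<open>The permutation character on tabloids at cycle type \<open>rs\<close>: every cycle goes
  into one row as a whole. Row sizes are integers because the determinantal formula inserts shapes
  with negative entries; for these the count is 0.\<close>

fun perm_count :: "nat \<Rightarrow> nat list \<Rightarrow> (nat \<Rightarrow> int) \<Rightarrow> int" where
  "perm_count l [] \<alpha> = of_bool (\<forall>i<l. \<alpha> i = 0)"
| "perm_count l (r # rs) \<alpha> = (\<Sum>j<l. perm_count l rs (shift \<alpha> j (- int r)))"

definition fixed_tabloids :: "nat \<Rightarrow> (nat \<Rightarrow> int) \<Rightarrow> 'a set \<Rightarrow> ('a \<Rightarrow> 'a) \<Rightarrow> 'a set list set"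
  where "fixed_tabloids l \<alpha> A g = {T \<in> tabloids l \<alpha> A. \<forall>i<l. g ` (T ! i) = T ! i}"

lemma cyclic_on_subset_invariant:
  assumes "cyclic_on g S" "x \<in> S" "x \<in> R" "g ` R = R"
  shows "S \<subseteq> (R :: 'a set)"
proof -
  have "S = orbit g x" using assms(1,2) by (simp add: cyclic_on_alldef)
  then show ?thesis using orbit_subset_invariant[of x R g] assms(3,4) by blast
qed

lemma cyclic_on_image_eq:
  assumes "cyclic_on g S" shows "g ` S = S"
proof -
  obtain s where s: "s \<in> S" "S = orbit g s" using assms by (auto simp: cyclic_on_def)
  have "x \<in> g ` S" if "x \<in> orbit g s" for x
    using that s by cases auto
  then show ?thesis using s(2) by (auto intro: orbit.step)
qed

text \<open>Deleting the cycle \<open>S\<close> from the row that holds it is invertible: since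
  \<open>S\<close> is disjoint from \<open>A\<close>, it can be put back into row
  \<open>j\<close>.\<close>

lemma card_fixed_tabloids_step:
  assumes S: "cyclic_on g S" "finite S" "S \<inter> A = {}" and A: "finite A" "g ` A = A" and j: "j < l"
  shows "card {T \<in> fixed_tabloids l \<alpha> (S \<union> A) g. S \<subseteq> T ! j}
     = card (fixed_tabloids l (shift \<alpha> j (- int (card S))) A g)"
proof (rule bij_betw_same_card, rule bij_betw_byWitness[where f' = "\<lambda>T. T[j := T ! j \<union> S]"])
  let ?L = "{T \<in> fixed_tabloids l \<alpha> (S \<union> A) g. S \<subseteq> T ! j}"
  let ?R = "fixed_tabloids l (shift \<alpha> j (- int (card S))) A g"
  let ?f = "\<lambda>T. T[j := T ! j - S]"
  have gS: "g ` S = S" by (rule cyclic_on_image_eq[OF S(1)])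
  show "\<forall>T\<in>?L. (?f T)[j := ?f T ! j \<union> S] = T"
    using j by (auto simp: fixed_tabloids_def tabloids_def list_update_id Un_absorb2)
  have RA: "T ! i \<subseteq> A" if "T \<in> ?R" "i < l" for T i
    using that by (auto simp: fixed_tabloids_def tabloids_def)
  show "\<forall>T\<in>?R. ?f (T[j := T ! j \<union> S]) = T"
  proof
    fix T assume T: "T \<in> ?R"
    then have "T ! j \<inter> S = {}" using RA[OF T j] S(3) by auto
    then have "T ! j \<union> S - S = T ! j" by auto
    then show "?f (T[j := T ! j \<union> S]) = T"
      using j T by (simp add: fixed_tabloids_def tabloids_def)
  qed
  show "?f ` ?L \<subseteq> ?R"
  proof safe
    fix T assume T: "T \<in> fixed_tabloids l \<alpha> (S \<union> A) g" "S \<subseteq> T ! j"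
    have len: "length T = l" and dis: "\<And>i k. i < l \<Longrightarrow> k < l \<Longrightarrow> i \<noteq> k \<Longrightarrow> T ! i \<inter> T ! k = {}"
      and un: "(\<Union>i<l. T ! i) = S \<union> A" and inv: "\<And>i. i < l \<Longrightarrow> g ` (T ! i) = T ! i"
      and cd: "\<And>i. i < l \<Longrightarrow> int (card (T ! i)) = \<alpha> i"
      using T by (auto simp: fixed_tabloids_def tabloids_def)
    have fin: "finite (T ! i)" if "i < l" for i
      using un that S(2) A(1) by (metis UN_upper finite_UnI finite_subset lessThan_iff)
    have nth: "?f T ! i = (if i = j then T ! j - S else T ! i)" if "i < l" for i using that len by auto
    have notS: "T ! i \<inter> S = {}" if "i < l" "i \<noteq> j" for i using dis[OF that(1) j that(2)] T(2) by auto
    have "(\<Union>i<l. ?f T ! i) = (\<Union>i<l. T ! i - S)"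
      using nth notS by (intro SUP_cong refl) auto
    also have "\<dots> = A" using un S(3) by auto
    finally have "(\<Union>i<l. ?f T ! i) = A" .
    moreover have "g ` (?f T ! i) = ?f T ! i" if i: "i < l" for i
    proof -
      have "g ` (T ! j - S) = T ! j - S"
      proof -
        have "T ! j - S = T ! j \<inter> A" using un j S(3) by auto
        have inj: "inj_on g (T ! j)" using inv[OF j] fin[OF j] by (simp add: eq_card_imp_inj_on)
        have "g ` (T ! j - S) = g ` (T ! j) - g ` S"
          using inj T(2) by (intro inj_on_image_set_diff[OF inj]) auto
        then show ?thesis using inv[OF j] gS by simp
      qed
      then show ?thesis using nth[OF i] inv[OF i] by simp
    qed
    moreover have "int (card (?f T ! i)) = shift \<alpha> j (- int (card S)) i" if i: "i < l" for i
      using nth[OF i] cd[OF i] T(2) card_Diff_subset[OF S(2) T(2)] card_mono[OF fin[OF j] T(2)]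
      by (auto simp: shift_def)
    moreover have "?f T ! i \<inter> ?f T ! k = {}" if "i < l" "k < l" "i \<noteq> k" for i k
      using nth that dis[OF that] by auto
    ultimately show "?f T \<in> ?R" using len by (auto simp: fixed_tabloids_def tabloids_def)
  qed
  show "(\<lambda>T. T[j := T ! j \<union> S]) ` ?R \<subseteq> ?L"
  proof safe
    fix T assume T: "T \<in> ?R"
    let ?h = "T[j := T ! j \<union> S]"
    have len: "length T = l" and dis: "\<And>i k. i < l \<Longrightarrow> k < l \<Longrightarrow> i \<noteq> k \<Longrightarrow> T ! i \<inter> T ! k = {}"
      and un: "(\<Union>i<l. T ! i) = A" and inv: "\<And>i. i < l \<Longrightarrow> g ` (T ! i) = T ! i"
      and cd: "\<And>i. i < l \<Longrightarrow> int (card (T ! i)) = shift \<alpha> j (- int (card S)) i"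
      using T by (auto simp: fixed_tabloids_def tabloids_def)
    have nth: "?h ! i = (if i = j then T ! j \<union> S else T ! i)" if "i < l" for i using that len by auto
    have fin: "finite (T ! i)" if "i < l" for i
      using RA[OF T that] A(1) finite_subset by blast
    have "(\<Union>i<l. ?h ! i) = (\<Union>i<l. (if i = j then T ! j \<union> S else T ! i))"
      using nth by (intro SUP_cong refl) auto
    also have "\<dots> = S \<union> A" using un j by (auto split: if_splits)
    finally have "(\<Union>i<l. ?h ! i) = S \<union> A" .
    moreover have "g ` (?h ! i) = ?h ! i" if i: "i < l" for i
      using nth[OF i] inv[OF i] inv[OF j] gS by (simp add: image_Un)
    moreover have "int (card (?h ! i)) = \<alpha> i" if i: "i < l" for i
    proof (cases "i = j")
      case True
      have "card (T ! j \<union> S) = card (T ! j) + card S"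
        using RA[OF T j] S(3) fin[OF j] S(2) by (intro card_Un_disjoint) auto
      then show ?thesis using nth[OF i] cd[OF j] True by (simp add: shift_def)
    qed (use nth[OF i] cd[OF i] in \<open>simp add: shift_def\<close>)
    moreover have "?h ! i \<inter> ?h ! k = {}" if "i < l" "k < l" "i \<noteq> k" for i k
      using nth that dis[OF that] RA[OF T that(1)] RA[OF T that(2)] S(3) by auto
    ultimately show "?h \<in> fixed_tabloids l \<alpha> (S \<union> A) g"
      using len by (simp add: fixed_tabloids_def tabloids_def)
    show "x \<in> ?h ! j" if "x \<in> S" for x using nth[OF j] that by simp
  qed
qed

lemma cycle_list_image: "cycle_list g A rs \<Longrightarrow> g ` A = A"
  by (induction rule: cycle_list.induct) (auto simp: cyclic_on_image_eq image_Un)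

text \<open>The rows of a fixed tabloid are invariant, so a cycle lies inside exactly one of them.
  Splitting by that row is the recursion of \<open>perm_count\<close>.\<close>

lemma card_fixed_tabloids:
  "cycle_list g A rs \<Longrightarrow> int (card (fixed_tabloids l \<alpha> A g)) = perm_count l rs \<alpha>"
proof (induction arbitrary: \<alpha> rule: cycle_list.induct)
  case Nil
  have "fixed_tabloids l \<alpha> {} g = (if \<forall>i<l. \<alpha> i = 0 then {replicate l {}} else {})"
    by (auto simp: fixed_tabloids_def tabloids_def intro!: nth_equalityI)
  then show ?case by simp
next
  case (Cons S A rs)
  let ?F = "fixed_tabloids l \<alpha> (S \<union> A) g"
  have A: "finite A" "g ` A = A" using cycle_list_finite[OF Cons(4)] cycle_list_image[OF Cons(4)] by auto
  have fin: "finite ?F" unfolding fixed_tabloids_def using finite_tabloids[of "S \<union> A"] Cons(2) A by auto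
  obtain s where s: "s \<in> S" using cyclic_on_nonempty[OF Cons(1)] by blast
  have F: "?F = (\<Union>j<l. {T \<in> ?F. S \<subseteq> T ! j})"
  proof safe
    fix T assume T: "T \<in> ?F"
    then have "(\<Union>i<l. T ! i) = S \<union> A" by (simp add: fixed_tabloids_def tabloids_def)
    then obtain j where j: "j < l" "s \<in> T ! j" using s by blast
    then have "S \<subseteq> T ! j"
      using cyclic_on_subset_invariant[OF Cons(1) s j(2)] T by (auto simp: fixed_tabloids_def)
    then show "T \<in> (\<Union>j<l. {T \<in> ?F. S \<subseteq> T ! j})" using j T by blast
  qed
  have "card ?F = (\<Sum>j<l. card {T \<in> ?F. S \<subseteq> T ! j})"
  proof (subst F, rule card_UN_disjoint)
    show "\<forall>i\<in>{..<l}. \<forall>j\<in>{..<l}. i \<noteq> j \<longrightarrow> {T \<in> ?F. S \<subseteq> T ! i} \<inter> {T \<in> ?F. S \<subseteq> T ! j} = {}"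
    proof (safe)
      fix i j T assume ij: "i < l" "j < l" "i \<noteq> j" "T \<in> ?F" "S \<subseteq> T ! i" "S \<subseteq> T ! j"
      then have "T ! i \<inter> T ! j = {}" by (simp add: fixed_tabloids_def tabloids_def)
      moreover have "s \<in> T ! i \<inter> T ! j" using s ij by auto
      ultimately show "T \<in> {}" by blast
    qed
  qed (use fin in auto)
  also have "\<dots> = (\<Sum>j<l. card (fixed_tabloids l (shift \<alpha> j (- int (card S))) A g))"
    using card_fixed_tabloids_step[OF Cons(1-3) A] by simp
  finally show ?case using Cons.IH by simp
qed

text \<open>The determinantal formula, writing an irreducible character as an alternating sum of
  permutation characters. Both sides obey the same recursion over the cycle type, because lowering
  an entry commutes with subtracting the permuted staircase.\<close>

lemma xchar_perm_count:
  "xchar l rs v = (\<Sum>\<pi> | \<pi> permutes {..<l}. sign \<pi> * perm_count l rs (\<lambda>i. v i - staircase l (\<pi> i)))"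
proof (induction rs arbitrary: v)
  case Nil
  then show ?case by (simp add: pairing_def)
next
  case (Cons r rs)
  have "(\<lambda>i. shift v j c i - staircase l (\<pi> i)) = shift (\<lambda>i. v i - staircase l (\<pi> i)) j c" for \<pi> j c
    by (auto simp: shift_def fun_eq_iff)
  then show ?case by (simp add: Cons.IH sum_distrib_left, subst sum.swap, simp)
qed

section \<open>Summation over permutations by the cycle of one point\<close>

lemma orbit_transpose_comp:
  assumes B: "finite B" and h: "h permutes B" and "a \<notin> B" "b \<in> B"
    and g: "g = transpose a b \<circ> h"
  shows "orbit g a = insert a (orbit h b)"
    and "x \<in> B - orbit h b \<Longrightarrow> g x = h x"
proof -
  have ph: "permutation h" using B h permutation_permutes by blast
  have g_perm: "g permutes insert a B"
    unfolding g by (rule permutes_compose[OF permutes_subset[OF h]]) (use assms in \<open>auto intro: permutes_swap_id\<close>)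
  then have pg: "permutation g" using B permutation_permutes by blast
  have ha: "h a = a" using assms by (simp add: permutes_not_in)
  have ga: "g a = b" using ha g by simp
  have hB: "h x \<in> B" if "x \<in> B" for x using permutes_in_image[OF h] that by simp
  have gB: "g x = (if h x = b then a else h x)" if "x \<in> B" for x
    using g hB[OF that] assms(3) by (auto simp: transpose_def)
  have orbB: "orbit h b \<subseteq> B" using orbit_subset_invariant[of b B h] assms(4) hB by blast
  have bb: "b \<in> orbit h b" using permutation_self_in_orbit[OF ph] .
  show "orbit g a = insert a (orbit h b)"
  proof
    show "orbit g a \<subseteq> insert a (orbit h b)"
    proof
      fix x assume "x \<in> orbit g a"
      then show "x \<in> insert a (orbit h b)"
      proof (induction rule: orbit.induct)
        case base
        show ?case using ga bb by simp
      next
        case (step x)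
        then show ?case using ga bb gB[of x] subsetD[OF orbB] orbit.step[of x h b] by (auto split: if_splits)
      qed
    qed
    have ba: "b \<in> orbit g a" using ga orbit.base[of g a] by simp
    have hy: "h y \<in> orbit g a" if "y \<in> B" "y \<in> orbit g a" for y
      using gB[OF that(1)] orbit.step[OF that(2)] ba by (auto split: if_splits)
    have "x \<in> orbit g a" if "x \<in> orbit h b" for x
      using that by (induction rule: orbit.induct) (use hy ba assms(4) subsetD[OF orbB] in auto)
    then show "insert a (orbit h b) \<subseteq> orbit g a" using permutation_self_in_orbit[OF pg] by auto
  qed
  assume x: "x \<in> B - orbit h b"
  then have "h x \<noteq> b" using permutation_orbit_eq_iff[OF ph, of x b] bb by auto
  then show "g x = h x" using gB x by simp
qed

text \<open>For each length, the number of possible cycles through \<open>a\<close> times the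
  factorial of the number of remaining points is \<open>fact (card B)\<close>; the hypothesis says
  that sums over the remaining points depend only on their number. The offset \<open>i\<close>
  counts points already cut out of the cycle: splitting off \<open>transpose a b\<close> removes
  \<open>a\<close> from its cycle, marks \<open>b\<close> instead and raises \<open>i\<close> by
  one.\<close>

lemma sum_permutes_by_orbit:
  fixes B :: "'a set"
  assumes "finite B" "a \<notin> B"
    and "\<And>(B' :: 'a set) c. finite B' \<Longrightarrow> c + card B' = i + 1 + card B \<Longrightarrow> i < c \<Longrightarrow>
      (\<Sum>h | h permutes B'. F c (cycle_type h B')) = fact (card B') * H c (card B')"
  shows "(\<Sum>g | g permutes insert a B. F (card (orbit g a) + i) (cycle_type g (insert a B - orbit g a)))
    = fact (card B) * (\<Sum>c\<in>{i + 1..i + 1 + card B}. H c (i + 1 + card B - c) :: int)"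
  using assms
proof (induction "card B" arbitrary: a B i rule: less_induct)
  case less
  note B = less.prems(1) and aB = less.prems(2) and hyp = less.prems(3)
  let ?G = "\<lambda>g. F (card (orbit g a) + i) (cycle_type g (insert a B - orbit g a))"
  have inj: "inj_on (\<lambda>(b, p). transpose a b \<circ> p) (insert a B \<times> {p. p permutes B})"
  proof (rule inj_onI, clarify)
    fix b p b' p' assume p: "p permutes B" "p' permutes B"
      and eq: "transpose a b \<circ> p = transpose a b' \<circ> p'"
    have "p a = a" "p' a = a" using p aB by (auto simp: permutes_not_in)
    then have "b = b'" using fun_cong[OF eq, of a] by simp
    moreover from this have "p = p'"
      using eq by (metis comp_assoc id_comp transpose_comp_involutory)
    ultimately show "b = b' \<and> p = p'" by simp
  qed
  have "(\<Sum>g | g permutes insert a B. ?G g)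
      = (\<Sum>(b, p)\<in>insert a B \<times> {p. p permutes B}. ?G (transpose a b \<circ> p))"
  proof -
    have "{(b, p). b \<in> insert a B \<and> p \<in> {p. p permutes B}} = insert a B \<times> {p. p permutes B}" by auto
    then show ?thesis
      unfolding permutes_insert by (simp only: sum.reindex[OF inj]) (simp add: case_prod_beta comp_def)
  qed
  also have "\<dots> = (\<Sum>b\<in>insert a B. \<Sum>p | p permutes B. ?G (transpose a b \<circ> p))"
    by (rule sum.cartesian_product[symmetric])
  also have "\<dots> = (\<Sum>p | p permutes B. ?G p) + (\<Sum>b\<in>B. \<Sum>p | p permutes B. ?G (transpose a b \<circ> p))"
    using B aB by simp
  \<comment> \<open>These permutations fix \<open>a\<close>, whose cycle therefore has length
    1.\<close>
  also have "(\<Sum>p | p permutes B. ?G p) = fact (card B) * H (i + 1) (card B)"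
  proof -
    have "?G p = F (i + 1) (cycle_type p B)" if "p permutes B" for p
    proof -
      have "p a = a" using that aB by (simp add: permutes_not_in)
      then have "orbit p a = {a}" by (simp add: orbit_eq_singleton_iff)
      then show ?thesis using aB by simp
    qed
    then have "(\<Sum>p | p permutes B. ?G p) = (\<Sum>p | p permutes B. F (i + 1) (cycle_type p B))" by simp
    also have "\<dots> = fact (card B) * H (i + 1) (card B)" using B by (intro hyp) auto
    finally show ?thesis .
  qed
  also have "(\<Sum>b\<in>B. \<Sum>p | p permutes B. ?G (transpose a b \<circ> p))
     = (\<Sum>b\<in>B. fact (card B - 1) * (\<Sum>c\<in>{i + 2..i + 1 + card B}. H c (i + 1 + card B - c)))"
  proof (rule sum.cong[OF refl])
    fix b assume b: "b \<in> B"
    then have cB: "card B = Suc (card (B - {b}))" using B by (metis card_Suc_Diff1)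
    have iB: "insert b (B - {b}) = B" using b by auto
    have "(\<Sum>p | p permutes B. ?G (transpose a b \<circ> p))
        = (\<Sum>p | p permutes insert b (B - {b}). F (card (orbit p b) + (i + 1)) (cycle_type p (insert b (B - {b}) - orbit p b)))"
      unfolding iB
    proof (rule sum.cong[OF refl])
      fix p assume "p \<in> {p. p permutes B}"
      then have p: "p permutes B" by simp
      note orb = orbit_transpose_comp[OF B p aB b refl]
      have "orbit p b \<subseteq> B" using orbit_subset_invariant[of b B p] b permutes_in_image[OF p] by blast
      then have "finite (orbit p b)" "a \<notin> orbit p b" using B aB finite_subset by auto
      moreover have "insert a B - orbit (transpose a b \<circ> p) a = B - orbit p b"
        unfolding orb(1) using aB by auto
      moreover have "cycle_type (transpose a b \<circ> p) (B - orbit p b) = cycle_type p (B - orbit p b)"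
        by (rule cycle_type_cong) (rule orb(2))
      ultimately show "?G (transpose a b \<circ> p) = F (card (orbit p b) + (i + 1)) (cycle_type p (B - orbit p b))"
        by (simp add: orb(1))
    qed
    also have "\<dots> = fact (card (B - {b})) * (\<Sum>c\<in>{i + 1 + 1..i + 1 + 1 + card (B - {b})}. H c (i + 1 + 1 + card (B - {b}) - c))"
    proof (rule less.hyps)
      show "card (B - {b}) < card B" using cB by simp
      fix B' :: "'a set" and c assume "finite B'" "c + card B' = i + 1 + 1 + card (B - {b})" "i + 1 < c"
      then show "(\<Sum>h | h permutes B'. F c (cycle_type h B')) = fact (card B') * H c (card B')"
        using cB by (intro hyp) auto
    qed (use B in auto)
    finally show "(\<Sum>p | p permutes B. ?G (transpose a b \<circ> p))
        = fact (card B - 1) * (\<Sum>c\<in>{i + 2..i + 1 + card B}. H c (i + 1 + card B - c))"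
      using cB by simp
  qed
  also have "\<dots> = fact (card B) * (\<Sum>c\<in>{i + 2..i + 1 + card B}. H c (i + 1 + card B - c))"
    by (cases "card B") auto
  also have "fact (card B) * H (i + 1) (card B) + \<dots>
      = fact (card B) * (\<Sum>c\<in>{i + 1..i + 1 + card B}. H c (i + 1 + card B - c))"
  proof -
    have "{i + 1..i + 1 + card B} = insert (i + 1) {i + 2..i + 1 + card B}" by auto
    then show ?thesis by (simp add: algebra_simps)
  qed
  finally show ?case .
qed

section \<open>Vectors with the least possible sum\<close>

lemma sum_ge_card:
  fixes S :: "nat set"
  assumes "finite S"
  shows "\<Sum>{..<card S} \<le> \<Sum>S \<and> (\<Sum>S = \<Sum>{..<card S} \<longrightarrow> S = {..<card S})"
  using assms
proof (induction "card S" arbitrary: S)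
  case (Suc n)
  then have ne: "S \<noteq> {}" by auto
  define M where "M = Max S"
  define S' where "S' = S - {M}"
  have M: "M \<in> S" using ne Suc by (simp add: M_def)
  then have S: "S = insert M S'" "M \<notin> S'" "finite S'" using Suc by (auto simp: S'_def)
  then have n: "card S' = n" using Suc by simp
  have "S \<subseteq> {..M}" using Suc by (auto simp: M_def)
  then have nM: "n \<le> M" using card_mono[of "{..M}" S] Suc(2) by simp
  have IH: "\<Sum>{..<n} \<le> \<Sum>S'" "\<Sum>S' = \<Sum>{..<n} \<longrightarrow> S' = {..<n}"
    using Suc(1)[OF n[symmetric] S(3)] n by auto
  have sum: "\<Sum>S = M + \<Sum>S'" "\<Sum>{..<Suc n} = n + \<Sum>{..<n}" using S by (auto simp: lessThan_Suc)
  have "S = {..<Suc n}" if "\<Sum>S = \<Sum>{..<Suc n}"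
  proof -
    have "M = n" "\<Sum>S' = \<Sum>{..<n}" using that sum IH nM by linarith+
    then show ?thesis using IH S by (auto simp: lessThan_Suc)
  qed
  then show ?case using sum IH nM Suc(2) by (metis add_mono)
qed simp

lemma inj_on_nonneg_sum:
  assumes pos: "\<And>j. j < l \<Longrightarrow> 0 \<le> v j" and inj: "inj_on v {..<l}"
  shows "int l * (int l - 1) \<le> 2 * (\<Sum>j<l. v j)"
    and "2 * (\<Sum>j<l. v j) = int l * (int l - 1) \<Longrightarrow> v ` {..<l} = {0..<int l}"
proof -
  define S where "S = (nat \<circ> v) ` {..<l}"
  have inj': "inj_on (nat \<circ> v) {..<l}"
  proof (rule inj_onI)
    fix x y assume xy: "x \<in> {..<l}" "y \<in> {..<l}" "(nat \<circ> v) x = (nat \<circ> v) y"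
    then have "v x = v y" using pos[of x] pos[of y] by simp
    then show "x = y" using inj xy by (auto simp: inj_on_def)
  qed
  have card: "card S = l" using card_image[OF inj'] by (simp only: S_def card_lessThan)
  have "int (\<Sum>S) = (\<Sum>j<l. v j)"
    using pos by (simp only: S_def of_nat_sum sum.reindex[OF inj']) (simp add: comp_def)
  moreover have gauss: "2 * int (\<Sum>{..<l}) = int l * (int l - 1)" for l :: nat
    by (induction l) (auto simp: lessThan_Suc algebra_simps)
  ultimately have eq: "2 * (\<Sum>j<l. v j) = 2 * int (\<Sum>S)" "int l * (int l - 1) = 2 * int (\<Sum>{..<l})"
    by auto
  have "finite S" by (simp add: S_def)
  note ge = sum_ge_card[OF this, unfolded card]
  then show "int l * (int l - 1) \<le> 2 * (\<Sum>j<l. v j)" unfolding eq by linarith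
  assume "2 * (\<Sum>j<l. v j) = int l * (int l - 1)"
  then have "\<Sum>S = \<Sum>{..<l}" unfolding eq by linarith
  then have S: "S = {..<l}" using ge by blast
  have "v ` {..<l} = int ` S" using pos by (force simp: S_def image_comp)
  then show "v ` {..<l} = {0..<int l}" unfolding S by (simp add: image_int_atLeastLessThan lessThan_atLeast0)
qed

lemma alternating_small_sum:
  assumes f: "alternating l f" and pos: "\<And>j. j < l \<Longrightarrow> 0 \<le> v j"
    and "2 * (\<Sum>j<l. v j) < int l * (int l - 1)"
  shows "f v = 0"
  using inj_on_nonneg_sum(1)[of l v] alternating_inj_on[OF f, of v] assms by force

lemma alternating_permute:
  assumes f: "alternating l f" and "\<pi> permutes {..<l}"
  shows "f (v \<circ> \<pi>) = sign \<pi> * f v"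
proof -
  have "\<forall>v. f (v \<circ> \<pi>) = sign \<pi> * f v"
  proof (rule permutes_induct[OF assms(2) finite_lessThan, where P = "\<lambda>p. \<forall>v. f (v \<circ> p) = sign p * f v"])
    fix a b and p :: "nat \<Rightarrow> nat"
    assume 2: "a \<in> {..<l}" "b \<in> {..<l}" "a \<noteq> b" "\<forall>v. f (v \<circ> p) = sign p * f v" "p permutes {..<l}"
    show "\<forall>v. f (v \<circ> (transpose a b \<circ> p)) = sign (transpose a b \<circ> p) * f v"
    proof
      fix v
      have "f (v \<circ> (transpose a b \<circ> p)) = sign p * f (v \<circ> transpose a b)"
        using 2 by (simp flip: comp_assoc)
      also have "f (v \<circ> transpose a b) = sign (transpose a b) * f v"
        using 2 alternating_swap[OF f] by (cases "a = b") (auto simp: sign_swap_id)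
      also have "sign p * (sign (transpose a b) * f v) = sign (transpose a b \<circ> p) * f v"
        using 2(5) permutation_permutes[of p] by (subst sign_compose) (auto simp: permutation_swap_id)
      finally show "f (v \<circ> (transpose a b \<circ> p)) = sign (transpose a b \<circ> p) * f v" .
    qed
  qed simp
  then show ?thesis by blast
qed

lemma staircase_bij: "bij_betw (staircase l) {..<l} {0..<int l}"
  by (rule bij_betw_byWitness[where f' = "\<lambda>x. nat (int l - 1 - x)"]) (auto simp: staircase_def)

text \<open>Distinct nonnegative entries of minimal sum are 0 to \<open>l - 1\<close> in some order,
  so \<open>v\<close> is a permuted staircase and both sides are its sign times
  \<open>f (staircase l)\<close>. A repetition makes both sides 0.\<close>

lemma alternating_ground:
  assumes f: "alternating l f" and pos: "\<And>j. j < l \<Longrightarrow> 0 \<le> v j"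
    and sum: "2 * (\<Sum>j<l. v j) = int l * (int l - 1)"
  shows "f v = pairing l v (staircase l) * f (staircase l)"
proof (cases "inj_on v {..<l}")
  case False
  then show ?thesis
    using alternating_inj_on[OF f] alternating_inj_on[OF alternating_pairing, of l v "staircase l"] by force
next
  case True
  have im: "v ` {..<l} = {0..<int l}" by (rule inj_on_nonneg_sum(2)[OF pos True sum])
  define \<pi> where "\<pi> i = (if i < l then the_inv_into {..<l} (staircase l) (v i) else i)" for i
  have bv: "bij_betw v {..<l} {0..<int l}" using True im by (simp add: bij_betw_def)
  have "bij_betw (the_inv_into {..<l} (staircase l) \<circ> v) {..<l} {..<l}"
    by (rule bij_betw_trans[OF bv bij_betw_the_inv_into[OF staircase_bij]])
  then have "bij_betw \<pi> {..<l} {..<l}"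
    by (rule bij_betw_cong[THEN iffD1, rotated]) (simp add: \<pi>_def)
  then have pi: "\<pi> permutes {..<l}"
    by (rule bij_imp_permutes) (simp add: \<pi>_def)
  have v: "v i = staircase l (\<pi> i)" if "i < l" for i
  proof -
    have "v i \<in> {0..<int l}" using that im by blast
    then show ?thesis using that f_the_inv_into_f_bij_betw[OF staircase_bij] by (simp add: \<pi>_def)
  qed
  have eq: "h v = sign \<pi> * h (staircase l)" if h: "alternating l h" for h
    using alternating_cong[OF h, of v "staircase l \<circ> \<pi>"] v alternating_permute[OF h pi] by simp
  have "pairing l (staircase l) (staircase l) = 1"
  proof -
    have "(\<forall>i<l. staircase l i = staircase l (\<pi> i)) \<longleftrightarrow> \<pi> = id" if "\<pi> permutes {..<l}" for \<pi>
      using that by (auto simp: staircase_def fun_eq_iff) (metis lessThan_iff permutes_not_in)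
    then have "pairing l (staircase l) (staircase l) = (\<Sum>\<pi> | \<pi> permutes {..<l}. if \<pi> = id then 1 else 0)"
      unfolding pairing_def by (intro sum.cong refl) auto
    then show ?thesis by (simp add: sum.delta finite_permutations permutes_id)
  qed
  then show ?thesis using eq[OF f] eq[OF alternating_pairing, of "staircase l"] by simp
qed

lemma pairing_negative:
  assumes "k < l" "w k < 0" "\<And>j. j < l \<Longrightarrow> 0 \<le> v j"
  shows "pairing l v w = 0"
  unfolding pairing_def
proof (rule sum.neutral, rule ballI)
  fix \<pi> assume "\<pi> \<in> {\<pi>. \<pi> permutes {..<l}}"
  then have pi: "\<pi> permutes {..<l}" by simp
  obtain i where "i < l" "\<pi> i = k"
    using permutes_image[OF pi] assms(1) by (metis imageE lessThan_iff)
  then have "\<not> (\<forall>i<l. v i = w (\<pi> i))" using assms(2) assms(3)[of i] by auto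
  then show "sign \<pi> * of_bool (\<forall>i<l. v i = w (\<pi> i)) = 0" by simp
qed

text \<open>Both lists count the same fixed tabloids, and by \<open>xchar_perm_count\<close> these
  counts determine the character value.\<close>

lemma xchar_cycle_list:
  assumes "cycle_list g A rs" "cycle_list g A rs'"
  shows "xchar l rs v = xchar l rs' v"
  unfolding xchar_perm_count using card_fixed_tabloids[OF assms(1)] card_fixed_tabloids[OF assms(2)]
  by (intro sum.cong refl) metis

text \<open>The Euler identity for \<open>pairing\<close> in its first argument, with raising in
  \<open>v\<close> moved across as lowering in \<open>w\<close>. The truncations lose nothing: a
  nonnegative vector pairs to 0 with one that has a negative entry, and for \<open>c\<close> beyond
  \<open>n\<close> the entries of the lowered \<open>v\<close> have a sum too small for distinct
  values.\<close>

lemma sum_pairing_shift: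
  assumes pos: "\<And>j. j < l \<Longrightarrow> 0 \<le> v j" and sum: "2 * (\<Sum>j<l. v j) = 2 * int n + int l * (int l - 1)"
  shows "(\<Sum>c\<in>{1..n}. \<Sum>j<l. \<Sum>k<l. if int c \<le> v j \<and> int c \<le> w k
      then pairing l (shift v j (- int c)) (shift w k (- int c)) else 0) = int n * pairing l v w"
proof -
  define P where "P c j = (\<Sum>k<l. pairing l (shift (shift v j (- int c)) k (int c)) w)" for c j
  have inner: "(\<Sum>k<l. if int c \<le> v j \<and> int c \<le> w k
      then pairing l (shift v j (- int c)) (shift w k (- int c)) else 0) = (if int c \<le> v j then P c j else 0)"
    if j: "j < l" for c j
  proof (cases "int c \<le> v j")
    case True
    have "pairing l (shift v j (- int c)) (shift w k (- int c)) = 0" if "k < l" "\<not> int c \<le> w k" for k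
      by (rule pairing_negative[of k]) (use that True pos in \<open>auto simp: shift_def\<close>)
    then have "(\<Sum>k<l. if int c \<le> v j \<and> int c \<le> w k
      then pairing l (shift v j (- int c)) (shift w k (- int c)) else 0)
      = (\<Sum>k<l. pairing l (shift v j (- int c)) (shift w k (- int c)))"
      using True by (intro sum.cong refl) auto
    then show ?thesis using True by (simp add: P_def pairing_adjoint)
  qed simp
  have big: "P c j = 0" if "j < l" "int c \<le> v j" "n < c" for c j
    unfolding P_def pairing_adjoint
  proof (rule sum.neutral, rule ballI)
    fix k
    have "(\<Sum>i<l. shift v j (- int c) i) = (\<Sum>i<l. v i) - int c"
      using that(1) by (simp add: shift_def sum.remove[of "{..<l}" j])
    then show "pairing l (shift v j (- int c)) (shift w k (- int c)) = 0"
      by (intro alternating_small_sum[OF alternating_pairing])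
        (use that sum pos in \<open>auto simp: shift_def\<close>)
  qed
  have "(\<Sum>c\<in>{1..n}. \<Sum>j<l. \<Sum>k<l. if int c \<le> v j \<and> int c \<le> w k
      then pairing l (shift v j (- int c)) (shift w k (- int c)) else 0)
      = (\<Sum>c\<in>{1..n}. \<Sum>j<l. if int c \<le> v j then P c j else 0)"
    by (intro sum.cong refl inner) auto
  also have "\<dots> = (\<Sum>j<l. \<Sum>c\<in>{1..n}. if int c \<le> v j then P c j else 0)" by (rule sum.swap)
  also have "\<dots> = (\<Sum>j<l. \<Sum>i\<in>{1..v j}. \<Sum>k<l. pairing l (shift (shift v j (- i)) k i) w)"
  proof (rule sum.cong[OF refl])
    fix j assume "j \<in> {..<l}"
    then have j: "j < l" by simp
    have "(\<Sum>c\<in>{1..n}. if int c \<le> v j then P c j else 0) = (\<Sum>c\<in>{1..nat (v j)}. P c j)"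
      by (rule sum.mono_neutral_cong) (use big[OF j] in \<open>auto simp: le_nat_iff not_le\<close>)
    also have "\<dots> = (\<Sum>i\<in>{1..v j}. \<Sum>k<l. pairing l (shift (shift v j (- i)) k i) w)"
      unfolding P_def by (rule sum.reindex_bij_witness[of _ nat int]) auto
    finally show "(\<Sum>c\<in>{1..n}. if int c \<le> v j then P c j else 0)
       = (\<Sum>i\<in>{1..v j}. \<Sum>k<l. pairing l (shift (shift v j (- i)) k i) w)" .
  qed
  also have "\<dots> = int n * pairing l v w"
    using alternating_euler[of l "\<lambda>v. pairing l v w" v, OF alternating_pairing pos] sum by simp
  finally show ?thesis .
qed

text \<open>Induction on the set: the cycle through a point \<open>a\<close>, of length
  \<open>c\<close> say, is cut off. The recursion expands both factors over removals of a
  \<open>c\<close>-ribbon, the induction hypothesis turns the sum over the remaining points into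
  \<open>pairing\<close>, and \<open>sum_pairing_shift\<close> adds up the lengths to the factor
  \<open>card A\<close>.\<close>

theorem xchar_orthonormal:
  fixes A :: "'a set"
  assumes "finite A" and v: "\<And>j. j < l \<Longrightarrow> 0 \<le> v j"
    and w: "\<And>j. j < l \<Longrightarrow> 0 \<le> w j" and "2 * (\<Sum>j<l. v j) = 2 * int (card A) + int l * (int l - 1)"
  shows "(\<Sum>g | g permutes A. xchar l (cycle_type g A) v * xchar l (cycle_type g A) w)
    = fact (card A) * pairing l v w"
  using assms
proof (induction "card A" arbitrary: A v w rule: less_induct)
  case less
  note v = less.prems(2) and w = less.prems(3) and sum = less.prems(4)
  show ?case
  proof (cases "A = {}")
    case True
    have "cycle_list id ({} :: 'a set) (cycle_type id ({} :: 'a set))"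
      using cycle_list_cycle_type[of id "{} :: 'a set"] by simp
    then have "cycle_type id ({} :: 'a set) = []" by cases (auto dest: cyclic_on_nonempty)
    then have ct: "xchar l (cycle_type id ({} :: 'a set)) u = pairing l u (staircase l)" for u by simp
    \<comment> \<open>For the empty set \<open>v\<close> has minimal sum, so it is compared with
      \<open>w\<close> through the staircase.\<close>
    have "pairing l v w = pairing l v (staircase l) * pairing l (staircase l) w"
      using alternating_ground[of l "\<lambda>v. pairing l v w" v, OF alternating_pairing v] sum True by simp
    then show ?thesis using True ct by (simp add: pairing_commute[of l w])
  next
    case False
    then obtain a B where A: "A = insert a B" and a: "a \<notin> B" by (meson Set.set_insert equals0I)
    have B: "finite B" using less.prems(1) A by simp
    have card: "card A = Suc (card B)" using A a B by simp
    let ?F = "\<lambda>c rs. xchar l (c # rs) v * xchar l (c # rs) w"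
    let ?H = "\<lambda>c (p :: nat). \<Sum>j<l. \<Sum>k<l. if int c \<le> v j \<and> int c \<le> w k
      then pairing l (shift v j (- int c)) (shift w k (- int c)) else 0"
    have "(\<Sum>g | g permutes A. xchar l (cycle_type g A) v * xchar l (cycle_type g A) w)
      = (\<Sum>g | g permutes insert a B. ?F (card (orbit g a) + 0) (cycle_type g (insert a B - orbit g a)))"
      unfolding A
    proof (rule sum.cong[OF refl])
      fix g assume "g \<in> {g. g permutes insert a B}"
      then have g: "g permutes insert a B" by simp
      have pg: "permutation g" using g B permutation_permutes by blast
      let ?S = "orbit g a"
      have S: "?S \<subseteq> insert a B" using orbit_subset_invariant[of a "insert a B" g] permutes_in_image[OF g] by blast
      have "cyclic_on g ?S" using permutation_self_in_orbit[OF pg] by (auto simp: cyclic_on_def)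
      moreover have "\<exists>rs. cycle_list g (insert a B - ?S) rs"
        by (rule cycle_list_exists)
          (use B pg permutes_in_image[OF g] permutation_orbit_eq_iff[OF pg] in auto)
      then have "cycle_list g (insert a B - ?S) (cycle_type g (insert a B - ?S))"
        unfolding cycle_type_def by (rule someI_ex)
      ultimately have "cycle_list g (?S \<union> (insert a B - ?S)) (card ?S # cycle_type g (insert a B - ?S))"
        using S B by (intro cycle_list.Cons) (auto intro: finite_subset)
      moreover have "?S \<union> (insert a B - ?S) = insert a B" using S by auto
      ultimately have cl: "cycle_list g (insert a B) (card ?S # cycle_type g (insert a B - ?S))" by simp
      have "cycle_list g (insert a B) (cycle_type g (insert a B))"
        by (rule cycle_list_cycle_type[OF g]) (use B in simp)
      note xchar_cycle_list[OF this cl]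
      then show "xchar l (cycle_type g (insert a B)) v * xchar l (cycle_type g (insert a B)) w
        = ?F (card (orbit g a) + 0) (cycle_type g (insert a B - orbit g a))"
        by (simp del: xchar.simps)
    qed
    also have "\<dots> = fact (card B) * (\<Sum>c\<in>{0 + 1..0 + 1 + card B}. ?H c (0 + 1 + card B - c))"
    proof (rule sum_permutes_by_orbit[OF B a])
      fix B' :: "'a set" and c :: nat
      assume B': "finite B'" "c + card B' = 0 + 1 + card B" "0 < c"
      have "(\<Sum>h | h permutes B'. ?F c (cycle_type h B'))
        = (\<Sum>h | h permutes B'. \<Sum>j<l. \<Sum>k<l. xchar l (cycle_type h B') (shift v j (- int c)) *
            xchar l (cycle_type h B') (shift w k (- int c)))"
        by (simp add: sum_product)
      also have "\<dots> = (\<Sum>j<l. \<Sum>k<l. \<Sum>h | h permutes B'. xchar l (cycle_type h B') (shift v j (- int c)) *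
            xchar l (cycle_type h B') (shift w k (- int c)))"
        by (subst sum.swap, intro sum.cong refl, rule sum.swap)
      also have "\<dots> = (\<Sum>j<l. \<Sum>k<l. fact (card B') * (if int c \<le> v j \<and> int c \<le> w k
          then pairing l (shift v j (- int c)) (shift w k (- int c)) else 0))"
      proof (intro sum.cong refl)
        fix j k assume jk: "j \<in> {..<l}" "k \<in> {..<l}"
        let ?v = "shift v j (- int c)" and ?w = "shift w k (- int c)"
        show "(\<Sum>h | h permutes B'. xchar l (cycle_type h B') ?v * xchar l (cycle_type h B') ?w)
          = fact (card B') * (if int c \<le> v j \<and> int c \<le> w k then pairing l ?v ?w else 0)"
        proof (cases "int c \<le> v j \<and> int c \<le> w k")
          case True
          have "(\<Sum>i<l. ?v i) = (\<Sum>i<l. v i) - int c"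
            using jk(1) by (simp add: shift_def sum.remove[of "{..<l}" j])
          then have "(\<Sum>h | h permutes B'. xchar l (cycle_type h B') ?v * xchar l (cycle_type h B') ?w)
            = fact (card B') * pairing l ?v ?w"
            by (intro less.hyps) (use card B' True v w sum in \<open>auto simp: shift_def\<close>)
          then show ?thesis using True by simp
        next
          case False
          then have "xchar l rs ?v * xchar l rs ?w = 0" for rs
            using xchar_negative[of j l ?v rs] xchar_negative[of k l ?w rs] jk by (auto simp: shift_def)
          then have "(\<Sum>h | h permutes B'. xchar l (cycle_type h B') ?v * xchar l (cycle_type h B') ?w) = 0"
            by (intro sum.neutral) blast
          then show ?thesis using False by auto
        qed
      qed
      finally show "(\<Sum>h | h permutes B'. ?F c (cycle_type h B')) = fact (card B') * ?H c (card B')"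
        by (simp add: sum_distrib_left)
    qed
    also have "\<dots> = fact (card B) * (int (card A) * pairing l v w)"
      using sum_pairing_shift[OF v sum, of w] card by simp
    finally show ?thesis using card by simp
  qed
qed

section \<open>Traces and intertwiners\<close>

text \<open>Linearity on a subspace only: a representation is prescribed on its space and may be
  anything outside it.\<close>

definition linear_on :: "('x \<Rightarrow> complex) set \<Rightarrow> ('y \<Rightarrow> complex) set \<Rightarrow> (('x \<Rightarrow> complex) \<Rightarrow> ('y \<Rightarrow> complex)) \<Rightarrow> bool"
  where "linear_on V W f \<longleftrightarrow> (\<forall>u\<in>V. f u \<in> W) \<and> (\<forall>u\<in>V. \<forall>v\<in>V. f (u + v) = f u + f v)
    \<and> (\<forall>c. \<forall>u\<in>V. f (cscale c u) = cscale c (f u))"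

definition basis_of :: "('x \<Rightarrow> complex) set \<Rightarrow> ('x \<Rightarrow> complex) set \<Rightarrow> bool"
  where "basis_of V B \<longleftrightarrow> finite B \<and> cfun.independent B \<and> cfun.span B = V"

definition coord :: "('x \<Rightarrow> complex) set \<Rightarrow> ('x \<Rightarrow> complex) \<Rightarrow> ('x \<Rightarrow> complex) \<Rightarrow> complex"
  where "coord B v b = cfun.representation B v b"

lemma sum_cscale_const: "(\<Sum>i\<in>I. u) = cscale (of_nat (card I)) u"
proof (induction I rule: infinite_finite_induct)
  case (insert i I)
  then show ?case
    by (simp only: sum.insert[OF insert(1,2)] card_insert_disjoint[OF insert(1,2)] of_nat_Suc cfun.scale_left_distrib cfun.scale_one)
next
  case (infinite I)
  then show ?case by (simp only: sum.infinite[OF infinite] card.infinite[OF infinite] of_nat_0 cfun.scale_zero_left)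
qed (simp only: sum.empty card.empty of_nat_0 cfun.scale_zero_left)

lemma linear_on_sum:
  assumes f: "linear_on V W f" and V: "cfun.subspace V" and "finite S" "\<And>x. x \<in> S \<Longrightarrow> h x \<in> V"
  shows "f (\<Sum>x\<in>S. cscale (c x) (h x)) = (\<Sum>x\<in>S. cscale (c x) (f (h x)))"
  using assms(3,4)
proof (induction S rule: finite_induct)
  case empty
  have "f (cscale 0 0) = cscale 0 (f 0)" using f cfun.subspace_0[OF V] unfolding linear_on_def by blast
  then show ?case by (simp only: sum.empty cfun.scale_zero_left)
next
  case (insert x S)
  have "(\<Sum>x\<in>S. cscale (c x) (h x)) \<in> V"
    using insert by (intro cfun.subspace_sum[OF V] cfun.subspace_scale[OF V]) auto
  moreover have "h x \<in> V" "cscale (c x) (h x) \<in> V" using insert cfun.subspace_scale[OF V] by auto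
  ultimately have "f (cscale (c x) (h x) + (\<Sum>x\<in>S. cscale (c x) (h x)))
      = cscale (c x) (f (h x)) + f (\<Sum>x\<in>S. cscale (c x) (h x))"
    using f unfolding linear_on_def by metis
  moreover have "f (\<Sum>x\<in>S. cscale (c x) (h x)) = (\<Sum>x\<in>S. cscale (c x) (f (h x)))" using insert by simp
  ultimately show ?case by (simp only: sum.insert[OF insert(1,2)])
qed

lemma basis_coord_sum:
  assumes "basis_of V B" "v \<in> V"
  shows "(\<Sum>b\<in>B. cscale (coord B v b) b) = v"
  using assms by (auto simp: basis_of_def coord_def intro!: cfun.sum_representation_eq)

lemma basis_mem: "basis_of V B \<Longrightarrow> b \<in> B \<Longrightarrow> b \<in> V"
  by (auto simp: basis_of_def cfun.span_base)

lemma basis_subspace: "basis_of V B \<Longrightarrow> cfun.subspace V"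
  by (auto simp: basis_of_def cfun.subspace_span)

lemma coord_add: "basis_of V B \<Longrightarrow> u \<in> V \<Longrightarrow> v \<in> V \<Longrightarrow> coord B (u + v) b = coord B u b + coord B v b"
  by (auto simp: basis_of_def coord_def cfun.representation_add)

lemma coord_scale: "basis_of V B \<Longrightarrow> u \<in> V \<Longrightarrow> coord B (cscale c u) b = c * coord B u b"
  by (auto simp: basis_of_def coord_def cfun.representation_scale)

lemma coord_sum: "basis_of V B \<Longrightarrow> (\<And>i. i \<in> I \<Longrightarrow> h i \<in> V) \<Longrightarrow> coord B (\<Sum>i\<in>I. h i) b = (\<Sum>i\<in>I. coord B (h i) b)"
  by (auto simp: basis_of_def coord_def cfun.representation_sum)

lemma basis_exists:
  assumes "finite S" "cfun.span S = V"
  shows "\<exists>B. basis_of V B"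
proof -
  obtain B where "B \<subseteq> S" "cfun.independent B" "cfun.span B = cfun.span S"
    by (metis cfun.maximal_independent_subset cfun.span_eq cfun.span_superset subset_trans cfun.span_mono cfun.span_minimal cfun.subspace_span)
  then show ?thesis using assms finite_subset[of B S] by (intro exI[of _ B]) (simp add: basis_of_def)
qed

lemma independent_basis_of:
  assumes "basis_of V B" "cfun.independent C" "cfun.span C = V"
  shows "basis_of V C"
proof -
  have "finite C"
    using cfun.independent_span_bound[of B C] assms cfun.span_superset[of C] by (auto simp: basis_of_def)
  then show ?thesis using assms by (simp add: basis_of_def)
qed

lemma coord_linear: "basis_of V B \<Longrightarrow> linear_on V W f \<Longrightarrow> basis_of W C \<Longrightarrow> v \<in> V \<Longrightarrow>
  coord C (f v) c = (\<Sum>b\<in>B. coord B v b * coord C (f b) c)"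
proof -
  assume B: "basis_of V B" and f: "linear_on V W f" and C: "basis_of W C" and v: "v \<in> V"
  have fB: "f b \<in> W" if "b \<in> B" for b using basis_mem[OF B that] f by (auto simp: linear_on_def)
  have "f v = f (\<Sum>b\<in>B. cscale (coord B v b) b)" using basis_coord_sum[OF B v] by simp
  also have "\<dots> = (\<Sum>b\<in>B. cscale (coord B v b) (f b))"
    using linear_on_sum[OF f basis_subspace[OF B], of B "\<lambda>b. b"] B basis_mem[OF B] by (auto simp: basis_of_def)
  finally have "coord C (f v) c = coord C (\<Sum>b\<in>B. cscale (coord B v b) (f b)) c" by simp
  also have "\<dots> = (\<Sum>b\<in>B. coord C (cscale (coord B v b) (f b)) c)"
    using fB by (intro coord_sum[OF C] cfun.subspace_scale[OF basis_subspace[OF C]])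
  also have "\<dots> = (\<Sum>b\<in>B. coord B v b * coord C (f b) c)"
    using fB by (intro sum.cong refl coord_scale[OF C])
  finally show ?thesis .
qed

lemma linear_on_id: "linear_on V V (\<lambda>v. v)" by (simp add: linear_on_def)

lemma linear_on_comp: "linear_on U V f \<Longrightarrow> linear_on V W g \<Longrightarrow> linear_on U W (\<lambda>u. g (f u))"
  by (simp add: linear_on_def)

text \<open>\<open>h\<close> and \<open>k\<close> are conjugate by \<open>f\<close>. Expanding
  \<open>f'\<close> after \<open>f\<close> after \<open>h\<close> in coordinates and exchanging the
  two sums is the rule tr(AB) = tr(BA), here between bases of two different spaces.\<close>

lemma basis_trace_iso:
  assumes B: "basis_of V B" and C: "basis_of W C"
    and h: "linear_on V V h" and k: "linear_on W W k"
    and f: "linear_on V W f" and f': "linear_on W V f'"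
    and f'f: "\<And>v. v \<in> V \<Longrightarrow> f' (f v) = v"
    and fh: "\<And>v. v \<in> V \<Longrightarrow> f (h v) = k (f v)"
    and ff': "\<And>w. w \<in> W \<Longrightarrow> f (f' w) = w"
  shows "(\<Sum>b\<in>B. coord B (h b) b) = (\<Sum>c\<in>C. coord C (k c) c)"
proof -
  have V: "h b \<in> V" if "b \<in> B" for b using basis_mem[OF B that] h by (auto simp: linear_on_def)
  have fV: "f v \<in> W" if "v \<in> V" for v using f that by (auto simp: linear_on_def)
  have fW: "f' w \<in> V" if "w \<in> W" for w using f' that by (auto simp: linear_on_def)
  have "(\<Sum>b\<in>B. coord B (h b) b) = (\<Sum>b\<in>B. coord B (f' (f (h b))) b)"
    using f'f V by simp
  also have "\<dots> = (\<Sum>b\<in>B. \<Sum>c\<in>C. coord C (f (h b)) c * coord B (f' c) b)"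
    by (intro sum.cong refl coord_linear[OF C f' B]) (use V fV in auto)
  also have "\<dots> = (\<Sum>c\<in>C. \<Sum>b\<in>B. coord B (f' c) b * coord C (f (h b)) c)"
    by (subst sum.swap) (simp add: mult.commute)
  also have "\<dots> = (\<Sum>c\<in>C. coord C (f (h (f' c))) c)"
    by (intro sum.cong refl coord_linear[OF B linear_on_comp[OF h f] C, symmetric])
      (use fW basis_mem[OF C] in auto)
  also have "\<dots> = (\<Sum>c\<in>C. coord C (k c) c)"
    using fh fW ff' basis_mem[OF C] by (intro sum.cong refl) simp
  finally show ?thesis .
qed

text \<open>Frees \<open>trace_on\<close> from its chosen basis: the identity map is an isomorphism,
  so \<open>basis_trace_iso\<close> compares the chosen basis with any given one.\<close>

lemma trace_on_basis:
  assumes B: "basis_of V B" and h: "linear_on V V h"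
  shows "trace_on V h = (\<Sum>b\<in>B. coord B (h b) b)"
proof -
  define C where "C = (SOME B. cfun.independent B \<and> cfun.span B = V)"
  have "cfun.independent C \<and> cfun.span C = V"
    unfolding C_def by (rule someI[of _ B]) (use B in \<open>auto simp: basis_of_def\<close>)
  then have C: "basis_of V C" using independent_basis_of[OF B] by blast
  have "trace_on V h = (\<Sum>c\<in>C. coord C (h c) c)"
    by (simp add: trace_on_def C_def coord_def Let_def)
  then show ?thesis
    using basis_trace_iso[OF C B h h linear_on_id linear_on_id] by simp
qed

lemma trace_on_iso:
  assumes B: "basis_of V B"
    and h: "linear_on V V h" and k: "linear_on W W k"
    and f: "linear_on V W f" and f': "linear_on W V f'"
    and "\<And>v. v \<in> V \<Longrightarrow> f' (f v) = v" "\<And>v. v \<in> V \<Longrightarrow> f (h v) = k (f v)" "\<And>w. w \<in> W \<Longrightarrow> f (f' w) = w"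
    and "basis_of W C"
  shows "trace_on V h = trace_on W k"
  using basis_trace_iso[OF B assms(9) assms(2-8)] trace_on_basis[OF B h] trace_on_basis[OF assms(9) k] by simp

text \<open>A sum of rank-one maps has the sum of their traces. The vectors \<open>e i\<close> may
  be linearly dependent, which admits the spanning set of all translates of a polytabloid.\<close>

lemma trace_on_rank_one:
  assumes B: "basis_of V B" and e: "\<And>i. i \<in> I \<Longrightarrow> e i \<in> V"
    and add: "\<And>i u v. u \<in> V \<Longrightarrow> v \<in> V \<Longrightarrow> \<phi> i (u + v) = \<phi> i u + \<phi> i v"
    and sc: "\<And>i c u. u \<in> V \<Longrightarrow> \<phi> i (cscale c u) = c * \<phi> i u"
    and h: "\<And>u. u \<in> V \<Longrightarrow> h u = (\<Sum>i\<in>I. cscale (\<phi> i u) (e i))"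
  shows "trace_on V h = (\<Sum>i\<in>I. \<phi> i (e i))"
proof -
  have V: "cfun.subspace V" by (rule basis_subspace[OF B])
  have lin: "linear_on V V h"
    unfolding linear_on_def
  proof (intro conjI ballI allI)
    fix u assume "u \<in> V" then show "h u \<in> V"
      using h e by (auto intro!: cfun.subspace_sum[OF V] cfun.subspace_scale[OF V])
  next
    fix u v assume "u \<in> V" "v \<in> V"
    then show "h (u + v) = h u + h v"
      using cfun.subspace_add[OF V, of u v] by (simp add: h add cfun.scale_left_distrib sum.distrib)
  next
    fix c u assume "u \<in> V"
    then show "h (cscale c u) = cscale c (h u)"
      using cfun.subspace_scale[OF V, of u c] by (simp add: h sc cfun.scale_sum_right)
  qed
  have phi_sum: "\<phi> i (\<Sum>b\<in>S. cscale (c b) b) = (\<Sum>b\<in>S. c b * \<phi> i b)" if "finite S" "S \<subseteq> V" for i S c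
    using that
  proof (induction S rule: finite_induct)
    case empty
    have "\<phi> i (cscale 0 0) = 0 * \<phi> i 0" by (rule sc[OF cfun.subspace_0[OF V]])
    then show ?case by (simp only: sum.empty cfun.scale_zero_left mult_zero_left)
  next
    case (insert b S)
    have "(\<Sum>b\<in>S. cscale (c b) b) \<in> V"
      using insert by (intro cfun.subspace_sum[OF V] cfun.subspace_scale[OF V]) auto
    moreover have "b \<in> V" "cscale (c b) b \<in> V" using insert cfun.subspace_scale[OF V] by auto
    moreover have "\<phi> i (\<Sum>b\<in>S. cscale (c b) b) = (\<Sum>b\<in>S. c b * \<phi> i b)" using insert by simp
    ultimately show ?case by (simp only: sum.insert[OF insert(1,2)] add sc)
  qed
  have "trace_on V h = (\<Sum>b\<in>B. coord B (h b) b)" by (rule trace_on_basis[OF B lin])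
  also have "\<dots> = (\<Sum>b\<in>B. \<Sum>i\<in>I. \<phi> i b * coord B (e i) b)"
  proof (rule sum.cong[OF refl])
    fix b assume "b \<in> B"
    then have "b \<in> V" using basis_mem[OF B] by simp
    then show "coord B (h b) b = (\<Sum>i\<in>I. \<phi> i b * coord B (e i) b)"
      using e coord_sum[OF B, of I "\<lambda>i. cscale (\<phi> i b) (e i)" b] cfun.subspace_scale[OF V] coord_scale[OF B]
      by (simp add: h)
  qed
  also have "\<dots> = (\<Sum>i\<in>I. \<Sum>b\<in>B. coord B (e i) b * \<phi> i b)"
    by (subst sum.swap) (simp add: mult.commute)
  also have "\<dots> = (\<Sum>i\<in>I. \<phi> i (e i))"
  proof (rule sum.cong[OF refl])
    fix i assume i: "i \<in> I"
    have "\<phi> i (\<Sum>b\<in>B. cscale (coord B (e i) b) b) = (\<Sum>b\<in>B. coord B (e i) b * \<phi> i b)"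
      using B basis_mem[OF B] by (intro phi_sum) (auto simp: basis_of_def)
    then show "(\<Sum>b\<in>B. coord B (e i) b * \<phi> i b) = \<phi> i (e i)"
      using basis_coord_sum[OF B e[OF i]] by simp
  qed
  finally show ?thesis .
qed

lemma rep_on_basis: "rep_on G W \<rho> \<Longrightarrow> \<exists>B. basis_of W B"
  unfolding rep_on_def using basis_exists by blast

lemma rep_on_linear: "rep_on G W \<rho> \<Longrightarrow> g \<in> carrier G \<Longrightarrow> linear_on W W (\<rho> g)"
  by (simp add: rep_on_def linear_on_def)

section \<open>Intertwiners and orthogonality of traces\<close>

definition intertwiner ::
    "('g, 'm) monoid_scheme \<Rightarrow> ('x \<Rightarrow> complex) set \<Rightarrow> ('g \<Rightarrow> ('x \<Rightarrow> complex) \<Rightarrow> ('x \<Rightarrow> complex)) \<Rightarrow>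
      ('y \<Rightarrow> complex) set \<Rightarrow> ('g \<Rightarrow> ('y \<Rightarrow> complex) \<Rightarrow> ('y \<Rightarrow> complex)) \<Rightarrow> (('x \<Rightarrow> complex) \<Rightarrow> ('y \<Rightarrow> complex)) \<Rightarrow> bool"
  where "intertwiner G V \<rho> W \<sigma> f \<longleftrightarrow> linear_on V W f \<and>
    (\<forall>g\<in>carrier G. \<forall>v\<in>V. f (\<rho> g v) = \<sigma> g (f v))"

definition average ::
    "('g, 'm) monoid_scheme \<Rightarrow> ('g \<Rightarrow> ('x \<Rightarrow> complex) \<Rightarrow> ('x \<Rightarrow> complex)) \<Rightarrow>
      ('g \<Rightarrow> ('y \<Rightarrow> complex) \<Rightarrow> ('y \<Rightarrow> complex)) \<Rightarrow> (('x \<Rightarrow> complex) \<Rightarrow> ('y \<Rightarrow> complex)) \<Rightarrow> ('x \<Rightarrow> complex) \<Rightarrow> ('y \<Rightarrow> complex)"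
  where "average G \<rho> \<sigma> E v = (\<Sum>g\<in>carrier G. \<sigma> g (E (\<rho> (inv\<^bsub>G\<^esub> g) v)))"

lemma linear_on_sum_fun:
  assumes W: "cfun.subspace W" and f: "\<And>i. i \<in> I \<Longrightarrow> linear_on V W (f i)"
  shows "linear_on V W (\<lambda>v. \<Sum>i\<in>I. f i v)"
  using f unfolding linear_on_def
  by (auto intro!: cfun.subspace_sum[OF W] simp: sum.distrib cfun.scale_sum_right)

text \<open>Translating the summation index by \<open>h\<close> carries \<open>\<sigma> h\<close>
  through the average.\<close>

lemma intertwiner_average:
  assumes G: "group G" "finite (carrier G)" and V: "rep_on G V \<rho>" and W: "rep_on G W \<sigma>"
    and E: "linear_on V W E"
  shows "intertwiner G V \<rho> W \<sigma> (average G \<rho> \<sigma> E)"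
proof -
  interpret group G by fact
  have sW: "cfun.subspace W" using rep_on_basis[OF W] basis_subspace by blast
  have lin: "linear_on V W (\<lambda>v. \<sigma> g (E (\<rho> (inv\<^bsub>G\<^esub> g) v)))" if "g \<in> carrier G" for g
    using that by (intro linear_on_comp[OF rep_on_linear[OF V] linear_on_comp[OF E rep_on_linear[OF W]]]) auto
  have "linear_on V W (average G \<rho> \<sigma> E)"
    unfolding average_def by (rule linear_on_sum_fun[OF sW lin])
  moreover have "average G \<rho> \<sigma> E (\<rho> h v) = \<sigma> h (average G \<rho> \<sigma> E v)" if h: "h \<in> carrier G" and v: "v \<in> V" for h v
  proof -
    let ?t = "\<lambda>g. \<sigma> g (E (\<rho> (inv\<^bsub>G\<^esub> g) v))"
    have tW: "?t g \<in> W" if "g \<in> carrier G" for g using lin[OF that] v by (auto simp: linear_on_def)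
    have "\<sigma> h (average G \<rho> \<sigma> E v) = \<sigma> h (\<Sum>g\<in>carrier G. cscale 1 (?t g))"
      by (simp add: average_def)
    also have "\<dots> = (\<Sum>g\<in>carrier G. cscale 1 (\<sigma> h (?t g)))"
      by (rule linear_on_sum[OF rep_on_linear[OF W h] sW G(2) tW])
    also have "\<dots> = (\<Sum>g\<in>carrier G. \<sigma> (h \<otimes>\<^bsub>G\<^esub> g) (E (\<rho> (inv\<^bsub>G\<^esub> (h \<otimes>\<^bsub>G\<^esub> g)) (\<rho> h v))))"
    proof (rule sum.cong[OF refl])
      fix g assume g: "g \<in> carrier G"
      have hv: "\<rho> h v \<in> V" using V h v by (auto simp: rep_on_def)
      have EW: "E (\<rho> (inv\<^bsub>G\<^esub> g) v) \<in> W"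
        using E V g v by (auto simp: linear_on_def rep_on_def)
      have "\<rho> (inv\<^bsub>G\<^esub> (h \<otimes>\<^bsub>G\<^esub> g)) (\<rho> h v) = \<rho> (inv\<^bsub>G\<^esub> (h \<otimes>\<^bsub>G\<^esub> g) \<otimes>\<^bsub>G\<^esub> h) v"
        using V g h v by (auto simp: rep_on_def)
      also have "inv\<^bsub>G\<^esub> (h \<otimes>\<^bsub>G\<^esub> g) \<otimes>\<^bsub>G\<^esub> h = inv\<^bsub>G\<^esub> g"
        using g h by (simp add: inv_mult_group m_assoc)
      finally show "cscale 1 (\<sigma> h (?t g)) = \<sigma> (h \<otimes>\<^bsub>G\<^esub> g) (E (\<rho> (inv\<^bsub>G\<^esub> (h \<otimes>\<^bsub>G\<^esub> g)) (\<rho> h v)))"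
        using W g h EW by (simp add: rep_on_def)
    qed
    also have "\<dots> = (\<Sum>g\<in>carrier G. \<sigma> g (E (\<rho> (inv\<^bsub>G\<^esub> g) (\<rho> h v))))"
    proof (rule sum.reindex_bij_betw)
      show "bij_betw (\<lambda>g. h \<otimes>\<^bsub>G\<^esub> g) (carrier G) (carrier G)"
        using h by (intro bij_betw_byWitness[where f' = "\<lambda>g. inv\<^bsub>G\<^esub> h \<otimes>\<^bsub>G\<^esub> g"]) (auto simp: inv_solve_left m_assoc[symmetric])
    qed
    finally show ?thesis by (simp add: average_def)
  qed
  ultimately show ?thesis by (simp add: intertwiner_def)
qed

text \<open>A matrix unit: it sends the source basis vector \<open>c\<close> to the target vector
  \<open>b\<close> and the other source basis vectors to 0.\<close>

definition elementary where "elementary B b c v = cscale (coord B v c) b"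

lemma linear_on_elementary:
  "basis_of V B \<Longrightarrow> basis_of W C \<Longrightarrow> c \<in> C \<Longrightarrow> linear_on V W (elementary B c b)"
  unfolding linear_on_def elementary_def
  by (auto simp: coord_add coord_scale cfun.scale_left_distrib basis_mem intro: cfun.subspace_scale[OF basis_subspace])

text \<open>A product of diagonal matrix entries of \<open>\<sigma> g\<close> at \<open>c\<close>
  and of the inverse action at \<open>b\<close> is the \<open>c\<close>-coordinate of the conjugated
  matrix unit at \<open>b\<close>. Summing over the group therefore averages the matrix
  units.\<close>

lemma sum_trace_trace:
  assumes G: "group G" "finite (carrier G)" and V: "rep_on G V \<rho>" and W: "rep_on G W \<sigma>"
    and B: "basis_of V B" and C: "basis_of W C"
  shows "(\<Sum>g\<in>carrier G. trace_on W (\<sigma> g) * trace_on V (\<rho> (inv\<^bsub>G\<^esub> g)))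
    = (\<Sum>c\<in>C. \<Sum>b\<in>B. coord C (average G \<rho> \<sigma> (elementary B c b) b) c)"
proof -
  interpret group G by fact
  have sW: "cfun.subspace W" by (rule basis_subspace[OF C])
  have "(\<Sum>g\<in>carrier G. trace_on W (\<sigma> g) * trace_on V (\<rho> (inv\<^bsub>G\<^esub> g)))
    = (\<Sum>g\<in>carrier G. \<Sum>c\<in>C. \<Sum>b\<in>B. coord C (\<sigma> g c) c * coord B (\<rho> (inv\<^bsub>G\<^esub> g) b) b)"
    using trace_on_basis[OF B rep_on_linear[OF V]] trace_on_basis[OF C rep_on_linear[OF W]]
    by (simp add: sum_product)
  also have "\<dots> = (\<Sum>c\<in>C. \<Sum>b\<in>B. \<Sum>g\<in>carrier G. coord C (\<sigma> g c) c * coord B (\<rho> (inv\<^bsub>G\<^esub> g) b) b)"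
    by (subst sum.swap, intro sum.cong refl, rule sum.swap)
  also have "\<dots> = (\<Sum>c\<in>C. \<Sum>b\<in>B. coord C (average G \<rho> \<sigma> (elementary B c b) b) c)"
  proof (intro sum.cong refl)
    fix c b assume cb: "c \<in> C" "b \<in> B"
    have c: "\<sigma> g c \<in> W" "\<sigma> g (cscale x c) = cscale x (\<sigma> g c)" if "g \<in> carrier G" for g x
      using that W basis_mem[OF C cb(1)] by (auto simp: rep_on_def)
    show "(\<Sum>g\<in>carrier G. coord C (\<sigma> g c) c * coord B (\<rho> (inv\<^bsub>G\<^esub> g) b) b)
      = coord C (average G \<rho> \<sigma> (elementary B c b) b) c"
      unfolding average_def elementary_def
      by (subst coord_sum[OF C]) (auto simp: c coord_scale[OF C] mult.commute intro: cfun.subspace_scale[OF sW])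
  qed
  finally show ?thesis .
qed

lemma sum_trace_trace_0:
  assumes G: "group G" "finite (carrier G)" and V: "rep_on G V \<rho>" and W: "rep_on G W \<sigma>"
    and none: "\<And>f v. intertwiner G V \<rho> W \<sigma> f \<Longrightarrow> v \<in> V \<Longrightarrow> f v = 0"
  shows "(\<Sum>g\<in>carrier G. trace_on W (\<sigma> g) * trace_on V (\<rho> (inv\<^bsub>G\<^esub> g))) = 0"
proof -
  obtain B C where B: "basis_of V B" and C: "basis_of W C"
    using rep_on_basis[OF V] rep_on_basis[OF W] by blast
  show ?thesis
    unfolding sum_trace_trace[OF assms(1-4) B C]
  proof (intro sum.neutral ballI)
    fix c b assume cb: "c \<in> C" "b \<in> B"
    have "average G \<rho> \<sigma> (elementary B c b) b = 0"
      by (rule none[OF intertwiner_average[OF assms(1-4) linear_on_elementary[OF B C cb(1)]] basis_mem[OF B cb(2)]])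
    moreover have "coord C 0 c = 0"
      using coord_scale[OF C, of 0 0] cfun.subspace_0[OF basis_subspace[OF C]] by simp
    ultimately show "coord C (average G \<rho> \<sigma> (elementary B c b) b) c = 0" by simp
  qed
qed

text \<open>Every averaged matrix unit is a multiple of \<open>F\<close>. Expanding \<open>F\<close>
  itself in matrix units and averaging gives the sought sum times \<open>F\<close>, while the
  average of \<open>F\<close> is \<open>order G\<close> times \<open>F\<close>; a vector with
  \<open>F u \<noteq> 0\<close> identifies the factors. The target may be reducible, as when a
  Specht module is mapped into its tabloid space.\<close>

lemma sum_trace_trace_1:
  assumes G: "group G" "finite (carrier G)" and V: "rep_on G V \<rho>" and W: "rep_on G W \<sigma>"
    and F: "intertwiner G V \<rho> W \<sigma> F" and u: "u \<in> V" "F u \<noteq> 0"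
    and one: "\<And>f. intertwiner G V \<rho> W \<sigma> f \<Longrightarrow> \<exists>k. \<forall>v\<in>V. f v = cscale k (F v)"
  shows "(\<Sum>g\<in>carrier G. trace_on W (\<sigma> g) * trace_on V (\<rho> (inv\<^bsub>G\<^esub> g))) = of_nat (order G)"
proof -
  interpret group G by fact
  obtain B C where B: "basis_of V B" and C: "basis_of W C"
    using rep_on_basis[OF V] rep_on_basis[OF W] by blast
  have sW: "cfun.subspace W" by (rule basis_subspace[OF C])
  have fin: "finite B" "finite C" using B C by (auto simp: basis_of_def)
  have FW: "F v \<in> W" if "v \<in> V" for v using F that by (auto simp: intertwiner_def linear_on_def)
  have "\<forall>c\<in>C. \<forall>b\<in>B. \<exists>k. \<forall>v\<in>V. average G \<rho> \<sigma> (elementary B c b) v = cscale k (F v)"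
    using one intertwiner_average[OF assms(1-4) linear_on_elementary[OF B C]] by blast
  then obtain k where k: "\<And>c b v. c \<in> C \<Longrightarrow> b \<in> B \<Longrightarrow> v \<in> V \<Longrightarrow>
      average G \<rho> \<sigma> (elementary B c b) v = cscale (k c b) (F v)" by metis
  let ?K = "\<Sum>c\<in>C. \<Sum>b\<in>B. k c b * coord C (F b) c"
  have "(\<Sum>g\<in>carrier G. trace_on W (\<sigma> g) * trace_on V (\<rho> (inv\<^bsub>G\<^esub> g))) = ?K"
    unfolding sum_trace_trace[OF assms(1-4) B C]
    by (intro sum.cong refl) (simp add: k basis_mem[OF B] FW coord_scale[OF C])
  \<comment> \<open>\<open>F\<close> written as a linear combination of matrix units, with its own
    matrix entries as coefficients.\<close>
  have Fexp: "F v = (\<Sum>c\<in>C. \<Sum>b\<in>B. cscale (coord C (F b) c) (elementary B c b v))" if v: "v \<in> V" for v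
  proof -
    have "F v = (\<Sum>c\<in>C. cscale (coord C (F v) c) c)" using basis_coord_sum[OF C FW[OF v]] by simp
    also have "\<dots> = (\<Sum>c\<in>C. cscale (\<Sum>b\<in>B. coord B v b * coord C (F b) c) c)"
      using F by (intro sum.cong refl arg_cong2[where f = cscale] coord_linear[OF B _ C v])
        (simp add: intertwiner_def)
    also have "\<dots> = (\<Sum>c\<in>C. \<Sum>b\<in>B. cscale (coord C (F b) c) (elementary B c b v))"
      by (simp add: elementary_def cfun.scale_sum_left mult.commute)
    finally show ?thesis .
  qed
  have "average G \<rho> \<sigma> F u = (\<Sum>g\<in>carrier G. F u)"
    unfolding average_def
  proof (rule sum.cong[OF refl])
    fix g assume g: "g \<in> carrier G"
    have "F (\<rho> (inv\<^bsub>G\<^esub> g) u) = \<sigma> (inv\<^bsub>G\<^esub> g) (F u)" using F g u by (simp add: intertwiner_def)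
    moreover have "\<sigma> g (\<sigma> (inv\<^bsub>G\<^esub> g) (F u)) = \<sigma> (g \<otimes>\<^bsub>G\<^esub> inv\<^bsub>G\<^esub> g) (F u)"
      using W g FW[OF u(1)] unfolding rep_on_def by (metis inv_closed)
    moreover have "\<sigma> (g \<otimes>\<^bsub>G\<^esub> inv\<^bsub>G\<^esub> g) (F u) = F u"
      using W g FW[OF u(1)] by (simp add: rep_on_def)
    ultimately show "\<sigma> g (F (\<rho> (inv\<^bsub>G\<^esub> g) u)) = F u" by simp
  qed
  also have "\<dots> = cscale (of_nat (order G)) (F u)"
    by (simp only: sum_cscale_const order_def)
  finally have 1: "average G \<rho> \<sigma> F u = cscale (of_nat (order G)) (F u)" .
  have "average G \<rho> \<sigma> F u = (\<Sum>g\<in>carrier G. \<sigma> g (\<Sum>(c, b)\<in>C \<times> B. cscale (coord C (F b) c) (elementary B c b (\<rho> (inv\<^bsub>G\<^esub> g) u))))"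
    unfolding average_def
    using V u by (intro sum.cong refl arg_cong[where f = "\<sigma> _"]) (subst Fexp, auto simp: rep_on_def sum.cartesian_product)
  also have "\<dots> = (\<Sum>g\<in>carrier G. \<Sum>(c, b)\<in>C \<times> B. cscale (coord C (F b) c) (\<sigma> g (elementary B c b (\<rho> (inv\<^bsub>G\<^esub> g) u))))"
  proof (rule sum.cong[OF refl])
    fix g assume g: "g \<in> carrier G"
    show "\<sigma> g (\<Sum>(c, b)\<in>C \<times> B. cscale (coord C (F b) c) (elementary B c b (\<rho> (inv\<^bsub>G\<^esub> g) u)))
      = (\<Sum>(c, b)\<in>C \<times> B. cscale (coord C (F b) c) (\<sigma> g (elementary B c b (\<rho> (inv\<^bsub>G\<^esub> g) u))))"
    proof -
      have "(\<lambda>(c, b). elementary B c b (\<rho> (inv\<^bsub>G\<^esub> g) u)) x \<in> W" if "x \<in> C \<times> B" for x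
        using that by (auto simp: elementary_def basis_mem[OF C] intro: cfun.subspace_scale[OF sW])
      from linear_on_sum[OF rep_on_linear[OF W g] sW _ this, of "C \<times> B" "\<lambda>x. x" "\<lambda>(c, b). coord C (F b) c"]
      show ?thesis using fin by (simp add: case_prod_beta)
    qed
  qed
  also have "\<dots> = (\<Sum>(c, b)\<in>C \<times> B. cscale (coord C (F b) c) (average G \<rho> \<sigma> (elementary B c b) u))"
    by (subst sum.swap) (simp add: average_def case_prod_beta cfun.scale_sum_right)
  also have "\<dots> = (\<Sum>(c, b)\<in>C \<times> B. cscale (k c b * coord C (F b) c) (F u))"
    by (intro sum.cong refl) (auto simp: k u mult.commute)
  also have "\<dots> = cscale ?K (F u)"
    by (simp add: sum.cartesian_product cfun.scale_sum_left case_prod_beta)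
  finally have "cscale ?K (F u) = cscale (of_nat (order G)) (F u)" using 1 by (simp only:)
  then have "?K = of_nat (order G)" using u(2) by simp
  then show ?thesis using \<open>_ = ?K\<close> by simp
qed

section \<open>Specht modules\<close>

lemma perm_act_add [simp]: "perm_act \<sigma> (f + g) = perm_act \<sigma> f + perm_act \<sigma> g"
  by (simp add: perm_act_def fun_eq_iff)

lemma perm_act_cscale [simp]: "perm_act \<sigma> (cscale c f) = cscale c (perm_act \<sigma> f)"
  by (simp add: perm_act_def cscale_def)

lemma perm_act_zero [simp]: "perm_act \<sigma> 0 = 0"
  by (simp add: perm_act_def fun_eq_iff)

lemma perm_act_sum: "perm_act \<sigma> (\<Sum>i\<in>I. f i) = (\<Sum>i\<in>I. perm_act \<sigma> (f i))"
  by (induction I rule: infinite_finite_induct) (simp_all only: sum.infinite sum.empty sum.insert perm_act_zero perm_act_add not_False_eq_True simp_thms)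

lemma perm_act_id [simp]: "perm_act id f = f"
  by (simp add: perm_act_def)

lemma map_image_comp: "map ((`) (f \<circ> g)) T = map ((`) f) (map ((`) g) T)"
  by (simp add: image_comp)

lemma perm_act_comp:
  assumes "bij \<sigma>" "bij \<tau>"
  shows "perm_act (\<sigma> \<circ> \<tau>) f = perm_act \<sigma> (perm_act \<tau> f)"
  by (simp only: perm_act_def o_inv_distrib[OF assms] map_image_comp)

lemma map_image_inv:
  assumes "bij \<sigma>"
  shows "map ((`) (inv' \<sigma>)) (map ((`) \<sigma>) T) = T" "map ((`) \<sigma>) (map ((`) (inv' \<sigma>)) T) = T"
  using assms by (auto simp: image_comp bij_is_inj bij_is_surj surj_f_inv_f inv_f_f map_idI comp_def image_image)

lemma perm_act_tabloid_vec:
  assumes "bij \<sigma>"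
  shows "perm_act \<sigma> (tabloid_vec T) = tabloid_vec (map ((`) \<sigma>) T)"
proof -
  have "map ((`) (inv' \<sigma>)) T' = T \<longleftrightarrow> T' = map ((`) \<sigma>) T" for T'
    using map_image_inv[OF assms] by metis
  then show ?thesis by (simp add: perm_act_def tabloid_vec_def)
qed

section \<open>Permutation modules on tabloids\<close>

definition tabloid_space :: "nat \<Rightarrow> (nat \<Rightarrow> int) \<Rightarrow> nat \<Rightarrow> (nat set list \<Rightarrow> complex) set"
  where "tabloid_space l \<alpha> n = {f. \<forall>T. f T \<noteq> 0 \<longrightarrow> T \<in> tabloids l \<alpha> {1..n}}"

lemma subspace_tabloid_space: "cfun.subspace (tabloid_space l \<alpha> n)"
  by (rule cfun.subspaceI) (auto simp: tabloid_space_def cscale_def, metis add.right_neutral)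

lemma sum_fun_at: "(\<Sum>i\<in>I. f i) x = (\<Sum>i\<in>I. f i x)"
  by (induction I rule: infinite_finite_induct) simp_all

lemma tabloid_space_expand:
  assumes "f \<in> tabloid_space l \<alpha> n"
  shows "f = (\<Sum>T\<in>tabloids l \<alpha> {1..n}. cscale (f T) (tabloid_vec T))"
proof
  fix T
  have "(\<Sum>T'\<in>tabloids l \<alpha> {1..n}. cscale (f T') (tabloid_vec T')) T
    = (\<Sum>T'\<in>tabloids l \<alpha> {1..n}. if T = T' then f T' else 0)"
    unfolding sum_fun_at by (intro sum.cong refl) (simp add: cscale_def tabloid_vec_def)
  then show "f T = (\<Sum>T'\<in>tabloids l \<alpha> {1..n}. cscale (f T') (tabloid_vec T')) T"
    using assms by (auto simp: finite_tabloids tabloid_space_def)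
qed

lemma tabloid_vec_mem: "T \<in> tabloids l \<alpha> {1..n} \<Longrightarrow> tabloid_vec T \<in> tabloid_space l \<alpha> n"
  by (auto simp: tabloid_space_def tabloid_vec_def split: if_splits)

lemma span_tabloid_vec: "cfun.span (tabloid_vec ` tabloids l \<alpha> {1..n}) = tabloid_space l \<alpha> n"
proof
  show "cfun.span (tabloid_vec ` tabloids l \<alpha> {1..n}) \<subseteq> tabloid_space l \<alpha> n"
    by (rule cfun.span_minimal) (auto simp: subspace_tabloid_space tabloid_vec_mem)
  show "tabloid_space l \<alpha> n \<subseteq> cfun.span (tabloid_vec ` tabloids l \<alpha> {1..n})"
  proof
    fix f assume "f \<in> tabloid_space l \<alpha> n"
    from tabloid_space_expand[OF this]
    show "f \<in> cfun.span (tabloid_vec ` tabloids l \<alpha> {1..n})"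
      by (metis (no_types, lifting) cfun.span_base cfun.span_scale cfun.span_sum imageI)
  qed
qed

lemma map_image_tabloids:
  assumes "\<sigma> permutes A" "T \<in> tabloids l \<alpha> A"
  shows "map ((`) \<sigma>) T \<in> tabloids l \<alpha> A"
proof -
  have inj: "inj \<sigma>" using assms(1) by (simp add: permutes_inj)
  have "(\<Union>i<l. \<sigma> ` (T ! i)) = \<sigma> ` A" using assms(2) by (auto simp: tabloids_def)
  also have "\<dots> = A" by (rule permutes_image[OF assms(1)])
  finally have "(\<Union>i<l. \<sigma> ` (T ! i)) = A" .
  moreover have "\<sigma> ` (T ! i) \<inter> \<sigma> ` (T ! j) = {}" if "i < l" "j < l" "i \<noteq> j" for i j
    using assms(2) that inj by (auto simp: tabloids_def inj_def) blast
  moreover have "card (\<sigma> ` (T ! i)) = card (T ! i)" for i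
    using inj by (intro card_image) (simp add: inj_on_def inj_def)
  ultimately show ?thesis using assms(2) by (auto simp: tabloids_def)
qed

lemma map_image_tabloids_iff:
  assumes "\<sigma> permutes A"
  shows "map ((`) \<sigma>) T \<in> tabloids l \<alpha> A \<longleftrightarrow> T \<in> tabloids l \<alpha> A"
  using map_image_tabloids[OF assms, of T] map_image_tabloids[OF permutes_inv[OF assms], of "map ((`) \<sigma>) T"]
    map_image_inv(1)[OF permutes_bij[OF assms], of T] by auto

lemma perm_act_tabloid_space:
  assumes "\<sigma> permutes {1..n}" "f \<in> tabloid_space l \<alpha> n"
  shows "perm_act \<sigma> f \<in> tabloid_space l \<alpha> n"
  using assms map_image_tabloids_iff[OF permutes_inv[OF assms(1)]]
  by (auto simp: tabloid_space_def perm_act_def)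

lemma rep_on_perm_act:
  assumes "finite B" "cfun.span B = W"
    and "\<And>\<sigma> u. \<sigma> permutes {1..n} \<Longrightarrow> u \<in> W \<Longrightarrow> perm_act \<sigma> u \<in> W"
  shows "rep_on (sym_group n) W perm_act"
  using assms by (auto simp: rep_on_def sym_group_def intro!: perm_act_comp permutes_bij)

lemma rep_on_tabloid_space: "rep_on (sym_group n) (tabloid_space l \<alpha> n) perm_act"
  by (rule rep_on_perm_act[OF _ span_tabloid_vec perm_act_tabloid_space])
    (simp_all add: finite_tabloids)

lemma finite_sym_group: "finite (carrier (sym_group n))"
  by (simp add: sym_group_def finite_permutations)

lemma order_sym_group: "order (sym_group n) = fact n"
  by (simp add: order_def sym_group_def card_permutations)

lemma inv_sym_group:
  assumes "g permutes {1..n}"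
  shows "inv\<^bsub>sym_group n\<^esub> g = inv' g"
proof (rule group.inv_equality[OF sym_group_is_group])
  show "inv' g \<otimes>\<^bsub>sym_group n\<^esub> g = \<one>\<^bsub>sym_group n\<^esub>"
    using permutes_inv_o(2)[OF assms] by (simp add: sym_group_def)
qed (use assms permutes_inv in \<open>auto simp: sym_group_def\<close>)

text \<open>In the basis of tabloids \<open>g\<close> acts by a permutation matrix, so its trace
  counts the fixed tabloids.\<close>

lemma trace_tabloid_space:
  assumes g: "g permutes {1..n}"
  shows "trace_on (tabloid_space l \<alpha> n) (perm_act g)
    = of_int (perm_count l (cycle_type g {1..n}) \<alpha>)"
proof -
  let ?T = "tabloids l \<alpha> {1..n}"
  have bij: "bij g" using g permutes_bij by blast
  obtain B where B: "basis_of (tabloid_space l \<alpha> n) B"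
    using rep_on_basis[OF rep_on_tabloid_space] by blast
  have "trace_on (tabloid_space l \<alpha> n) (perm_act g) = (\<Sum>T\<in>?T. perm_act g (tabloid_vec T) T)"
  proof (rule trace_on_rank_one[OF B, where \<phi> = "\<lambda>T u. u T" and e = "\<lambda>T. perm_act g (tabloid_vec T)"])
    fix u assume u: "u \<in> tabloid_space l \<alpha> n"
    have "perm_act g u = perm_act g (\<Sum>T\<in>?T. cscale (u T) (tabloid_vec T))"
      using tabloid_space_expand[OF u] by simp
    then show "perm_act g u = (\<Sum>T\<in>?T. cscale (u T) (perm_act g (tabloid_vec T)))"
      by (simp add: perm_act_sum)
  next
    fix T assume "T \<in> ?T"
    then show "perm_act g (tabloid_vec T) \<in> tabloid_space l \<alpha> n"
      by (rule perm_act_tabloid_space[OF g tabloid_vec_mem])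
  qed (simp_all add: cscale_def)
  also have "\<dots> = (\<Sum>T\<in>?T. if map ((`) g) T = T then 1 else 0)"
    unfolding perm_act_tabloid_vec[OF bij] by (intro sum.cong refl) (auto simp: tabloid_vec_def)
  also have "\<dots> = of_nat (card {T \<in> ?T. map ((`) g) T = T})"
    by (subst sum.inter_filter[symmetric]) (simp_all add: finite_tabloids)
  also have "{T \<in> ?T. map ((`) g) T = T} = fixed_tabloids l \<alpha> {1..n} g"
    by (auto simp: fixed_tabloids_def tabloids_def list_eq_iff_nth_eq)
  finally show ?thesis
    using card_fixed_tabloids[OF cycle_list_cycle_type[OF g finite_atLeastAtMost], of l \<alpha>]
    by (metis of_int_of_nat_eq)
qed

lemma linear_on_eq_span:
  assumes f: "linear_on (cfun.span E) W f" and g: "linear_on (cfun.span E) W g"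
    and eq: "\<And>e. e \<in> E \<Longrightarrow> f e = g e" and v: "v \<in> cfun.span E"
  shows "f v = g v"
proof -
  have "v \<in> cfun.span E \<and> f v = g v"
    using v
  proof (induction rule: cfun.span_induct_alt)
    case base
    have "f (cscale 0 0) = cscale 0 (f 0)" "g (cscale 0 0) = cscale 0 (g 0)"
      using f g cfun.span_zero[of E] unfolding linear_on_def by blast+
    then have "f 0 = g 0" by (simp only: cfun.scale_zero_left)
    then show ?case using cfun.span_zero by blast
  next
    case (step c x y)
    have x: "x \<in> cfun.span E" "cscale c x \<in> cfun.span E" using step cfun.span_base cfun.span_scale by blast+
    have "f (cscale c x + y) = cscale c (f x) + f y" "g (cscale c x + y) = cscale c (g x) + g y"
      using f g x step unfolding linear_on_def by metis+
    moreover have "cscale c x + y \<in> cfun.span E" using x step cfun.span_add by blast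
    ultimately show ?case using step eq by metis
  qed
  then show ?thesis by blast
qed

section \<open>Column antisymmetrizers\<close>

locale diagram =
  fixes \<mu> :: "nat list"
  assumes sorted: "sorted_wrt (\<ge>) \<mu>"
begin

abbreviation "n \<equiv> sum_list \<mu>"
abbreviation "l \<equiv> length \<mu>"

text \<open>James' signed column sum as an operator; the polytabloid of \<open>t\<close> is its
  value at the tabloid of \<open>t\<close>.\<close>

definition antisym :: "(nat \<times> nat \<Rightarrow> nat) \<Rightarrow> (nat set list \<Rightarrow> complex) \<Rightarrow> (nat set list \<Rightarrow> complex)"
  where "antisym t f = (\<Sum>\<pi>\<in>column_stabilizer \<mu> t. cscale (of_int (sign \<pi>)) (perm_act \<pi> f))"

lemma polytabloid_antisym: "polytabloid \<mu> t = antisym t (tabloid_vec (tabloid \<mu> t))"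
  by (simp add: polytabloid_def antisym_def)

lemma column_stabilizer_permutes: "\<pi> \<in> column_stabilizer \<mu> t \<Longrightarrow> \<pi> permutes {1..n}"
  by (simp add: column_stabilizer_def)

lemma column_stabilizer_bij: "\<pi> \<in> column_stabilizer \<mu> t \<Longrightarrow> bij \<pi>"
  using column_stabilizer_permutes permutes_bij by blast

lemma column_stabilizer_permutation: "\<pi> \<in> column_stabilizer \<mu> t \<Longrightarrow> permutation \<pi>"
  using column_stabilizer_permutes permutation_permutes by blast

lemma finite_column_stabilizer [simp]: "finite (column_stabilizer \<mu> t)"
  by (rule finite_subset[OF _ finite_permutations[of "{1..n}"]]) (auto simp: column_stabilizer_def)

lemma column_stabilizer_id: "id \<in> column_stabilizer \<mu> t"
  by (simp add: column_stabilizer_def permutes_id)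

lemma column_stabilizer_comp:
  "\<pi> \<in> column_stabilizer \<mu> t \<Longrightarrow> \<tau> \<in> column_stabilizer \<mu> t \<Longrightarrow> \<pi> \<circ> \<tau> \<in> column_stabilizer \<mu> t"
proof -
  assume *: "\<pi> \<in> column_stabilizer \<mu> t" "\<tau> \<in> column_stabilizer \<mu> t"
  have "\<forall>c. (\<pi> \<circ> \<tau>) ` column_set \<mu> t c = column_set \<mu> t c"
  proof
    fix c
    have "\<pi> ` column_set \<mu> t c = column_set \<mu> t c" "\<tau> ` column_set \<mu> t c = column_set \<mu> t c"
      using * by (simp_all add: column_stabilizer_def)
    then show "(\<pi> \<circ> \<tau>) ` column_set \<mu> t c = column_set \<mu> t c"
      by (simp only: image_comp[symmetric])
  qed
  moreover have "\<pi> \<circ> \<tau> permutes {1..n}"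
    by (rule permutes_compose[OF column_stabilizer_permutes[OF *(2)] column_stabilizer_permutes[OF *(1)]])
  ultimately show ?thesis unfolding column_stabilizer_def by (intro CollectI conjI)
qed

lemma column_stabilizer_inv:
  assumes "\<pi> \<in> column_stabilizer \<mu> t" shows "inv' \<pi> \<in> column_stabilizer \<mu> t"
proof -
  have "inv' \<pi> ` X = X" if "\<pi> ` X = X" for X
    using that column_stabilizer_bij[OF assms] by (metis bij_is_inj image_inv_f_f)
  then show ?thesis using assms by (auto simp: column_stabilizer_def permutes_inv)
qed

lemma column_stabilizer_translate:
  assumes "\<pi> \<in> column_stabilizer \<mu> t"
  shows "bij_betw (\<lambda>\<tau>. \<pi> \<circ> \<tau>) (column_stabilizer \<mu> t) (column_stabilizer \<mu> t)"
    and "bij_betw (\<lambda>\<tau>. \<tau> \<circ> \<pi>) (column_stabilizer \<mu> t) (column_stabilizer \<mu> t)"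
proof -
  note b = column_stabilizer_bij[OF assms]
  have inv: "inv' \<pi> \<circ> (\<pi> \<circ> \<tau>) = \<tau>" "\<pi> \<circ> (inv' \<pi> \<circ> \<tau>) = \<tau>"
    "(\<tau> \<circ> \<pi>) \<circ> inv' \<pi> = \<tau>" "(\<tau> \<circ> inv' \<pi>) \<circ> \<pi> = \<tau>" for \<tau>
    using b by (simp_all add: fun_eq_iff bij_is_inj bij_is_surj surj_f_inv_f)
  show "bij_betw (\<lambda>\<tau>. \<pi> \<circ> \<tau>) (column_stabilizer \<mu> t) (column_stabilizer \<mu> t)"
    by (rule bij_betw_byWitness[where f' = "\<lambda>\<tau>. inv' \<pi> \<circ> \<tau>"])
      (use inv column_stabilizer_comp column_stabilizer_inv assms in blast)+
  show "bij_betw (\<lambda>\<tau>. \<tau> \<circ> \<pi>) (column_stabilizer \<mu> t) (column_stabilizer \<mu> t)"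
    by (rule bij_betw_byWitness[where f' = "\<lambda>\<tau>. \<tau> \<circ> inv' \<pi>"])
      (use inv column_stabilizer_comp column_stabilizer_inv assms in blast)+
qed

lemma antisym_cscale: "antisym t (cscale c f) = cscale c (antisym t f)"
  by (simp add: antisym_def cfun.scale_sum_right mult.commute)

lemma antisym_sum: "antisym t (\<Sum>i\<in>I. f i) = (\<Sum>i\<in>I. antisym t (f i))"
  unfolding antisym_def by (subst sum.swap) (simp only: perm_act_sum cfun.scale_sum_right)

lemma perm_act_antisym:
  assumes "\<pi> \<in> column_stabilizer \<mu> t"
  shows "perm_act \<pi> (antisym t f) = cscale (of_int (sign \<pi>)) (antisym t f)"
proof -
  note b = column_stabilizer_bij[OF assms]
  have "perm_act \<pi> (antisym t f) = (\<Sum>\<tau>\<in>column_stabilizer \<mu> t. cscale (of_int (sign \<tau>)) (perm_act (\<pi> \<circ> \<tau>) f))"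
    unfolding antisym_def perm_act_sum
    by (intro sum.cong refl) (simp add: perm_act_comp b column_stabilizer_bij)
  also have "\<dots> = (\<Sum>\<tau>\<in>column_stabilizer \<mu> t. cscale (of_int (sign \<pi>)) (cscale (of_int (sign (\<pi> \<circ> \<tau>))) (perm_act (\<pi> \<circ> \<tau>) f)))"
  proof (rule sum.cong[OF refl])
    fix \<tau> assume \<tau>: "\<tau> \<in> column_stabilizer \<mu> t"
    have s: "sign \<tau> = sign \<pi> * sign (\<pi> \<circ> \<tau>)"
    proof -
      have "sign \<pi> * sign (\<pi> \<circ> \<tau>) = (sign \<pi> * sign \<pi>) * sign \<tau>"
        by (simp only: sign_compose column_stabilizer_permutation[OF assms] column_stabilizer_permutation[OF \<tau>] mult_ac)
      then show ?thesis by (simp only: sign_idempotent mult_1)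
    qed
    show "cscale (of_int (sign \<tau>)) (perm_act (\<pi> \<circ> \<tau>) f)
      = cscale (of_int (sign \<pi>)) (cscale (of_int (sign (\<pi> \<circ> \<tau>))) (perm_act (\<pi> \<circ> \<tau>) f))"
      by (subst s) simp
  qed
  also have "\<dots> = (\<Sum>\<tau>\<in>column_stabilizer \<mu> t. cscale (of_int (sign \<pi>)) (cscale (of_int (sign \<tau>)) (perm_act \<tau> f)))"
    by (rule sum.reindex_bij_betw[OF column_stabilizer_translate(1)[OF assms]])
  finally show ?thesis by (simp only: antisym_def cfun.scale_sum_right)
qed

lemma antisym_perm_act:
  assumes "\<pi> \<in> column_stabilizer \<mu> t"
  shows "antisym t (perm_act \<pi> f) = cscale (of_int (sign \<pi>)) (antisym t f)"
proof -
  note b = column_stabilizer_bij[OF assms]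
  have "antisym t (perm_act \<pi> f) = (\<Sum>\<tau>\<in>column_stabilizer \<mu> t. cscale (of_int (sign \<tau>)) (perm_act (\<tau> \<circ> \<pi>) f))"
    unfolding antisym_def
    by (intro sum.cong refl) (simp add: perm_act_comp b column_stabilizer_bij)
  also have "\<dots> = (\<Sum>\<tau>\<in>column_stabilizer \<mu> t. cscale (of_int (sign \<pi>)) (cscale (of_int (sign (\<tau> \<circ> \<pi>))) (perm_act (\<tau> \<circ> \<pi>) f)))"
  proof (rule sum.cong[OF refl])
    fix \<tau> assume \<tau>: "\<tau> \<in> column_stabilizer \<mu> t"
    have s: "sign \<tau> = sign \<pi> * sign (\<tau> \<circ> \<pi>)"
    proof -
      have "sign \<pi> * sign (\<tau> \<circ> \<pi>) = (sign \<pi> * sign \<pi>) * sign \<tau>"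
        by (simp only: sign_compose column_stabilizer_permutation[OF assms] column_stabilizer_permutation[OF \<tau>] mult_ac)
      then show ?thesis by (simp only: sign_idempotent mult_1)
    qed
    show "cscale (of_int (sign \<tau>)) (perm_act (\<tau> \<circ> \<pi>) f)
      = cscale (of_int (sign \<pi>)) (cscale (of_int (sign (\<tau> \<circ> \<pi>))) (perm_act (\<tau> \<circ> \<pi>) f))"
      by (subst s) simp
  qed
  also have "\<dots> = (\<Sum>\<tau>\<in>column_stabilizer \<mu> t. cscale (of_int (sign \<pi>)) (cscale (of_int (sign \<tau>)) (perm_act \<tau> f)))"
    by (rule sum.reindex_bij_betw[OF column_stabilizer_translate(2)[OF assms]])
  finally show ?thesis by (simp only: antisym_def cfun.scale_sum_right)
qed

lemma column_set_mem: "x \<in> column_set \<mu> t c \<longleftrightarrow> (\<exists>r. (r, c) \<in> cells \<mu> \<and> x = t (r, c))"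
  by (auto simp: column_set_def)

lemma column_set_unique:
  assumes "tableau \<mu> t" "x \<in> column_set \<mu> t c" "x \<in> column_set \<mu> t d"
  shows "c = d"
  using assms by (auto simp: column_set_mem tableau_def bij_betw_def inj_on_def)

lemma column_set_subset: "tableau \<mu> t \<Longrightarrow> column_set \<mu> t c \<subseteq> {1..n}"
  unfolding column_set_def tableau_def bij_betw_def by blast

text \<open>The transposition of \<open>x\<close> and \<open>y\<close> lies in the column stabilizer
  and fixes \<open>T\<close>, so it multiplies the value both by 1 and by -1.\<close>

lemma antisym_same_column:
  assumes t: "tableau \<mu> t" and xy: "x \<noteq> y" "x \<in> column_set \<mu> t c" "y \<in> column_set \<mu> t c"
    and T: "T \<in> tabloids l' \<beta> {1..n}" "i < l'" "x \<in> T ! i" "y \<in> T ! i"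
  shows "antisym t (tabloid_vec T) = 0"
proof -
  let ?p = "transpose x y"
  have p: "?p permutes {1..n}"
    using column_set_subset[OF t, of c] xy by (intro permutes_swap_id) blast+
  have im: "?p ` X = X" if "x \<in> X \<longleftrightarrow> y \<in> X" for X
    using that by (auto simp: transpose_def image_iff)
  have "?p ` column_set \<mu> t d = column_set \<mu> t d" for d
    by (rule im) (use column_set_unique[OF t] xy in blast)
  then have "?p \<in> column_stabilizer \<mu> t" using p by (simp add: column_stabilizer_def)
  note eq = antisym_perm_act[OF this, of "tabloid_vec T"]
  have "?p ` (T ! j) = T ! j" if "j < l'" for j
  proof (rule im)
    have "j \<noteq> i \<longrightarrow> T ! i \<inter> T ! j = {}" using T that by (auto simp: tabloids_def)
    then show "x \<in> T ! j \<longleftrightarrow> y \<in> T ! j" using T by (cases "j = i") auto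
  qed
  then have "map ((`) ?p) T = T"
    using T by (auto simp: tabloids_def list_eq_iff_nth_eq)
  then have "perm_act ?p (tabloid_vec T) = tabloid_vec T"
    by (simp add: perm_act_tabloid_vec)
  then have "antisym t (tabloid_vec T) = cscale (- 1) (antisym t (tabloid_vec T))"
    using eq xy by (simp add: sign_swap_id)
  then show ?thesis by (auto simp: fun_eq_iff cscale_def)
qed

end

lemma down_closed_eq_lessThan:
  fixes S :: "nat set"
  assumes "finite S" "\<And>x y. x \<in> S \<Longrightarrow> y \<le> x \<Longrightarrow> y \<in> S"
  shows "S = {..<card S}"
proof (cases "S = {}")
  case False
  have "x \<in> S \<longleftrightarrow> x \<le> Max S" for x
    using Max_ge[OF assms(1)] assms(2)[OF Max_in[OF assms(1) False]] by blast
  then have "S = {..Max S}" by blast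
  then obtain m where "S = {..<Suc m}" by (metis lessThan_Suc_atMost)
  then show ?thesis by simp
qed simp

section \<open>Dominance and the action of antisymmetrizers\<close>

context diagram begin

text \<open>The parts of the conjugate partition. By \<open>cells_iff\<close> a column occupies an
  initial segment of the rows.\<close>

definition column_length :: "nat \<Rightarrow> nat"
  where "column_length c = card {r. (r, c) \<in> cells \<mu>}"

lemma cells_iff: "(r, c) \<in> cells \<mu> \<longleftrightarrow> r < column_length c"
proof -
  have "{r. (r, c) \<in> cells \<mu>} = {..<card {r. (r, c) \<in> cells \<mu>}}"
  proof (rule down_closed_eq_lessThan)
    show "finite {r. (r, c) \<in> cells \<mu>}"
      by (rule finite_subset[of _ "{..<l}"]) (auto simp: cells_def)
    fix x y assume "x \<in> {r. (r, c) \<in> cells \<mu>}" "y \<le> x"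
    moreover from this have "\<mu> ! x \<le> \<mu> ! y"
      using sorted_wrt_nth_less[OF sorted, of y x] by (cases "x = y") (auto simp: cells_def)
    ultimately show "y \<in> {r. (r, c) \<in> cells \<mu>}" by (auto simp: cells_def)
  qed
  then show ?thesis unfolding column_length_def by blast
qed

lemma cells_bound: "(r, c) \<in> cells \<mu> \<Longrightarrow> c < n"
proof -
  assume "(r, c) \<in> cells \<mu>"
  then have "\<mu> ! r \<in> set \<mu>" "c < \<mu> ! r" by (auto simp: cells_def)
  moreover from this have "\<mu> ! r \<le> n" using member_le_sum_list by blast
  ultimately show "c < n" by simp
qed

text \<open>Counts the cells of the first \<open>k\<close> rows column by column.\<close>

lemma sum_column_min:
  "k \<le> l \<Longrightarrow> (\<Sum>c<n. min k (column_length c)) = (\<Sum>r<k. \<mu> ! r)"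
proof (induction k)
  case (Suc k)
  have "card {c \<in> {..<n}. k < column_length c} = card {..<\<mu> ! k}"
    using cells_bound[of k] Suc.prems
    by (intro arg_cong[where f = card]) (auto simp: cells_def simp flip: cells_iff)
  then have "(\<Sum>c<n. of_bool (k < column_length c)) = \<mu> ! k"
    unfolding of_bool_def by (subst sum.inter_filter[symmetric]) simp_all
  moreover have "min (Suc k) (column_length c) = min k (column_length c) + of_bool (k < column_length c)" for c
    by auto
  ultimately show ?case using Suc by (simp add: sum.distrib)
qed simp

lemma card_column_set:
  assumes "tableau \<mu> t" shows "card (column_set \<mu> t c) = column_length c"
proof -
  have "column_set \<mu> t c = (\<lambda>r. t (r, c)) ` {r. (r, c) \<in> cells \<mu>}" by (auto simp: column_set_def)
  moreover have "inj_on (\<lambda>r. t (r, c)) {r. (r, c) \<in> cells \<mu>}"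
    using assms by (auto simp: tableau_def bij_betw_def inj_on_def)
  ultimately show ?thesis by (simp add: card_image column_length_def)
qed

text \<open>The condition under which \<open>antisym t\<close> can be nonzero at the tabloid
  \<open>T\<close>: no row of \<open>T\<close> contains two entries of one column of
  \<open>t\<close>.\<close>

definition column_separated :: "(nat \<times> nat \<Rightarrow> nat) \<Rightarrow> nat \<Rightarrow> nat set list \<Rightarrow> bool"
  where "column_separated t l' T \<longleftrightarrow> (\<forall>i<l'. \<forall>c. card (T ! i \<inter> column_set \<mu> t c) \<le> 1)"

lemma antisym_not_separated:
  assumes "tableau \<mu> t" "T \<in> tabloids l' \<beta> {1..n}" "\<not> column_separated t l' T"
  shows "antisym t (tabloid_vec T) = 0"
proof -
  obtain i c where ic: "i < l'" "\<not> card (T ! i \<inter> column_set \<mu> t c) \<le> 1"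
    using assms(3) by (auto simp: column_separated_def)
  have fin: "finite (T ! i \<inter> column_set \<mu> t c)"
    using column_set_subset[OF assms(1), of c] finite_subset by blast
  then obtain x y where "x \<noteq> y" "x \<in> T ! i \<inter> column_set \<mu> t c" "y \<in> T ! i \<inter> column_set \<mu> t c"
    using ic(2) by (metis card_le_Suc0_iff_eq One_nat_def)
  then show ?thesis using antisym_same_column[OF assms(1) _ _ _ assms(2) ic(1)] by blast
qed

lemma Union_column_set:
  assumes t: "tableau \<mu> t" shows "(\<Union>c<n. column_set \<mu> t c) = {1..n}"
proof -
  have "{1..n} = t ` cells \<mu>" using t by (simp add: tableau_def bij_betw_def)
  also have "\<dots> = (\<Union>c<n. column_set \<mu> t c)"
    using cells_bound by (fastforce simp: column_set_def)
  finally show ?thesis by simp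
qed

text \<open>Each of the first \<open>k\<close> rows takes at most one entry from a column, and a
  column has only \<open>column_length c\<close> entries. Summed over all columns, these
  intersections exhaust the first \<open>k\<close> rows.\<close>

lemma separated_counts:
  assumes t: "tableau \<mu> t" and T: "T \<in> tabloids l' \<beta> {1..n}" and sep: "column_separated t l' T"
    and k: "k \<le> l'"
  shows "card ((\<Union>i<k. T ! i) \<inter> column_set \<mu> t c) \<le> min k (column_length c)"
    and "(\<Sum>c<n. int (card ((\<Union>i<k. T ! i) \<inter> column_set \<mu> t c))) = (\<Sum>i<k. \<beta> i)"
proof -
  let ?U = "\<Union>i<k. T ! i"
  have fin: "finite (column_set \<mu> t c)" for c using column_set_subset[OF t] finite_subset by blast
  have TU: "T ! i \<subseteq> {1..n}" if "i < l'" for i using T that by (auto simp: tabloids_def)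
  then have U: "?U \<subseteq> {1..n}" using k by (intro UN_least TU) simp
  have "card (?U \<inter> column_set \<mu> t c) = card (\<Union>i<k. T ! i \<inter> column_set \<mu> t c)" by simp
  also have "\<dots> \<le> (\<Sum>i<k. card (T ! i \<inter> column_set \<mu> t c))" by (rule card_UN_le) simp
  also have "\<dots> \<le> (\<Sum>i<k. 1)" using sep k by (intro sum_mono) (auto simp: column_separated_def)
  finally have "card (?U \<inter> column_set \<mu> t c) \<le> k" by simp
  moreover have "card (?U \<inter> column_set \<mu> t c) \<le> column_length c"
    using card_mono[OF fin, of "?U \<inter> column_set \<mu> t c"] card_column_set[OF t] by simp
  ultimately show "card (?U \<inter> column_set \<mu> t c) \<le> min k (column_length c)" by simp
  have "card (\<Union>c<n. ?U \<inter> column_set \<mu> t c) = (\<Sum>c<n. card (?U \<inter> column_set \<mu> t c))"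
  proof (rule card_UN_disjoint)
    have "column_set \<mu> t c \<inter> column_set \<mu> t d = {}" if "c \<noteq> d" for c d
      using column_set_unique[OF t] that by blast
    then show "\<forall>c\<in>{..<n}. \<forall>d\<in>{..<n}. c \<noteq> d \<longrightarrow> (?U \<inter> column_set \<mu> t c) \<inter> (?U \<inter> column_set \<mu> t d) = {}"
      by blast
  qed (use fin in auto)
  moreover have "(\<Union>c<n. ?U \<inter> column_set \<mu> t c) = ?U" using Union_column_set[OF t] U by auto
  ultimately have "card ?U = (\<Sum>c<n. card (?U \<inter> column_set \<mu> t c))" by simp
  moreover have "card ?U = (\<Sum>i<k. card (T ! i))"
  proof (rule card_UN_disjoint)
    show "\<forall>i\<in>{..<k}. finite (T ! i)" using TU k finite_subset[of _ "{1..n}"] by auto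
    show "\<forall>i\<in>{..<k}. \<forall>j\<in>{..<k}. i \<noteq> j \<longrightarrow> T ! i \<inter> T ! j = {}" using T k by (simp add: tabloids_def)
  qed simp
  moreover have "(\<Sum>i<k. int (card (T ! i))) = (\<Sum>i<k. \<beta> i)" using T k by (intro sum.cong) (auto simp: tabloids_def)
  ultimately show "(\<Sum>c<n. int (card (?U \<inter> column_set \<mu> t c))) = (\<Sum>i<k. \<beta> i)" by (simp flip: of_nat_sum)
qed

text \<open>If the first \<open>k\<close> rows of shape \<open>\<beta>\<close> hold more entries
  than those of \<open>\<mu>\<close>, the column counts leave no separated tabloid, so every tabloid
  is killed.\<close>

lemma antisym_zero:
  assumes t: "tableau \<mu> t" and k: "k \<le> l" "k \<le> l'" "(\<Sum>r<k. int (\<mu> ! r)) < (\<Sum>i<k. \<beta> i)"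
    and f: "f \<in> tabloid_space l' \<beta> n"
  shows "antisym t f = 0"
proof -
  have "antisym t (tabloid_vec T) = 0" if T: "T \<in> tabloids l' \<beta> {1..n}" for T
  proof (rule antisym_not_separated[OF t T], rule notI)
    assume sep: "column_separated t l' T"
    have "(\<Sum>i<k. \<beta> i) = (\<Sum>c<n. int (card ((\<Union>i<k. T ! i) \<inter> column_set \<mu> t c)))"
      using separated_counts(2)[OF t T sep k(2)] by simp
    also have "\<dots> \<le> (\<Sum>c<n. int (min k (column_length c)))"
      using separated_counts(1)[OF t T sep k(2)] by (intro sum_mono) (simp only: of_nat_le_iff)
    also have "\<dots> = (\<Sum>r<k. int (\<mu> ! r))" using sum_column_min[OF k(1)] by (simp flip: of_nat_sum)
    finally show False using k by simp
  qed
  then have "antisym t (\<Sum>T\<in>tabloids l' \<beta> {1..n}. cscale (f T) (tabloid_vec T)) = 0"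
    by (simp add: antisym_sum antisym_cscale)
  then show ?thesis using tabloid_space_expand[OF f] by simp
qed

abbreviation "shape \<equiv> \<lambda>i. int (\<mu> ! i)"

lemma card_row_set:
  assumes "tableau \<mu> t" "r < l" shows "card (row_set \<mu> t r) = \<mu> ! r"
proof -
  have "row_set \<mu> t r = (\<lambda>c. t (r, c)) ` {..<\<mu> ! r}" using assms by (auto simp: row_set_def cells_def)
  moreover have "inj_on (\<lambda>c. t (r, c)) {..<\<mu> ! r}"
    using assms by (auto simp: tableau_def bij_betw_def inj_on_def cells_def)
  ultimately show ?thesis by (simp add: card_image)
qed

lemma row_set_mem: "x \<in> row_set \<mu> t r \<longleftrightarrow> (\<exists>c. (r, c) \<in> cells \<mu> \<and> x = t (r, c))"
  by (auto simp: row_set_def)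

lemma tabloid_in_tabloids:
  assumes t: "tableau \<mu> t" shows "tabloid \<mu> t \<in> tabloids l shape {1..n}"
proof -
  have "(\<Union>i<l. row_set \<mu> t i) = t ` cells \<mu>" by (auto simp: row_set_def cells_def)
  also have "\<dots> = {1..n}" using t by (simp add: tableau_def bij_betw_def)
  finally have "(\<Union>i<l. row_set \<mu> t i) = {1..n}" .
  moreover have "row_set \<mu> t i \<inter> row_set \<mu> t j = {}" if "i \<noteq> j" for i j
  proof -
    have "(i, c) = (j, d)" if "(i, c) \<in> cells \<mu>" "(j, d) \<in> cells \<mu>" "t (i, c) = t (j, d)" for c d
      using t that unfolding tableau_def bij_betw_def inj_on_def by blast
    then show ?thesis using \<open>i \<noteq> j\<close> by (auto simp: row_set_mem)
  qed
  ultimately show ?thesis using card_row_set[OF t] by (simp add: tabloids_def tabloid_def)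
qed

text \<open>For the same shape the bounds of \<open>separated_counts\<close> are attained, so row
  \<open>r\<close> of \<open>T\<close> contains an entry of every column that reaches row
  \<open>r\<close>. Sending the entry of \<open>t\<close> in cell \<open>(r, c)\<close> to this one
  is a column permutation.\<close>

lemma separated_tabloid:
  assumes t: "tableau \<mu> t" and T: "T \<in> tabloids l shape {1..n}" and sep: "column_separated t l T"
  shows "\<exists>\<pi>\<in>column_stabilizer \<mu> t. T = map ((`) \<pi>) (tabloid \<mu> t)"
proof -
  let ?U = "\<lambda>k. \<Union>i<k. T ! i"
  have finc: "finite (column_set \<mu> t c)" for c using column_set_subset[OF t] finite_subset by blast
  \<comment> \<open>Both sums over the columns equal the number of cells in the first
    \<open>k\<close> rows, and a termwise bound with equal sums is a termwise equality.\<close>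
  have cU: "card (?U k \<inter> column_set \<mu> t c) = min k (column_length c)" if "k \<le> l" "c < n" for k c
  proof -
    have "(\<Sum>c<n. int (card (?U k \<inter> column_set \<mu> t c))) = (\<Sum>c<n. int (min k (column_length c)))"
      using separated_counts(2)[OF t T sep that(1)] sum_column_min[OF that(1)] by (simp flip: of_nat_sum)
    moreover have "int (card (?U k \<inter> column_set \<mu> t c)) \<le> int (min k (column_length c))" for c
      using separated_counts(1)[OF t T sep that(1)] by (simp only: of_nat_le_iff)
    ultimately have "int (card (?U k \<inter> column_set \<mu> t c)) = int (min k (column_length c))"
      using that(2) by (intro sum_mono_inv[of "\<lambda>c. int (card (?U k \<inter> column_set \<mu> t c))" "{..<n}"]) simp_all
    then show ?thesis by simp
  qed
  have ex: "\<exists>x. x \<in> T ! r \<inter> column_set \<mu> t c" if rc: "(r, c) \<in> cells \<mu>" for r c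
  proof (rule ccontr)
    assume "\<not> ?thesis"
    then have "?U (Suc r) \<inter> column_set \<mu> t c = ?U r \<inter> column_set \<mu> t c" by (auto simp: less_Suc_eq)
    moreover have "r < l" "c < n" "r < column_length c"
      using rc cells_bound[OF rc] cells_iff by (auto simp: cells_def)
    ultimately show False using cU[of "Suc r" c] cU[of r c] by simp
  qed
  \<comment> \<open>The entry of \<open>T\<close> destined for a cell; distinct cells differ in
    their row of \<open>T\<close> or in their column of \<open>t\<close>, so \<open>p\<close> is
    injective.\<close>
  define p where "p rc = (SOME x. x \<in> T ! fst rc \<inter> column_set \<mu> t (snd rc))" for rc
  have p: "p (r, c) \<in> T ! r \<inter> column_set \<mu> t c" if "(r, c) \<in> cells \<mu>" for r c
    using someI_ex[OF ex[OF that]] by (simp add: p_def)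
  define \<pi> where "\<pi> x = (if x \<in> {1..n} then p (inv_into (cells \<mu>) t x) else x)" for x
  have tb: "inj_on t (cells \<mu>)" "t ` cells \<mu> = {1..n}" using t by (auto simp: tableau_def bij_betw_def)
  have pi: "\<pi> (t rc) = p rc" if "rc \<in> cells \<mu>" for rc
    using that tb by (auto simp: \<pi>_def)
  have pinj: "rc = rc'" if "rc \<in> cells \<mu>" "rc' \<in> cells \<mu>" "p rc = p rc'" for rc rc'
  proof -
    obtain r c r' c' where eq: "rc = (r, c)" "rc' = (r', c')" by (meson surj_pair)
    have m: "p rc \<in> T ! r \<inter> column_set \<mu> t c" "p rc \<in> T ! r' \<inter> column_set \<mu> t c'"
      using p[of r c] p[of r' c'] that unfolding eq by simp_all
    have "r < l" "r' < l" using that by (auto simp: eq cells_def)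
    then have "r \<noteq> r' \<longrightarrow> T ! r \<inter> T ! r' = {}" using T by (simp add: tabloids_def)
    then have "r = r'" using m by blast
    moreover have "c = c'" using column_set_unique[OF t] m by blast
    ultimately show ?thesis using eq by simp
  qed
  have injpi: "inj_on \<pi> {1..n}"
    unfolding tb(2)[symmetric] using pinj pi by (auto simp: inj_on_def)
  have pcol: "p (r, c) \<in> {1..n}" if "(r, c) \<in> cells \<mu>" for r c
    using p[OF that] column_set_subset[OF t] by blast
  have "\<pi> ` {1..n} \<subseteq> {1..n}"
  proof
    fix y assume "y \<in> \<pi> ` {1..n}"
    then obtain r c where "(r, c) \<in> cells \<mu>" "y = \<pi> (t (r, c))" unfolding tb(2)[symmetric] by auto
    then show "y \<in> {1..n}" using pi pcol by simp
  qed
  then have "\<pi> ` {1..n} = {1..n}" by (rule endo_inj_surj[OF finite_atLeastAtMost _ injpi])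
  then have "bij_betw \<pi> {1..n} {1..n}" using injpi by (simp only: bij_betw_def simp_thms)
  then have perm: "\<pi> permutes {1..n}" by (rule bij_imp_permutes) (simp only: \<pi>_def if_False)
  have "\<pi> ` column_set \<mu> t c = column_set \<mu> t c" for c
  proof (rule card_subset_eq[OF finc])
    show "\<pi> ` column_set \<mu> t c \<subseteq> column_set \<mu> t c" using pi p by (auto simp: column_set_mem)
    show "card (\<pi> ` column_set \<mu> t c) = card (column_set \<mu> t c)"
      by (intro card_image inj_on_subset[OF permutes_inj[OF perm]]) simp
  qed
  then have "\<pi> \<in> column_stabilizer \<mu> t" using perm by (simp add: column_stabilizer_def)
  moreover have "\<pi> ` row_set \<mu> t r = T ! r" if r: "r < l" for r
  proof (rule card_subset_eq)
    have "T ! r \<subseteq> (\<Union>i<l. T ! i)" using r by blast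
    also have "\<dots> = {1..n}" using T by (simp add: tabloids_def)
    finally show "finite (T ! r)" by (rule finite_subset) simp
    show "\<pi> ` row_set \<mu> t r \<subseteq> T ! r" using pi p by (auto simp: row_set_mem)
    have "card (\<pi> ` row_set \<mu> t r) = card (row_set \<mu> t r)"
      by (intro card_image inj_on_subset[OF permutes_inj[OF perm]]) simp
    then show "card (\<pi> ` row_set \<mu> t r) = card (T ! r)"
      using card_row_set[OF t r] T r by (simp add: tabloids_def)
  qed
  then have "T = map ((`) \<pi>) (tabloid \<mu> t)"
    using T by (intro nth_equalityI) (simp_all add: tabloids_def tabloid_def)
  ultimately show ?thesis by blast
qed

text \<open>A separated tabloid is a column permutation of the tabloid of \<open>t\<close>, which
  after antisymmetrizing costs only a sign; all other tabloids are killed.\<close>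

lemma antisym_multiple:
  assumes t: "tableau \<mu> t" and f: "f \<in> tabloid_space l shape n"
  shows "\<exists>k. antisym t f = cscale k (polytabloid \<mu> t)"
proof -
  have "\<exists>k. antisym t (tabloid_vec T) = cscale k (polytabloid \<mu> t)" if T: "T \<in> tabloids l shape {1..n}" for T
  proof (cases "column_separated t l T")
    case True
    then obtain \<pi> where pi: "\<pi> \<in> column_stabilizer \<mu> t" "T = map ((`) \<pi>) (tabloid \<mu> t)"
      using separated_tabloid[OF t T] by blast
    then have "tabloid_vec T = perm_act \<pi> (tabloid_vec (tabloid \<mu> t))"
      by (simp add: perm_act_tabloid_vec column_stabilizer_bij)
    then show ?thesis using antisym_perm_act[OF pi(1)] by (auto simp: polytabloid_antisym)
  next
    case False
    have "antisym t (tabloid_vec T) = cscale 0 (polytabloid \<mu> t)"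
      using antisym_not_separated[OF t T False] by simp
    then show ?thesis by blast
  qed
  then obtain k where k: "\<And>T. T \<in> tabloids l shape {1..n} \<Longrightarrow> antisym t (tabloid_vec T) = cscale (k T) (polytabloid \<mu> t)"
    by metis
  have "antisym t f = antisym t (\<Sum>T\<in>tabloids l shape {1..n}. cscale (f T) (tabloid_vec T))"
    using tabloid_space_expand[OF f] by simp
  also have "\<dots> = (\<Sum>T\<in>tabloids l shape {1..n}. cscale (f T * k T) (polytabloid \<mu> t))"
    by (simp add: antisym_sum antisym_cscale k)
  also have "\<dots> = cscale (\<Sum>T\<in>tabloids l shape {1..n}. f T * k T) (polytabloid \<mu> t)"
    by (simp add: cfun.scale_sum_left)
  finally show ?thesis by blast
qed

end

definition beta :: "nat list \<Rightarrow> nat \<Rightarrow> int"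
  where "beta \<mu> i = int (\<mu> ! i) + staircase (length \<mu>) i"

section \<open>Maps from a Specht module into tabloid spaces\<close>

context diagram begin

lemma tableau_exists: "\<exists>t. tableau \<mu> t"
proof -
  have eq: "cells \<mu> = (SIGMA r:{..<l}. {..<\<mu> ! r})" by (auto simp: cells_def)
  have "card (cells \<mu>) = (\<Sum>r<l. \<mu> ! r)" unfolding eq by (subst card_SigmaI) auto
  also have "\<dots> = n" by (simp add: sum_list_sum_nth atLeast0LessThan)
  finally have "card (cells \<mu>) = card {1..n}" by simp
  moreover have "finite (cells \<mu>)" unfolding eq by (rule finite_SigmaI) auto
  ultimately show ?thesis unfolding tableau_def by (intro finite_same_card_bij) auto
qed

definition t0 where "t0 = (SOME t. tableau \<mu> t)"
definition e where "e = polytabloid \<mu> t0"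

lemma tableau_t0: "tableau \<mu> t0"
  unfolding t0_def using tableau_exists by (rule someI_ex)

lemma polytabloid_cong:
  assumes "\<And>x. x \<in> cells \<mu> \<Longrightarrow> t x = t' x"
  shows "polytabloid \<mu> t = polytabloid \<mu> t'"
proof -
  have "row_set \<mu> t = row_set \<mu> t'"
    unfolding row_set_def by (intro ext Collect_cong) (metis assms)
  moreover have "column_set \<mu> t = column_set \<mu> t'"
    unfolding column_set_def by (intro ext Collect_cong) (metis assms)
  ultimately show ?thesis by (simp add: polytabloid_def tabloid_def column_stabilizer_def)
qed

lemma polytabloid_comp:
  \<comment> \<open>Conjugation by \<open>\<sigma>\<close> carries the column stabilizer of
    \<open>t\<close> to that of \<open>\<sigma> \<circ> t\<close> and preserves signs.\<close>
  assumes s: "\<sigma> permutes {1..n}"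
  shows "polytabloid \<mu> (\<sigma> \<circ> t) = perm_act \<sigma> (polytabloid \<mu> t)"
proof -
  have b: "bij \<sigma>" using s permutes_bij by blast
  have ps: "permutation \<sigma>" using s permutation_permutes by blast
  have io: "inv' \<sigma> \<circ> \<sigma> = id" "\<sigma> \<circ> inv' \<sigma> = id" using permutes_inv_o[OF s] by auto
  have col: "column_set \<mu> (\<sigma> \<circ> t) c = \<sigma> ` column_set \<mu> t c" for c by (auto simp: column_set_def)
  have row: "row_set \<mu> (\<sigma> \<circ> t) r = \<sigma> ` row_set \<mu> t r" for r by (auto simp: row_set_def)
  have tab: "tabloid \<mu> (\<sigma> \<circ> t) = map ((`) \<sigma>) (tabloid \<mu> t)" by (simp add: tabloid_def row)
  have conj: "\<sigma> \<circ> \<pi> \<circ> inv' \<sigma> \<in> column_stabilizer \<mu> (\<sigma> \<circ> t)" if pi: "\<pi> \<in> column_stabilizer \<mu> t" for \<pi>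
  proof -
    have "(\<sigma> \<circ> \<pi> \<circ> inv' \<sigma>) ` column_set \<mu> (\<sigma> \<circ> t) c = column_set \<mu> (\<sigma> \<circ> t) c" for c
    proof -
      have "(\<sigma> \<circ> \<pi> \<circ> inv' \<sigma>) ` column_set \<mu> (\<sigma> \<circ> t) c = \<sigma> ` (\<pi> ` ((inv' \<sigma> \<circ> \<sigma>) ` column_set \<mu> t c))"
        unfolding col by (simp only: image_comp comp_assoc)
      also have "\<dots> = \<sigma> ` column_set \<mu> t c" using pi io by (simp add: column_stabilizer_def)
      finally show ?thesis unfolding col .
    qed
    moreover have "\<sigma> \<circ> \<pi> \<circ> inv' \<sigma> permutes {1..n}"
      by (rule permutes_compose[OF permutes_inv[OF s] permutes_compose[OF column_stabilizer_permutes[OF pi] s]])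
    ultimately show ?thesis unfolding column_stabilizer_def by (intro CollectI conjI allI)
  qed
  have conj': "inv' \<sigma> \<circ> \<tau> \<circ> \<sigma> \<in> column_stabilizer \<mu> t" if tau: "\<tau> \<in> column_stabilizer \<mu> (\<sigma> \<circ> t)" for \<tau>
  proof -
    have "(inv' \<sigma> \<circ> \<tau> \<circ> \<sigma>) ` column_set \<mu> t c = column_set \<mu> t c" for c
    proof -
      have "(inv' \<sigma> \<circ> \<tau> \<circ> \<sigma>) ` column_set \<mu> t c = inv' \<sigma> ` (\<tau> ` (column_set \<mu> (\<sigma> \<circ> t) c))"
        unfolding col by (simp only: image_comp comp_assoc)
      also have "\<dots> = inv' \<sigma> ` (column_set \<mu> (\<sigma> \<circ> t) c)" using tau by (simp add: column_stabilizer_def)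
      also have "\<dots> = column_set \<mu> t c" unfolding col by (simp only: image_comp io image_id id_apply)
      finally show ?thesis .
    qed
    moreover have "inv' \<sigma> \<circ> \<tau> \<circ> \<sigma> permutes {1..n}"
      by (rule permutes_compose[OF s permutes_compose[OF column_stabilizer_permutes[OF tau] permutes_inv[OF s]]])
    ultimately show ?thesis unfolding column_stabilizer_def by (intro CollectI conjI allI)
  qed
  have cancel: "inv' \<sigma> \<circ> (\<sigma> \<circ> \<pi> \<circ> inv' \<sigma>) \<circ> \<sigma> = \<pi>" "\<sigma> \<circ> (inv' \<sigma> \<circ> \<pi> \<circ> \<sigma>) \<circ> inv' \<sigma> = \<pi>" for \<pi>
  proof -
    have "inv' \<sigma> \<circ> (\<sigma> \<circ> \<pi> \<circ> inv' \<sigma>) \<circ> \<sigma> = (inv' \<sigma> \<circ> \<sigma>) \<circ> \<pi> \<circ> (inv' \<sigma> \<circ> \<sigma>)" by (simp only: comp_assoc)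
    then show "inv' \<sigma> \<circ> (\<sigma> \<circ> \<pi> \<circ> inv' \<sigma>) \<circ> \<sigma> = \<pi>" by (simp only: io id_comp comp_id)
    have "\<sigma> \<circ> (inv' \<sigma> \<circ> \<pi> \<circ> \<sigma>) \<circ> inv' \<sigma> = (\<sigma> \<circ> inv' \<sigma>) \<circ> \<pi> \<circ> (\<sigma> \<circ> inv' \<sigma>)" by (simp only: comp_assoc)
    then show "\<sigma> \<circ> (inv' \<sigma> \<circ> \<pi> \<circ> \<sigma>) \<circ> inv' \<sigma> = \<pi>" by (simp only: io id_comp comp_id)
  qed
  have bij: "bij_betw (\<lambda>\<pi>. \<sigma> \<circ> \<pi> \<circ> inv' \<sigma>) (column_stabilizer \<mu> t) (column_stabilizer \<mu> (\<sigma> \<circ> t))"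
    by (rule bij_betw_byWitness[where f' = "\<lambda>\<tau>. inv' \<sigma> \<circ> \<tau> \<circ> \<sigma>"])
      (intro ballI cancel image_subsetI conj conj'; assumption)+
  have "polytabloid \<mu> (\<sigma> \<circ> t) = (\<Sum>\<pi>\<in>column_stabilizer \<mu> t. cscale (of_int (sign (\<sigma> \<circ> \<pi> \<circ> inv' \<sigma>)))
      (perm_act (\<sigma> \<circ> \<pi> \<circ> inv' \<sigma>) (tabloid_vec (map ((`) \<sigma>) (tabloid \<mu> t)))))"
    unfolding polytabloid_def tab by (rule sum.reindex_bij_betw[OF bij, symmetric])
  also have "\<dots> = (\<Sum>\<pi>\<in>column_stabilizer \<mu> t. perm_act \<sigma> (cscale (of_int (sign \<pi>)) (perm_act \<pi> (tabloid_vec (tabloid \<mu> t)))))"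
  proof (rule sum.cong[OF refl])
    fix \<pi> assume pi: "\<pi> \<in> column_stabilizer \<mu> t"
    note bp = column_stabilizer_bij[OF pi] and pp = column_stabilizer_permutation[OF pi]
    have "sign (\<sigma> \<circ> \<pi> \<circ> inv' \<sigma>) = sign \<sigma> * sign \<pi> * sign \<sigma>"
      by (simp only: sign_compose permutation_compose permutation_inverse ps pp sign_inverse)
    also have "\<dots> = sign \<sigma> * sign \<sigma> * sign \<pi>" by (simp only: mult_ac)
    also have "\<dots> = sign \<pi>" by (simp only: sign_idempotent mult_1)
    finally have sg: "sign (\<sigma> \<circ> \<pi> \<circ> inv' \<sigma>) = sign \<pi>" .
    have "perm_act (\<sigma> \<circ> \<pi> \<circ> inv' \<sigma>) (tabloid_vec (map ((`) \<sigma>) (tabloid \<mu> t)))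
      = perm_act (\<sigma> \<circ> \<pi> \<circ> inv' \<sigma>) (perm_act \<sigma> (tabloid_vec (tabloid \<mu> t)))"
      by (simp only: perm_act_tabloid_vec[OF b])
    also have "\<dots> = perm_act (\<sigma> \<circ> \<pi> \<circ> inv' \<sigma> \<circ> \<sigma>) (tabloid_vec (tabloid \<mu> t))"
      by (rule perm_act_comp[symmetric]) (intro bij_comp bij_imp_bij_inv b bp)+
    also have "\<sigma> \<circ> \<pi> \<circ> inv' \<sigma> \<circ> \<sigma> = \<sigma> \<circ> \<pi>" using io by (simp only: comp_assoc comp_id)
    also have "perm_act (\<sigma> \<circ> \<pi>) (tabloid_vec (tabloid \<mu> t)) = perm_act \<sigma> (perm_act \<pi> (tabloid_vec (tabloid \<mu> t)))"
      by (rule perm_act_comp[OF b bp])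
    finally show "cscale (of_int (sign (\<sigma> \<circ> \<pi> \<circ> inv' \<sigma>))) (perm_act (\<sigma> \<circ> \<pi> \<circ> inv' \<sigma>) (tabloid_vec (map ((`) \<sigma>) (tabloid \<mu> t))))
      = perm_act \<sigma> (cscale (of_int (sign \<pi>)) (perm_act \<pi> (tabloid_vec (tabloid \<mu> t))))"
      by (simp only: sg perm_act_cscale)
  qed
  also have "\<dots> = perm_act \<sigma> (polytabloid \<mu> t)" by (simp only: polytabloid_def perm_act_sum)
  finally show ?thesis .
qed

lemma tableau_comp:
  assumes "\<sigma> permutes {1..n}" "tableau \<mu> t" shows "tableau \<mu> (\<sigma> \<circ> t)"
  unfolding tableau_def
  by (rule bij_betw_trans[OF assms(2)[unfolded tableau_def] permutes_imp_bij[OF assms(1)]])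

lemma tableau_transitive:
  assumes "tableau \<mu> t" "tableau \<mu> t'"
  obtains \<sigma> where "\<sigma> permutes {1..n}" "\<And>x. x \<in> cells \<mu> \<Longrightarrow> t' x = \<sigma> (t x)"
proof -
  define \<sigma> where "\<sigma> x = (if x \<in> {1..n} then t' (inv_into (cells \<mu>) t x) else x)" for x
  have t: "bij_betw t (cells \<mu>) {1..n}" and t': "bij_betw t' (cells \<mu>) {1..n}"
    using assms by (auto simp: tableau_def)
  have "bij_betw (t' \<circ> inv_into (cells \<mu>) t) {1..n} {1..n}"
    by (rule bij_betw_trans[OF bij_betw_inv_into[OF t] t'])
  then have "bij_betw \<sigma> {1..n} {1..n}"
    by (rule bij_betw_cong[THEN iffD1, rotated]) (simp add: \<sigma>_def)
  then have "\<sigma> permutes {1..n}" by (rule bij_imp_permutes) (auto simp: \<sigma>_def)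
  moreover have "t' x = \<sigma> (t x)" if "x \<in> cells \<mu>" for x
    using that bij_betw_apply[OF t that] bij_betw_inv_into_left[OF t that] unfolding \<sigma>_def by (simp only: if_True)
  ultimately show thesis by (rule that)
qed

text \<open>All polytabloids, listed as translates of one. The tableaux themselves form an infinite
  set, being arbitrary functions outside the diagram; this description makes the finiteness
  visible.\<close>

definition generators where "generators = (\<lambda>\<sigma>. perm_act \<sigma> e) ` {\<sigma>. \<sigma> permutes {1..n}}"

lemma finite_generators: "finite generators"
  unfolding generators_def by (simp add: finite_permutations)

lemma polytabloids_eq: "{polytabloid \<mu> t | t. tableau \<mu> t} = generators"
proof
  show "{polytabloid \<mu> t | t. tableau \<mu> t} \<subseteq> generators"
  proof clarify
    fix t assume "tableau \<mu> t"
    then obtain \<sigma> where s: "\<sigma> permutes {1..n}" "\<And>x. x \<in> cells \<mu> \<Longrightarrow> t x = \<sigma> (t0 x)"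
      using tableau_transitive[OF tableau_t0] by blast
    then have "polytabloid \<mu> t = polytabloid \<mu> (\<sigma> \<circ> t0)" by (intro polytabloid_cong) simp
    then show "polytabloid \<mu> t \<in> generators"
      using s polytabloid_comp by (auto simp: generators_def e_def)
  qed
  show "generators \<subseteq> {polytabloid \<mu> t | t. tableau \<mu> t}"
  proof
    fix x assume "x \<in> generators"
    then obtain \<sigma> where s: "\<sigma> permutes {1..n}" "x = perm_act \<sigma> e" by (auto simp: generators_def)
    then have "x = polytabloid \<mu> (\<sigma> \<circ> t0)" using polytabloid_comp[OF s(1)] by (simp only: e_def)
    then show "x \<in> {polytabloid \<mu> t | t. tableau \<mu> t}" using tableau_comp[OF s(1) tableau_t0] by blast
  qed
qed

lemma specht_eq: "specht_module \<mu> = cfun.span generators"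
  by (simp only: specht_module_def polytabloids_eq)

lemma e_space: "e \<in> tabloid_space l shape n"
  unfolding e_def polytabloid_def
  by (intro cfun.subspace_sum[OF subspace_tabloid_space] cfun.subspace_scale[OF subspace_tabloid_space]
      perm_act_tabloid_space[OF column_stabilizer_permutes] tabloid_vec_mem tabloid_in_tabloids tableau_t0)

lemma specht_subset: "specht_module \<mu> \<subseteq> tabloid_space l shape n"
  unfolding specht_eq
  by (rule cfun.span_minimal[OF _ subspace_tabloid_space]) (auto simp: generators_def intro: perm_act_tabloid_space e_space)

lemma e_specht: "e \<in> specht_module \<mu>"
proof -
  have "perm_act id e \<in> generators" unfolding generators_def using permutes_id by blast
  then show ?thesis unfolding specht_eq by (simp add: cfun.span_base)
qed

lemma perm_act_generators:
  assumes s: "\<sigma> permutes {1..n}" and "x \<in> generators"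
  shows "perm_act \<sigma> x \<in> generators"
proof -
  obtain \<tau> where t: "\<tau> permutes {1..n}" "x = perm_act \<tau> e" using assms(2) by (auto simp: generators_def)
  then have "perm_act \<sigma> x = perm_act (\<sigma> \<circ> \<tau>) e" using s by (simp only: perm_act_comp permutes_bij)
  then show ?thesis using permutes_compose[OF t(1) s] unfolding generators_def by blast
qed

lemma perm_act_specht:
  assumes s: "\<sigma> permutes {1..n}" and u: "u \<in> specht_module \<mu>"
  shows "perm_act \<sigma> u \<in> specht_module \<mu>"
  using u unfolding specht_eq
proof (induction rule: cfun.span_induct_alt)
  case base
  then show ?case by (simp only: perm_act_zero cfun.span_zero)
next
  case (step c x y)
  have x: "perm_act \<sigma> x \<in> cfun.span generators"
    using step perm_act_generators[OF s] cfun.span_base by blast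
  have "cscale c (perm_act \<sigma> x) + perm_act \<sigma> y \<in> cfun.span generators"
    by (rule cfun.span_add[OF cfun.span_scale[OF x]]) (use step in blast)
  then show ?case by (simp only: perm_act_add perm_act_cscale)
qed

lemma rep_on_specht: "rep_on (sym_group n) (specht_module \<mu>) perm_act"
  by (rule rep_on_perm_act[OF finite_generators specht_eq[symmetric] perm_act_specht])

lemma perm_act_stabilizer_e:
  "\<pi> \<in> column_stabilizer \<mu> t0 \<Longrightarrow> perm_act \<pi> e = cscale (of_int (sign \<pi>)) e"
  unfolding e_def polytabloid_antisym by (rule perm_act_antisym)

text \<open>The column stabilizer acts on \<open>e\<close> by the sign, hence also on
  \<open>f e\<close>, so antisymmetrizing \<open>f e\<close> multiplies it by the order of the
  stabilizer.\<close>

lemma intertwiner_antisym: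
  assumes f: "intertwiner (sym_group n) (specht_module \<mu>) perm_act W perm_act f"
  shows "cscale (of_nat (card (column_stabilizer \<mu> t0))) (f e) = antisym t0 (f e)"
proof -
  have "antisym t0 (f e) = (\<Sum>\<pi>\<in>column_stabilizer \<mu> t0. f e)"
    unfolding antisym_def
  proof (rule sum.cong[OF refl])
    fix \<pi> assume pi: "\<pi> \<in> column_stabilizer \<mu> t0"
    have "perm_act \<pi> (f e) = f (perm_act \<pi> e)"
      using f e_specht column_stabilizer_permutes[OF pi] by (simp add: intertwiner_def sym_group_carrier)
    also have "\<dots> = cscale (of_int (sign \<pi>)) (f e)"
      using f e_specht by (simp add: perm_act_stabilizer_e[OF pi] intertwiner_def linear_on_def)
    finally show "cscale (of_int (sign \<pi>)) (perm_act \<pi> (f e)) = f e"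
      by (simp add: sign_idempotent flip: of_int_mult)
  qed
  then show ?thesis by (simp only: sum_cscale_const)
qed

text \<open>The translates of \<open>e\<close> span the module, so \<open>f\<close> is determined by
  \<open>f e\<close>, which is a multiple of \<open>e\<close> by
  \<open>intertwiner_antisym\<close>.\<close>

lemma intertwiner_scalar:
  assumes f: "intertwiner (sym_group n) (specht_module \<mu>) perm_act W perm_act f"
    and W: "cfun.subspace W" "specht_module \<mu> \<subseteq> W" and k: "antisym t0 (f e) = cscale k e"
  shows "\<exists>k. \<forall>v\<in>specht_module \<mu>. f v = cscale k v"
proof -
  let ?c = "of_nat (card (column_stabilizer \<mu> t0)) :: complex"
  have "column_stabilizer \<mu> t0 \<noteq> {}" using column_stabilizer_id by blast
  then have "?c \<noteq> 0" by simp
  moreover have "cscale ?c (f e) = cscale k e" using intertwiner_antisym[OF f] k by simp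
  ultimately have fe: "f e = cscale (k / ?c) e"
    by (metis (no_types, lifting) cfun.scale_scale cfun.scale_one divide_inverse_commute left_inverse)
  have "f v = cscale (k / ?c) v" if v: "v \<in> specht_module \<mu>" for v
  proof (rule linear_on_eq_span[of generators W f "cscale (k / ?c)"])
    show "linear_on (cfun.span generators) W f" using f by (simp add: intertwiner_def specht_eq)
    show "linear_on (cfun.span generators) W (cscale (k / ?c))"
      using W cfun.subspace_scale[OF W(1)] unfolding linear_on_def specht_eq
      by (auto simp: cfun.scale_right_distrib mult.commute)
    show "v \<in> cfun.span generators" using v specht_eq by simp
    fix x assume "x \<in> generators"
    then obtain \<tau> where t: "\<tau> permutes {1..n}" "x = perm_act \<tau> e" by (auto simp: generators_def)
    then have "f x = perm_act \<tau> (f e)" using f e_specht by (simp add: intertwiner_def sym_group_carrier)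
    then show "f x = cscale (k / ?c) x" using t fe by (simp only: perm_act_cscale)
  qed
  then show ?thesis by blast
qed

lemma intertwiner_tabloid_space:
  assumes f: "intertwiner (sym_group n) (specht_module \<mu>) perm_act (tabloid_space l shape n) perm_act f"
  shows "\<exists>k. \<forall>v\<in>specht_module \<mu>. f v = cscale k v"
proof -
  have "f e \<in> tabloid_space l shape n" using f e_specht by (simp add: intertwiner_def linear_on_def)
  then obtain k where "antisym t0 (f e) = cscale k e"
    using antisym_multiple[OF tableau_t0] unfolding e_def by blast
  then show ?thesis by (rule intertwiner_scalar[OF f subspace_tabloid_space specht_subset])
qed

text \<open>Up to a nonzero factor \<open>f e\<close> is its own antisymmetrization, which vanishes
  by dominance.\<close>

lemma intertwiner_zero:
  assumes f: "intertwiner (sym_group n) (specht_module \<mu>) perm_act (tabloid_space l' \<beta> n) perm_act f"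
    and k: "k \<le> l" "k \<le> l'" "(\<Sum>r<k. int (\<mu> ! r)) < (\<Sum>i<k. \<beta> i)" and v: "v \<in> specht_module \<mu>"
  shows "f v = 0"
proof (rule linear_on_eq_span[of generators "tabloid_space l' \<beta> n" f "\<lambda>_. 0"])
  have "f e \<in> tabloid_space l' \<beta> n" using f e_specht by (simp add: intertwiner_def linear_on_def)
  then have "antisym t0 (f e) = 0" by (rule antisym_zero[OF tableau_t0 k])
  moreover have "column_stabilizer \<mu> t0 \<noteq> {}" using column_stabilizer_id by blast
  ultimately have fe: "f e = 0" using intertwiner_antisym[OF f] by simp
  show "linear_on (cfun.span generators) (tabloid_space l' \<beta> n) f" using f by (simp add: intertwiner_def specht_eq)
  show "linear_on (cfun.span generators) (tabloid_space l' \<beta> n) (\<lambda>_. 0)"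
    unfolding linear_on_def using cfun.subspace_0[OF subspace_tabloid_space] by simp
  show "v \<in> cfun.span generators" using v specht_eq by simp
  fix x assume "x \<in> generators"
  then obtain \<tau> where t: "\<tau> permutes {1..n}" "x = perm_act \<tau> e" by (auto simp: generators_def)
  then have "f x = perm_act \<tau> (f e)" using f e_specht by (simp add: intertwiner_def sym_group_carrier)
  then show "f x = 0" using fe by (simp only: perm_act_zero)
qed

end

lemma permutes_translate:
  assumes g: "g permutes A"
  shows "bij_betw (\<lambda>\<sigma>. g \<circ> \<sigma>) {\<sigma>. \<sigma> permutes A} {\<sigma>. \<sigma> permutes A}"
proof (rule bij_betw_byWitness[where f' = "\<lambda>\<sigma>. inv' g \<circ> \<sigma>"])
  show "\<forall>\<sigma>\<in>{\<sigma>. \<sigma> permutes A}. inv' g \<circ> (g \<circ> \<sigma>) = \<sigma>" "\<forall>\<sigma>\<in>{\<sigma>. \<sigma> permutes A}. g \<circ> (inv' g \<circ> \<sigma>) = \<sigma>"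
    by (simp_all only: comp_assoc[symmetric] permutes_inv_o[OF g] id_comp simp_thms ball_triv)
  show "(\<lambda>\<sigma>. g \<circ> \<sigma>) ` {\<sigma>. \<sigma> permutes A} \<subseteq> {\<sigma>. \<sigma> permutes A}"
    using permutes_compose[OF _ g] by (intro image_subsetI CollectI) (elim CollectE)
  show "(\<lambda>\<sigma>. inv' g \<circ> \<sigma>) ` {\<sigma>. \<sigma> permutes A} \<subseteq> {\<sigma>. \<sigma> permutes A}"
    using permutes_compose[OF _ permutes_inv[OF g]] by (intro image_subsetI CollectI) (elim CollectE)
qed

section \<open>The invariant form and irreducibility\<close>

context diagram begin

text \<open>The invariant form for which the tabloids are orthonormal. It is bilinear, so that no
  conjugation enters when arguments are exchanged.\<close>

definition form :: "(nat set list \<Rightarrow> complex) \<Rightarrow> (nat set list \<Rightarrow> complex) \<Rightarrow> complex"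
  where "form u v = (\<Sum>T\<in>tabloids l shape {1..n}. u T * v T)"

lemma form_commute: "form u v = form v u"
  by (simp add: form_def mult.commute)

lemma form_add: "form (u + u') v = form u v + form u' v"
  by (simp add: form_def distrib_right sum.distrib)

lemma form_cscale: "form (cscale c u) v = c * form u v"
  by (simp add: form_def cscale_def sum_distrib_left mult.assoc)

lemma form_sum: "form (\<Sum>i\<in>I. u i) v = (\<Sum>i\<in>I. form (u i) v)"
  unfolding form_def by (subst sum.swap) (simp only: sum_fun_at sum_distrib_right)

lemma form_perm_act:
  assumes s: "\<sigma> permutes {1..n}"
  shows "form (perm_act \<sigma> u) (perm_act \<sigma> v) = form u v"
proof -
  have b: "bij \<sigma>" using s permutes_bij by blast
  have "bij_betw (map ((`) (inv' \<sigma>))) (tabloids l shape {1..n}) (tabloids l shape {1..n})"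
    by (rule bij_betw_byWitness[where f' = "map ((`) \<sigma>)"])
      (use map_image_inv[OF b] map_image_tabloids[OF s] map_image_tabloids[OF permutes_inv[OF s]] in \<open>simp_all only: image_subset_iff\<close>, simp_all)
  from sum.reindex_bij_betw[OF this, of "\<lambda>T. u T * v T"]
  show ?thesis by (simp only: form_def perm_act_def)
qed

text \<open>A permutation that preserves every row and every column of \<open>t0\<close> fixes each
  entry, as a row and a column meet in at most one cell.\<close>

lemma tabloid_fixed_by_column_stabilizer:
  assumes pi: "\<pi> \<in> column_stabilizer \<mu> t0" and fixed: "map ((`) \<pi>) (tabloid \<mu> t0) = tabloid \<mu> t0"
  shows "\<pi> = id"
proof
  fix x
  show "\<pi> x = id x"
  proof (cases "x \<in> {1..n}")
    case True
    have t: "inj_on t0 (cells \<mu>)" "t0 ` cells \<mu> = {1..n}"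
      using tableau_t0 by (auto simp: tableau_def bij_betw_def)
    then obtain r c where rc: "(r, c) \<in> cells \<mu>" "x = t0 (r, c)" using True by (metis imageE surj_pair)
    have r: "r < l" using rc by (simp add: cells_def)
    have "map ((`) \<pi>) (tabloid \<mu> t0) ! r = tabloid \<mu> t0 ! r" by (simp only: fixed)
    then have "\<pi> ` row_set \<mu> t0 r = row_set \<mu> t0 r" using r by (simp add: tabloid_def)
    moreover have "x \<in> row_set \<mu> t0 r" using rc row_set_mem by blast
    ultimately have "\<pi> x \<in> row_set \<mu> t0 r" by blast
    then obtain c' where c': "(r, c') \<in> cells \<mu>" "\<pi> x = t0 (r, c')" using row_set_mem by blast
    have "\<pi> ` column_set \<mu> t0 c = column_set \<mu> t0 c" using pi by (simp add: column_stabilizer_def)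
    moreover have "x \<in> column_set \<mu> t0 c" using rc column_set_mem by blast
    ultimately have "\<pi> x \<in> column_set \<mu> t0 c" by blast
    moreover have "\<pi> x \<in> column_set \<mu> t0 c'" using c' column_set_mem by blast
    ultimately have "c = c'" using column_set_unique[OF tableau_t0] by blast
    then show ?thesis using c' rc by simp
  next
    case False
    then show ?thesis using column_stabilizer_permutes[OF pi] by (simp add: permutes_not_in)
  qed
qed

lemma e_apply: "e T = (\<Sum>\<pi>\<in>column_stabilizer \<mu> t0. of_int (sign \<pi>) * (if T = map ((`) \<pi>) (tabloid \<mu> t0) then 1 else 0))"
  unfolding e_def polytabloid_def sum_fun_at
proof (rule sum.cong[OF refl])
  fix \<pi> assume "\<pi> \<in> column_stabilizer \<mu> t0"
  from perm_act_tabloid_vec[OF column_stabilizer_bij[OF this]]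
  show "cscale (of_int (sign \<pi>)) (perm_act \<pi> (tabloid_vec (tabloid \<mu> t0))) T
    = of_int (sign \<pi>) * (if T = map ((`) \<pi>) (tabloid \<mu> t0) then 1 else 0)"
    by (simp only: cscale_def) (simp only: tabloid_vec_def)
qed

lemma e_tabloid: "e (tabloid \<mu> t0) = 1"
proof -
  have "e (tabloid \<mu> t0) = (\<Sum>\<pi>\<in>column_stabilizer \<mu> t0. if \<pi> = id then 1 else 0)"
    unfolding e_apply
  proof (rule sum.cong[OF refl])
    fix \<pi> assume pi: "\<pi> \<in> column_stabilizer \<mu> t0"
    show "of_int (sign \<pi>) * (if tabloid \<mu> t0 = map ((`) \<pi>) (tabloid \<mu> t0) then 1 else 0) = (if \<pi> = id then 1 else 0 :: complex)"
      using tabloid_fixed_by_column_stabilizer[OF pi] by (cases "\<pi> = id") (auto simp: map_idI)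
  qed
  then show ?thesis using column_stabilizer_id by (simp add: sum.delta)
qed

lemma e_real: "e T \<in> \<real>"
  unfolding e_apply by (intro sum_in_Reals Reals_mult) auto

lemma perm_act_e_real: "perm_act \<sigma> e T \<in> \<real>"
  unfolding perm_act_def by (rule e_real)

text \<open>Inversion permutes the column stabilizer and keeps signs, so \<open>antisym t0\<close>
  is self-adjoint for \<open>form\<close>. Its coefficient at the tabloid of \<open>t0\<close> is
  thus the product with the polytabloid \<open>e\<close>.\<close>

lemma antisym_at_tabloid: "antisym t0 u (tabloid \<mu> t0) = form u e"
proof -
  let ?C = "column_stabilizer \<mu> t0" and ?t = "tabloid \<mu> t0"
  have "form u e = (\<Sum>T\<in>tabloids l shape {1..n}. \<Sum>\<pi>\<in>?C. if T = map ((`) \<pi>) ?t then of_int (sign \<pi>) * u T else 0)"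
    unfolding form_def e_apply sum_distrib_left by (intro sum.cong refl) simp
  also have "\<dots> = (\<Sum>\<pi>\<in>?C. \<Sum>T\<in>tabloids l shape {1..n}. if T = map ((`) \<pi>) ?t then of_int (sign \<pi>) * u T else 0)"
    by (rule sum.swap)
  also have "\<dots> = (\<Sum>\<pi>\<in>?C. of_int (sign \<pi>) * u (map ((`) \<pi>) ?t))"
  proof (rule sum.cong[OF refl])
    fix \<pi> assume pi: "\<pi> \<in> ?C"
    have "map ((`) \<pi>) ?t \<in> tabloids l shape {1..n}"
      by (rule map_image_tabloids[OF column_stabilizer_permutes[OF pi] tabloid_in_tabloids[OF tableau_t0]])
    moreover have "finite (tabloids l shape {1..n})" by (rule finite_tabloids) simp
    ultimately show "(\<Sum>T\<in>tabloids l shape {1..n}. if T = map ((`) \<pi>) ?t then of_int (sign \<pi>) * u T else 0)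
      = of_int (sign \<pi>) * u (map ((`) \<pi>) ?t)"
      by (simp only: sum.delta if_True)
  qed
  also have "\<dots> = (\<Sum>\<pi>\<in>?C. of_int (sign \<pi>) * u (map ((`) (inv' \<pi>)) ?t))"
  proof (rule sum.reindex_bij_witness[of _ "Hilbert_Choice.inv" "Hilbert_Choice.inv"])
    fix \<pi> assume pi: "\<pi> \<in> ?C"
    note perm = column_stabilizer_permutes[OF pi]
    show "inv' (inv' \<pi>) = \<pi>" by (rule permutes_inv_inv[OF perm])
    show "inv' (inv' \<pi>) = \<pi>" by (rule permutes_inv_inv[OF perm])
    show "inv' \<pi> \<in> ?C" "inv' \<pi> \<in> ?C" using column_stabilizer_inv[OF pi] by simp_all
    show "of_int (sign (inv' \<pi>)) * u (map ((`) (inv' (inv' \<pi>))) ?t) = of_int (sign \<pi>) * u (map ((`) \<pi>) ?t)"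
      by (simp only: permutes_inv_inv[OF perm] sign_inverse[OF column_stabilizer_permutation[OF pi]])
  qed
  also have "\<dots> = antisym t0 u ?t"
    unfolding antisym_def sum_fun_at by (simp only: cscale_def perm_act_def)
  finally show ?thesis by simp
qed

text \<open>The generators have real values. Closure under conjugation makes up for the fact that
  \<open>form\<close> is bilinear: a vector orthogonal to its own conjugate is 0.\<close>

lemma cnj_specht:
  assumes "u \<in> specht_module \<mu>" shows "(\<lambda>T. cnj (u T)) \<in> specht_module \<mu>"
  using assms unfolding specht_eq
proof (induction rule: cfun.span_induct_alt)
  case base
  have "(\<lambda>T. cnj (0 T)) = (0 :: nat set list \<Rightarrow> complex)" by (simp add: fun_eq_iff)
  then show ?case using cfun.span_zero[of generators] by simp
next
  case (step c x y)
  have x: "cnj (x T) = x T" for T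
    using step perm_act_e_real by (auto simp: generators_def Reals_cnj_iff)
  have "(\<lambda>T. cnj ((cscale c x + y) T)) = cscale (cnj c) x + (\<lambda>T. cnj (y T))"
    by (simp add: fun_eq_iff cscale_def x)
  moreover have "cscale (cnj c) x + (\<lambda>T. cnj (y T)) \<in> cfun.span generators"
    using step cfun.span_add[OF cfun.span_scale[OF cfun.span_base]] by blast
  ultimately show ?case by (simp only:)
qed

lemma form_orthogonal:
  assumes "\<And>\<sigma>. \<sigma> permutes {1..n} \<Longrightarrow> form u (perm_act \<sigma> e) = 0" and "s \<in> specht_module \<mu>"
  shows "form u s = 0"
  using assms(2) unfolding specht_eq
proof (induction rule: cfun.span_induct_alt)
  case base
  then show ?case by (simp add: form_def)
next
  case (step c x y)
  then have "form x u = 0" using assms(1) by (auto simp: generators_def form_commute)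
  moreover have "form y u = 0" using step form_commute[of u y] by simp
  ultimately have "form (cscale c x + y) u = 0" by (simp only: form_add form_cscale mult_zero_right add_0_right)
  then show ?case by (subst form_commute)
qed

text \<open>The submodule theorem. If \<open>antisym t0\<close> is nonzero somewhere on
  \<open>U\<close>, its value there is a multiple of \<open>e\<close> lying in \<open>U\<close>, and
  \<open>e\<close> generates everything. Otherwise each \<open>u\<close> in \<open>U\<close> is
  orthogonal to the whole Specht module, in particular to its own conjugate, and is 0.\<close>

lemma specht_irreducible: "irreducible_rep_on (sym_group n) (specht_module \<mu>) perm_act"
  unfolding irreducible_rep_on_def
proof (intro conjI allI impI)
  show "rep_on (sym_group n) (specht_module \<mu>) perm_act" by (rule rep_on_specht)
  have "e \<noteq> 0" using e_tabloid by auto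
  then show "specht_module \<mu> \<noteq> {0}" using e_specht by blast
  fix U assume U: "cfun.subspace U \<and> U \<subseteq> specht_module \<mu> \<and> (\<forall>g\<in>carrier (sym_group n). \<forall>u\<in>U. perm_act g u \<in> U)"
  then have sub: "cfun.subspace U" and US: "U \<subseteq> specht_module \<mu>"
    and inv: "\<And>g u. g permutes {1..n} \<Longrightarrow> u \<in> U \<Longrightarrow> perm_act g u \<in> U"
    by (auto simp: sym_group_carrier)
  show "U = {0} \<or> U = specht_module \<mu>"
  proof (cases "\<exists>u\<in>U. antisym t0 u \<noteq> 0")
    case True
    then obtain u where u: "u \<in> U" "antisym t0 u \<noteq> 0" by blast
    obtain k where k: "antisym t0 u = cscale k e"
      using antisym_multiple[OF tableau_t0, of u] u(1) US specht_subset unfolding e_def by blast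
    have "k \<noteq> 0" using u k by auto
    have "antisym t0 u \<in> U"
      unfolding antisym_def using inv u column_stabilizer_permutes
      by (intro cfun.subspace_sum[OF sub] cfun.subspace_scale[OF sub]) blast
    then have "cscale (1 / k) (cscale k e) \<in> U" unfolding k by (rule cfun.subspace_scale[OF sub])
    then have "e \<in> U" using \<open>k \<noteq> 0\<close> by simp
    then have "generators \<subseteq> U" using inv by (auto simp: generators_def)
    then have "specht_module \<mu> \<subseteq> U" unfolding specht_eq by (rule cfun.span_minimal[OF _ sub])
    then show ?thesis using US by blast
  next
    case False
    have "u = 0" if u: "u \<in> U" for u
    proof -
      have "form u (perm_act \<sigma> e) = 0" if s: "\<sigma> permutes {1..n}" for \<sigma>
      proof -
        have si: "inv' \<sigma> permutes {1..n}" by (rule permutes_inv[OF s])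
        have b: "bij \<sigma>" using s permutes_bij by blast
        have "form u (perm_act \<sigma> e) = form (perm_act (inv' \<sigma>) u) (perm_act (inv' \<sigma>) (perm_act \<sigma> e))"
          by (rule form_perm_act[OF si, symmetric])
        also have "perm_act (inv' \<sigma>) (perm_act \<sigma> e) = perm_act (inv' \<sigma> \<circ> \<sigma>) e"
          by (rule perm_act_comp[symmetric]) (use b bij_imp_bij_inv in blast)+
        also have "\<dots> = e" by (simp only: permutes_inv_o(2)[OF s] perm_act_id)
        also have "form (perm_act (inv' \<sigma>) u) e = antisym t0 (perm_act (inv' \<sigma>) u) (tabloid \<mu> t0)"
          by (rule antisym_at_tabloid[symmetric])
        also have "\<dots> = 0" using False inv[OF si u] by simp
        finally show ?thesis .
      qed
      then have "form u (\<lambda>T. cnj (u T)) = 0"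
        using form_orthogonal cnj_specht u US by blast
      then have "(\<Sum>T\<in>tabloids l shape {1..n}. complex_of_real ((cmod (u T))\<^sup>2)) = 0"
        by (simp only: form_def complex_norm_square)
      then have "(\<Sum>T\<in>tabloids l shape {1..n}. (cmod (u T))\<^sup>2) = 0"
        by (metis of_real_eq_0_iff of_real_sum)
      then have "u T = 0" if "T \<in> tabloids l shape {1..n}" for T
        using that by (subst (asm) sum_nonneg_eq_0_iff) (auto simp: finite_tabloids)
      moreover have "u T = 0" if "T \<notin> tabloids l shape {1..n}" for T
        using that u US specht_subset unfolding tabloid_space_def by blast
      ultimately show "u = 0" by (auto simp: fun_eq_iff)
    qed
    then show ?thesis using cfun.subspace_0[OF sub] by blast
  qed
qed

section \<open>Reality of the trace\<close>

lemma form_real: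
  assumes "\<And>T. u T \<in> \<real>" "\<And>T. v T \<in> \<real>" shows "form u v \<in> \<real>"
  unfolding form_def using assms by (intro sum_in_Reals Reals_mult) auto

text \<open>The equivariant sum of the rank-one maps given by the translates of \<open>e\<close>. It
  acts on the Specht module by a nonzero scalar, so after division it is an expansion of the
  identity from which traces can be read off.\<close>

definition kernel :: "(nat set list \<Rightarrow> complex) \<Rightarrow> (nat set list \<Rightarrow> complex)"
  where "kernel u = (\<Sum>\<sigma> | \<sigma> permutes {1..n}. cscale (form u (perm_act \<sigma> e)) (perm_act \<sigma> e))"

lemma intertwiner_kernel: "intertwiner (sym_group n) (specht_module \<mu>) perm_act (tabloid_space l shape n) perm_act kernel"
  unfolding intertwiner_def linear_on_def
proof (intro conjI ballI allI)
  have ee: "perm_act \<sigma> e \<in> tabloid_space l shape n" if "\<sigma> permutes {1..n}" for \<sigma>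
    using that e_space by (rule perm_act_tabloid_space)
  show "kernel u \<in> tabloid_space l shape n" for u
    unfolding kernel_def
    by (intro cfun.subspace_sum[OF subspace_tabloid_space] cfun.subspace_scale[OF subspace_tabloid_space] ee) simp
  show "kernel (u + v) = kernel u + kernel v" for u v
    by (simp only: kernel_def form_add cfun.scale_left_distrib sum.distrib)
  show "kernel (cscale c u) = cscale c (kernel u)" for c u
    by (simp only: kernel_def form_cscale cfun.scale_sum_right cfun.scale_scale)
  fix g u assume "g \<in> carrier (sym_group n)"
  then have g: "g permutes {1..n}" by (simp add: sym_group_carrier)
  let ?P = "{\<sigma>. \<sigma> permutes {1..n}}"
  have "kernel (perm_act g u) = (\<Sum>\<sigma>\<in>?P. cscale (form (perm_act g u) (perm_act (g \<circ> \<sigma>) e)) (perm_act (g \<circ> \<sigma>) e))"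
    unfolding kernel_def
    by (rule sum.reindex_bij_betw[OF permutes_translate[OF g], symmetric])
  also have "\<dots> = (\<Sum>\<sigma>\<in>?P. perm_act g (cscale (form u (perm_act \<sigma> e)) (perm_act \<sigma> e)))"
  proof (rule sum.cong[OF refl])
    fix \<sigma> assume "\<sigma> \<in> ?P"
    then have "bij \<sigma>" "bij g" using g permutes_bij by auto
    then show "cscale (form (perm_act g u) (perm_act (g \<circ> \<sigma>) e)) (perm_act (g \<circ> \<sigma>) e)
      = perm_act g (cscale (form u (perm_act \<sigma> e)) (perm_act \<sigma> e))"
      by (simp only: perm_act_comp form_perm_act[OF g] perm_act_cscale)
  qed
  also have "\<dots> = perm_act g (kernel u)" by (simp only: kernel_def perm_act_sum)
  finally show "kernel (perm_act g u) = perm_act g (kernel u)" .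
qed

text \<open>Pairing \<open>kernel e\<close> with \<open>e\<close> gives \<open>c * form e e\<close>
  on one side and a sum of squares of real numbers on the other. The identity permutation
  contributes the positive number \<open>form e e\<close> to both.\<close>

lemma kernel_scalar: "\<exists>c\<in>\<real>. c \<noteq> 0 \<and> (\<forall>u\<in>specht_module \<mu>. kernel u = cscale c u)"
proof -
  let ?P = "{\<sigma>. \<sigma> permutes {1..n}}"
  obtain c where c: "\<forall>u\<in>specht_module \<mu>. kernel u = cscale c u"
    using intertwiner_tabloid_space[OF intertwiner_kernel] by blast
  define b where "b \<sigma> = Re (form e (perm_act \<sigma> e))" for \<sigma>
  have b: "form e (perm_act \<sigma> e) = of_real (b \<sigma>)" for \<sigma>
    using form_real[of e "perm_act \<sigma> e"] e_real perm_act_e_real by (simp add: b_def of_real_Re)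
  have "form e e = (\<Sum>T\<in>tabloids l shape {1..n}. of_real ((Re (e T))\<^sup>2))"
    unfolding form_def
  proof (rule sum.cong[OF refl])
    fix T show "e T * e T = of_real ((Re (e T))\<^sup>2)" using e_real[of T] by (metis of_real_Re of_real_mult power2_eq_square)
  qed
  then have "b id = (\<Sum>T\<in>tabloids l shape {1..n}. (Re (e T))\<^sup>2)"
    using b[of id] by (metis of_real_eq_iff of_real_sum perm_act_id)
  also have "\<dots> > 0"
  proof (rule sum_pos2[of _ "tabloid \<mu> t0"])
    show "tabloid \<mu> t0 \<in> tabloids l shape {1..n}" by (rule tabloid_in_tabloids[OF tableau_t0])
  qed (simp_all add: e_tabloid finite_tabloids)
  finally have pos: "0 < b id" .
  have "c * form e e = form (kernel e) e" using c e_specht by (simp add: form_cscale)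
  also have "\<dots> = (\<Sum>\<sigma>\<in>?P. form e (perm_act \<sigma> e) * form e (perm_act \<sigma> e))"
    unfolding kernel_def form_sum form_cscale by (intro sum.cong refl arg_cong2[where f = "(*)"] form_commute)
  also have "\<dots> = of_real (\<Sum>\<sigma>\<in>?P. b \<sigma> * b \<sigma>)" by (simp add: b)
  finally have "c * of_real (b id) = of_real (\<Sum>\<sigma>\<in>?P. b \<sigma> * b \<sigma>)" using b[of id] by simp
  then have ceq: "c = of_real ((\<Sum>\<sigma>\<in>?P. b \<sigma> * b \<sigma>) / b id)" using pos by (simp add: field_simps)
  have "0 < (\<Sum>\<sigma>\<in>?P. b \<sigma> * b \<sigma>)"
    using pos by (intro sum_pos2[of _ id]) (simp_all add: finite_permutations permutes_id)
  then have "(\<Sum>\<sigma>\<in>?P. b \<sigma> * b \<sigma>) / b id \<noteq> 0" using pos by simp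
  then have "c \<noteq> 0" unfolding ceq by (simp only: of_real_eq_0_iff not_False_eq_True)
  moreover have "c \<in> \<real>" unfolding ceq by (rule Reals_of_real)
  ultimately show ?thesis using c by blast
qed

abbreviation "\<psi> g \<equiv> trace_on (specht_module \<mu>) (perm_act g)"

lemma specht_trace:
  obtains c where "c \<in> \<real>"
    "\<And>g. g permutes {1..n} \<Longrightarrow> \<psi> g = (\<Sum>\<sigma> | \<sigma> permutes {1..n}. form (perm_act g (perm_act \<sigma> e)) (perm_act \<sigma> e) / c)"
proof -
  let ?P = "{\<sigma>. \<sigma> permutes {1..n}}"
  obtain c where c: "c \<in> \<real>" "c \<noteq> 0" "\<And>u. u \<in> specht_module \<mu> \<Longrightarrow> kernel u = cscale c u"
    using kernel_scalar by blast
  obtain B where B: "basis_of (specht_module \<mu>) B" using rep_on_basis[OF rep_on_specht] by blast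
  have "\<psi> g = (\<Sum>\<sigma>\<in>?P. form (perm_act g (perm_act \<sigma> e)) (perm_act \<sigma> e) / c)" if g: "g permutes {1..n}" for g
  proof (rule trace_on_rank_one[OF B, where \<phi> = "\<lambda>\<sigma> u. form u (perm_act \<sigma> e) / c" and e = "\<lambda>\<sigma>. perm_act g (perm_act \<sigma> e)"])
    fix u assume u: "u \<in> specht_module \<mu>"
    have "u = cscale (1 / c) (kernel u)" using c u by simp
    then have "perm_act g u = perm_act g (cscale (1 / c) (kernel u))" by simp
    also have "\<dots> = (\<Sum>\<sigma>\<in>?P. cscale (form u (perm_act \<sigma> e) / c) (perm_act g (perm_act \<sigma> e)))"
      by (simp add: kernel_def perm_act_sum cfun.scale_sum_right)
    finally show "perm_act g u = (\<Sum>\<sigma>\<in>?P. cscale (form u (perm_act \<sigma> e) / c) (perm_act g (perm_act \<sigma> e)))" .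
  next
    fix \<sigma> assume "\<sigma> \<in> ?P"
    then show "perm_act g (perm_act \<sigma> e) \<in> specht_module \<mu>"
      using perm_act_specht[OF g perm_act_specht[OF _ e_specht]] by blast
  qed (simp_all only: form_add form_cscale add_divide_distrib times_divide_eq_right)
  then show thesis by (rule that[OF c(1)])
qed

lemma specht_trace_real: "g permutes {1..n} \<Longrightarrow> \<psi> g \<in> \<real>"
proof -
  assume g: "g permutes {1..n}"
  obtain c where c: "c \<in> \<real>"
    "\<And>g. g permutes {1..n} \<Longrightarrow> \<psi> g = (\<Sum>\<sigma> | \<sigma> permutes {1..n}. form (perm_act g (perm_act \<sigma> e)) (perm_act \<sigma> e) / c)"
    by (rule specht_trace) blast
  show ?thesis unfolding c(2)[OF g]
    by (intro sum_in_Reals Reals_divide form_real c(1)) (auto simp: perm_act_def intro: e_real)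
qed

text \<open>In each term of the trace formula the form is invariant and symmetric, so moving
  \<open>g\<close> to the other argument replaces it by its inverse.\<close>

lemma specht_trace_inv: "g permutes {1..n} \<Longrightarrow> \<psi> (inv' g) = \<psi> g"
proof -
  assume g: "g permutes {1..n}"
  obtain c where c: "\<And>g. g permutes {1..n} \<Longrightarrow> \<psi> g = (\<Sum>\<sigma> | \<sigma> permutes {1..n}. form (perm_act g (perm_act \<sigma> e)) (perm_act \<sigma> e) / c)"
    by (rule specht_trace) blast
  have "form (perm_act (inv' g) v) v = form (perm_act g v) v" for v
  proof -
    have "form (perm_act (inv' g) v) v = form (perm_act g (perm_act (inv' g) v)) (perm_act g v)"
      by (rule form_perm_act[OF g, symmetric])
    also have "perm_act g (perm_act (inv' g) v) = perm_act (g \<circ> inv' g) v"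
      by (rule perm_act_comp[symmetric]) (use g permutes_bij permutes_inv in blast)+
    also have "\<dots> = v" by (simp only: permutes_inv_o(1)[OF g] perm_act_id)
    also have "form v (perm_act g v) = form (perm_act g v) v" by (rule form_commute)
    finally show ?thesis .
  qed
  then show ?thesis using c[OF g] c[OF permutes_inv[OF g]] by simp
qed

lemma sum_inv_carrier:
  "(\<Sum>g\<in>carrier (sym_group n). F g * \<psi> (inv\<^bsub>sym_group n\<^esub> g)) = (\<Sum>g | g permutes {1..n}. F g * \<psi> g)"
proof (rule sum.cong)
  show "carrier (sym_group n) = {g. g permutes {1..n}}" by (simp add: sym_group_def)
  fix g assume "g \<in> {g. g permutes {1..n}}"
  then have "g permutes {1..n}" by blast
  from inv_sym_group[OF this] specht_trace_inv[OF this]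
  show "F g * \<psi> (inv\<^bsub>sym_group n\<^esub> g) = F g * \<psi> g" by (simp only:)
qed

lemma sum_specht_norm: "(\<Sum>g | g permutes {1..n}. \<psi> g * \<psi> g) = fact n"
proof -
  have sub: "intertwiner (sym_group n) (specht_module \<mu>) perm_act (tabloid_space l shape n) perm_act f"
    if "intertwiner (sym_group n) (specht_module \<mu>) perm_act (specht_module \<mu>) perm_act f" for f
    using that specht_subset by (auto simp: intertwiner_def linear_on_def)
  have "(\<Sum>g\<in>carrier (sym_group n). \<psi> g * \<psi> (inv\<^bsub>sym_group n\<^esub> g)) = of_nat (order (sym_group n))"
  proof (rule sum_trace_trace_1[OF sym_group_is_group finite_sym_group rep_on_specht rep_on_specht])
    show "intertwiner (sym_group n) (specht_module \<mu>) perm_act (specht_module \<mu>) perm_act (\<lambda>v. v)"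
      by (simp add: intertwiner_def linear_on_id)
    show "e \<in> specht_module \<mu>" by (rule e_specht)
    show "e \<noteq> 0" using e_tabloid by auto
  qed (use sub intertwiner_tabloid_space in blast)
  then show ?thesis unfolding sum_inv_carrier order_sym_group by simp
qed

lemma sum_specht_perm_zero:
  assumes "k \<le> l" "(\<Sum>r<k. int (\<mu> ! r)) < (\<Sum>i<k. \<alpha> i)"
  shows "(\<Sum>g | g permutes {1..n}. of_int (perm_count l (cycle_type g {1..n}) \<alpha>) * \<psi> g) = 0"
proof -
  have "(\<Sum>g\<in>carrier (sym_group n). trace_on (tabloid_space l \<alpha> n) (perm_act g) * \<psi> (inv\<^bsub>sym_group n\<^esub> g)) = 0"
    by (rule sum_trace_trace_0[OF sym_group_is_group finite_sym_group rep_on_specht rep_on_tabloid_space])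
      (rule intertwiner_zero[OF _ assms(1) assms(1) assms(2)])
  then have "(\<Sum>g | g permutes {1..n}. trace_on (tabloid_space l \<alpha> n) (perm_act g) * \<psi> g) = 0"
    unfolding sum_inv_carrier .
  moreover have "(\<Sum>g | g permutes {1..n}. trace_on (tabloid_space l \<alpha> n) (perm_act g) * \<psi> g)
    = (\<Sum>g | g permutes {1..n}. of_int (perm_count l (cycle_type g {1..n}) \<alpha>) * \<psi> g)"
    by (rule sum.cong[OF refl]) (simp only: trace_tabloid_space mem_Collect_eq)
  ultimately show ?thesis by (simp only:)
qed

lemma sum_specht_perm_one:
  "(\<Sum>g | g permutes {1..n}. of_int (perm_count l (cycle_type g {1..n}) shape) * \<psi> g) = fact n"
proof -
  have "(\<Sum>g\<in>carrier (sym_group n). trace_on (tabloid_space l shape n) (perm_act g) * \<psi> (inv\<^bsub>sym_group n\<^esub> g)) = of_nat (order (sym_group n))"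
  proof (rule sum_trace_trace_1[OF sym_group_is_group finite_sym_group rep_on_specht rep_on_tabloid_space])
    show "intertwiner (sym_group n) (specht_module \<mu>) perm_act (tabloid_space l shape n) perm_act (\<lambda>v. v)"
      using specht_subset by (auto simp: intertwiner_def linear_on_def)
    show "e \<in> specht_module \<mu>" by (rule e_specht)
    show "e \<noteq> 0" using e_tabloid by auto
  qed (rule intertwiner_tabloid_space)
  then have "(\<Sum>g | g permutes {1..n}. trace_on (tabloid_space l shape n) (perm_act g) * \<psi> g) = fact n"
    unfolding sum_inv_carrier order_sym_group by simp
  moreover have "(\<Sum>g | g permutes {1..n}. trace_on (tabloid_space l shape n) (perm_act g) * \<psi> g)
    = (\<Sum>g | g permutes {1..n}. of_int (perm_count l (cycle_type g {1..n}) shape) * \<psi> g)"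
    by (rule sum.cong[OF refl]) (simp only: trace_tabloid_space mem_Collect_eq)
  ultimately show ?thesis by (simp only:)
qed

end

section \<open>Identification of the trace with the recursion\<close>

lemma permutes_first_moved:
  assumes "\<pi> permutes {..<l}" "\<pi> \<noteq> id"
  obtains k :: nat where "k < l" "\<And>i. i < k \<Longrightarrow> \<pi> i = i" "k < \<pi> k"
proof -
  define k where "k = (LEAST k. \<pi> k \<noteq> k)"
  have "\<exists>k. \<pi> k \<noteq> k" using assms(2) by (auto simp: fun_eq_iff)
  then have k: "\<pi> k \<noteq> k" unfolding k_def by (rule LeastI_ex)
  have less: "\<pi> i = i" if "i < k" for i using not_less_Least that unfolding k_def by blast
  have "k < l" using k permutes_not_in[OF assms(1), of k] by auto
  moreover have "\<not> \<pi> k < k"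
  proof
    assume "\<pi> k < k"
    then have "\<pi> (\<pi> k) = \<pi> k" by (rule less)
    then show False using k permutes_inj[OF assms(1)] by (simp add: inj_eq)
  qed
  ultimately show thesis using that[of k] less k by simp
qed

lemma beta_strict: 
  assumes "sorted_wrt (\<ge>) \<mu>" "i < j" "j < length \<mu>" shows "beta \<mu> j < beta \<mu> i"
  using sorted_wrt_nth_less[OF assms] assms by (simp add: beta_def staircase_def)

text \<open>Only the identity can match two strictly decreasing sequences: if \<open>k\<close> is
  the first moved index and \<open>j\<close> its preimage, then \<open>v j < v k\<close> and
  \<open>w (\<pi> k) < w k\<close>, while matching turns the former into
  \<open>w k < w (\<pi> k)\<close>.\<close>

lemma pairing_decreasing:
  assumes "\<And>i j. i < j \<Longrightarrow> j < l \<Longrightarrow> v j < v i" "\<And>i j. i < j \<Longrightarrow> j < l \<Longrightarrow> w j < w i"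
  shows "pairing l v w = of_bool (\<forall>i<l. v i = w i)"
proof -
  have "\<pi> = id" if pi: "\<pi> permutes {..<l}" and eq: "\<forall>i<l. v i = w (\<pi> i)" for \<pi>
  proof (rule ccontr)
    assume "\<pi> \<noteq> id"
    then obtain k where k: "k < l" "\<And>i. i < k \<Longrightarrow> \<pi> i = i" "k < \<pi> k"
      using permutes_first_moved[OF pi] by blast
    obtain j where j: "j < l" "\<pi> j = k" using permutes_image[OF pi] k(1) by (metis imageE lessThan_iff)
    have "\<not> j < k" using k(2)[of j] j by auto
    moreover have "j \<noteq> k" using j k by auto
    ultimately have "v j < v k" using assms(1)[of k j] j by simp
    moreover have "\<pi> k < l" using permutes_in_image[OF pi] k(1) by blast
    then have "w (\<pi> k) < w k" using assms(2)[of k "\<pi> k"] k by simp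
    ultimately show False using eq j k by simp
  qed
  then have "pairing l v w = (\<Sum>\<pi> | \<pi> permutes {..<l}. if \<pi> = id then of_bool (\<forall>i<l. v i = w i) else 0)"
    unfolding pairing_def by (intro sum.cong refl) (auto simp: sign_id)
  then show ?thesis by (simp add: sum.delta finite_permutations permutes_id)
qed

lemma pairing_beta:
  assumes "sorted_wrt (\<ge>) \<mu>" "sorted_wrt (\<ge>) \<nu>" "length \<nu> = length \<mu>"
  shows "pairing (length \<mu>) (beta \<mu>) (beta \<nu>) = of_bool (\<mu> = \<nu>)"
proof -
  have "pairing (length \<mu>) (beta \<mu>) (beta \<nu>) = of_bool (\<forall>i<length \<mu>. beta \<mu> i = beta \<nu> i)"
    using beta_strict[OF assms(1)] beta_strict[OF assms(2)] assms(3) by (intro pairing_decreasing) simp_all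
  also have "(\<forall>i<length \<mu>. beta \<mu> i = beta \<nu> i) \<longleftrightarrow> \<mu> = \<nu>"
    using assms(3) by (auto simp: beta_def list_eq_iff_nth_eq)
  finally show ?thesis .
qed

lemma sum_staircase: "2 * (\<Sum>j<l. staircase l j) = int l * (int l - 1)"
proof -
  have "2 * (\<Sum>j<l. int j) = int l * (int l - 1)" by (induction l) (auto simp: algebra_simps)
  then show ?thesis by (simp add: staircase_def sum_subtractf sum.distrib algebra_simps)
qed

lemma sum_beta: "2 * (\<Sum>j<length \<mu>. beta \<mu> j) = 2 * int (sum_list \<mu>) + int (length \<mu>) * (int (length \<mu>) - 1)"
proof -
  have "(\<Sum>j<length \<mu>. int (\<mu> ! j)) = int (sum_list \<mu>)"
    by (simp add: sum_list_sum_nth atLeast0LessThan)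
  then show ?thesis using sum_staircase[of "length \<mu>"] by (simp add: beta_def sum.distrib)
qed

lemma beta_nonneg: "j < length \<mu> \<Longrightarrow> 0 \<le> beta \<mu> j"
  by (simp add: beta_def staircase_def)

lemma xchar_beta_orthonormal:
  assumes "sorted_wrt (\<ge>) \<mu>" "sorted_wrt (\<ge>) \<nu>" "length \<nu> = length \<mu>"
  shows "(\<Sum>g | g permutes {1..sum_list \<mu>}. xchar (length \<mu>) (cycle_type g {1..sum_list \<mu>}) (beta \<mu>) *
      xchar (length \<mu>) (cycle_type g {1..sum_list \<mu>}) (beta \<nu>)) = fact (sum_list \<mu>) * of_bool (\<mu> = \<nu>)"
  using xchar_orthonormal[of "{1..sum_list \<mu>}" "length \<mu>" "beta \<mu>" "beta \<nu>"] pairing_beta[OF assms]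
    sum_beta[of \<mu>] beta_nonneg[of _ \<mu>] beta_nonneg[of _ \<nu>] assms(3) by (simp del: One_nat_def)

context diagram begin

text \<open>Expansion by the determinantal formula. For \<open>\<pi>\<close> other than the identity
  let \<open>k\<close> be the first moved row: the shape agrees with \<open>\<mu>\<close> above row
  \<open>k\<close> and exceeds it there by \<open>\<pi> k - k\<close>, so dominance gives 0. The
  identity contributes the shape \<open>\<mu>\<close> itself.\<close>

lemma sum_specht_xchar:
  "(\<Sum>g | g permutes {1..n}. of_int (xchar l (cycle_type g {1..n}) (beta \<mu>)) * \<psi> g) = fact n"
proof -
  let ?\<alpha> = "\<lambda>\<pi> i. beta \<mu> i - staircase l (\<pi> i)"
  let ?s = "\<lambda>\<alpha>. \<Sum>g | g permutes {1..n}. of_int (perm_count l (cycle_type g {1..n}) \<alpha>) * \<psi> g"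
  have "(\<Sum>g | g permutes {1..n}. of_int (xchar l (cycle_type g {1..n}) (beta \<mu>)) * \<psi> g)
    = (\<Sum>g | g permutes {1..n}. \<Sum>\<pi> | \<pi> permutes {..<l}. of_int (sign \<pi>) *
        (of_int (perm_count l (cycle_type g {1..n}) (?\<alpha> \<pi>)) * \<psi> g))"
    by (simp only: xchar_perm_count of_int_sum of_int_mult sum_distrib_right mult.assoc)
  also have "\<dots> = (\<Sum>\<pi> | \<pi> permutes {..<l}. of_int (sign \<pi>) * ?s (?\<alpha> \<pi>))"
    by (subst sum.swap) (simp only: sum_distrib_left)
  also have "\<dots> = (\<Sum>\<pi> | \<pi> permutes {..<l}. if \<pi> = id then fact n else 0)"
  proof (rule sum.cong[OF refl])
    fix \<pi> assume "\<pi> \<in> {\<pi>. \<pi> permutes {..<l}}"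
    then have pi: "\<pi> permutes {..<l}" by simp
    show "of_int (sign \<pi>) * ?s (?\<alpha> \<pi>) = (if \<pi> = id then fact n else 0)"
    proof (cases "\<pi> = id")
      case True
      have "?\<alpha> id = shape" by (simp add: beta_def fun_eq_iff)
      then show ?thesis using True sum_specht_perm_one by (simp add: sign_id del: One_nat_def)
    next
      case False
      then obtain k where k: "k < l" "\<And>i. i < k \<Longrightarrow> \<pi> i = i" "k < \<pi> k"
        using permutes_first_moved[OF pi] by blast
      have "?s (?\<alpha> \<pi>) = 0"
      proof (rule sum_specht_perm_zero)
        show "Suc k \<le> l" using k by simp
        have "(\<Sum>i<k. ?\<alpha> \<pi> i) = (\<Sum>i<k. int (\<mu> ! i))"
          using k(2) by (intro sum.cong) (auto simp: beta_def)
        then show "(\<Sum>r<Suc k. int (\<mu> ! r)) < (\<Sum>i<Suc k. ?\<alpha> \<pi> i)"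
          using k(3) by (simp add: beta_def staircase_def)
      qed
      then show ?thesis using False by (simp only: mult_zero_right if_False)
    qed
  qed
  also have "\<dots> = fact n" by (simp add: sum.delta finite_permutations permutes_id)
  finally show ?thesis .
qed

lemma specht_trace_xchar:
  assumes "g permutes {1..n}"
  shows "\<psi> g = of_int (xchar l (cycle_type g {1..n}) (beta \<mu>))"
proof -
  let ?P = "{g. g permutes {1..n}}"
  define X where "X g = complex_of_int (xchar l (cycle_type g {1..n}) (beta \<mu>))" for g
  have XX: "(\<Sum>g\<in>?P. X g * X g) = fact n"
  proof -
    have "(\<Sum>g\<in>?P. X g * X g) = of_int (\<Sum>g\<in>?P. xchar l (cycle_type g {1..n}) (beta \<mu>) * xchar l (cycle_type g {1..n}) (beta \<mu>))"
      by (simp only: X_def of_int_sum of_int_mult)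
    then show ?thesis by (simp only: xchar_beta_orthonormal[OF sorted sorted refl]) simp
  qed
  have "(\<Sum>g\<in>?P. (\<psi> g - X g) * (\<psi> g - X g)) = (\<Sum>g\<in>?P. \<psi> g * \<psi> g) - 2 * (\<Sum>g\<in>?P. X g * \<psi> g) + (\<Sum>g\<in>?P. X g * X g)"
    unfolding sum_distrib_left sum_subtractf[symmetric] sum.distrib[symmetric]
    by (intro sum.cong refl) (simp add: algebra_simps)
  \<comment> \<open>All three inner products equal \<open>fact n\<close>, entering with the factors
    1, -2 and 1.\<close>
  also have "\<dots> = 0" using XX sum_specht_norm sum_specht_xchar unfolding X_def by simp
  finally have zero: "(\<Sum>g\<in>?P. (\<psi> g - X g) * (\<psi> g - X g)) = 0" .
  have sq: "(\<psi> g - X g) * (\<psi> g - X g) = of_real ((Re (\<psi> g - X g))\<^sup>2)" if "g \<in> ?P" for g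
  proof -
    have "\<psi> g - X g \<in> \<real>" using specht_trace_real that by (simp add: X_def)
    then have "\<psi> g - X g = of_real (Re (\<psi> g - X g))" by (simp only: of_real_Re)
    then show ?thesis by (metis of_real_mult power2_eq_square)
  qed
  have "complex_of_real (\<Sum>g\<in>?P. (Re (\<psi> g - X g))\<^sup>2) = (\<Sum>g\<in>?P. (\<psi> g - X g) * (\<psi> g - X g))"
    unfolding of_real_sum by (rule sum.cong[OF refl sq[symmetric]])
  then have "complex_of_real (\<Sum>g\<in>?P. (Re (\<psi> g - X g))\<^sup>2) = 0" by (simp only: zero)
  then have "(\<Sum>g\<in>?P. (Re (\<psi> g - X g))\<^sup>2) = 0" by (simp only: of_real_eq_0_iff)
  then have "(Re (\<psi> g - X g))\<^sup>2 = 0"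
    using assms by (subst (asm) sum_nonneg_eq_0_iff) (simp_all add: finite_permutations)
  then have "(\<psi> g - X g) * (\<psi> g - X g) = 0" using sq[of g] assms by simp
  then show ?thesis by (simp add: X_def)
qed

end

theorem irr_char_xchar:
  assumes "sorted_wrt (\<ge>) \<mu>" "g permutes {1..sum_list \<mu>}"
  shows "irr_char \<mu> g = of_int (xchar (length \<mu>) (cycle_type g {1..sum_list \<mu>}) (beta \<mu>))"
proof -
  interpret diagram \<mu> by unfold_locales (rule assms(1))
  show ?thesis
    using assms specht_trace_xchar[OF assms(2)] by (simp add: irr_char_def rep_char_def sym_group_carrier)
qed

section \<open>Multiplication by cycle counts\<close>

definition shifts :: "nat \<Rightarrow> int \<Rightarrow> ((nat \<Rightarrow> int) \<Rightarrow> int) \<Rightarrow> (nat \<Rightarrow> int) \<Rightarrow> int"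
  where "shifts l i f v = (\<Sum>k<l. f (shift v k i))"

definition nonneg_part :: "nat \<Rightarrow> ((nat \<Rightarrow> int) \<Rightarrow> int) \<Rightarrow> (nat \<Rightarrow> int) \<Rightarrow> int"
  where "nonneg_part l f v = (if \<forall>j<l. 0 \<le> v j then f v else 0)"

fun ups :: "nat \<Rightarrow> nat list \<Rightarrow> ((nat \<Rightarrow> int) \<Rightarrow> int) \<Rightarrow> (nat \<Rightarrow> int) \<Rightarrow> int" where
  "ups l [] f = f"
| "ups l (i # is) f = shifts l (int i) (ups l is f)"

fun downs :: "nat \<Rightarrow> nat list \<Rightarrow> ((nat \<Rightarrow> int) \<Rightarrow> int) \<Rightarrow> (nat \<Rightarrow> int) \<Rightarrow> int" where
  "downs l [] f = f"
| "downs l (i # is) f = shifts l (- int i) (downs l is f)"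

lemma alternating_shifts: "alternating l f \<Longrightarrow> alternating l (shifts l i f)"
  using alternating_shift_sum[of l f i] by (simp add: shifts_def[abs_def])

lemma alternating_nonneg_part:
  assumes f: "alternating l f" shows "alternating l (nonneg_part l f)"
  unfolding alternating_def
proof safe
  fix v :: "nat \<Rightarrow> int" and p q :: nat assume pq: "p < l" "q < l" "p \<noteq> q"
  have t: "transpose p q permutes {..<l}" using pq by (simp add: permutes_swap_id)
  have "(\<forall>j<l. 0 \<le> (v \<circ> transpose p q) j) \<longleftrightarrow> (\<forall>j<l. 0 \<le> v j)"
    using permutes_in_image[OF t] by (metis comp_apply lessThan_iff transpose_involutory)
  then show "nonneg_part l f (v \<circ> transpose p q) = - nonneg_part l f v"
    using alternating_swap[OF f pq, of v] by (cases "\<forall>j<l. 0 \<le> v j") (auto simp: nonneg_part_def)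
next
  fix v w :: "nat \<Rightarrow> int" assume "\<forall>i<l. v i = w i"
  then show "nonneg_part l f v = nonneg_part l f w"
    using alternating_cong[OF f, of v w] by (cases "\<forall>j<l. 0 \<le> w j") (auto simp: nonneg_part_def)
qed

lemma alternating_ups: "alternating l f \<Longrightarrow> alternating l (ups l is f)"
  by (induction "is") (simp_all add: alternating_shifts)

lemma alternating_downs: "alternating l f \<Longrightarrow> alternating l (downs l is f)"
  by (induction "is") (simp_all add: alternating_shifts)

definition vanishes_negative :: "nat \<Rightarrow> ((nat \<Rightarrow> int) \<Rightarrow> int) \<Rightarrow> bool"
  where "vanishes_negative l f \<longleftrightarrow> (\<forall>v j. j < l \<and> v j < 0 \<longrightarrow> f v = 0)"

lemma vanishes_negative_nonneg_part: "vanishes_negative l (nonneg_part l f)"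
  by (auto simp: vanishes_negative_def nonneg_part_def)

lemma vanishes_negative_shifts:
  assumes "vanishes_negative l f" "i \<le> 0" shows "vanishes_negative l (shifts l i f)"
  unfolding vanishes_negative_def shifts_def
proof (intro allI impI)
  fix v :: "nat \<Rightarrow> int" and j assume j: "j < l \<and> v j < 0"
  have "f (shift v k i) = 0" for k
  proof -
    have "shift v k i j < 0" using j assms(2) by (auto simp: shift_def)
    then show ?thesis using assms(1) j unfolding vanishes_negative_def by blast
  qed
  then show "(\<Sum>k<l. f (shift v k i)) = 0" by simp
qed

lemma vanishes_negative_downs: "vanishes_negative l f \<Longrightarrow> vanishes_negative l (downs l is f)"
  by (induction "is") (simp_all add: vanishes_negative_shifts)

fun strip :: "nat list \<Rightarrow> nat list \<Rightarrow> nat list" where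
  "strip [] rs = rs"
| "strip (i # is) rs = remove1 i (strip is rs)"

text \<open>With \<open>mi\<close> the number of entries \<open>i\<close> of \<open>rs\<close>, the
  list \<open>[1, 1]\<close> gives \<open>m1 * (m1 - 1)\<close>, \<open>[1, 2]\<close> gives
  \<open>2 * m1 * m2\<close> and \<open>[3]\<close> gives \<open>3 * m3\<close>: a falling product
  with every factor scaled by its ribbon length, the form in which ribbon additions produce
  it.\<close>

fun falling :: "nat list \<Rightarrow> nat list \<Rightarrow> int" where
  "falling [] rs = 1"
| "falling (i # is) rs = int i * int (count_list (strip is rs) i) * falling is rs"

text \<open>In a beta sequence the values 0 to \<open>s - 1\<close> are those of \<open>s\<close>
  empty rows at the bottom.\<close>

definition low :: "nat \<Rightarrow> nat \<Rightarrow> (nat \<Rightarrow> int) \<Rightarrow> bool"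
  where "low l s u \<longleftrightarrow> (\<forall>c<s. \<exists>j<l. u j = int c)"

lemma strip_nonzero: "0 \<notin> set rs \<Longrightarrow> 0 \<notin> set (strip is rs)"
  by (induction "is") (auto dest: set_remove1_subset[THEN subsetD])

text \<open>Iterates \<open>xchar_sum_shift\<close>; the point to check is that enough low values
  survive each raise unless the term vanishes.\<close>

lemma ups_xchar:
  assumes "0 \<notin> set rs" "0 \<notin> set is" "low l (sum_list is) u"
  shows "ups l is (xchar l rs) u = falling is rs * xchar l (strip is rs) u"
  using assms(2,3)
proof (induction "is" arbitrary: u)
  case (Cons i "is")
  have i: "0 < i" "0 \<notin> set is" using Cons.prems by auto
  show ?case
  proof (cases "inj_on u {..<l}")
    case False
    have "ups l (i # is) (xchar l rs) u = 0"
      using alternating_inj_on[OF alternating_ups[OF alternating_xchar]] False by blast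
    moreover have "xchar l (strip (i # is) rs) u = 0"
      using alternating_inj_on[OF alternating_xchar] False by blast
    ultimately show ?thesis by simp
  next
    case inj: True
    have "ups l (i # is) (xchar l rs) u = (\<Sum>k<l. falling is rs * xchar l (strip is rs) (shift u k (int i)))"
      unfolding ups.simps shifts_def
    proof (rule sum.cong[OF refl])
      fix k assume "k \<in> {..<l}"
      then have k: "k < l" by simp
      show "ups l is (xchar l rs) (shift u k (int i)) = falling is rs * xchar l (strip is rs) (shift u k (int i))"
      proof (cases "inj_on (shift u k (int i)) {..<l}")
        case True
        have "low l (sum_list is) (shift u k (int i))"
          unfolding low_def
        proof (intro allI impI)
          fix c assume "c < sum_list is"
          then have c: "c < sum_list (i # is)" "c + i < sum_list (i # is)" by simp_all
          obtain j where j: "j < l" "u j = int c" using Cons.prems(2) c(1) unfolding low_def by blast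
          show "\<exists>j<l. shift u k (int i) j = int c"
          proof (cases "j = k")
            case False
            then show ?thesis using j by (auto simp: shift_def)
          next
            case eq: True
            obtain p where p: "p < l" "u p = int (c + i)" using Cons.prems(2) c(2) unfolding low_def by blast
            \<comment> \<open>A low value \<open>c\<close> raised by \<open>i\<close> lands on
              \<open>c + i\<close>, which is low as well and hence already taken; this contradicts
              the injectivity of the raised vector.\<close>
            then have "p \<noteq> k" using eq j i by auto
            moreover have "shift u k (int i) p = shift u k (int i) k" using p eq j \<open>p \<noteq> k\<close> by (auto simp: shift_def)
            ultimately show ?thesis using inj_onD[OF True, of p k] p k by auto
          qed
        qed
        then show ?thesis by (rule Cons.IH[OF i(2)])
      next
        case False
        have "ups l is (xchar l rs) (shift u k (int i)) = 0"
          using alternating_inj_on[OF alternating_ups[OF alternating_xchar]] False by blast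
        moreover have "xchar l (strip is rs) (shift u k (int i)) = 0"
          using alternating_inj_on[OF alternating_xchar] False by blast
        ultimately show ?thesis by simp
      qed
    qed
    also have "\<dots> = falling is rs * (\<Sum>k<l. xchar l (strip is rs) (shift u k (int i)))"
      by (simp add: sum_distrib_left)
    also have "\<dots> = falling is rs * (int i * int (count_list (strip is rs) i) * xchar l (remove1 i (strip is rs)) u)"
    proof -
      have "\<forall>c<i. \<exists>j<l. u j = int c" using Cons.prems(2) by (simp add: low_def)
      then show ?thesis using xchar_sum_shift[OF i(1) strip_nonzero[OF assms(1)]] by simp
    qed
    finally show ?thesis by simp
  qed
qed simp

text \<open>Lowering an entry below \<open>s\<close> hits another low value or becomes negative;
  lowering a larger entry leaves the low values in place.\<close>

lemma low_shift_down:
  assumes "low l s v" "0 < i" "k < l"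
  shows "low l s (shift v k (- int i)) \<or> \<not> inj_on (shift v k (- int i)) {..<l} \<or> (\<exists>j<l. shift v k (- int i) j < 0)"
proof (cases "v k - int i < 0")
  case True
  then show ?thesis using assms(3) by (auto simp: shift_def)
next
  case False
  show ?thesis
  proof (cases "v k < int s")
    case True
    then have "nat (v k - int i) < s" using False assms(2) by simp
    then obtain p where p: "p < l" "v p = int (nat (v k - int i))"
      using assms(1) unfolding low_def by blast
    then have "p \<noteq> k" using False assms(2) by auto
    moreover from this have "shift v k (- int i) p = shift v k (- int i) k"
      using p False by (auto simp: shift_def)
    ultimately have "\<not> inj_on (shift v k (- int i)) {..<l}"
      using p assms(3) by (auto dest: inj_onD)
    then show ?thesis by blast
  next
    case False
    have "\<exists>j<l. shift v k (- int i) j = int c" if c: "c < s" for c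
    proof -
      obtain j where "j < l" "v j = int c" using assms(1) c unfolding low_def by blast
      moreover from this have "j \<noteq> k" using False c by auto
      ultimately show ?thesis by (auto simp: shift_def)
    qed
    then show ?thesis by (simp add: low_def)
  qed
qed

text \<open>Removing ribbons is the recursion itself, so it puts \<open>is\<close> in front of the
  cycle type. The claim includes vectors with a negative entry because lowering produces
  them.\<close>

lemma downs_xchar:
  assumes alt: "alternating l g"
    and g: "\<And>u. low l s u \<or> (\<exists>j<l. u j < 0) \<Longrightarrow> g u = K * xchar l \<rho> u"
    and "0 \<notin> set is" and "low l s v \<or> (\<exists>j<l. v j < 0)"
  shows "downs l is g v = K * xchar l (is @ \<rho>) v"
  using assms(3,4)
proof (induction "is" arbitrary: v)
  case Nil
  then show ?case using g by simp
next
  case (Cons i "is")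
  have i: "0 < i" "0 \<notin> set is" using Cons.prems by auto
  have "downs l is g (shift v k (- int i)) = K * xchar l (is @ \<rho>) (shift v k (- int i))" if k: "k < l" for k
  proof (cases "inj_on (shift v k (- int i)) {..<l}")
    case True
    have "low l s (shift v k (- int i)) \<or> (\<exists>j<l. shift v k (- int i) j < 0)"
    proof (cases "low l s v")
      case True
      then show ?thesis using low_shift_down[OF True i(1) k] \<open>inj_on _ _\<close> by blast
    next
      case False
      then obtain j where "j < l" "v j < 0" using Cons.prems(2) by blast
      then have "shift v k (- int i) j < 0" by (auto simp: shift_def)
      then show ?thesis using \<open>j < l\<close> by blast
    qed
    then show ?thesis by (rule Cons.IH[OF i(2)])
  next
    case False
    have "downs l is g (shift v k (- int i)) = 0"
      using alternating_inj_on[OF alternating_downs[OF alt]] False by blast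
    moreover have "xchar l (is @ \<rho>) (shift v k (- int i)) = 0"
      using alternating_inj_on[OF alternating_xchar] False by blast
    ultimately show ?thesis by simp
  qed
  then show ?case by (simp add: shifts_def sum_distrib_left)
qed

lemma falling_nonzero_mset:
  assumes "falling is rs \<noteq> 0" shows "mset (is @ strip is rs) = mset rs"
  using assms
proof (induction "is")
  case (Cons i "is")
  then have "i \<in> set (strip is rs)" by (metis count_list_0_iff falling.simps(2) mult_zero_left mult_zero_right of_nat_0)
  then have "add_mset i (mset (remove1 i (strip is rs))) = mset (strip is rs)" by simp
  moreover have "mset (is @ strip is rs) = mset rs" using Cons by auto
  ultimately show ?case by (metis append_Cons mset.simps(2) mset_append strip.simps(2) union_mset_add_mset_right)
qed simp

text \<open>
  The truncation between adding and removing ribbons discards the vectors that stand for no partition.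
\<close>

theorem falling_times_xchar:
  assumes "0 \<notin> set rs" "0 \<notin> set is" "low l (sum_list is) v"
  shows "falling is rs * xchar l rs v = downs l is (nonneg_part l (ups l is (xchar l rs))) v"
proof -
  let ?g = "nonneg_part l (ups l is (xchar l rs))"
  have "downs l is ?g v = falling is rs * xchar l (is @ strip is rs) v"
  proof (rule downs_xchar)
    show "alternating l ?g" by (intro alternating_nonneg_part alternating_ups alternating_xchar)
    show "0 \<notin> set is" "low l (sum_list is) v \<or> (\<exists>j<l. v j < 0)" using assms by auto
    fix u assume u: "low l (sum_list is) u \<or> (\<exists>j<l. u j < 0)"
    show "?g u = falling is rs * xchar l (strip is rs) u"
    proof (cases "\<exists>j<l. u j < 0")
      case True
      then have "xchar l (strip is rs) u = 0" using xchar_negative by blast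
      then show ?thesis using True by (auto simp: nonneg_part_def not_le)
    next
      case False
      then have "\<forall>j<l. 0 \<le> u j" by (meson not_le)
      moreover have "low l (sum_list is) u" using u False by blast
      ultimately show ?thesis using ups_xchar[OF assms(1,2)] by (simp add: nonneg_part_def)
    qed
  qed
  \<comment> \<open>Either some part of \<open>is\<close> is missing from \<open>rs\<close> and the
    product is 0, or taking the parts out and putting them in front merely permutes
    \<open>rs\<close>.\<close>
  moreover have "falling is rs = 0 \<or> xchar l (is @ strip is rs) v = xchar l rs v"
    using xchar_mset falling_nonzero_mset by blast
  ultimately show ?thesis by auto
qed

text \<open>One more empty row raises all beta numbers by one and adds the value 0. This value
  matches only the last staircase entry, so just the permutations fixing \<open>l\<close>
  contribute.\<close>

lemma pairing_Suc:
  assumes "v' l = 0" "\<And>i. i < l \<Longrightarrow> v' i = v i + 1"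
  shows "pairing (Suc l) v' (staircase (Suc l)) = pairing l v (staircase l)"
proof -
  let ?t = "\<lambda>l v \<pi>. sign \<pi> * of_bool (\<forall>i<l. v i = staircase l (\<pi> i)) :: int"
  have "pairing (Suc l) v' (staircase (Suc l)) = (\<Sum>\<pi> | \<pi> permutes {..<l}. ?t (Suc l) v' \<pi>)"
    unfolding pairing_def
  proof (rule sum.mono_neutral_right)
    show "{\<pi>. \<pi> permutes {..<l}} \<subseteq> {\<pi>. \<pi> permutes {..<Suc l}}"
      using permutes_subset[of _ "{..<l}" "{..<Suc l}"] by auto
    show "\<forall>\<pi>\<in>{\<pi>. \<pi> permutes {..<Suc l}} - {\<pi>. \<pi> permutes {..<l}}. ?t (Suc l) v' \<pi> = 0"
    proof (rule ballI)
      fix \<pi> assume "\<pi> \<in> {\<pi>. \<pi> permutes {..<Suc l}} - {\<pi>. \<pi> permutes {..<l}}"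
      then have pi: "\<pi> permutes {..<Suc l}" and n: "\<not> \<pi> permutes {..<l}" by simp_all
      have "\<pi> l \<noteq> l"
      proof
        assume "\<pi> l = l"
        then have "\<pi> permutes {..<l}"
          using pi by (intro permutes_superset[OF pi]) (auto simp: less_Suc_eq)
        then show False using n by simp
      qed
      then have "\<pi> l < l" using permutes_in_image[OF pi, of l] by auto
      then show "?t (Suc l) v' \<pi> = 0" using assms(1) by (auto simp: staircase_def intro!: exI[of _ l])
    qed
  qed (simp add: finite_permutations)
  also have "\<dots> = (\<Sum>\<pi> | \<pi> permutes {..<l}. ?t l v \<pi>)"
  proof (rule sum.cong[OF refl])
    fix \<pi> assume "\<pi> \<in> {\<pi>. \<pi> permutes {..<l}}"
    then have pi: "\<pi> permutes {..<l}" by simp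
    have "\<pi> l = l" using permutes_not_in[OF pi] by simp
    then have "(\<forall>i<Suc l. v' i = staircase (Suc l) (\<pi> i)) \<longleftrightarrow> (\<forall>i<l. v i = staircase l (\<pi> i))"
      using assms by (auto simp: less_Suc_eq staircase_def)
    then show "?t (Suc l) v' \<pi> = ?t l v \<pi>" by simp
  qed
  finally show ?thesis by (simp add: pairing_def)
qed

lemma xchar_Suc:
  assumes "v' l = 0" "\<And>i. i < l \<Longrightarrow> v' i = v i + 1" "0 \<notin> set rs"
  shows "xchar (Suc l) rs v' = xchar l rs v"
  using assms
proof (induction rs arbitrary: v v')
  case Nil
  then show ?case using pairing_Suc by simp
next
  case (Cons r rs)
  have "xchar (Suc l) rs (shift v' l (- int r)) = 0"
    by (rule xchar_negative[of l]) (use Cons.prems in \<open>auto simp: shift_def\<close>)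
  moreover have "xchar (Suc l) rs (shift v' j (- int r)) = xchar l rs (shift v j (- int r))" if "j < l" for j
    by (rule Cons.IH) (use Cons.prems that in \<open>auto simp: shift_def\<close>)
  ultimately show ?case by (simp add: lessThan_Suc)
qed

text \<open>Characters indexed by arbitrary integer sequences, with \<open>rs\<close> the cycle type.\<close>

definition lchar :: "nat list \<Rightarrow> int list \<Rightarrow> int"
  where "lchar rs xs = xchar (length xs) rs (\<lambda>i. xs ! i + staircase (length xs) i)"

lemma lchar_append_zero: "0 \<notin> set rs \<Longrightarrow> lchar rs (xs @ [0]) = lchar rs xs"
  unfolding lchar_def length_append
  by (simp, rule xchar_Suc) (auto simp: nth_append staircase_def)

lemma lchar_append_zeros: "0 \<notin> set rs \<Longrightarrow> lchar rs (xs @ replicate c 0) = lchar rs xs"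
  by (induction c) (auto simp: replicate_append_same[symmetric] lchar_append_zero simp flip: append_assoc)

lemma irr_char_lchar:
  assumes "sorted_wrt (\<ge>) \<mu>" "g permutes {1..sum_list \<mu>}"
  shows "irr_char \<mu> g = of_int (lchar (cycle_type g {1..sum_list \<mu>}) (map int \<mu>))"
proof -
  have "xchar (length \<mu>) rs (beta \<mu>) = lchar rs (map int \<mu>)" for rs
    unfolding lchar_def length_map
    by (rule alternating_cong[OF alternating_xchar]) (simp add: beta_def)
  then show ?thesis using irr_char_xchar[OF assms] by (simp only:)
qed

text \<open>A row longer by one than the row above it has the same beta number.\<close>

lemma lchar_ascent:
  assumes "Suc i < length xs" "xs ! Suc i = xs ! i + 1" shows "lchar rs xs = 0"
  unfolding lchar_def
  by (rule xchar_repeat[of i _ "Suc i"]) (use assms in \<open>auto simp: staircase_def\<close>)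

section \<open>Straightening\<close>

definition at_rows :: "((nat \<Rightarrow> int) \<Rightarrow> int) \<Rightarrow> int list \<Rightarrow> int"
  where "at_rows f xs = f (\<lambda>i. xs ! i + staircase (length xs) i)"

lemma vanishes_negativeD: "vanishes_negative l f \<Longrightarrow> j < l \<Longrightarrow> v j < 0 \<Longrightarrow> f v = 0"
  unfolding vanishes_negative_def by blast

lemma lchar_at: "lchar rs xs = at_rows (xchar (length xs) rs) xs"
  by (simp add: lchar_def at_rows_def)

text \<open>Exchanging two adjacent beta numbers turns the rows \<open>p, q\<close> into
  \<open>q - 1, p + 1\<close>, since the staircase drops by one between them.\<close>

lemma at_swap:
  assumes f: "alternating l f" and l: "length pre + length post + 2 = l" and "q' = q - 1" "p' = p + 1"
  shows "at_rows f (pre @ p # q # post) = - at_rows f (pre @ q' # p' # post)"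
  unfolding at_rows_def
proof (rule alternating_swap'[OF f, of "length pre" "Suc (length pre)"])
  fix i assume "i < l" "i \<noteq> length pre" "i \<noteq> Suc (length pre)"
  then show "(pre @ p # q # post) ! i + staircase (length (pre @ p # q # post)) i
    = (pre @ q' # p' # post) ! i + staircase (length (pre @ q' # p' # post)) i"
    by (auto simp: nth_append nth_Cons split: nat.splits)
qed (use assms in \<open>auto simp: nth_append staircase_def\<close>)

lemma at_ascent:
  assumes "alternating l f" "length pre + length post + 2 = l" "q = p + 1"
  shows "at_rows f (pre @ p # q # post) = 0"
  using at_swap[OF assms(1,2), of p q q p] assms(3) by simp

text \<open>Swapping the last two of the three rows gives \<open>p, p + 1, p + 1\<close>, which
  starts with an ascent by one.\<close>

lemma at_ascent2:
  assumes f: "alternating l f" and l: "length pre + length post + 3 = l" and q: "q = p + 2"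
  shows "at_rows f (pre @ p # p # q # post) = 0"
proof -
  have "at_rows f ((pre @ [p]) @ p # q # post) = - at_rows f ((pre @ [p]) @ (p + 1) # (p + 1) # post)"
    by (rule at_swap[OF f]) (use l q in simp_all)
  moreover have "at_rows f (pre @ p # (p + 1) # (p + 1) # post) = 0"
    by (rule at_ascent[OF f]) (use l in simp_all)
  ultimately show ?thesis by simp
qed

lemma at_ascent2':
  assumes f: "alternating l f" and l: "length pre + length post + 3 = l" and q: "q = p + 2"
  shows "at_rows f (pre @ p # q # q # post) = 0"
proof -
  have "at_rows f (pre @ p # q # q # post) = - at_rows f (pre @ (p + 1) # (p + 1) # q # post)"
    by (rule at_swap[OF f]) (use l q in simp_all)
  moreover have "at_rows f ((pre @ [p + 1]) @ (p + 1) # q # post) = 0"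
    by (rule at_ascent[OF f]) (use l q in simp_all)
  ultimately show ?thesis by simp
qed

text \<open>Straightens \<open>x\<close> on top of a weakly decreasing list by repeated swaps. Sign
  0 marks a vanishing term, and the list then returned carries no meaning.\<close>

fun insert_row :: "int \<Rightarrow> int list \<Rightarrow> int \<times> int list" where
  "insert_row x [] = (1, [x])"
| "insert_row x (y # ys) = (if y \<le> x then (1, x # y # ys) else if y = x + 1 then (0, [])
     else case insert_row (x + 1) ys of (s, zs) \<Rightarrow> (- s, (y - 1) # zs))"

fun cons_terms :: "int \<Rightarrow> (int \<times> int list) list \<Rightarrow> (int \<times> int list) list" where
  "cons_terms x [] = []"
| "cons_terms x ((c, ys) # ts) = (case insert_row x ys of (s, zs) \<Rightarrow>
     if s = 0 then cons_terms x ts else (s * c, zs) # cons_terms x ts)"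

text \<open>After a move in the tail, the untouched head is put back by \<open>cons_terms\<close>,
  because a raised row may have to travel past it.\<close>

fun moves :: "int \<Rightarrow> int list \<Rightarrow> (int \<times> int list) list" where
  "moves i [] = []"
| "moves i (x # xs) = cons_terms (x + i) [(1, xs)] @ cons_terms x (moves i xs)"

definition eval_terms :: "('b \<Rightarrow> int) \<Rightarrow> (int \<times> 'b) list \<Rightarrow> int"
  where "eval_terms G ts = (\<Sum>(c, y)\<leftarrow>ts. c * G y)"

lemma eval_terms_simps [simp]:
  "eval_terms G [] = 0"
  "eval_terms G ((c, y) # ts) = c * G y + eval_terms G ts"
  "eval_terms G (ts @ us) = eval_terms G ts + eval_terms G us"
  by (simp_all add: eval_terms_def)

lemma eval_terms_cong:
  "(\<And>c y. (c, y) \<in> set ts \<Longrightarrow> G y = H y) \<Longrightarrow> eval_terms G ts = eval_terms H ts"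
  unfolding eval_terms_def by (intro arg_cong[where f = sum_list] map_cong refl) auto

lemma eval_terms_map: "eval_terms G (map (\<lambda>(c, y). (d * c, h y)) ts) = d * eval_terms (\<lambda>y. G (h y)) ts"
  by (induction ts) (auto simp: algebra_simps)

lemma insert_row_length: "insert_row x ys = (s, zs) \<Longrightarrow> s \<noteq> 0 \<Longrightarrow> length zs = Suc (length ys)"
  by (induction x ys arbitrary: s zs rule: insert_row.induct) (auto split: if_splits prod.splits)

lemma cons_terms_length:
  "(c, zs) \<in> set (cons_terms x ts) \<Longrightarrow> \<exists>d ys. (d, ys) \<in> set ts \<and> length zs = Suc (length ys)"
proof (induction ts)
  case (Cons t ts)
  obtain d us where t: "t = (d, us)" by (cases t)
  obtain s ws where ins: "insert_row x us = (s, ws)" by fastforce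
  show ?case
  proof (cases "(c, zs) \<in> set (cons_terms x ts)")
    case True
    then show ?thesis using Cons.IH by auto
  next
    case False
    then have "s \<noteq> 0" "zs = ws" using Cons.prems t ins by (auto split: if_splits)
    then show ?thesis using insert_row_length[OF ins] t by auto
  qed
qed simp

lemma moves_length: "(c, ys) \<in> set (moves i xs) \<Longrightarrow> length ys = length xs"
  by (induction xs arbitrary: c ys) (auto dest!: cons_terms_length simp del: cons_terms.simps)

text \<open>Swaps depend only on differences of rows, so the common offset \<open>a\<close> passes
  through unchanged.\<close>

lemma insert_row_sound:
  assumes f: "alternating l f" and "length pre + Suc (length ys) + length post = l"
    and "insert_row x ys = (s, zs)"
  shows "at_rows f (pre @ map ((+) a) (x # ys) @ post) = s * at_rows f (pre @ map ((+) a) zs @ post)"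
  using assms(2,3)
proof (induction ys arbitrary: x s zs pre)
  case (Cons y ys)
  consider "y \<le> x" | "y = x + 1" | "x + 1 < y" by linarith
  then show ?case
  proof cases
    case 1
    then show ?thesis using Cons.prems by auto
  next
    case 2
    have "at_rows f (pre @ (a + x) # (a + y) # map ((+) a) ys @ post) = 0"
      by (rule at_ascent[OF f]) (use Cons.prems 2 in simp_all)
    then show ?thesis using Cons.prems 2 by auto
  next
    case 3
    obtain t us where t: "insert_row (x + 1) ys = (t, us)" by fastforce
    then have eq: "s = - t" "zs = (y - 1) # us" using Cons.prems 3 by auto
    have IH: "at_rows f ((pre @ [a + (y - 1)]) @ map ((+) a) ((x + 1) # ys) @ post)
        = t * at_rows f ((pre @ [a + (y - 1)]) @ map ((+) a) us @ post)"
      by (rule Cons.IH[OF _ t]) (use Cons.prems in simp)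
    have "at_rows f (pre @ (a + x) # (a + y) # map ((+) a) ys @ post)
      = - at_rows f (pre @ (a + (y - 1)) # (a + (x + 1)) # map ((+) a) ys @ post)"
      by (rule at_swap[OF f]) (use Cons.prems in simp_all)
    then show ?thesis using IH unfolding eq
      by (simp only: append.assoc append_Cons append_Nil list.map mult_minus_left)
  qed
qed auto

lemma cons_terms_sound:
  assumes f: "alternating l f" and "\<And>c ys. (c, ys) \<in> set ts \<Longrightarrow> length pre + Suc (length ys) + length post = l"
  shows "eval_terms (\<lambda>ys. at_rows f (pre @ map ((+) a) (x # ys) @ post)) ts
      = eval_terms (\<lambda>ys. at_rows f (pre @ map ((+) a) ys @ post)) (cons_terms x ts)"
  using assms(2)
proof (induction ts)
  case (Cons t ts)
  obtain d us where t: "t = (d, us)" by (cases t)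
  obtain s zs where ins: "insert_row x us = (s, zs)" by fastforce
  have "at_rows f (pre @ map ((+) a) (x # us) @ post) = s * at_rows f (pre @ map ((+) a) zs @ post)"
    by (rule insert_row_sound[OF f _ ins]) (use Cons.prems[of d us] t in simp)
  moreover have "eval_terms (\<lambda>ys. at_rows f (pre @ map ((+) a) (x # ys) @ post)) ts
      = eval_terms (\<lambda>ys. at_rows f (pre @ map ((+) a) ys @ post)) (cons_terms x ts)"
    by (rule Cons.IH) (use Cons.prems in auto)
  ultimately show ?case using ins by (simp add: t)
qed simp

definition rows_sum where
  "rows_sum f i pre xs post = (\<Sum>k<length xs. at_rows f (pre @ xs[k := xs ! k + i] @ post))"

lemma rows_sum_Nil [simp]: "rows_sum f i pre [] post = 0"
  by (simp add: rows_sum_def)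

lemma rows_sum_Cons: "rows_sum f i pre (x # xs) post = at_rows f (pre @ (x + i) # xs @ post) + rows_sum f i (pre @ [x]) xs post"
  by (simp add: rows_sum_def sum.lessThan_Suc_shift del: sum.lessThan_Suc)

lemma rows_sum_append: "rows_sum f i pre (xs @ ys) post = rows_sum f i pre xs (ys @ post) + rows_sum f i (pre @ xs) ys post"
  by (induction xs arbitrary: pre) (auto simp: rows_sum_Cons)

lemma at_shifts:
  assumes f: "alternating l f" and l: "length xs = l"
  shows "at_rows (shifts l i f) xs = rows_sum f i [] xs []"
  unfolding at_rows_def shifts_def rows_sum_def using l
  by (intro sum.cong alternating_cong[OF f]) (auto simp: shift_def nth_list_update)

lemma moves_sound:
  assumes f: "alternating l f" and "length pre + length xs + length post = l"
  shows "rows_sum f i pre (map ((+) a) xs) post = eval_terms (\<lambda>ys. at_rows f (pre @ map ((+) a) ys @ post)) (moves i xs)"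
  using assms(2)
proof (induction xs arbitrary: pre)
  case (Cons x xs)
  have "rows_sum f i (pre @ [a + x]) (map ((+) a) xs) post
    = eval_terms (\<lambda>ys. at_rows f ((pre @ [a + x]) @ map ((+) a) ys @ post)) (moves i xs)"
    by (rule Cons.IH) (use Cons.prems in simp)
  also have "\<dots> = eval_terms (\<lambda>ys. at_rows f (pre @ map ((+) a) (x # ys) @ post)) (moves i xs)" by simp
  also have "\<dots> = eval_terms (\<lambda>ys. at_rows f (pre @ map ((+) a) ys @ post)) (cons_terms x (moves i xs))"
    by (rule cons_terms_sound[OF f]) (use Cons.prems in \<open>simp add: moves_length\<close>)
  finally have tail: "rows_sum f i (pre @ [a + x]) (map ((+) a) xs) post
    = eval_terms (\<lambda>ys. at_rows f (pre @ map ((+) a) ys @ post)) (cons_terms x (moves i xs))" .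
  have "eval_terms (\<lambda>ys. at_rows f (pre @ map ((+) a) ((x + i) # ys) @ post)) [(1, xs)]
    = eval_terms (\<lambda>ys. at_rows f (pre @ map ((+) a) ys @ post)) (cons_terms (x + i) [(1, xs)])"
    by (rule cons_terms_sound[OF f]) (use Cons.prems in simp)
  then show ?case using tail by (simp add: rows_sum_Cons add.assoc del: cons_terms.simps)
qed simp

text \<open>
  A sequence is described by three groups of rows: the first two are offset by \<open>a\<close> and separated
  by \<open>m\<close> rows equal to \<open>a\<close>, the last one is not offset.
\<close>

type_synonym groups = "int list \<times> int list \<times> int list"

fun embed :: "int \<Rightarrow> nat \<Rightarrow> groups \<Rightarrow> int list" where
  "embed a m (g1, g2, g3) = map ((+) a) g1 @ replicate m a @ map ((+) a) g2 @ g3"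

fun same_shape :: "groups \<Rightarrow> groups \<Rightarrow> bool" where
  "same_shape (g1, g2, g3) (h1, h2, h3) \<longleftrightarrow> length g1 = length h1 \<and> length g2 = length h2 \<and> length g3 = length h3"

text \<open>A certificate that changing any one middle row by \<open>i\<close> gives 0. For positive
  \<open>i\<close> the rows just above it equal \<open>a\<close>, for negative \<open>i\<close>
  those just below do, and the change creates \<open>a, a + 1\<close> or \<open>a, a, a + 2\<close>
  or a mirror image of these.\<close>

fun middle_fixed :: "int \<Rightarrow> groups \<Rightarrow> bool" where
  "middle_fixed i (g1, g2, g3) \<longleftrightarrow> i = 1 \<and> g1 \<noteq> [] \<and> last g1 = 0 \<or> i = 2 \<and> g1 = [0, 0]
     \<or> i = -1 \<and> g2 \<noteq> [] \<and> hd g2 = 0 \<or> i = -2 \<and> g2 = [0, 0]"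

text \<open>The row next to the block violates the order by 1 or 2, from above or from below.
  Against at least two rows equal to \<open>a\<close> such a term vanishes.\<close>

fun middle_vanish :: "groups \<Rightarrow> bool" where
  "middle_vanish (g1, g2, g3) \<longleftrightarrow> g1 \<noteq> [] \<and> (last g1 = -1 \<or> last g1 = -2) \<or> g2 \<noteq> [] \<and> (hd g2 = 1 \<or> hd g2 = 2)"

lemma middle_fixed_sound:
  assumes f: "alternating l f" and l: "length (embed a m (g1, g2, g3)) = l" and "middle_fixed i (g1, g2, g3)"
  shows "rows_sum f i (map ((+) a) g1) (replicate m a) (map ((+) a) g2 @ g3) = 0"
  unfolding rows_sum_def
proof (rule sum.neutral, rule ballI)
  fix k assume "k \<in> {..<length (replicate m a)}"
  then have k: "k < m" by simp
  then have up: "(replicate m a)[k := replicate m a ! k + i] = replicate k a @ (a + i) # replicate (m - Suc k) a"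
    by (simp add: upd_conv_take_nth_drop min_def)
  let ?x = "map ((+) a) g1 @ (replicate m a)[k := replicate m a ! k + i] @ map ((+) a) g2 @ g3"
  have lx: "length ?x = l" using l by simp
  consider "i = 1" "g1 \<noteq> []" "last g1 = 0" | "i = 2" "g1 = [0, 0]" | "i = -1" "g2 \<noteq> []" "hd g2 = 0" | "i = -2" "g2 = [0, 0]"
    using assms(3) by auto
  then show "at_rows f ?x = 0"
  proof cases
    case 1
    have g1: "map ((+) a) g1 = map ((+) a) (butlast g1) @ [a]"
      using 1 by (cases g1 rule: rev_cases) auto
    obtain p where p: "map ((+) a) g1 @ replicate k a = p @ [a]"
      unfolding g1 by (cases k) (auto simp: replicate_append_same[symmetric] simp flip: append_assoc)
    have "?x = (map ((+) a) g1 @ replicate k a) @ (a + 1) # replicate (m - Suc k) a @ map ((+) a) g2 @ g3"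
      unfolding up using 1 by simp
    then have x: "?x = p @ a # (a + 1) # replicate (m - Suc k) a @ map ((+) a) g2 @ g3"
      unfolding p by simp
    show ?thesis
      unfolding x by (rule at_ascent[OF f]) (use lx in \<open>simp_all add: x\<close>)
  next
    case 2
    have g1: "map ((+) a) g1 = [a, a]" using 2 by simp
    obtain p where p: "map ((+) a) g1 @ replicate k a = p @ [a, a]"
    proof (cases k)
      case 0
      then show ?thesis using that[of "[]"] g1 by simp
    next
      case (Suc j)
      have "[a, a] @ replicate (Suc j) a = (a # replicate j a) @ [a, a]"
        by (simp add: replicate_append_same[symmetric])
      then show ?thesis using that g1 Suc by metis
    qed
    have "?x = (map ((+) a) g1 @ replicate k a) @ (a + 2) # replicate (m - Suc k) a @ map ((+) a) g2 @ g3"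
      unfolding up using 2 by simp
    then have x: "?x = p @ a # a # (a + 2) # replicate (m - Suc k) a @ map ((+) a) g2 @ g3"
      unfolding p by simp
    show ?thesis
      unfolding x by (rule at_ascent2[OF f]) (use lx in \<open>simp_all add: x\<close>)
  next
    case 3
    obtain p where p: "replicate (m - Suc k) a @ map ((+) a) g2 @ g3 = a # p"
      using 3 by (cases g2; cases "m - Suc k") auto
    have x: "?x = (map ((+) a) g1 @ replicate k a) @ (a - 1) # a # p"
      unfolding up using 3 p by simp
    show ?thesis
      unfolding x by (rule at_ascent[OF f]) (use lx in \<open>simp_all add: x\<close>)
  next
    case 4
    obtain p where p: "replicate (m - Suc k) a @ map ((+) a) g2 @ g3 = a # a # p"
    proof (cases "m - Suc k")
      case 0
      then show ?thesis using that[of g3] 4 by simp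
    next
      case (Suc j)
      then show ?thesis using that 4 by (cases j) auto
    qed
    have x: "?x = (map ((+) a) g1 @ replicate k a) @ (a - 2) # a # a # p"
      unfolding up using 4 p by simp
    show ?thesis
      unfolding x by (rule at_ascent2'[OF f]) (use lx in \<open>simp_all add: x\<close>)
  qed
qed

lemma middle_vanish_sound:
  assumes f: "alternating l f" and l: "length (embed a m (g1, g2, g3)) = l" and "middle_vanish (g1, g2, g3)" and m: "2 \<le> m"
  shows "at_rows f (embed a m (g1, g2, g3)) = 0"
proof -
  obtain j where m2: "m = Suc (Suc j)" using m by (metis add_2_eq_Suc le_Suc_ex)
  have r: "replicate m a = a # a # replicate j a" "replicate m a = replicate j a @ [a, a]"
    unfolding m2 by (simp, simp add: replicate_append_same[symmetric])
  let ?x = "embed a m (g1, g2, g3)"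
  consider "g1 \<noteq> []" "last g1 = -1 \<or> last g1 = -2" | "g2 \<noteq> []" "hd g2 = 1 \<or> hd g2 = 2"
    using assms(3) by auto
  then show ?thesis
  proof cases
    case 1
    define p where "p = map ((+) a) (butlast g1)"
    have g1: "map ((+) a) g1 = p @ [a + last g1]"
      using 1(1) unfolding p_def by (cases g1 rule: rev_cases) auto
    define q where "q = replicate j a @ map ((+) a) g2 @ g3"
    have x: "?x = p @ (a + last g1) # a # a # q" using g1 r by (simp add: q_def)
    then have len: "length p + length q + 3 = l" using l by simp
    from 1(2) show ?thesis
    proof
      assume "last g1 = -1"
      then show ?thesis unfolding x by (intro at_ascent[OF f]) (use len in simp_all)
    next
      assume "last g1 = -2"
      then show ?thesis unfolding x by (intro at_ascent2'[OF f]) (use len in simp_all)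
    qed
  next
    case 2
    define p where "p = map ((+) a) g1 @ replicate j a"
    obtain q where q: "map ((+) a) g2 @ g3 = (a + hd g2) # q" using 2(1) by (cases g2) auto
    have x: "?x = p @ a # a # (a + hd g2) # q" using q r(2) by (simp add: p_def)
    then have len: "length p + length q + 3 = l" using l by simp
    from 2(2) show ?thesis
    proof
      assume "hd g2 = 1"
      then show ?thesis unfolding x using at_ascent[OF f, of "p @ [a]" q "a + hd g2" a] len by simp
    next
      assume "hd g2 = 2"
      then show ?thesis unfolding x by (intro at_ascent2[OF f]) (use len in simp_all)
    qed
  qed
qed

section \<open>Symbolic ribbon moves around a block of unspecified length\<close>

fun group_moves :: "bool \<Rightarrow> int \<Rightarrow> groups \<Rightarrow> (int \<times> groups) list" where
  "group_moves lowest i (g1, g2, g3) = map (\<lambda>(c, h). (c, (h, g2, g3))) (moves i g1)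
     @ map (\<lambda>(c, h). (c, (g1, h, g3))) (moves i g2)
     @ (if lowest then map (\<lambda>(c, h). (c, (g1, g2, h))) (moves i g3) else [])"

fun add_term :: "int \<Rightarrow> 'b \<Rightarrow> (int \<times> 'b) list \<Rightarrow> (int \<times> 'b) list" where
  "add_term c g [] = [(c, g)]"
| "add_term c g ((d, h) # ts) = (if g = h then (if c + d = 0 then ts else (c + d, h) # ts)
     else (d, h) # add_term c g ts)"

fun absorb :: "bool \<Rightarrow> int \<Rightarrow> (int \<times> groups) list \<Rightarrow> (int \<times> groups) list \<Rightarrow> (int \<times> groups) list" where
  "absorb mid c [] us = us"
| "absorb mid c ((d, h) # hs) us = (let vs = absorb mid c hs us in
     if mid \<and> middle_vanish h then vs else add_term (c * d) h vs)"

text \<open>\<open>None\<close> means that the vanishing of moves inside the middle block is not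
  certified, not that the result is zero.\<close>

fun step :: "bool \<Rightarrow> bool \<Rightarrow> int \<Rightarrow> (int \<times> groups) list \<Rightarrow> (int \<times> groups) list option" where
  "step mid lowest i [] = Some []"
| "step mid lowest i ((c, g) # ts) = (if mid \<and> \<not> middle_fixed i g then None
     else case step mid lowest i ts of None \<Rightarrow> None
       | Some us \<Rightarrow> Some (absorb mid c (group_moves lowest i g) us))"

fun run_steps :: "bool \<Rightarrow> bool \<Rightarrow> int list \<Rightarrow> (int \<times> groups) list \<Rightarrow> (int \<times> groups) list option" where
  "run_steps mid lowest [] ts = Some ts"
| "run_steps mid lowest (i # is) ts = (case step mid lowest i ts of None \<Rightarrow> None
     | Some us \<Rightarrow> run_steps mid lowest is us)"

fun bounded_below :: "int \<Rightarrow> groups \<Rightarrow> bool" where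
  "bounded_below d (g1, g2, g3) \<longleftrightarrow> (\<forall>x\<in>set g1. - d \<le> x) \<and> (\<forall>x\<in>set g2. - d \<le> x) \<and> (\<forall>x\<in>set g3. 0 \<le> x)"

text \<open>Evaluated at a vector, the outer operators \<open>downs\<close> act before
  \<open>ups\<close>: rows are lowered, then tested against the truncation, then raised. The bound
  \<open>d\<close> makes all lowered rows nonnegative for every \<open>a\<close> with
  \<open>d \<le> a\<close>, so that the truncation keeps each term.\<close>

definition run :: "bool \<Rightarrow> int \<Rightarrow> nat list \<Rightarrow> groups \<Rightarrow> (int \<times> groups) list option" where
  "run mid d is g = (case run_steps mid False (map (\<lambda>i. - int i) is) [(1, g)] of None \<Rightarrow> None
     | Some ts \<Rightarrow> if \<forall>(c, h)\<in>set ts. bounded_below d h then run_steps mid True (map int is) ts else None)"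

fun combine :: "bool \<Rightarrow> int \<Rightarrow> (int \<times> nat list) list \<Rightarrow> groups \<Rightarrow> (int \<times> groups) list \<Rightarrow> (int \<times> groups) list option" where
  "combine mid d [] g us = Some us"
| "combine mid d ((k, is) # ops) g us = (case run mid d is g of None \<Rightarrow> None
     | Some ts \<Rightarrow> combine mid d ops g (absorb False k ts us))"

lemma eval_add_term: "eval_terms G (add_term c g ts) = c * G g + eval_terms G ts"
proof (induction ts)
  case (Cons t ts)
  obtain d h where t: "t = (d, h)" by (cases t)
  have "c * G g + d * G g = (c + d) * G g" by (simp add: distrib_right)
  then show ?case using Cons.IH t by (cases "g = h"; cases "c + d = 0") auto
qed simp

lemma set_add_term: "(d, h) \<in> set (add_term c g ts) \<Longrightarrow> h = g \<or> (\<exists>e. (e, h) \<in> set ts)"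
  by (induction c g ts rule: add_term.induct) (auto split: if_splits)

lemma set_absorb: "(d, h) \<in> set (absorb mid c hs us) \<Longrightarrow> h \<in> snd ` set hs \<or> h \<in> snd ` set us"
proof (induction hs arbitrary: d)
  case Nil
  then show ?case by force
next
  case (Cons t hs)
  obtain e k where t: "t = (e, k)" by (cases t)
  show ?case
  proof (cases "mid \<and> middle_vanish k")
    case True
    have "absorb mid c (t # hs) us = absorb mid c hs us" by (simp only: t absorb.simps Let_def True if_True simp_thms)
    then show ?thesis using Cons by auto
  next
    case False
    have "absorb mid c (t # hs) us = add_term (c * e) k (absorb mid c hs us)"
      by (simp only: t absorb.simps Let_def False if_False)
    then have "(d, h) \<in> set (add_term (c * e) k (absorb mid c hs us))" using Cons.prems by simp
    from set_add_term[OF this] show ?thesis using Cons.IH t by auto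
  qed
qed

lemma eval_absorb_False: "eval_terms G (absorb False c hs us) = c * eval_terms G hs + eval_terms G us"
proof (induction hs)
  case (Cons t hs)
  obtain d h where t: "t = (d, h)" by (cases t)
  have "absorb False c (t # hs) us = add_term (c * d) h (absorb False c hs us)"
    by (simp only: t absorb.simps Let_def simp_thms if_False)
  then show ?case using Cons.IH t by (simp only: eval_add_term eval_terms_simps) (simp add: algebra_simps)
qed simp

context
  fixes l m :: nat and a :: int and mid :: bool
  assumes m: "mid \<Longrightarrow> 2 \<le> m" "\<not> mid \<Longrightarrow> m = 0"
begin

lemma eval_absorb:
  assumes f: "alternating l f" and "\<forall>t\<in>set hs. length (embed a m (snd t)) = l"
  shows "eval_terms (\<lambda>g. at_rows f (embed a m g)) (absorb mid c hs us)
    = c * eval_terms (\<lambda>g. at_rows f (embed a m g)) hs + eval_terms (\<lambda>g. at_rows f (embed a m g)) us"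
  using assms(2)
proof (induction hs)
  case (Cons t hs)
  obtain d h where t: "t = (d, h)" by (cases t)
  have IH: "eval_terms (\<lambda>g. at_rows f (embed a m g)) (absorb mid c hs us)
    = c * eval_terms (\<lambda>g. at_rows f (embed a m g)) hs + eval_terms (\<lambda>g. at_rows f (embed a m g)) us"
    using Cons by simp
  have lh: "length (embed a m h) = l" using Cons.prems t by simp
  show ?case
  proof (cases "mid \<and> middle_vanish h")
    case True
    obtain g1 g2 g3 where h: "h = (g1, g2, g3)" by (cases h)
    have "at_rows f (embed a m h) = 0"
      unfolding h by (rule middle_vanish_sound[OF f]) (use lh True m(1) h in blast)+
    moreover have "absorb mid c (t # hs) us = absorb mid c hs us"
      by (simp only: t absorb.simps Let_def True if_True simp_thms)
    ultimately show ?thesis using IH t by simp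
  next
    case False
    have "absorb mid c (t # hs) us = add_term (c * d) h (absorb mid c hs us)"
      by (simp only: t absorb.simps Let_def False if_False)
    then show ?thesis using IH t by (simp add: eval_add_term algebra_simps)
  qed
qed simp

lemma group_moves_length: "(d, h) \<in> set (group_moves lowest i g) \<Longrightarrow> length (embed a m h) = length (embed a m g)"
  by (cases g) (auto dest: moves_length split: if_splits)

text \<open>Lowering a zero row at the bottom makes its beta number negative or equal to that of a
  lower zero row. Hence removals may skip the last group.\<close>

lemma zero_rows_sum:
  assumes f: "alternating l f" "vanishes_negative l f" and l: "length pre + z = l" and i: "0 < i"
  shows "rows_sum f (- int i) pre (replicate z 0) [] = 0"
  unfolding rows_sum_def
proof (rule sum.neutral, rule ballI)
  fix k assume "k \<in> {..<length (replicate z (0 :: int))}"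
  then have k: "k < z" by simp
  let ?x = "pre @ (replicate z 0)[k := replicate z 0 ! k + - int i] @ []"
  let ?v = "\<lambda>j. ?x ! j + staircase (length ?x) j"
  have v: "?v (length pre + j) = int z - 1 - int j - (if j = k then int i else 0)" if "j < z" for j
    using that k by (simp add: nth_append staircase_def nth_list_update)
  show "at_rows f ?x = 0"
  proof (cases "int z - 1 - int k - int i < 0")
    case True
    then have neg: "length pre + k < l \<and> ?v (length pre + k) < 0" using v[OF k] k l by simp
    show ?thesis unfolding at_rows_def
      by (rule vanishes_negativeD[OF f(2), of "length pre + k"]) (use neg in blast)+
  next
    case False
    then have ki: "k + i < z" by simp
    have "?v (length pre + (k + i)) = ?v (length pre + k)" using v[OF ki] v[OF k] i by simp
    then show ?thesis unfolding at_rows_def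
      by (intro alternating_repeat[OF f(1), of "length pre + (k + i)" "length pre + k"]) (use k ki l i in auto)
  qed
qed

text \<open>The sum over all rows splits into the three groups and the middle block; the certificate
  removes the block, and during removals the zero rows drop out too.\<close>

lemma at_shifts_embed:
  assumes f: "alternating l f" and l: "length (embed a m (g1, g2, g3)) = l"
    and mf: "mid \<Longrightarrow> middle_fixed i (g1, g2, g3)"
    and lowest: "\<not> lowest \<Longrightarrow> vanishes_negative l f \<and> i < 0 \<and> set g3 \<subseteq> {0}"
  shows "at_rows (shifts l i f) (embed a m (g1, g2, g3))
    = eval_terms (\<lambda>g. at_rows f (embed a m g)) (group_moves lowest i (g1, g2, g3))"
proof -
  let ?A = "map ((+) a) g1" and ?B = "replicate m a" and ?C = "map ((+) a) g2"
  have comp: "eval_terms G (map (\<lambda>(c, h). (c, k h)) ts) = eval_terms (\<lambda>h. G (k h)) ts" for G k ts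
    using eval_terms_map[of G 1 k ts] by simp
  have "at_rows (shifts l i f) (embed a m (g1, g2, g3)) = rows_sum f i [] (embed a m (g1, g2, g3)) []"
    by (rule at_shifts[OF f l])
  also have "\<dots> = rows_sum f i [] ?A (?B @ ?C @ g3) + rows_sum f i ?A ?B (?C @ g3)
      + rows_sum f i (?A @ ?B) ?C g3 + rows_sum f i (?A @ ?B @ ?C) g3 []"
    by (simp add: rows_sum_append)
  also have "rows_sum f i ?A ?B (?C @ g3) = 0"
  proof (cases mid)
    case True
    then show ?thesis using middle_fixed_sound[OF f l mf] by simp
  next
    case False
    then show ?thesis using m by simp
  qed
  also have "rows_sum f i [] ?A (?B @ ?C @ g3)
    = eval_terms (\<lambda>h. at_rows f (embed a m (h, g2, g3))) (moves i g1)"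
    using moves_sound[OF f, of "[]" g1 "?B @ ?C @ g3" i a] l by simp
  also have "rows_sum f i (?A @ ?B) ?C g3
    = eval_terms (\<lambda>h. at_rows f (embed a m (g1, h, g3))) (moves i g2)"
    using moves_sound[OF f, of "?A @ ?B" g2 g3 i a] l by simp
  also have "rows_sum f i (?A @ ?B @ ?C) g3 []
    = (if lowest then eval_terms (\<lambda>h. at_rows f (embed a m (g1, g2, h))) (moves i g3) else 0)"
  proof (cases lowest)
    case True
    have "map ((+) 0) xs = xs" for xs :: "int list" by (simp add: map_idI)
    then show ?thesis using moves_sound[OF f, of "?A @ ?B @ ?C" g3 "[]" i 0] l True by simp
  next
    case False
    note nl = lowest[OF False]
    then have g3: "g3 = replicate (length g3) 0"
      by (intro replicate_length_same[symmetric]) auto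
    have "rows_sum f (- int (nat (- i))) (?A @ ?B @ ?C) (replicate (length g3) 0) [] = 0"
      by (rule zero_rows_sum[OF f]) (use nl l in auto)
    then show ?thesis using nl False g3 by simp
  qed
  finally show ?thesis by (simp add: comp)
qed

lemma step_sound:
  assumes f: "alternating l f" and "step mid lowest i ts = Some us"
    and "\<forall>t\<in>set ts. length (embed a m (snd t)) = l"
    and "\<not> lowest \<Longrightarrow> vanishes_negative l f \<and> i < 0 \<and> (\<forall>t\<in>set ts. set (snd (snd (snd t))) \<subseteq> {0})"
  shows "eval_terms (\<lambda>g. at_rows (shifts l i f) (embed a m g)) ts = eval_terms (\<lambda>g. at_rows f (embed a m g)) us
    \<and> (\<forall>t\<in>set us. length (embed a m (snd t)) = l)
    \<and> (\<not> lowest \<longrightarrow> (\<forall>t\<in>set us. set (snd (snd (snd t))) \<subseteq> {0}))"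
  using assms(2-)
proof (induction ts arbitrary: us)
  case (Cons t ts)
  obtain c g where t: "t = (c, g)" by (cases t)
  obtain g1 g2 g3 where g: "g = (g1, g2, g3)" by (cases g)
  obtain vs where vs: "step mid lowest i ts = Some vs" "us = absorb mid c (group_moves lowest i g) vs"
    and mf: "mid \<Longrightarrow> middle_fixed i g"
    using Cons.prems(1) t by (auto split: if_splits option.splits)
  have IH: "eval_terms (\<lambda>g. at_rows (shifts l i f) (embed a m g)) ts = eval_terms (\<lambda>g. at_rows f (embed a m g)) vs
    \<and> (\<forall>t\<in>set vs. length (embed a m (snd t)) = l)
    \<and> (\<not> lowest \<longrightarrow> (\<forall>t\<in>set vs. set (snd (snd (snd t))) \<subseteq> {0}))"
    by (rule Cons.IH[OF vs(1)]) (use Cons.prems in auto)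
  have lg: "length (embed a m g) = l" using Cons.prems(2) t by simp
  have lm: "length (embed a m h) = l" if "h \<in> snd ` set (group_moves lowest i g)" for h
    using group_moves_length[of _ h lowest i g] that lg by force
  have g0: "set g3 \<subseteq> {0}" if "\<not> lowest" using Cons.prems(3)[OF that] t g by auto
  have hd: "at_rows (shifts l i f) (embed a m g) = eval_terms (\<lambda>g. at_rows f (embed a m g)) (group_moves lowest i g)"
    unfolding g
  proof (rule at_shifts_embed[OF f])
    show "length (embed a m (g1, g2, g3)) = l" using lg g by simp
    show "mid \<Longrightarrow> middle_fixed i (g1, g2, g3)" using mf g by simp
    show "\<not> lowest \<Longrightarrow> vanishes_negative l f \<and> i < 0 \<and> set g3 \<subseteq> {0}" using g0 Cons.prems(3) by blast
  qed
  have "\<forall>t\<in>set us. length (embed a m (snd t)) = l"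
  proof
    fix u assume "u \<in> set us"
    then have "snd u \<in> snd ` set (group_moves lowest i g) \<or> snd u \<in> snd ` set vs"
      using set_absorb[of "fst u" "snd u"] vs(2) by simp
    then show "length (embed a m (snd u)) = l"
    proof
      assume "snd u \<in> snd ` set vs"
      then obtain w where "w \<in> set vs" "snd u = snd w" by blast
      then show ?thesis using IH by simp
    qed (rule lm)
  qed
  moreover have "\<forall>t\<in>set us. set (snd (snd (snd t))) \<subseteq> {0}" if low: "\<not> lowest"
  proof
    fix u assume "u \<in> set us"
    then have "snd u \<in> snd ` set (group_moves lowest i g) \<or> snd u \<in> snd ` set vs"
      using set_absorb[of "fst u" "snd u"] vs(2) by simp
    then show "set (snd (snd (snd u))) \<subseteq> {0}"
    proof
      assume "snd u \<in> snd ` set (group_moves lowest i g)"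
      then have "snd (snd (snd u)) = g3" using low g by auto
      then show ?thesis using g0[OF low] by simp
    next
      assume "snd u \<in> snd ` set vs"
      then obtain w where "w \<in> set vs" "snd u = snd w" by blast
      then show ?thesis using IH low by simp
    qed
  qed
  moreover have "eval_terms (\<lambda>g. at_rows (shifts l i f) (embed a m g)) (t # ts) = eval_terms (\<lambda>g. at_rows f (embed a m g)) us"
    using eval_absorb[OF f, of "group_moves lowest i g" c vs] lm hd IH vs(2) t by simp
  ultimately show ?case by blast
qed auto

lemma run_ups_sound:
  assumes f: "alternating l f" and "run_steps mid True (map int is) ts = Some us"
    and "\<forall>t\<in>set ts. length (embed a m (snd t)) = l"
  shows "eval_terms (\<lambda>g. at_rows (ups l is f) (embed a m g)) ts = eval_terms (\<lambda>g. at_rows f (embed a m g)) us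
    \<and> (\<forall>t\<in>set us. length (embed a m (snd t)) = l)"
  using assms(2-)
proof (induction "is" arbitrary: ts)
  case (Cons i "is")
  obtain vs where vs: "step mid True (int i) ts = Some vs" "run_steps mid True (map int is) vs = Some us"
    using Cons.prems(1) by (auto split: option.splits)
  have st: "eval_terms (\<lambda>g. at_rows (shifts l (int i) (ups l is f)) (embed a m g)) ts = eval_terms (\<lambda>g. at_rows (ups l is f) (embed a m g)) vs
    \<and> (\<forall>t\<in>set vs. length (embed a m (snd t)) = l)"
    using step_sound[OF alternating_ups[OF f, of "is"] vs(1) Cons.prems(2)] by blast
  then have "\<forall>t\<in>set vs. length (embed a m (snd t)) = l" by blast
  from Cons.IH[OF vs(2) this] st show ?case by simp
qed auto

lemma run_downs_sound:
  assumes f: "alternating l f" "vanishes_negative l f" and "run_steps mid False (map (\<lambda>i. - int i) is) ts = Some us"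
    and "\<forall>t\<in>set ts. length (embed a m (snd t)) = l"
    and "\<forall>t\<in>set ts. set (snd (snd (snd t))) \<subseteq> {0}" and "0 \<notin> set is"
  shows "eval_terms (\<lambda>g. at_rows (downs l is f) (embed a m g)) ts = eval_terms (\<lambda>g. at_rows f (embed a m g)) us
    \<and> (\<forall>t\<in>set us. length (embed a m (snd t)) = l)"
  using assms(3-)
proof (induction "is" arbitrary: ts)
  case (Cons i "is")
  obtain vs where vs: "step mid False (- int i) ts = Some vs" "run_steps mid False (map (\<lambda>i. - int i) is) vs = Some us"
    using Cons.prems(1) by (auto split: option.splits)
  note st = step_sound[OF alternating_downs[OF f(1), of "is"] vs(1) Cons.prems(2)]
  have st: "eval_terms (\<lambda>g. at_rows (shifts l (- int i) (downs l is f)) (embed a m g)) ts = eval_terms (\<lambda>g. at_rows (downs l is f) (embed a m g)) vs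
    \<and> (\<forall>t\<in>set vs. length (embed a m (snd t)) = l) \<and> (\<forall>t\<in>set vs. set (snd (snd (snd t))) \<subseteq> {0})"
    using st vanishes_negative_downs[OF f(2)] Cons.prems(3,4) by auto
  then have "\<forall>t\<in>set vs. length (embed a m (snd t)) = l" by blast
  from Cons.IH[OF vs(2) this] st Cons.prems(4) show ?case by simp
qed auto

lemma run_sound:
  assumes f: "alternating l f" and g: "length (embed a m g) = l" "set (snd (snd g)) \<subseteq> {0}"
    and r: "run mid d is g = Some us" and "0 \<notin> set is" and d: "d \<le> a" "0 \<le> a"
  shows "at_rows (downs l is (nonneg_part l (ups l is f))) (embed a m g) = eval_terms (\<lambda>g. at_rows f (embed a m g)) us
    \<and> (\<forall>t\<in>set us. length (embed a m (snd t)) = l)"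
proof -
  let ?h = "nonneg_part l (ups l is f)"
  obtain ts where ts: "run_steps mid False (map (\<lambda>i. - int i) is) [(1, g)] = Some ts"
      "\<forall>(c, h)\<in>set ts. bounded_below d h" "run_steps mid True (map int is) ts = Some us"
    using r by (auto simp: run_def split: option.splits if_splits)
  have down: "eval_terms (\<lambda>g. at_rows (downs l is ?h) (embed a m g)) [(1, g)] = eval_terms (\<lambda>g. at_rows ?h (embed a m g)) ts
    \<and> (\<forall>t\<in>set ts. length (embed a m (snd t)) = l)"
    by (rule run_downs_sound[OF alternating_nonneg_part[OF alternating_ups[OF f]] vanishes_negative_nonneg_part ts(1)])
      (use g assms(5) in auto)
  \<comment> \<open>By the test with \<open>bounded_below\<close> all lowered rows are nonnegative,
    hence so are their beta numbers, and the truncation acts as the identity.\<close>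
  have "eval_terms (\<lambda>g. at_rows ?h (embed a m g)) ts = eval_terms (\<lambda>g. at_rows (ups l is f) (embed a m g)) ts"
  proof (rule eval_terms_cong)
    fix c h assume ch: "(c, h) \<in> set ts"
    obtain g1 g2 g3 where h: "h = (g1, g2, g3)" by (cases h)
    have "bounded_below d h" "length (embed a m h) = l" using ts(2) down ch by force+
    then have "0 \<le> embed a m h ! j" if "j < l" for j
      using that d nth_mem[of j "embed a m h"] unfolding h by fastforce
    then have "\<forall>j<l. 0 \<le> embed a m h ! j + staircase (length (embed a m h)) j"
      using \<open>length (embed a m h) = l\<close> by (simp add: staircase_def)
    then show "at_rows ?h (embed a m h) = at_rows (ups l is f) (embed a m h)"
      by (simp add: at_rows_def nonneg_part_def)
  qed
  moreover have "eval_terms (\<lambda>g. at_rows (ups l is f) (embed a m g)) ts = eval_terms (\<lambda>g. at_rows f (embed a m g)) us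
    \<and> (\<forall>t\<in>set us. length (embed a m (snd t)) = l)"
    by (rule run_ups_sound[OF f ts(3)]) (use down in auto)
  ultimately show ?thesis using down by simp
qed

end

section \<open>Certificates for products\<close>

lemma falling_times_lchar:
  assumes "0 \<notin> set rs" "0 \<notin> set is" "sum_list is \<le> z" "xs = ys @ replicate z 0"
  shows "falling is rs * lchar rs xs
    = at_rows (downs (length xs) is (nonneg_part (length xs) (ups (length xs) is (xchar (length xs) rs)))) xs"
  unfolding lchar_def at_rows_def
proof (rule falling_times_xchar[OF assms(1,2)])
  show "low (length xs) (sum_list is) (\<lambda>i. xs ! i + staircase (length xs) i)"
    unfolding low_def
  proof (intro allI impI)
    fix c assume "c < sum_list is"
    then have "c < z" using assms(3) by simp
    then show "\<exists>j<length xs. xs ! j + staircase (length xs) j = int c"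
      using assms(4) by (intro exI[of _ "length xs - 1 - c"]) (auto simp: nth_append staircase_def)
  qed
qed

lemma combine_sound:
  assumes "0 \<notin> set rs" and m: "mid \<Longrightarrow> 2 \<le> m" "\<not> mid \<Longrightarrow> m = 0" and d: "d \<le> a" "0 \<le> a"
    and g: "set (snd (snd g)) \<subseteq> {0}"
    and "\<forall>(k, is)\<in>set ops. 0 \<notin> set is \<and> sum_list is \<le> length (snd (snd g))"
    and "\<forall>t\<in>set us. length (embed a m (snd t)) = length (embed a m g)"
    and "combine mid d ops g us = Some vs"
  shows "(\<Sum>(k, is)\<leftarrow>ops. k * falling is rs) * lchar rs (embed a m g) + eval_terms (\<lambda>h. lchar rs (embed a m h)) us
    = eval_terms (\<lambda>h. lchar rs (embed a m h)) vs"
  using assms(7-)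
proof (induction ops arbitrary: us)
  case (Cons op ops)
  obtain k "is" where op: "op = (k, is)" by (cases op)
  let ?l = "length (embed a m g)"
  let ?f = "xchar ?l rs"
  obtain ts where ts: "run mid d is g = Some ts" "combine mid d ops g (absorb False k ts us) = Some vs"
    using Cons.prems(3) op by (auto split: option.splits)
  have is0: "0 \<notin> set is" "sum_list is \<le> length (snd (snd g))" using Cons.prems(1) op by auto
  obtain g1 g2 g3 where g': "g = (g1, g2, g3)" by (cases g)
  have "g3 = replicate (length g3) 0" using g g' by (intro replicate_length_same[symmetric]) auto
  then have emb: "embed a m g = (map ((+) a) g1 @ replicate m a @ map ((+) a) g2) @ replicate (length g3) 0"
    using g' by simp
  have rs: "at_rows (downs ?l is (nonneg_part ?l (ups ?l is ?f))) (embed a m g) = eval_terms (\<lambda>g. at_rows ?f (embed a m g)) ts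
    \<and> (\<forall>t\<in>set ts. length (embed a m (snd t)) = ?l)"
    by (rule run_sound[OF m alternating_xchar refl g ts(1) is0(1) d])
  have lch: "eval_terms (\<lambda>h. lchar rs (embed a m h)) ws = eval_terms (\<lambda>h. at_rows ?f (embed a m h)) ws"
    if "\<forall>t\<in>set ws. length (embed a m (snd t)) = ?l" for ws
    using that by (intro eval_terms_cong) (force simp: lchar_at)
  have fall: "falling is rs * lchar rs (embed a m g) = eval_terms (\<lambda>h. lchar rs (embed a m h)) ts"
    using falling_times_lchar[OF assms(1) is0(1) _ emb] is0(2) g' rs lch[of ts] by simp
  have abs: "\<forall>t\<in>set (absorb False k ts us). length (embed a m (snd t)) = ?l"
  proof
    fix u assume "u \<in> set (absorb False k ts us)"
    then have "snd u \<in> snd ` set ts \<or> snd u \<in> snd ` set us" using set_absorb[of "fst u" "snd u"] by simp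
    then show "length (embed a m (snd u)) = ?l"
    proof
      assume "snd u \<in> snd ` set ts"
      then obtain w where "w \<in> set ts" "snd u = snd w" by blast
      then show ?thesis using rs by simp
    next
      assume "snd u \<in> snd ` set us"
      then obtain w where "w \<in> set us" "snd u = snd w" by blast
      then show ?thesis using Cons.prems(2) by simp
    qed
  qed
  have "eval_terms (\<lambda>h. at_rows ?f (embed a m h)) (absorb False k ts us)
    = k * eval_terms (\<lambda>h. at_rows ?f (embed a m h)) ts + eval_terms (\<lambda>h. at_rows ?f (embed a m h)) us"
    by (rule eval_absorb_False)
  then have "eval_terms (\<lambda>h. lchar rs (embed a m h)) (absorb False k ts us)
    = k * eval_terms (\<lambda>h. lchar rs (embed a m h)) ts + eval_terms (\<lambda>h. lchar rs (embed a m h)) us"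
    using lch[OF abs] lch[of ts] lch[of us] rs Cons.prems(2) by simp
  moreover have "(\<Sum>(k, is)\<leftarrow>ops. k * falling is rs) * lchar rs (embed a m g)
      + eval_terms (\<lambda>h. lchar rs (embed a m h)) (absorb False k ts us) = eval_terms (\<lambda>h. lchar rs (embed a m h)) vs"
    by (rule Cons.IH[OF _ abs ts(2)]) (use Cons.prems(1) in auto)
  ultimately show ?case using fall op by (simp add: algebra_simps)
qed simp

text \<open>The target enters with negated coefficients, so the identity amounts to complete
  cancellation. The last group must consist of zero rows, enough of them to receive the added
  ribbons.\<close>

definition verify :: "bool \<Rightarrow> int \<Rightarrow> (int \<times> nat list) list \<Rightarrow> groups \<Rightarrow> (int \<times> groups) list \<Rightarrow> bool" where
  "verify mid d ops g tgt \<longleftrightarrow> combine mid d ops g (map (\<lambda>(c, h). (- c, h)) tgt) = Some []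
    \<and> list_all (\<lambda>(k, is). 0 \<notin> set is \<and> sum_list is \<le> length (snd (snd g))) ops
    \<and> list_all (\<lambda>x. x = 0) (snd (snd g)) \<and> list_all (\<lambda>(c, h). same_shape g h) tgt"

theorem verify_sound:
  assumes "verify mid d ops g tgt" "0 \<notin> set rs" "mid \<Longrightarrow> 2 \<le> m" "\<not> mid \<Longrightarrow> m = 0" "d \<le> a" "0 \<le> a"
  shows "(\<Sum>(k, is)\<leftarrow>ops. k * falling is rs) * lchar rs (embed a m g) = eval_terms (\<lambda>h. lchar rs (embed a m h)) tgt"
proof -
  note v = assms(1)[unfolded verify_def list_all_iff]
  have neg: "eval_terms G (map (\<lambda>(c, h). (- c, h)) tgt) = - eval_terms G tgt" for G :: "groups \<Rightarrow> int"
    using eval_terms_map[of G "-1" "\<lambda>h. h" tgt] by simp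
  have "length (embed a m h) = length (embed a m g)" if "same_shape g h" for h
    using that by (cases g; cases h) simp
  then have shape: "\<forall>t\<in>set (map (\<lambda>(c, h). (- c, h)) tgt). length (embed a m (snd t)) = length (embed a m g)"
    using v by fastforce
  have "(\<Sum>(k, is)\<leftarrow>ops. k * falling is rs) * lchar rs (embed a m g)
      + eval_terms (\<lambda>h. lchar rs (embed a m h)) (map (\<lambda>(c, h). (- c, h)) tgt)
    = eval_terms (\<lambda>h. lchar rs (embed a m h)) []"
  proof (rule combine_sound[OF assms(2-6) _ _ shape])
    show "set (snd (snd g)) \<subseteq> {0}" using v by auto
    show "combine mid d ops g (map (\<lambda>(c, h). (- c, h)) tgt) = Some []" using v by blast
    show "\<forall>(k, is)\<in>set ops. 0 \<notin> set is \<and> sum_list is \<le> length (snd (snd g))" using v by blast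
  qed
  then show ?thesis by (simp add: neg)
qed

text \<open>The operators amount to \<open>m1 * (m1 - 1) + 2 * m2 - 2 * m1\<close>: twice the number
  of fixed 2-subsets minus twice the number of fixed points. Applied to the trivial character of a
  single row, this is twice \<open>[n-2,2]\<close>.\<close>

lemma verify_two_two: "verify False 2 [(1, [1, 1]), (1, [2]), (-2, [1])] ([], [0], [0, 0]) [(2, ([], [-2], [2, 0]))]"
  by code_simp

text \<open>\<open>[n-2,1,1]\<close> is the exterior square of \<open>[n-1,1]\<close>, and twice its
  value is \<open>m1 * (m1 - 1) - 2 * m2 - 2 * m1 + 2\<close>.\<close>

lemma verify_two_one_one: "verify False 2 [(1, [1, 1]), (-2, [1]), (2, []), (-1, [2])] ([], [0], [0, 0]) [(2, ([], [-2], [1, 1]))]"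
  by code_simp

text \<open>Six times the number of fixed 3-subsets minus six times the number of fixed 2-subsets.
  The lists \<open>[1, 2]\<close> and \<open>[3]\<close> stand for \<open>2 * m1 * m2\<close> and
  \<open>3 * m3\<close>, whence their coefficients 3 and 2.\<close>

lemma verify_three_three: "verify False 3 [(1, [1, 1, 1]), (3, [1, 2]), (2, [3]), (-3, [1, 1]), (-3, [2])] ([], [0], [0, 0, 0])
    [(6, ([], [-3], [3, 0, 0]))]"
  by code_simp

section \<open>Products with rectangles\<close>

lemma lchar_pad:
  assumes "0 \<notin> set rs" "xs = ys @ replicate z 0"
  shows "lchar rs xs = lchar rs ys"
  unfolding assms(2) by (rule lchar_append_zeros[OF assms(1)])

lemma verify_two_two_2: "verify False 2 [(1, [1, 1]), (1, [2]), (-2, [1])] ([], [0, 0], [0, 0])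
    [(2, ([], [0, 0], [0, 0])), (2, ([], [0, -1], [1, 0])), (2, ([], [-1, -1], [1, 1])), (2, ([], [2, -2], [0, 0])), (2, ([], [1, -2], [1, 0])), (2, ([], [0, -2], [2, 0]))]"
  by code_simp

lemma verify_two_two_3: "verify False 2 [(1, [1, 1]), (1, [2]), (-2, [1])] ([], [0, 0, 0], [0, 0])
    [(2, ([], [0, 0, 0], [0, 0])), (2, ([], [0, 0, -1], [1, 0])), (2, ([], [0, -1, -1], [1, 1])), (2, ([], [1, 0, -1], [0, 0])), (2, ([], [1, -1, -1], [1, 0])), (2, ([], [2, 0, -2], [0, 0])), (2, ([], [1, 0, -2], [1, 0])), (2, ([], [0, 0, -2], [2, 0]))]"
  by code_simp

lemma verify_two_two_4: "verify False 2 [(1, [1, 1]), (1, [2]), (-2, [1])] ([], [0, 0, 0, 0], [0, 0])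
    [(2, ([], [0, 0, 0, 0], [0, 0])), (2, ([], [0, 0, 0, -1], [1, 0])), (2, ([], [0, 0, -1, -1], [1, 1])), (2, ([], [1, 1, -1, -1], [0, 0])), (2, ([], [1, 0, 0, -1], [0, 0])), (2, ([], [1, 0, -1, -1], [1, 0])), (2, ([], [2, 0, 0, -2], [0, 0])), (2, ([], [1, 0, 0, -2], [1, 0])), (2, ([], [0, 0, 0, -2], [2, 0]))]"
  by code_simp

lemma verify_two_two_5: "verify False 2 [(1, [1, 1]), (1, [2]), (-2, [1])] ([], [0, 0, 0, 0, 0], [0, 0])
    [(2, ([], [0, 0, 0, 0, 0], [0, 0])), (2, ([], [0, 0, 0, 0, -1], [1, 0])), (2, ([], [0, 0, 0, -1, -1], [1, 1])), (2, ([], [1, 1, 0, -1, -1], [0, 0])), (2, ([], [1, 0, 0, 0, -1], [0, 0])), (2, ([], [1, 0, 0, -1, -1], [1, 0])), (2, ([], [2, 0, 0, 0, -2], [0, 0])), (2, ([], [1, 0, 0, 0, -2], [1, 0])), (2, ([], [0, 0, 0, 0, -2], [2, 0]))]"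
  by code_simp

text \<open>Covers all heights from 6 on: two corner rows at the top, two at the bottom and a block
  of at least two rows between them. The heights 2 to 5 have certificates of their own.\<close>

lemma verify_two_two_middle: "verify True 2 [(1, [1, 1]), (1, [2]), (-2, [1])] ([0, 0], [0, 0], [0, 0])
    [(2, ([0, 0], [0, 0], [0, 0])), (2, ([0, 0], [0, -1], [1, 0])), (2, ([0, 0], [-1, -1], [1, 1])), (2, ([1, 1], [-1, -1], [0, 0])), (2, ([1, 0], [0, -1], [0, 0])), (2, ([1, 0], [-1, -1], [1, 0])), (2, ([2, 0], [0, -2], [0, 0])), (2, ([1, 0], [0, -2], [1, 0])), (2, ([0, 0], [0, -2], [2, 0]))]"
  by code_simp

lemma verify_two_one_one_2: "verify False 2 [(1, [1, 1]), (-2, [1]), (2, []), (-1, [2])] ([], [0, 0], [0, 0])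
    [(2, ([], [1, -1], [0, 0])), (2, ([], [1, -2], [1, 0])), (2, ([], [-1, -1], [2, 0])), (2, ([], [0, -2], [1, 1])), (2, ([], [0, -1], [1, 0]))]"
  by code_simp

lemma verify_two_one_one_3: "verify False 2 [(1, [1, 1]), (-2, [1]), (2, []), (-1, [2])] ([], [0, 0, 0], [0, 0])
    [(2, ([], [2, -1, -1], [0, 0])), (2, ([], [1, 0, -1], [0, 0])), (2, ([], [1, 0, -2], [1, 0])), (2, ([], [0, -1, -1], [2, 0])), (2, ([], [1, -1, -1], [1, 0])), (2, ([], [1, 1, -2], [0, 0])), (2, ([], [0, 0, -2], [1, 1])), (2, ([], [0, 0, -1], [1, 0]))]"
  by code_simp

lemma verify_two_one_one_4: "verify False 2 [(1, [1, 1]), (-2, [1]), (2, []), (-1, [2])] ([], [0, 0, 0, 0], [0, 0])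
    [(2, ([], [2, 0, -1, -1], [0, 0])), (2, ([], [1, 0, 0, -1], [0, 0])), (2, ([], [1, 0, 0, -2], [1, 0])), (2, ([], [0, 0, -1, -1], [2, 0])), (2, ([], [1, 0, -1, -1], [1, 0])), (2, ([], [1, 1, 0, -2], [0, 0])), (2, ([], [0, 0, 0, -2], [1, 1])), (2, ([], [0, 0, 0, -1], [1, 0]))]"
  by code_simp

lemma verify_two_one_one_5: "verify False 2 [(1, [1, 1]), (-2, [1]), (2, []), (-1, [2])] ([], [0, 0, 0, 0, 0], [0, 0])
    [(2, ([], [2, 0, 0, -1, -1], [0, 0])), (2, ([], [1, 0, 0, 0, -1], [0, 0])), (2, ([], [1, 0, 0, 0, -2], [1, 0])), (2, ([], [0, 0, 0, -1, -1], [2, 0])), (2, ([], [1, 0, 0, -1, -1], [1, 0])), (2, ([], [1, 1, 0, 0, -2], [0, 0])), (2, ([], [0, 0, 0, 0, -2], [1, 1])), (2, ([], [0, 0, 0, 0, -1], [1, 0]))]"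
  by code_simp

lemma verify_two_one_one_middle: "verify True 2 [(1, [1, 1]), (-2, [1]), (2, []), (-1, [2])] ([0, 0], [0, 0], [0, 0])
    [(2, ([2, 0], [-1, -1], [0, 0])), (2, ([1, 0], [0, -1], [0, 0])), (2, ([1, 0], [0, -2], [1, 0])), (2, ([0, 0], [-1, -1], [2, 0])), (2, ([1, 0], [-1, -1], [1, 0])), (2, ([1, 1], [0, -2], [0, 0])), (2, ([0, 0], [0, -2], [1, 1])), (2, ([0, 0], [0, -1], [1, 0]))]"
  by code_simp

text \<open>The identity for generic \<open>a\<close>: the terms that degenerate for
  \<open>a = 2\<close> or \<open>a = 3\<close> are kept as they stand, although they need not be
  weakly decreasing. They are straightened only when characters are formed.\<close>

lemma lchar_two_two_rectangle:
  assumes rs: "0 \<notin> set rs" and a: "2 \<le> a" and b: "2 \<le> b"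
  shows "(\<Sum>(k, is)\<leftarrow>[(1, [1, 1]), (1, [2]), (-2, [1])]. k * falling is rs) * lchar rs (map int (replicate b a)) =
    2 * (lchar rs (map int (replicate b a))
      + lchar rs (map int (replicate (b - 1) a @ [a - 1, 1]))
      + lchar rs (map int (replicate (b - 2) a @ [a - 1, a - 1, 1, 1]))
      + (if b > 3 then lchar rs (map int ([a + 1, a + 1] @ replicate (b - 4) a @ [a - 1, a - 1])) else 0)
      + (if b > 2 then lchar rs (map int ([a + 1] @ replicate (b - 2) a @ [a - 1])) else 0)
      + (if b > 2 then lchar rs (map int ([a + 1] @ replicate (b - 3) a @ [a - 1, a - 1, 1])) else 0)
      + lchar rs (map int ([a + 2] @ replicate (b - 2) a @ [a - 2]))
      + lchar rs (map int ([a + 1] @ replicate (b - 2) a @ [a - 2, 1]))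
      + lchar rs (map int (replicate (b - 1) a) @ [int a - 2, 2]))"
proof -
  consider "b = 2" | "b = 3" | "b = 4" | "b = 5" | "6 \<le> b"
    using b by linarith
  then show ?thesis
  proof cases
    case 1
    note v = verify_sound[OF verify_two_two_2 rs, of 0 "int a"]
    have e0: "lchar rs (embed (int a) 0 ([], [0, 0], [0, 0])) = lchar rs (map int (replicate b a))"
      by (rule lchar_pad[OF rs, of _ _ 2]) (simp add: 1 numeral_eq_Suc replicate_app_Cons_same)
    have e1: "lchar rs (embed (int a) 0 ([], [0, 0], [0, 0])) = lchar rs (map int (replicate b a))"
      by (rule lchar_pad[OF rs, of _ _ 2]) (use a in \<open>simp add: 1 numeral_eq_Suc replicate_app_Cons_same of_nat_diff\<close>)
    have e2: "lchar rs (embed (int a) 0 ([], [0, -1], [1, 0])) = lchar rs (map int (replicate (b - 1) a @ [a - 1, 1]))"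
      by (rule lchar_pad[OF rs, of _ _ 1]) (use a in \<open>simp add: 1 numeral_eq_Suc replicate_app_Cons_same of_nat_diff\<close>)
    have e3: "lchar rs (embed (int a) 0 ([], [-1, -1], [1, 1])) = lchar rs (map int (replicate (b - 2) a @ [a - 1, a - 1, 1, 1]))"
      by (rule lchar_pad[OF rs, of _ _ 0]) (use a in \<open>simp add: 1 numeral_eq_Suc replicate_app_Cons_same of_nat_diff\<close>)
    have e4: "lchar rs (embed (int a) 0 ([], [2, -2], [0, 0])) = lchar rs (map int ([a + 2] @ replicate (b - 2) a @ [a - 2]))"
      by (rule lchar_pad[OF rs, of _ _ 2]) (use a in \<open>simp add: 1 numeral_eq_Suc replicate_app_Cons_same of_nat_diff\<close>)
    have e5: "lchar rs (embed (int a) 0 ([], [1, -2], [1, 0])) = lchar rs (map int ([a + 1] @ replicate (b - 2) a @ [a - 2, 1]))"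
      by (rule lchar_pad[OF rs, of _ _ 1]) (use a in \<open>simp add: 1 numeral_eq_Suc replicate_app_Cons_same of_nat_diff\<close>)
    have e6: "lchar rs (embed (int a) 0 ([], [0, -2], [2, 0])) = lchar rs (map int (replicate (b - 1) a) @ [int a - 2, 2])"
      by (rule lchar_pad[OF rs, of _ _ 1]) (use a in \<open>simp add: 1 numeral_eq_Suc replicate_app_Cons_same of_nat_diff\<close>)
    show ?thesis
      using v a by (simp only: e0 e1 e2 e3 e4 e5 e6 eval_terms_simps) (simp add: 1)
  next
    case 2
    note v = verify_sound[OF verify_two_two_3 rs, of 0 "int a"]
    have e0: "lchar rs (embed (int a) 0 ([], [0, 0, 0], [0, 0])) = lchar rs (map int (replicate b a))"
      by (rule lchar_pad[OF rs, of _ _ 2]) (simp add: 2 numeral_eq_Suc replicate_app_Cons_same)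
    have e1: "lchar rs (embed (int a) 0 ([], [0, 0, 0], [0, 0])) = lchar rs (map int (replicate b a))"
      by (rule lchar_pad[OF rs, of _ _ 2]) (use a in \<open>simp add: 2 numeral_eq_Suc replicate_app_Cons_same of_nat_diff\<close>)
    have e2: "lchar rs (embed (int a) 0 ([], [0, 0, -1], [1, 0])) = lchar rs (map int (replicate (b - 1) a @ [a - 1, 1]))"
      by (rule lchar_pad[OF rs, of _ _ 1]) (use a in \<open>simp add: 2 numeral_eq_Suc replicate_app_Cons_same of_nat_diff\<close>)
    have e3: "lchar rs (embed (int a) 0 ([], [0, -1, -1], [1, 1])) = lchar rs (map int (replicate (b - 2) a @ [a - 1, a - 1, 1, 1]))"
      by (rule lchar_pad[OF rs, of _ _ 0]) (use a in \<open>simp add: 2 numeral_eq_Suc replicate_app_Cons_same of_nat_diff\<close>)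
    have e4: "lchar rs (embed (int a) 0 ([], [1, 0, -1], [0, 0])) = lchar rs (map int ([a + 1] @ replicate (b - 2) a @ [a - 1]))"
      by (rule lchar_pad[OF rs, of _ _ 2]) (use a in \<open>simp add: 2 numeral_eq_Suc replicate_app_Cons_same of_nat_diff\<close>)
    have e5: "lchar rs (embed (int a) 0 ([], [1, -1, -1], [1, 0])) = lchar rs (map int ([a + 1] @ replicate (b - 3) a @ [a - 1, a - 1, 1]))"
      by (rule lchar_pad[OF rs, of _ _ 1]) (use a in \<open>simp add: 2 numeral_eq_Suc replicate_app_Cons_same of_nat_diff\<close>)
    have e6: "lchar rs (embed (int a) 0 ([], [2, 0, -2], [0, 0])) = lchar rs (map int ([a + 2] @ replicate (b - 2) a @ [a - 2]))"
      by (rule lchar_pad[OF rs, of _ _ 2]) (use a in \<open>simp add: 2 numeral_eq_Suc replicate_app_Cons_same of_nat_diff\<close>)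
    have e7: "lchar rs (embed (int a) 0 ([], [1, 0, -2], [1, 0])) = lchar rs (map int ([a + 1] @ replicate (b - 2) a @ [a - 2, 1]))"
      by (rule lchar_pad[OF rs, of _ _ 1]) (use a in \<open>simp add: 2 numeral_eq_Suc replicate_app_Cons_same of_nat_diff\<close>)
    have e8: "lchar rs (embed (int a) 0 ([], [0, 0, -2], [2, 0])) = lchar rs (map int (replicate (b - 1) a) @ [int a - 2, 2])"
      by (rule lchar_pad[OF rs, of _ _ 1]) (use a in \<open>simp add: 2 numeral_eq_Suc replicate_app_Cons_same of_nat_diff\<close>)
    show ?thesis
      using v a by (simp only: e0 e1 e2 e3 e4 e5 e6 e7 e8 eval_terms_simps) (simp add: 2)
  next
    case 3
    note v = verify_sound[OF verify_two_two_4 rs, of 0 "int a"]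
    have e0: "lchar rs (embed (int a) 0 ([], [0, 0, 0, 0], [0, 0])) = lchar rs (map int (replicate b a))"
      by (rule lchar_pad[OF rs, of _ _ 2]) (simp add: 3 numeral_eq_Suc replicate_app_Cons_same)
    have e1: "lchar rs (embed (int a) 0 ([], [0, 0, 0, 0], [0, 0])) = lchar rs (map int (replicate b a))"
      by (rule lchar_pad[OF rs, of _ _ 2]) (use a in \<open>simp add: 3 numeral_eq_Suc replicate_app_Cons_same of_nat_diff\<close>)
    have e2: "lchar rs (embed (int a) 0 ([], [0, 0, 0, -1], [1, 0])) = lchar rs (map int (replicate (b - 1) a @ [a - 1, 1]))"
      by (rule lchar_pad[OF rs, of _ _ 1]) (use a in \<open>simp add: 3 numeral_eq_Suc replicate_app_Cons_same of_nat_diff\<close>)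
    have e3: "lchar rs (embed (int a) 0 ([], [0, 0, -1, -1], [1, 1])) = lchar rs (map int (replicate (b - 2) a @ [a - 1, a - 1, 1, 1]))"
      by (rule lchar_pad[OF rs, of _ _ 0]) (use a in \<open>simp add: 3 numeral_eq_Suc replicate_app_Cons_same of_nat_diff\<close>)
    have e4: "lchar rs (embed (int a) 0 ([], [1, 1, -1, -1], [0, 0])) = lchar rs (map int ([a + 1, a + 1] @ replicate (b - 4) a @ [a - 1, a - 1]))"
      by (rule lchar_pad[OF rs, of _ _ 2]) (use a in \<open>simp add: 3 numeral_eq_Suc replicate_app_Cons_same of_nat_diff\<close>)
    have e5: "lchar rs (embed (int a) 0 ([], [1, 0, 0, -1], [0, 0])) = lchar rs (map int ([a + 1] @ replicate (b - 2) a @ [a - 1]))"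
      by (rule lchar_pad[OF rs, of _ _ 2]) (use a in \<open>simp add: 3 numeral_eq_Suc replicate_app_Cons_same of_nat_diff\<close>)
    have e6: "lchar rs (embed (int a) 0 ([], [1, 0, -1, -1], [1, 0])) = lchar rs (map int ([a + 1] @ replicate (b - 3) a @ [a - 1, a - 1, 1]))"
      by (rule lchar_pad[OF rs, of _ _ 1]) (use a in \<open>simp add: 3 numeral_eq_Suc replicate_app_Cons_same of_nat_diff\<close>)
    have e7: "lchar rs (embed (int a) 0 ([], [2, 0, 0, -2], [0, 0])) = lchar rs (map int ([a + 2] @ replicate (b - 2) a @ [a - 2]))"
      by (rule lchar_pad[OF rs, of _ _ 2]) (use a in \<open>simp add: 3 numeral_eq_Suc replicate_app_Cons_same of_nat_diff\<close>)
    have e8: "lchar rs (embed (int a) 0 ([], [1, 0, 0, -2], [1, 0])) = lchar rs (map int ([a + 1] @ replicate (b - 2) a @ [a - 2, 1]))"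
      by (rule lchar_pad[OF rs, of _ _ 1]) (use a in \<open>simp add: 3 numeral_eq_Suc replicate_app_Cons_same of_nat_diff\<close>)
    have e9: "lchar rs (embed (int a) 0 ([], [0, 0, 0, -2], [2, 0])) = lchar rs (map int (replicate (b - 1) a) @ [int a - 2, 2])"
      by (rule lchar_pad[OF rs, of _ _ 1]) (use a in \<open>simp add: 3 numeral_eq_Suc replicate_app_Cons_same of_nat_diff\<close>)
    show ?thesis
      using v a by (simp only: e0 e1 e2 e3 e4 e5 e6 e7 e8 e9 eval_terms_simps) (simp add: 3)
  next
    case 4
    note v = verify_sound[OF verify_two_two_5 rs, of 0 "int a"]
    have e0: "lchar rs (embed (int a) 0 ([], [0, 0, 0, 0, 0], [0, 0])) = lchar rs (map int (replicate b a))"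
      by (rule lchar_pad[OF rs, of _ _ 2]) (simp add: 4 numeral_eq_Suc replicate_app_Cons_same)
    have e1: "lchar rs (embed (int a) 0 ([], [0, 0, 0, 0, 0], [0, 0])) = lchar rs (map int (replicate b a))"
      by (rule lchar_pad[OF rs, of _ _ 2]) (use a in \<open>simp add: 4 numeral_eq_Suc replicate_app_Cons_same of_nat_diff\<close>)
    have e2: "lchar rs (embed (int a) 0 ([], [0, 0, 0, 0, -1], [1, 0])) = lchar rs (map int (replicate (b - 1) a @ [a - 1, 1]))"
      by (rule lchar_pad[OF rs, of _ _ 1]) (use a in \<open>simp add: 4 numeral_eq_Suc replicate_app_Cons_same of_nat_diff\<close>)
    have e3: "lchar rs (embed (int a) 0 ([], [0, 0, 0, -1, -1], [1, 1])) = lchar rs (map int (replicate (b - 2) a @ [a - 1, a - 1, 1, 1]))"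
      by (rule lchar_pad[OF rs, of _ _ 0]) (use a in \<open>simp add: 4 numeral_eq_Suc replicate_app_Cons_same of_nat_diff\<close>)
    have e4: "lchar rs (embed (int a) 0 ([], [1, 1, 0, -1, -1], [0, 0])) = lchar rs (map int ([a + 1, a + 1] @ replicate (b - 4) a @ [a - 1, a - 1]))"
      by (rule lchar_pad[OF rs, of _ _ 2]) (use a in \<open>simp add: 4 numeral_eq_Suc replicate_app_Cons_same of_nat_diff\<close>)
    have e5: "lchar rs (embed (int a) 0 ([], [1, 0, 0, 0, -1], [0, 0])) = lchar rs (map int ([a + 1] @ replicate (b - 2) a @ [a - 1]))"
      by (rule lchar_pad[OF rs, of _ _ 2]) (use a in \<open>simp add: 4 numeral_eq_Suc replicate_app_Cons_same of_nat_diff\<close>)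
    have e6: "lchar rs (embed (int a) 0 ([], [1, 0, 0, -1, -1], [1, 0])) = lchar rs (map int ([a + 1] @ replicate (b - 3) a @ [a - 1, a - 1, 1]))"
      by (rule lchar_pad[OF rs, of _ _ 1]) (use a in \<open>simp add: 4 numeral_eq_Suc replicate_app_Cons_same of_nat_diff\<close>)
    have e7: "lchar rs (embed (int a) 0 ([], [2, 0, 0, 0, -2], [0, 0])) = lchar rs (map int ([a + 2] @ replicate (b - 2) a @ [a - 2]))"
      by (rule lchar_pad[OF rs, of _ _ 2]) (use a in \<open>simp add: 4 numeral_eq_Suc replicate_app_Cons_same of_nat_diff\<close>)
    have e8: "lchar rs (embed (int a) 0 ([], [1, 0, 0, 0, -2], [1, 0])) = lchar rs (map int ([a + 1] @ replicate (b - 2) a @ [a - 2, 1]))"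
      by (rule lchar_pad[OF rs, of _ _ 1]) (use a in \<open>simp add: 4 numeral_eq_Suc replicate_app_Cons_same of_nat_diff\<close>)
    have e9: "lchar rs (embed (int a) 0 ([], [0, 0, 0, 0, -2], [2, 0])) = lchar rs (map int (replicate (b - 1) a) @ [int a - 2, 2])"
      by (rule lchar_pad[OF rs, of _ _ 1]) (use a in \<open>simp add: 4 numeral_eq_Suc replicate_app_Cons_same of_nat_diff\<close>)
    show ?thesis
      using v a by (simp only: e0 e1 e2 e3 e4 e5 e6 e7 e8 e9 eval_terms_simps) (simp add: 4)
  next
    case 5
    then obtain k where k: "b = k + 6" using le_Suc_ex add.commute by metis
    \<comment> \<open>Two corner rows at either end leave \<open>b - 4 = k + 2\<close> middle
      rows.\<close>
    note v = verify_sound[OF verify_two_two_middle rs, of "k + 2" "int a"]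
    have e0: "lchar rs (embed (int a) (k + 2) ([0, 0], [0, 0], [0, 0])) = lchar rs (map int (replicate b a))"
      by (rule lchar_pad[OF rs, of _ _ 2]) (simp add: k numeral_eq_Suc replicate_app_Cons_same)
    have e1: "lchar rs (embed (int a) (k + 2) ([0, 0], [0, 0], [0, 0])) = lchar rs (map int (replicate b a))"
      by (rule lchar_pad[OF rs, of _ _ 2]) (use a in \<open>simp add: k numeral_eq_Suc replicate_app_Cons_same of_nat_diff\<close>)
    have e2: "lchar rs (embed (int a) (k + 2) ([0, 0], [0, -1], [1, 0])) = lchar rs (map int (replicate (b - 1) a @ [a - 1, 1]))"
      by (rule lchar_pad[OF rs, of _ _ 1]) (use a in \<open>simp add: k numeral_eq_Suc replicate_app_Cons_same of_nat_diff\<close>)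
    have e3: "lchar rs (embed (int a) (k + 2) ([0, 0], [-1, -1], [1, 1])) = lchar rs (map int (replicate (b - 2) a @ [a - 1, a - 1, 1, 1]))"
      by (rule lchar_pad[OF rs, of _ _ 0]) (use a in \<open>simp add: k numeral_eq_Suc replicate_app_Cons_same of_nat_diff\<close>)
    have e4: "lchar rs (embed (int a) (k + 2) ([1, 1], [-1, -1], [0, 0])) = lchar rs (map int ([a + 1, a + 1] @ replicate (b - 4) a @ [a - 1, a - 1]))"
      by (rule lchar_pad[OF rs, of _ _ 2]) (use a in \<open>simp add: k numeral_eq_Suc replicate_app_Cons_same of_nat_diff\<close>)
    have e5: "lchar rs (embed (int a) (k + 2) ([1, 0], [0, -1], [0, 0])) = lchar rs (map int ([a + 1] @ replicate (b - 2) a @ [a - 1]))"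
      by (rule lchar_pad[OF rs, of _ _ 2]) (use a in \<open>simp add: k numeral_eq_Suc replicate_app_Cons_same of_nat_diff\<close>)
    have e6: "lchar rs (embed (int a) (k + 2) ([1, 0], [-1, -1], [1, 0])) = lchar rs (map int ([a + 1] @ replicate (b - 3) a @ [a - 1, a - 1, 1]))"
      by (rule lchar_pad[OF rs, of _ _ 1]) (use a in \<open>simp add: k numeral_eq_Suc replicate_app_Cons_same of_nat_diff\<close>)
    have e7: "lchar rs (embed (int a) (k + 2) ([2, 0], [0, -2], [0, 0])) = lchar rs (map int ([a + 2] @ replicate (b - 2) a @ [a - 2]))"
      by (rule lchar_pad[OF rs, of _ _ 2]) (use a in \<open>simp add: k numeral_eq_Suc replicate_app_Cons_same of_nat_diff\<close>)
    have e8: "lchar rs (embed (int a) (k + 2) ([1, 0], [0, -2], [1, 0])) = lchar rs (map int ([a + 1] @ replicate (b - 2) a @ [a - 2, 1]))"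
      by (rule lchar_pad[OF rs, of _ _ 1]) (use a in \<open>simp add: k numeral_eq_Suc replicate_app_Cons_same of_nat_diff\<close>)
    have e9: "lchar rs (embed (int a) (k + 2) ([0, 0], [0, -2], [2, 0])) = lchar rs (map int (replicate (b - 1) a) @ [int a - 2, 2])"
      by (rule lchar_pad[OF rs, of _ _ 1]) (use a in \<open>simp add: k numeral_eq_Suc replicate_app_Cons_same of_nat_diff\<close>)
    show ?thesis
      using v a by (simp only: e0 e1 e2 e3 e4 e5 e6 e7 e8 e9 eval_terms_simps) (simp add: k)
  qed
qed

text \<open>Again the generic identity, with degenerate terms kept for \<open>a = 2\<close>; small
  heights are separate and the block of \<open>b - 4\<close> rows serves from height 6 on.\<close>

lemma lchar_two_one_one_rectangle:
  assumes rs: "0 \<notin> set rs" and a: "2 \<le> a" and b: "2 \<le> b"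
  shows "(\<Sum>(k, is)\<leftarrow>[(1, [1, 1]), (-2, [1]), (2, []), (-1, [2])]. k * falling is rs) * lchar rs (map int (replicate b a)) =
    2 * ((if b > 2 then lchar rs (map int ([a + 2] @ replicate (b - 3) a @ [a - 1, a - 1])) else 0)
      + lchar rs (map int ([a + 1] @ replicate (b - 2) a @ [a - 1]))
      + lchar rs (map int ([a + 1] @ replicate (b - 2) a @ [a - 2, 1]))
      + lchar rs (map int (replicate (b - 2) a @ [a - 1, a - 1, 2]))
      + (if b > 2 then lchar rs (map int ([a + 1] @ replicate (b - 3) a @ [a - 1, a - 1, 1])) else 0)
      + (if b > 2 then lchar rs (map int ([a + 1, a + 1] @ replicate (b - 3) a @ [a - 2])) else 0)
      + lchar rs (map int (replicate (b - 1) a @ [a - 2, 1, 1]))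
      + lchar rs (map int (replicate (b - 1) a @ [a - 1, 1])))"
proof -
  consider "b = 2" | "b = 3" | "b = 4" | "b = 5" | "6 \<le> b"
    using b by linarith
  then show ?thesis
  proof cases
    case 1
    note v = verify_sound[OF verify_two_one_one_2 rs, of 0 "int a"]
    have e0: "lchar rs (embed (int a) 0 ([], [0, 0], [0, 0])) = lchar rs (map int (replicate b a))"
      by (rule lchar_pad[OF rs, of _ _ 2]) (simp add: 1 numeral_eq_Suc replicate_app_Cons_same)
    have e1: "lchar rs (embed (int a) 0 ([], [1, -1], [0, 0])) = lchar rs (map int ([a + 1] @ replicate (b - 2) a @ [a - 1]))"
      by (rule lchar_pad[OF rs, of _ _ 2]) (use a in \<open>simp add: 1 numeral_eq_Suc replicate_app_Cons_same of_nat_diff\<close>)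
    have e2: "lchar rs (embed (int a) 0 ([], [1, -2], [1, 0])) = lchar rs (map int ([a + 1] @ replicate (b - 2) a @ [a - 2, 1]))"
      by (rule lchar_pad[OF rs, of _ _ 1]) (use a in \<open>simp add: 1 numeral_eq_Suc replicate_app_Cons_same of_nat_diff\<close>)
    have e3: "lchar rs (embed (int a) 0 ([], [-1, -1], [2, 0])) = lchar rs (map int (replicate (b - 2) a @ [a - 1, a - 1, 2]))"
      by (rule lchar_pad[OF rs, of _ _ 1]) (use a in \<open>simp add: 1 numeral_eq_Suc replicate_app_Cons_same of_nat_diff\<close>)
    have e4: "lchar rs (embed (int a) 0 ([], [0, -2], [1, 1])) = lchar rs (map int (replicate (b - 1) a @ [a - 2, 1, 1]))"
      by (rule lchar_pad[OF rs, of _ _ 0]) (use a in \<open>simp add: 1 numeral_eq_Suc replicate_app_Cons_same of_nat_diff\<close>)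
    have e5: "lchar rs (embed (int a) 0 ([], [0, -1], [1, 0])) = lchar rs (map int (replicate (b - 1) a @ [a - 1, 1]))"
      by (rule lchar_pad[OF rs, of _ _ 1]) (use a in \<open>simp add: 1 numeral_eq_Suc replicate_app_Cons_same of_nat_diff\<close>)
    show ?thesis
      using v a by (simp only: e0 e1 e2 e3 e4 e5 eval_terms_simps) (simp add: 1)
  next
    case 2
    note v = verify_sound[OF verify_two_one_one_3 rs, of 0 "int a"]
    have e0: "lchar rs (embed (int a) 0 ([], [0, 0, 0], [0, 0])) = lchar rs (map int (replicate b a))"
      by (rule lchar_pad[OF rs, of _ _ 2]) (simp add: 2 numeral_eq_Suc replicate_app_Cons_same)
    have e1: "lchar rs (embed (int a) 0 ([], [2, -1, -1], [0, 0])) = lchar rs (map int ([a + 2] @ replicate (b - 3) a @ [a - 1, a - 1]))"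
      by (rule lchar_pad[OF rs, of _ _ 2]) (use a in \<open>simp add: 2 numeral_eq_Suc replicate_app_Cons_same of_nat_diff\<close>)
    have e2: "lchar rs (embed (int a) 0 ([], [1, 0, -1], [0, 0])) = lchar rs (map int ([a + 1] @ replicate (b - 2) a @ [a - 1]))"
      by (rule lchar_pad[OF rs, of _ _ 2]) (use a in \<open>simp add: 2 numeral_eq_Suc replicate_app_Cons_same of_nat_diff\<close>)
    have e3: "lchar rs (embed (int a) 0 ([], [1, 0, -2], [1, 0])) = lchar rs (map int ([a + 1] @ replicate (b - 2) a @ [a - 2, 1]))"
      by (rule lchar_pad[OF rs, of _ _ 1]) (use a in \<open>simp add: 2 numeral_eq_Suc replicate_app_Cons_same of_nat_diff\<close>)
    have e4: "lchar rs (embed (int a) 0 ([], [0, -1, -1], [2, 0])) = lchar rs (map int (replicate (b - 2) a @ [a - 1, a - 1, 2]))"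
      by (rule lchar_pad[OF rs, of _ _ 1]) (use a in \<open>simp add: 2 numeral_eq_Suc replicate_app_Cons_same of_nat_diff\<close>)
    have e5: "lchar rs (embed (int a) 0 ([], [1, -1, -1], [1, 0])) = lchar rs (map int ([a + 1] @ replicate (b - 3) a @ [a - 1, a - 1, 1]))"
      by (rule lchar_pad[OF rs, of _ _ 1]) (use a in \<open>simp add: 2 numeral_eq_Suc replicate_app_Cons_same of_nat_diff\<close>)
    have e6: "lchar rs (embed (int a) 0 ([], [1, 1, -2], [0, 0])) = lchar rs (map int ([a + 1, a + 1] @ replicate (b - 3) a @ [a - 2]))"
      by (rule lchar_pad[OF rs, of _ _ 2]) (use a in \<open>simp add: 2 numeral_eq_Suc replicate_app_Cons_same of_nat_diff\<close>)
    have e7: "lchar rs (embed (int a) 0 ([], [0, 0, -2], [1, 1])) = lchar rs (map int (replicate (b - 1) a @ [a - 2, 1, 1]))"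
      by (rule lchar_pad[OF rs, of _ _ 0]) (use a in \<open>simp add: 2 numeral_eq_Suc replicate_app_Cons_same of_nat_diff\<close>)
    have e8: "lchar rs (embed (int a) 0 ([], [0, 0, -1], [1, 0])) = lchar rs (map int (replicate (b - 1) a @ [a - 1, 1]))"
      by (rule lchar_pad[OF rs, of _ _ 1]) (use a in \<open>simp add: 2 numeral_eq_Suc replicate_app_Cons_same of_nat_diff\<close>)
    show ?thesis
      using v a by (simp only: e0 e1 e2 e3 e4 e5 e6 e7 e8 eval_terms_simps) (simp add: 2)
  next
    case 3
    note v = verify_sound[OF verify_two_one_one_4 rs, of 0 "int a"]
    have e0: "lchar rs (embed (int a) 0 ([], [0, 0, 0, 0], [0, 0])) = lchar rs (map int (replicate b a))"
      by (rule lchar_pad[OF rs, of _ _ 2]) (simp add: 3 numeral_eq_Suc replicate_app_Cons_same)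
    have e1: "lchar rs (embed (int a) 0 ([], [2, 0, -1, -1], [0, 0])) = lchar rs (map int ([a + 2] @ replicate (b - 3) a @ [a - 1, a - 1]))"
      by (rule lchar_pad[OF rs, of _ _ 2]) (use a in \<open>simp add: 3 numeral_eq_Suc replicate_app_Cons_same of_nat_diff\<close>)
    have e2: "lchar rs (embed (int a) 0 ([], [1, 0, 0, -1], [0, 0])) = lchar rs (map int ([a + 1] @ replicate (b - 2) a @ [a - 1]))"
      by (rule lchar_pad[OF rs, of _ _ 2]) (use a in \<open>simp add: 3 numeral_eq_Suc replicate_app_Cons_same of_nat_diff\<close>)
    have e3: "lchar rs (embed (int a) 0 ([], [1, 0, 0, -2], [1, 0])) = lchar rs (map int ([a + 1] @ replicate (b - 2) a @ [a - 2, 1]))"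
      by (rule lchar_pad[OF rs, of _ _ 1]) (use a in \<open>simp add: 3 numeral_eq_Suc replicate_app_Cons_same of_nat_diff\<close>)
    have e4: "lchar rs (embed (int a) 0 ([], [0, 0, -1, -1], [2, 0])) = lchar rs (map int (replicate (b - 2) a @ [a - 1, a - 1, 2]))"
      by (rule lchar_pad[OF rs, of _ _ 1]) (use a in \<open>simp add: 3 numeral_eq_Suc replicate_app_Cons_same of_nat_diff\<close>)
    have e5: "lchar rs (embed (int a) 0 ([], [1, 0, -1, -1], [1, 0])) = lchar rs (map int ([a + 1] @ replicate (b - 3) a @ [a - 1, a - 1, 1]))"
      by (rule lchar_pad[OF rs, of _ _ 1]) (use a in \<open>simp add: 3 numeral_eq_Suc replicate_app_Cons_same of_nat_diff\<close>)
    have e6: "lchar rs (embed (int a) 0 ([], [1, 1, 0, -2], [0, 0])) = lchar rs (map int ([a + 1, a + 1] @ replicate (b - 3) a @ [a - 2]))"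
      by (rule lchar_pad[OF rs, of _ _ 2]) (use a in \<open>simp add: 3 numeral_eq_Suc replicate_app_Cons_same of_nat_diff\<close>)
    have e7: "lchar rs (embed (int a) 0 ([], [0, 0, 0, -2], [1, 1])) = lchar rs (map int (replicate (b - 1) a @ [a - 2, 1, 1]))"
      by (rule lchar_pad[OF rs, of _ _ 0]) (use a in \<open>simp add: 3 numeral_eq_Suc replicate_app_Cons_same of_nat_diff\<close>)
    have e8: "lchar rs (embed (int a) 0 ([], [0, 0, 0, -1], [1, 0])) = lchar rs (map int (replicate (b - 1) a @ [a - 1, 1]))"
      by (rule lchar_pad[OF rs, of _ _ 1]) (use a in \<open>simp add: 3 numeral_eq_Suc replicate_app_Cons_same of_nat_diff\<close>)
    show ?thesis
      using v a by (simp only: e0 e1 e2 e3 e4 e5 e6 e7 e8 eval_terms_simps) (simp add: 3)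
  next
    case 4
    note v = verify_sound[OF verify_two_one_one_5 rs, of 0 "int a"]
    have e0: "lchar rs (embed (int a) 0 ([], [0, 0, 0, 0, 0], [0, 0])) = lchar rs (map int (replicate b a))"
      by (rule lchar_pad[OF rs, of _ _ 2]) (simp add: 4 numeral_eq_Suc replicate_app_Cons_same)
    have e1: "lchar rs (embed (int a) 0 ([], [2, 0, 0, -1, -1], [0, 0])) = lchar rs (map int ([a + 2] @ replicate (b - 3) a @ [a - 1, a - 1]))"
      by (rule lchar_pad[OF rs, of _ _ 2]) (use a in \<open>simp add: 4 numeral_eq_Suc replicate_app_Cons_same of_nat_diff\<close>)
    have e2: "lchar rs (embed (int a) 0 ([], [1, 0, 0, 0, -1], [0, 0])) = lchar rs (map int ([a + 1] @ replicate (b - 2) a @ [a - 1]))"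
      by (rule lchar_pad[OF rs, of _ _ 2]) (use a in \<open>simp add: 4 numeral_eq_Suc replicate_app_Cons_same of_nat_diff\<close>)
    have e3: "lchar rs (embed (int a) 0 ([], [1, 0, 0, 0, -2], [1, 0])) = lchar rs (map int ([a + 1] @ replicate (b - 2) a @ [a - 2, 1]))"
      by (rule lchar_pad[OF rs, of _ _ 1]) (use a in \<open>simp add: 4 numeral_eq_Suc replicate_app_Cons_same of_nat_diff\<close>)
    have e4: "lchar rs (embed (int a) 0 ([], [0, 0, 0, -1, -1], [2, 0])) = lchar rs (map int (replicate (b - 2) a @ [a - 1, a - 1, 2]))"
      by (rule lchar_pad[OF rs, of _ _ 1]) (use a in \<open>simp add: 4 numeral_eq_Suc replicate_app_Cons_same of_nat_diff\<close>)
    have e5: "lchar rs (embed (int a) 0 ([], [1, 0, 0, -1, -1], [1, 0])) = lchar rs (map int ([a + 1] @ replicate (b - 3) a @ [a - 1, a - 1, 1]))"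
      by (rule lchar_pad[OF rs, of _ _ 1]) (use a in \<open>simp add: 4 numeral_eq_Suc replicate_app_Cons_same of_nat_diff\<close>)
    have e6: "lchar rs (embed (int a) 0 ([], [1, 1, 0, 0, -2], [0, 0])) = lchar rs (map int ([a + 1, a + 1] @ replicate (b - 3) a @ [a - 2]))"
      by (rule lchar_pad[OF rs, of _ _ 2]) (use a in \<open>simp add: 4 numeral_eq_Suc replicate_app_Cons_same of_nat_diff\<close>)
    have e7: "lchar rs (embed (int a) 0 ([], [0, 0, 0, 0, -2], [1, 1])) = lchar rs (map int (replicate (b - 1) a @ [a - 2, 1, 1]))"
      by (rule lchar_pad[OF rs, of _ _ 0]) (use a in \<open>simp add: 4 numeral_eq_Suc replicate_app_Cons_same of_nat_diff\<close>)
    have e8: "lchar rs (embed (int a) 0 ([], [0, 0, 0, 0, -1], [1, 0])) = lchar rs (map int (replicate (b - 1) a @ [a - 1, 1]))"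
      by (rule lchar_pad[OF rs, of _ _ 1]) (use a in \<open>simp add: 4 numeral_eq_Suc replicate_app_Cons_same of_nat_diff\<close>)
    show ?thesis
      using v a by (simp only: e0 e1 e2 e3 e4 e5 e6 e7 e8 eval_terms_simps) (simp add: 4)
  next
    case 5
    then obtain k where k: "b = k + 6" using le_Suc_ex add.commute by metis
    note v = verify_sound[OF verify_two_one_one_middle rs, of "k + 2" "int a"]
    have e0: "lchar rs (embed (int a) (k + 2) ([0, 0], [0, 0], [0, 0])) = lchar rs (map int (replicate b a))"
      by (rule lchar_pad[OF rs, of _ _ 2]) (simp add: k numeral_eq_Suc replicate_app_Cons_same)
    have e1: "lchar rs (embed (int a) (k + 2) ([2, 0], [-1, -1], [0, 0])) = lchar rs (map int ([a + 2] @ replicate (b - 3) a @ [a - 1, a - 1]))"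
      by (rule lchar_pad[OF rs, of _ _ 2]) (use a in \<open>simp add: k numeral_eq_Suc replicate_app_Cons_same of_nat_diff\<close>)
    have e2: "lchar rs (embed (int a) (k + 2) ([1, 0], [0, -1], [0, 0])) = lchar rs (map int ([a + 1] @ replicate (b - 2) a @ [a - 1]))"
      by (rule lchar_pad[OF rs, of _ _ 2]) (use a in \<open>simp add: k numeral_eq_Suc replicate_app_Cons_same of_nat_diff\<close>)
    have e3: "lchar rs (embed (int a) (k + 2) ([1, 0], [0, -2], [1, 0])) = lchar rs (map int ([a + 1] @ replicate (b - 2) a @ [a - 2, 1]))"
      by (rule lchar_pad[OF rs, of _ _ 1]) (use a in \<open>simp add: k numeral_eq_Suc replicate_app_Cons_same of_nat_diff\<close>)
    have e4: "lchar rs (embed (int a) (k + 2) ([0, 0], [-1, -1], [2, 0])) = lchar rs (map int (replicate (b - 2) a @ [a - 1, a - 1, 2]))"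
      by (rule lchar_pad[OF rs, of _ _ 1]) (use a in \<open>simp add: k numeral_eq_Suc replicate_app_Cons_same of_nat_diff\<close>)
    have e5: "lchar rs (embed (int a) (k + 2) ([1, 0], [-1, -1], [1, 0])) = lchar rs (map int ([a + 1] @ replicate (b - 3) a @ [a - 1, a - 1, 1]))"
      by (rule lchar_pad[OF rs, of _ _ 1]) (use a in \<open>simp add: k numeral_eq_Suc replicate_app_Cons_same of_nat_diff\<close>)
    have e6: "lchar rs (embed (int a) (k + 2) ([1, 1], [0, -2], [0, 0])) = lchar rs (map int ([a + 1, a + 1] @ replicate (b - 3) a @ [a - 2]))"
      by (rule lchar_pad[OF rs, of _ _ 2]) (use a in \<open>simp add: k numeral_eq_Suc replicate_app_Cons_same of_nat_diff\<close>)
    have e7: "lchar rs (embed (int a) (k + 2) ([0, 0], [0, -2], [1, 1])) = lchar rs (map int (replicate (b - 1) a @ [a - 2, 1, 1]))"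
      by (rule lchar_pad[OF rs, of _ _ 0]) (use a in \<open>simp add: k numeral_eq_Suc replicate_app_Cons_same of_nat_diff\<close>)
    have e8: "lchar rs (embed (int a) (k + 2) ([0, 0], [0, -1], [1, 0])) = lchar rs (map int (replicate (b - 1) a @ [a - 1, 1]))"
      by (rule lchar_pad[OF rs, of _ _ 1]) (use a in \<open>simp add: k numeral_eq_Suc replicate_app_Cons_same of_nat_diff\<close>)
    show ?thesis
      using v a by (simp only: e0 e1 e2 e3 e4 e5 e6 e7 e8 eval_terms_simps) (simp add: k)
  qed
qed

section \<open>From recursion values to characters\<close>

lemma double_cancel: "2 * x = 2 * y \<Longrightarrow> x = (y :: int)"
  by simp

lemma lchar_swap:
  assumes "q' = q - 1" "p' = p + 1"
  shows "lchar rs (pre @ p # q # post) = - lchar rs (pre @ q' # p' # post)"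
  unfolding lchar_at using at_swap[OF alternating_xchar _ assms, of pre post _ rs] by simp

text \<open>The trivial character: from a single row each ribbon can be removed in exactly one way,
  with positive sign.\<close>

lemma lchar_row: "0 \<notin> set rs \<Longrightarrow> lchar rs [int (sum_list rs)] = 1"
proof (induction rs)
  case Nil
  have "{\<pi>. \<pi> permutes {..<1 :: nat}} = {id}" by (simp add: lessThan_Suc)
  then show ?case by (simp add: lchar_def pairing_def sign_id)
next
  case (Cons r rs)
  have "lchar (r # rs) [int (sum_list (r # rs))] = xchar 1 rs (shift (\<lambda>i. [int (r + sum_list rs)] ! i + staircase 1 i) 0 (- int r))"
    by (simp add: lchar_def)
  also have "\<dots> = lchar rs [int (sum_list rs)]"
    unfolding lchar_def by (rule trans[OF alternating_cong[OF alternating_xchar]]) (auto simp: shift_def)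
  finally show ?case using Cons by simp
qed

lemma cycle_type_permutes:
  assumes "g permutes {1..n}"
  shows "0 \<notin> set (cycle_type g {1..n})" "sum_list (cycle_type g {1..n}) = n"
  using cycle_list_nonzero[OF cycle_list_cycle_type[OF assms finite_atLeastAtMost]]
    cycle_list_sum[OF cycle_list_cycle_type[OF assms finite_atLeastAtMost]] by simp_all

text \<open>On the single row \<open>[n]\<close> the character is 1, so a certificate there
  expresses \<open>c\<close> times the target character by the operator list alone.\<close>

lemma lchar_row_shape:
  assumes "verify False d ops ([], [0], replicate z 0) [(c, ([], [-e], h))]" "0 \<notin> set rs" "sum_list rs = n"
    "d \<le> int n" "map int \<mu> @ replicate y 0 = (int n - e) # h"
  shows "c * lchar rs (map int \<mu>) = (\<Sum>(k, is)\<leftarrow>ops. k * falling is rs)"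
proof -
  have "lchar rs (embed (int n) 0 ([], [0], replicate z 0)) = lchar rs [int n]"
    by (rule lchar_pad[OF assms(2), of _ _ z]) simp
  then have "lchar rs (embed (int n) 0 ([], [0], replicate z 0)) = 1" using lchar_row[OF assms(2)] assms(3) by simp
  moreover have "lchar rs (embed (int n) 0 ([], [-e], h)) = lchar rs (map int \<mu>)"
    by (rule lchar_pad[OF assms(2), of _ _ y]) (simp add: assms(5))
  ultimately show ?thesis using verify_sound[OF assms(1,2), of 0 "int n"] assms(4) by simp
qed

text \<open>An integer version of \<open>irr_char\<close> that also makes sense for sequences that
  are not weakly decreasing, where it follows the straightening rule instead of the convention of
  being 0.\<close>

definition pchar :: "nat \<Rightarrow> nat list \<Rightarrow> (nat \<Rightarrow> nat) \<Rightarrow> int"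
  where "pchar n \<mu> g = (if g permutes {1..n} then lchar (cycle_type g {1..n}) (map int \<mu>) else 0)"

text \<open>For a sequence that is not a partition the convention gives 0, and so does the recursion
  when some row exceeds the row above it by exactly one.\<close>

lemma irr_char_pchar:
  assumes "sum_list \<mu> = n" "sorted_wrt (\<ge>) \<mu> \<or> (\<exists>i. Suc i < length \<mu> \<and> \<mu> ! Suc i = \<mu> ! i + 1)"
  shows "irr_char \<mu> g = of_int (pchar n \<mu> g)"
proof (cases "sorted_wrt (\<ge>) \<mu>")
  case True
  show ?thesis
  proof (cases "g permutes {1..n}")
    case perm: True
    then show ?thesis using irr_char_lchar[OF True, of g] assms(1) by (simp add: pchar_def)
  next
    case False
    then show ?thesis using True assms(1) by (simp add: pchar_def irr_char_def rep_char_def sym_group_carrier)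
  qed
next
  case False
  then obtain i where "Suc i < length \<mu>" "\<mu> ! Suc i = \<mu> ! i + 1" using assms(2) by blast
  then have "lchar rs (map int \<mu>) = 0" for rs by (intro lchar_ascent[of i]) auto
  then show ?thesis using False by (simp add: pchar_def irr_char_def)
qed

lemma sum_list_rectangle:
  assumes "p \<le> b"
  shows "sum_list (xs @ replicate (b - p) a @ ys) = a * b \<longleftrightarrow> sum_list xs + sum_list ys = a * p"
proof -
  obtain c where "b = p + c" using assms le_Suc_ex by blast
  then show ?thesis by (auto simp: sum_list_replicate algebra_simps)
qed

lemma sorted_rectangle:
  assumes "sorted_wrt (\<ge>) xs" "\<forall>x\<in>set xs. a \<le> x" "sorted_wrt (\<ge>) ys" "\<forall>y\<in>set ys. y \<le> a"
  shows "sorted_wrt (\<ge>) (xs @ replicate c a @ (ys :: nat list))"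
proof -
  have "sorted_wrt (\<ge>) (replicate c a)" by (induction c) auto
  then show ?thesis using assms by (force simp: sorted_wrt_append)
qed

lemma irr_char_rectangle:
  assumes "p \<le> b" "sorted_wrt (\<ge>) xs" "\<forall>x\<in>set xs. a \<le> x" "sorted_wrt (\<ge>) ys" "\<forall>y\<in>set ys. y \<le> a"
    "sum_list xs + sum_list ys = a * p"
  shows "irr_char (xs @ replicate (b - p) a @ ys) g = of_int (pchar (a * b) (xs @ replicate (b - p) a @ ys) g)"
  using irr_char_pchar sum_list_rectangle[OF assms(1)] sorted_rectangle[OF assms(2-5)] assms(6) by blast

text \<open>The conditions on \<open>a\<close> come from straightening the generic identity. For
  \<open>a = 2\<close> the final rows \<open>0, 2\<close> become minus \<open>1, 1\<close>, which
  cancels the term ending in \<open>a - 1, 1\<close>, and the final rows \<open>0, 1\<close> form an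
  ascent; for \<open>a = 3\<close> the final rows \<open>1, 2\<close> form an ascent.\<close>

theorem two_two_times_rectangle:
  fixes n a b :: nat
  assumes n: "n = a * b" "n \<ge> 6" and a: "a > 1" and b: "b > 1"
  shows "irr_char [n - 2, 2] * irr_char (replicate b a) =
        irr_char (replicate b a)
      + (if a > 2 then irr_char (replicate (b - 1) a @ [a - 1, 1]) else 0)
      + irr_char (replicate (b - 2) a @ [a - 1, a - 1, 1, 1])
      + (if b > 3 then irr_char ([a + 1, a + 1] @ replicate (b - 4) a @ [a - 1, a - 1]) else 0)
      + (if b > 2 then irr_char ([a + 1] @ replicate (b - 2) a @ [a - 1]) else 0)
      + (if b > 2 then irr_char ([a + 1] @ replicate (b - 3) a @ [a - 1, a - 1, 1]) else 0)
      + irr_char ([a + 2] @ replicate (b - 2) a @ [a - 2])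
      + (if a > 2 then irr_char ([a + 1] @ replicate (b - 2) a @ [a - 2, 1]) else 0)
      + (if a > 3 then irr_char (replicate (b - 1) a @ [a - 2, 2]) else 0)"
    (is "_ = ?r1 + (if a > 2 then ?r2 else 0) + ?r3 + (if b > 3 then ?r4 else 0) + (if b > 2 then ?r5 else 0)
      + (if b > 2 then ?r6 else 0) + ?r7 + (if a > 2 then ?r8 else 0) + (if a > 3 then ?r9 else 0)")
proof
  fix g
  let ?P = "\<lambda>\<mu>. pchar n \<mu> g"
  let ?x9 = "if g permutes {1..n} then lchar (cycle_type g {1..n}) (map int (replicate (b - 1) a) @ [int a - 2, 2]) else 0"
  have c0: "irr_char [n - 2, 2] g = of_int (?P [n - 2, 2])" by (rule irr_char_pchar) (use n in auto)
  have c1: "?r1 g = of_int (?P (replicate b a))"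
    using irr_char_rectangle[of 0 b "[]" a "[]" g] n by simp
  have c2: "?r2 g = of_int (?P (replicate (b - 1) a @ [a - 1, 1]))"
    using irr_char_rectangle[of 1 b "[]" a "[a - 1, 1]" g] n a b by simp
  have c3: "?r3 g = of_int (?P (replicate (b - 2) a @ [a - 1, a - 1, 1, 1]))"
    using irr_char_rectangle[of 2 b "[]" a "[a - 1, a - 1, 1, 1]" g] n a b by simp
  have c4: "?r4 g = of_int (?P ([a + 1, a + 1] @ replicate (b - 4) a @ [a - 1, a - 1]))" if "b > 3"
    using irr_char_rectangle[of 4 b "[a + 1, a + 1]" a "[a - 1, a - 1]" g] n a that by simp
  have c5: "?r5 g = of_int (?P ([a + 1] @ replicate (b - 2) a @ [a - 1]))"
    using irr_char_rectangle[of 2 b "[a + 1]" a "[a - 1]" g] n a b by simp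
  have c6: "?r6 g = of_int (?P ([a + 1] @ replicate (b - 3) a @ [a - 1, a - 1, 1]))" if "b > 2"
    using irr_char_rectangle[of 3 b "[a + 1]" a "[a - 1, a - 1, 1]" g] n a that by simp
  have c7: "?r7 g = of_int (?P ([a + 2] @ replicate (b - 2) a @ [a - 2]))"
    using irr_char_rectangle[of 2 b "[a + 2]" a "[a - 2]" g] n a b by simp
  have c8: "?r8 g = of_int (?P ([a + 1] @ replicate (b - 2) a @ [a - 2, 1]))" if "a > 2"
    using irr_char_rectangle[of 2 b "[a + 1]" a "[a - 2, 1]" g] n that b by simp
  have c9: "?r9 g = of_int (?P (replicate (b - 1) a @ [a - 2, 2]))" if "a > 3"
    using irr_char_rectangle[of 1 b "[]" a "[a - 2, 2]" g] n that b by simp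
  have x8: "?P ([a + 1] @ replicate (b - 2) a @ [a - 2, 1]) = 0" if "a = 2"
  proof -
    have "lchar rs (map int ([a + 1] @ replicate (b - 2) a @ [a - 2, 1])) = 0" for rs
      using lchar_swap[of 0 1 1 0 rs "map int ([a + 1] @ replicate (b - 2) a)" "[]"] that by simp
    then show ?thesis by (simp add: pchar_def)
  qed
  have x9: "?x9 = (if a > 3 then ?P (replicate (b - 1) a @ [a - 2, 2]) else if a = 2 then - ?P (replicate (b - 1) a @ [a - 1, 1]) else 0)"
  proof -
    have "lchar rs (map int (replicate (b - 1) a) @ [int a - 2, 2])
      = - lchar rs (map int (replicate (b - 1) a) @ [1, int a - 1])" for rs
      by (rule lchar_swap) simp_all
    note swap = this
    consider "a = 2" | "a = 3" | "a > 3" using a by linarith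
    then show ?thesis
    proof cases
      case 1
      then show ?thesis using swap by (simp add: pchar_def)
    next
      case 2
      then have "lchar rs (map int (replicate (b - 1) a) @ [int a - 2, 2]) = 0" for rs using swap[of rs] by simp
      then show ?thesis using 2 by simp
    next
      case 3
      then show ?thesis by (simp add: pchar_def of_nat_diff)
    qed
  qed
  have "?P [n - 2, 2] * ?P (replicate b a) = ?P (replicate b a)
      + ?P (replicate (b - 1) a @ [a - 1, 1])
      + ?P (replicate (b - 2) a @ [a - 1, a - 1, 1, 1])
      + (if b > 3 then ?P ([a + 1, a + 1] @ replicate (b - 4) a @ [a - 1, a - 1]) else 0)
      + (if b > 2 then ?P ([a + 1] @ replicate (b - 2) a @ [a - 1]) else 0)
      + (if b > 2 then ?P ([a + 1] @ replicate (b - 3) a @ [a - 1, a - 1, 1]) else 0)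
      + ?P ([a + 2] @ replicate (b - 2) a @ [a - 2])
      + ?P ([a + 1] @ replicate (b - 2) a @ [a - 2, 1]) + ?x9"
  proof (cases "g permutes {1..n}")
    case True
    note rs = cycle_type_permutes[OF True]
    have "2 * lchar (cycle_type g {1..n}) (map int [n - 2, 2])
      = (\<Sum>(k, is)\<leftarrow>[(1, [1, 1]), (1, [2]), (-2, [1])]. k * falling is (cycle_type g {1..n}))"
    proof (rule lchar_row_shape[of 2 _ 2 2 2 "[2, 0]" _ n _ 1])
      have "replicate 2 (0 :: int) = [0, 0]" by (simp add: numeral_2_eq_2)
      then show "verify False 2 [(1, [1, 1]), (1, [2]), (-2, [1])] ([], [0], replicate 2 0) [(2, ([], [-2], [2, 0]))]"
        using verify_two_two by (simp only:)
      show "2 \<le> int n" "map int [n - 2, 2] @ replicate 1 0 = (int n - 2) # [2, 0]" using n(2) by simp_all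
    qed (rule rs)+
    note row = this
    have ab: "2 \<le> a" "2 \<le> b" using a b by simp_all
    have "2 * (lchar (cycle_type g {1..n}) (map int [n - 2, 2]) * lchar (cycle_type g {1..n}) (map int (replicate b a)))
      = (2 * lchar (cycle_type g {1..n}) (map int [n - 2, 2])) * lchar (cycle_type g {1..n}) (map int (replicate b a))"
      by (simp only: mult.assoc)
    note this[unfolded row lchar_two_two_rectangle[OF rs(1) ab]]
    then show ?thesis unfolding pchar_def if_P[OF True] by (rule double_cancel)
  next
    case False
    then show ?thesis unfolding pchar_def by simp
  qed
  note eq = this
  have "?P [n - 2, 2] * ?P (replicate b a) = ?P (replicate b a)
      + (if a > 2 then ?P (replicate (b - 1) a @ [a - 1, 1]) else 0)
      + ?P (replicate (b - 2) a @ [a - 1, a - 1, 1, 1])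
      + (if b > 3 then ?P ([a + 1, a + 1] @ replicate (b - 4) a @ [a - 1, a - 1]) else 0)
      + (if b > 2 then ?P ([a + 1] @ replicate (b - 2) a @ [a - 1]) else 0)
      + (if b > 2 then ?P ([a + 1] @ replicate (b - 3) a @ [a - 1, a - 1, 1]) else 0)
      + ?P ([a + 2] @ replicate (b - 2) a @ [a - 2])
      + (if a > 2 then ?P ([a + 1] @ replicate (b - 2) a @ [a - 2, 1]) else 0)
      + (if a > 3 then ?P (replicate (b - 1) a @ [a - 2, 2]) else 0)"
  proof -
    consider "a = 2" | "a = 3" | "a > 3" using a by linarith
    then show ?thesis
    proof cases
      case 1
      then show ?thesis using eq x8 unfolding x9 by simp
    next
      case 2
      then show ?thesis using eq unfolding x9 by simp
    next
      case 3
      then show ?thesis using eq unfolding x9 by simp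
    qed
  qed
  note int_eq = this
  have i2: "(if a > 2 then ?r2 else 0) g = of_int (if a > 2 then ?P (replicate (b - 1) a @ [a - 1, 1]) else 0)"
    using c2 by simp
  have i4: "(if b > 3 then ?r4 else 0) g = of_int (if b > 3 then ?P ([a + 1, a + 1] @ replicate (b - 4) a @ [a - 1, a - 1]) else 0)"
    using c4 by (cases "b > 3") simp_all
  have i5: "(if b > 2 then ?r5 else 0) g = of_int (if b > 2 then ?P ([a + 1] @ replicate (b - 2) a @ [a - 1]) else 0)"
    using c5 by (cases "b > 2") simp_all
  have i6: "(if b > 2 then ?r6 else 0) g = of_int (if b > 2 then ?P ([a + 1] @ replicate (b - 3) a @ [a - 1, a - 1, 1]) else 0)"
    using c6 by (cases "b > 2") simp_all
  have i8: "(if a > 2 then ?r8 else 0) g = of_int (if a > 2 then ?P ([a + 1] @ replicate (b - 2) a @ [a - 2, 1]) else 0)"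
    using c8 by (cases "a > 2") simp_all
  have i9: "(if a > 3 then ?r9 else 0) g = of_int (if a > 3 then ?P (replicate (b - 1) a @ [a - 2, 2]) else 0)"
    using c9 by (cases "a > 3") simp_all
  show "(irr_char [n - 2, 2] * ?r1) g = (?r1 + (if a > 2 then ?r2 else 0) + ?r3 + (if b > 3 then ?r4 else 0) + (if b > 2 then ?r5 else 0)
      + (if b > 2 then ?r6 else 0) + ?r7 + (if a > 2 then ?r8 else 0) + (if a > 3 then ?r9 else 0)) g"
    by (simp only: times_fun_apply plus_fun_apply c0 c1 i2 c3 i4 i5 i6 c7 i8 i9
        of_int_add[symmetric] of_int_mult[symmetric] int_eq)
qed

text \<open>For \<open>a = 2\<close> the hypothesis \<open>a \<ge> b\<close> forces
  \<open>b = 2\<close>. The sequences that are then not partitions are \<open>[3, 0, 1]\<close>,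
  \<open>[1, 1, 2]\<close> and \<open>[2, 0, 1, 1]\<close>; each has an ascent by one, so convention
  and recursion agree on the value 0.\<close>

theorem two_one_one_times_rectangle:
  fixes n a b :: nat
  assumes n: "n = a * b" and a: "a \<ge> b" and b: "b > 1"
  shows "irr_char [n - 2, 1, 1] * irr_char (replicate b a) =
        (if b > 2 then irr_char ([a + 2] @ replicate (b - 3) a @ [a - 1, a - 1]) else 0)
      + irr_char ([a + 1] @ replicate (b - 2) a @ [a - 1])
      + irr_char ([a + 1] @ replicate (b - 2) a @ [a - 2, 1])
      + irr_char (replicate (b - 2) a @ [a - 1, a - 1, 2])
      + (if b > 2 then irr_char ([a + 1] @ replicate (b - 3) a @ [a - 1, a - 1, 1]) else 0)
      + (if b > 2 then irr_char ([a + 1, a + 1] @ replicate (b - 3) a @ [a - 2]) else 0)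
      + irr_char (replicate (b - 1) a @ [a - 2, 1, 1])
      + irr_char (replicate (b - 1) a @ [a - 1, 1])"
    (is "_ = (if b > 2 then ?r1 else 0) + ?r2 + ?r3 + ?r4 + (if b > 2 then ?r5 else 0) + (if b > 2 then ?r6 else 0) + ?r7 + ?r8")
proof
  fix g
  let ?P = "\<lambda>\<mu>. pchar n \<mu> g"
  have n4: "4 \<le> n" using n a b mult_le_mono[of 2 a 2 b] by simp
  have c0: "irr_char [n - 2, 1, 1] g = of_int (?P [n - 2, 1, 1])" by (rule irr_char_pchar) (use n4 in auto)
  have c: "irr_char (replicate b a) g = of_int (?P (replicate b a))"
    using irr_char_rectangle[of 0 b "[]" a "[]" g] n by simp
  have i1: "(if b > 2 then ?r1 else 0) g = of_int (if b > 2 then ?P ([a + 2] @ replicate (b - 3) a @ [a - 1, a - 1]) else 0)"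
    using irr_char_rectangle[of 3 b "[a + 2]" a "[a - 1, a - 1]" g] n a by (cases "b > 2") simp_all
  have c2: "?r2 g = of_int (?P ([a + 1] @ replicate (b - 2) a @ [a - 1]))"
    using irr_char_rectangle[of 2 b "[a + 1]" a "[a - 1]" g] n a b by simp
  have small: "a = 2 \<Longrightarrow> b = 2" using a b by simp
  have c3: "?r3 g = of_int (?P ([a + 1] @ replicate (b - 2) a @ [a - 2, 1]))"
  proof (cases "a = 2")
    case True
    then show ?thesis using n small by (intro irr_char_pchar) (auto intro!: exI[of _ 1])
  next
    case False
    then show ?thesis using irr_char_rectangle[of 2 b "[a + 1]" a "[a - 2, 1]" g] n a b by simp
  qed
  have c4: "?r4 g = of_int (?P (replicate (b - 2) a @ [a - 1, a - 1, 2]))"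
  proof (cases "a = 2")
    case True
    then show ?thesis using n small by (intro irr_char_pchar) (auto intro!: exI[of _ 1])
  next
    case False
    then show ?thesis using irr_char_rectangle[of 2 b "[]" a "[a - 1, a - 1, 2]" g] n a b by simp
  qed
  have i5: "(if b > 2 then ?r5 else 0) g = of_int (if b > 2 then ?P ([a + 1] @ replicate (b - 3) a @ [a - 1, a - 1, 1]) else 0)"
    using irr_char_rectangle[of 3 b "[a + 1]" a "[a - 1, a - 1, 1]" g] n a by (cases "b > 2") simp_all
  have i6: "(if b > 2 then ?r6 else 0) g = of_int (if b > 2 then ?P ([a + 1, a + 1] @ replicate (b - 3) a @ [a - 2]) else 0)"
    using irr_char_rectangle[of 3 b "[a + 1, a + 1]" a "[a - 2]" g] n a by (cases "b > 2") simp_all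
  have c7: "?r7 g = of_int (?P (replicate (b - 1) a @ [a - 2, 1, 1]))"
  proof (cases "a = 2")
    case True
    then show ?thesis using n small by (intro irr_char_pchar) (auto intro!: exI[of _ 1])
  next
    case False
    then show ?thesis using irr_char_rectangle[of 1 b "[]" a "[a - 2, 1, 1]" g] n a b by simp
  qed
  have c8: "?r8 g = of_int (?P (replicate (b - 1) a @ [a - 1, 1]))"
    using irr_char_rectangle[of 1 b "[]" a "[a - 1, 1]" g] n a b by simp
  have int_eq: "?P [n - 2, 1, 1] * ?P (replicate b a) =
        (if b > 2 then ?P ([a + 2] @ replicate (b - 3) a @ [a - 1, a - 1]) else 0)
      + ?P ([a + 1] @ replicate (b - 2) a @ [a - 1])
      + ?P ([a + 1] @ replicate (b - 2) a @ [a - 2, 1])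
      + ?P (replicate (b - 2) a @ [a - 1, a - 1, 2])
      + (if b > 2 then ?P ([a + 1] @ replicate (b - 3) a @ [a - 1, a - 1, 1]) else 0)
      + (if b > 2 then ?P ([a + 1, a + 1] @ replicate (b - 3) a @ [a - 2]) else 0)
      + ?P (replicate (b - 1) a @ [a - 2, 1, 1])
      + ?P (replicate (b - 1) a @ [a - 1, 1])"
  proof (cases "g permutes {1..n}")
    case True
    note rs = cycle_type_permutes[OF True]
    have "2 * lchar (cycle_type g {1..n}) (map int [n - 2, 1, 1])
      = (\<Sum>(k, is)\<leftarrow>[(1, [1, 1]), (-2, [1]), (2, []), (-1, [2])]. k * falling is (cycle_type g {1..n}))"
    proof (rule lchar_row_shape[of 2 _ 2 2 2 "[1, 1]" _ n _ 0])
      have "replicate 2 (0 :: int) = [0, 0]" by (simp add: numeral_2_eq_2)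
      then show "verify False 2 [(1, [1, 1]), (-2, [1]), (2, []), (-1, [2])] ([], [0], replicate 2 0) [(2, ([], [-2], [1, 1]))]"
        using verify_two_one_one by (simp only:)
      show "2 \<le> int n" "map int [n - 2, 1, 1] @ replicate 0 0 = (int n - 2) # [1, 1]" using n4 by simp_all
    qed (rule rs)+
    note row = this
    have ab: "2 \<le> a" "2 \<le> b" using a b by simp_all
    have "2 * (lchar (cycle_type g {1..n}) (map int [n - 2, 1, 1]) * lchar (cycle_type g {1..n}) (map int (replicate b a)))
      = (2 * lchar (cycle_type g {1..n}) (map int [n - 2, 1, 1])) * lchar (cycle_type g {1..n}) (map int (replicate b a))"
      by (simp only: mult.assoc)
    note this[unfolded row lchar_two_one_one_rectangle[OF rs(1) ab]]
    then show ?thesis unfolding pchar_def if_P[OF True] by (rule double_cancel)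
  next
    case False
    then show ?thesis unfolding pchar_def by simp
  qed
  show "(irr_char [n - 2, 1, 1] * irr_char (replicate b a)) g
    = ((if b > 2 then ?r1 else 0) + ?r2 + ?r3 + ?r4 + (if b > 2 then ?r5 else 0) + (if b > 2 then ?r6 else 0) + ?r7 + ?r8) g"
    by (simp only: times_fun_apply plus_fun_apply c0 c i1 c2 c3 c4 i5 i6 c7 c8
        of_int_add[symmetric] of_int_mult[symmetric] int_eq)
qed

section \<open>The product of \<open>[n-3,3]\<close> with two equal rows\<close>

definition three_three_ops :: "(int \<times> nat list) list"
  where "three_three_ops = [(1, [1, 1, 1]), (3, [1, 2]), (2, [3]), (-3, [1, 1]), (-3, [2])]"

lemma three_three_lchar:
  assumes "g permutes {1..n}" "3 \<le> n"
  shows "6 * lchar (cycle_type g {1..n}) (map int [n - 3, 3]) = (\<Sum>(k, is)\<leftarrow>three_three_ops. k * falling is (cycle_type g {1..n}))"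
proof (rule lchar_row_shape[of 3 _ 3 6 3 "[3, 0, 0]" _ n _ 2])
  have "replicate 3 (0 :: int) = [0, 0, 0]" by (simp add: numeral_3_eq_3)
  then show "verify False 3 three_three_ops ([], [0], replicate 3 0) [(6, ([], [-3], [3, 0, 0]))]"
    using verify_three_three by (simp only: three_three_ops_def)
  show "3 \<le> int n" "map int [n - 3, 3] @ replicate 2 0 = (int n - 3) # [3, 0, 0]"
    using assms(2) by (simp_all add: numeral_2_eq_2)
qed (rule cycle_type_permutes[OF assms(1)])+

text \<open>Three zero rows are appended because the added ribbons have total length at most
  3.\<close>

lemma verify_three_three_two_rows: "verify False 3 three_three_ops ([], [0, 0], [0, 0, 0])
  [(6, ([], [1, -1], [0, 0, 0])), (6, ([], [1, -2], [1, 0, 0])), (6, ([], [0, -1], [1, 0, 0])),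
   (6, ([], [0, -2], [1, 1, 0])), (6, ([], [0, -2], [2, 0, 0])), (6, ([], [0, -3], [3, 0, 0])),
   (6, ([], [-1, -1], [2, 0, 0])), (6, ([], [-1, -2], [2, 1, 0])), (6, ([], [3, -3], [0, 0, 0])),
   (6, ([], [2, -3], [1, 0, 0])), (6, ([], [1, -3], [2, 0, 0]))]"
  by code_simp

text \<open>Since \<open>k\<close> exceeds 8, all eleven sequences are weakly decreasing, so the
  certificate translates directly into characters after division by 6.\<close>

theorem three_three_times_two_rows:
  fixes n k :: nat
  assumes n: "n = 2 * k" "n > 16"
  shows "irr_char [n - 3, 3] * irr_char [k, k] =
        irr_char [k + 1, k - 1] + irr_char [k + 1, k - 2, 1] + irr_char [k, k - 1, 1]
      + irr_char [k, k - 2, 1, 1] + irr_char [k, k - 2, 2] + irr_char [k, k - 3, 3]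
      + irr_char [k - 1, k - 1, 2] + irr_char [k - 1, k - 2, 2, 1] + irr_char [k + 3, k - 3]
      + irr_char [k + 2, k - 3, 1] + irr_char [k + 1, k - 3, 2]"
    (is "_ = ?r")
proof
  fix g
  let ?P = "\<lambda>\<mu>. pchar n \<mu> g"
  have k: "8 < k" using n by simp
  have irr: "irr_char \<mu> g = of_int (?P \<mu>)" if "sum_list \<mu> = n" "sorted_wrt (\<ge>) \<mu>" for \<mu>
    using irr_char_pchar that by blast
  have c: "irr_char [n - 3, 3] g = of_int (?P [n - 3, 3])" "irr_char [k, k] g = of_int (?P [k, k])"
    "irr_char [k + 1, k - 1] g = of_int (?P [k + 1, k - 1])"
    "irr_char [k + 1, k - 2, 1] g = of_int (?P [k + 1, k - 2, 1])"
    "irr_char [k, k - 1, 1] g = of_int (?P [k, k - 1, 1])"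
    "irr_char [k, k - 2, 1, 1] g = of_int (?P [k, k - 2, 1, 1])"
    "irr_char [k, k - 2, 2] g = of_int (?P [k, k - 2, 2])"
    "irr_char [k, k - 3, 3] g = of_int (?P [k, k - 3, 3])"
    "irr_char [k - 1, k - 1, 2] g = of_int (?P [k - 1, k - 1, 2])"
    "irr_char [k - 1, k - 2, 2, 1] g = of_int (?P [k - 1, k - 2, 2, 1])"
    "irr_char [k + 3, k - 3] g = of_int (?P [k + 3, k - 3])"
    "irr_char [k + 2, k - 3, 1] g = of_int (?P [k + 2, k - 3, 1])"
    "irr_char [k + 1, k - 3, 2] g = of_int (?P [k + 1, k - 3, 2])"
    by (rule irr; use n(1) k in \<open>simp; arith\<close>)+
  have int_eq: "?P [n - 3, 3] * ?P [k, k] = ?P [k + 1, k - 1] + ?P [k + 1, k - 2, 1] + ?P [k, k - 1, 1]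
      + ?P [k, k - 2, 1, 1] + ?P [k, k - 2, 2] + ?P [k, k - 3, 3]
      + ?P [k - 1, k - 1, 2] + ?P [k - 1, k - 2, 2, 1] + ?P [k + 3, k - 3]
      + ?P [k + 2, k - 3, 1] + ?P [k + 1, k - 3, 2]"
  proof (cases "g permutes {1..n}")
    case True
    let ?rs = "cycle_type g {1..n}"
    have rs: "0 \<notin> set ?rs" using cycle_type_permutes[OF True] by blast
    note pad = lchar_pad[OF rs]
    have l0: "lchar ?rs [int k, int k, 0, 0, 0] = lchar ?rs (map int [k, k])"
      by (rule pad[of _ _ 3]) (simp add: numeral_3_eq_3)
    have l: "lchar ?rs [int k + 1, int k - 1, 0, 0, 0] = lchar ?rs (map int [k + 1, k - 1])"
      "lchar ?rs [int k + 1, int k - 2, 1, 0, 0] = lchar ?rs (map int [k + 1, k - 2, 1])"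
      "lchar ?rs [int k, int k - 1, 1, 0, 0] = lchar ?rs (map int [k, k - 1, 1])"
      "lchar ?rs [int k, int k - 2, 1, 1, 0] = lchar ?rs (map int [k, k - 2, 1, 1])"
      "lchar ?rs [int k, int k - 2, 2, 0, 0] = lchar ?rs (map int [k, k - 2, 2])"
      "lchar ?rs [int k, int k - 3, 3, 0, 0] = lchar ?rs (map int [k, k - 3, 3])"
      "lchar ?rs [int k - 1, int k - 1, 2, 0, 0] = lchar ?rs (map int [k - 1, k - 1, 2])"
      "lchar ?rs [int k - 1, int k - 2, 2, 1, 0] = lchar ?rs (map int [k - 1, k - 2, 2, 1])"
      "lchar ?rs [int k + 3, int k - 3, 0, 0, 0] = lchar ?rs (map int [k + 3, k - 3])"
      "lchar ?rs [int k + 2, int k - 3, 1, 0, 0] = lchar ?rs (map int [k + 2, k - 3, 1])"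
      "lchar ?rs [int k + 1, int k - 3, 2, 0, 0] = lchar ?rs (map int [k + 1, k - 3, 2])"
      by ((rule pad[of _ _ 3], use k in \<open>simp add: numeral_3_eq_3 of_nat_diff; fail\<close>)
        | (rule pad[of _ _ 2], use k in \<open>simp add: numeral_2_eq_2 of_nat_diff; fail\<close>)
        | (rule pad[of _ _ 1], use k in \<open>simp add: of_nat_diff; fail\<close>))+
    have "6 * lchar ?rs (map int [n - 3, 3]) * lchar ?rs (map int [k, k])
      = (\<Sum>(k, is)\<leftarrow>three_three_ops. k * falling is ?rs) * lchar ?rs (embed (int k) 0 ([], [0, 0], [0, 0, 0]))"
      using three_three_lchar[OF True] n l0 by simp
    also have "\<dots> = 6 * (lchar ?rs (map int [k + 1, k - 1]) + lchar ?rs (map int [k + 1, k - 2, 1])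
      + lchar ?rs (map int [k, k - 1, 1]) + lchar ?rs (map int [k, k - 2, 1, 1]) + lchar ?rs (map int [k, k - 2, 2])
      + lchar ?rs (map int [k, k - 3, 3]) + lchar ?rs (map int [k - 1, k - 1, 2]) + lchar ?rs (map int [k - 1, k - 2, 2, 1])
      + lchar ?rs (map int [k + 3, k - 3]) + lchar ?rs (map int [k + 2, k - 3, 1]) + lchar ?rs (map int [k + 1, k - 3, 2]))"
      unfolding l[symmetric] using verify_sound[OF verify_three_three_two_rows rs, of 0 "int k"] k by simp
    finally have "6 * (lchar ?rs (map int [n - 3, 3]) * lchar ?rs (map int [k, k])) = \<dots>"
      by (simp only: mult.assoc)
    then show ?thesis unfolding pchar_def if_P[OF True]
      by (rule mult_left_cancel[THEN iffD1, rotated]) simp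
  next
    case False
    then show ?thesis unfolding pchar_def by simp
  qed
  show "(irr_char [n - 3, 3] * irr_char [k, k]) g = ?r g"
    by (simp only: times_fun_apply plus_fun_apply c of_int_add[symmetric] of_int_mult[symmetric] int_eq)
qed

section \<open>Irreducible characters of the symmetric group\<close>

lemma linear_on_module_hom: "linear_on UNIV UNIV f \<Longrightarrow> module_hom cscale cscale f"
  by (intro module_hom.intro module_hom_axioms.intro cfun.module_axioms) (simp_all add: linear_on_def)

lemma linear_on_mono: "linear_on UNIV UNIV f \<Longrightarrow> (\<And>v. v \<in> V \<Longrightarrow> f v \<in> W) \<Longrightarrow> linear_on V W f"
  by (simp add: linear_on_def)

lemma linear_on_zero:
  assumes "cfun.subspace V" "linear_on V W f" shows "f 0 = 0"
proof -
  have "f (cscale 0 0) = cscale 0 (f 0)" using assms cfun.subspace_0 unfolding linear_on_def by blast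
  then show ?thesis by simp
qed

text \<open>\<open>irr_chars\<close> admits only spaces of functions on \<open>nat\<close>, whereas
  Specht modules consist of functions on tabloids. A linear map with a left inverse on
  \<open>V\<close> carries the action over, together with its invariant subspaces and
  traces.\<close>

lemma irreducible_transport:
  assumes irr: "irreducible_rep_on G V \<rho>" and T: "linear_on UNIV UNIV T" and T': "linear_on UNIV UNIV T'"
    and inv: "\<And>v. v \<in> V \<Longrightarrow> T' (T v) = v"
  shows "irreducible_rep_on G (T ` V) (\<lambda>g w. T (\<rho> g (T' w)))"
    and "rep_char G (T ` V) (\<lambda>g w. T (\<rho> g (T' w))) = rep_char G V \<rho>"
proof -
  let ?\<sigma> = "\<lambda>g w. T (\<rho> g (T' w))"
  have rep: "rep_on G V \<rho>" using irr by (simp add: irreducible_rep_on_def)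
  obtain B where B: "basis_of V B" using rep_on_basis[OF rep] by blast
  note sV = basis_subspace[OF B]
  interpret T: module_hom cscale cscale T by (rule linear_on_module_hom[OF T])
  interpret T': module_hom cscale cscale T' by (rule linear_on_module_hom[OF T'])
  have span: "cfun.span (T ` B) = T ` V" using T.span_image[of B] B by (simp add: basis_of_def)
  have fin: "finite (T ` B)" using B by (simp add: basis_of_def)
  have mem: "\<rho> g v \<in> V" if "g \<in> carrier G" "v \<in> V" for g v using rep that by (simp add: rep_on_def)
  show rep': "irreducible_rep_on G (T ` V) ?\<sigma>"
    unfolding irreducible_rep_on_def
  proof (intro conjI allI impI)
    have "T (u + v) = T u + T v" "T (cscale c u) = cscale c (T u)" for u v c by (rule T.add T.scale)+
    moreover have "T' (u + v) = T' u + T' v" "T' (cscale c u) = cscale c (T' u)" for u v c by (rule T'.add T'.scale)+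
    ultimately show "rep_on G (T ` V) ?\<sigma>"
      using rep span fin unfolding rep_on_def by (auto simp: inv)
    have "V \<noteq> {0}" using irr by (simp add: irreducible_rep_on_def)
    then obtain v where "v \<in> V" "v \<noteq> 0" using cfun.subspace_0[OF sV] by blast
    then have "T v \<noteq> 0" using inv T'.zero by metis
    then show "T ` V \<noteq> {0}" using \<open>v \<in> V\<close> by blast
  next
    fix U assume U: "cfun.subspace U \<and> U \<subseteq> T ` V \<and> (\<forall>g\<in>carrier G. \<forall>u\<in>U. ?\<sigma> g u \<in> U)"
    have TT: "T (T' u) = u" if "u \<in> U" for u using U that inv by auto
    have "cfun.subspace (T' ` U)" using T'.subspace_image U by blast
    moreover have "T' ` U \<subseteq> V" using U inv by auto
    moreover have "\<rho> g v \<in> T' ` U" if g: "g \<in> carrier G" and v: "v \<in> T' ` U" for g v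
    proof -
      obtain u where u: "u \<in> U" "v = T' u" using v by blast
      have "?\<sigma> g u \<in> U" using U g u by blast
      moreover have "T' (?\<sigma> g u) = \<rho> g v" using u inv mem g \<open>T' ` U \<subseteq> V\<close> by auto
      ultimately show ?thesis by (metis imageI)
    qed
    ultimately have "T' ` U = {0} \<or> T' ` U = V"
      using irr unfolding irreducible_rep_on_def by blast
    moreover have "U = T ` (T' ` U)" using TT by (auto simp: image_image)
    ultimately show "U = {0} \<or> U = T ` V" by (metis T.zero image_empty image_insert)
  qed
  show "rep_char G (T ` V) ?\<sigma> = rep_char G V \<rho>"
    unfolding rep_char_def
  proof (intro ext if_cong refl)
    fix g assume g: "g \<in> carrier G"
    have "rep_on G (T ` V) ?\<sigma>" using rep' by (simp add: irreducible_rep_on_def)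
    moreover obtain C where "basis_of (T ` V) C" using rep_on_basis[OF calculation] by blast
    ultimately have "trace_on V (\<rho> g) = trace_on (T ` V) (?\<sigma> g)"
      by (intro trace_on_iso[OF B rep_on_linear[OF rep g] rep_on_linear[OF _ g], of "T ` V" ?\<sigma> T T' C]
          linear_on_mono[OF T] linear_on_mono[OF T']) (auto simp: inv)
    then show "trace_on (T ` V) (?\<sigma> g) = trace_on V (\<rho> g)" by simp
  qed
qed

text \<open>Schur's lemma: the kernel and the image of a nonzero intertwiner are invariant, so it is
  bijective and the traces agree. If every intertwiner is zero, so are the averaged matrix
  units.\<close>

lemma schur_dichotomy:
  assumes G: "group G" "finite (carrier G)" and V: "irreducible_rep_on G V \<rho>" and W: "irreducible_rep_on G W \<sigma>"
  shows "(\<forall>g\<in>carrier G. trace_on W (\<sigma> g) = trace_on V (\<rho> g)) \<or>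
    (\<Sum>g\<in>carrier G. trace_on W (\<sigma> g) * trace_on V (\<rho> (inv\<^bsub>G\<^esub> g))) = 0"
proof (cases "\<forall>f v. intertwiner G V \<rho> W \<sigma> f \<longrightarrow> v \<in> V \<longrightarrow> f v = 0")
  case True
  then show ?thesis
    using V W by (intro disjI2 sum_trace_trace_0[OF G]) (auto simp: irreducible_rep_on_def)
next
  case False
  then obtain f v0 where f: "intertwiner G V \<rho> W \<sigma> f" and v0: "v0 \<in> V" "f v0 \<noteq> 0" by blast
  have rV: "rep_on G V \<rho>" and rW: "rep_on G W \<sigma>" using V W by (simp_all add: irreducible_rep_on_def)
  obtain B C where B: "basis_of V B" and C: "basis_of W C" using rep_on_basis[OF rV] rep_on_basis[OF rW] by blast
  note sV = basis_subspace[OF B] and sW = basis_subspace[OF C]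
  have lin: "linear_on V W f" using f by (simp add: intertwiner_def)
  have add: "f (u + v) = f u + f v" if "u \<in> V" "v \<in> V" for u v using lin that by (simp add: linear_on_def)
  have scale: "f (cscale c u) = cscale c (f u)" if "u \<in> V" for c u using lin that by (simp add: linear_on_def)
  have comm: "f (\<rho> g v) = \<sigma> g (f v)" if "g \<in> carrier G" "v \<in> V" for g v using f that by (simp add: intertwiner_def)
  have mem: "\<rho> g v \<in> V" if "g \<in> carrier G" "v \<in> V" for g v using rV that by (simp add: rep_on_def)
  have f0: "f 0 = 0" by (rule linear_on_zero[OF sV lin])
  have s0: "\<sigma> g 0 = 0" if "g \<in> carrier G" for g by (rule linear_on_zero[OF sW rep_on_linear[OF rW that]])
  have "{v \<in> V. f v = 0} = {0} \<or> {v \<in> V. f v = 0} = V"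
  proof -
    have "cfun.subspace {v \<in> V. f v = 0}"
      using sV f0 by (intro cfun.subspaceI) (auto simp: add scale cfun.subspace_add cfun.subspace_scale cfun.subspace_0)
    moreover have "\<forall>g\<in>carrier G. \<forall>v\<in>{v \<in> V. f v = 0}. \<rho> g v \<in> {v \<in> V. f v = 0}"
      by (auto simp: mem comm s0)
    ultimately show ?thesis using V unfolding irreducible_rep_on_def by blast
  qed
  then have ker: "v = 0" if "v \<in> V" "f v = 0" for v using v0 that by blast
  have "f ` V = {0} \<or> f ` V = W"
  proof -
    have "cfun.subspace (f ` V)"
    proof (rule cfun.subspaceI)
      show "0 \<in> f ` V" using f0 cfun.subspace_0[OF sV] by (metis imageI)
    next
      fix x y assume "x \<in> f ` V" "y \<in> f ` V"
      then obtain u v where "u \<in> V" "v \<in> V" "x = f u" "y = f v" by blast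
      then show "x + y \<in> f ` V" using add cfun.subspace_add[OF sV] by (metis imageI)
    next
      fix c x assume "x \<in> f ` V"
      then show "cscale c x \<in> f ` V" using scale cfun.subspace_scale[OF sV] by (metis imageE imageI)
    qed
    moreover have "f ` V \<subseteq> W" using lin by (auto simp: linear_on_def)
    moreover have "\<forall>g\<in>carrier G. \<forall>w\<in>f ` V. \<sigma> g w \<in> f ` V"
      using comm mem by (metis (no_types, lifting) imageE imageI)
    ultimately show ?thesis using W unfolding irreducible_rep_on_def by blast
  qed
  then have onto: "f ` V = W" using v0 by blast
  have inj: "inj_on f V"
  proof (rule inj_onI)
    fix u v assume uv: "u \<in> V" "v \<in> V" "f u = f v"
    have "f (u + cscale (-1) v) = f u + cscale (-1) (f v)" using uv add scale cfun.subspace_scale[OF sV] by metis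
    also have "\<dots> = 0" using uv by (simp add: cscale_def fun_eq_iff)
    finally have "u + cscale (-1) v = 0"
      using ker uv cfun.subspace_add[OF sV] cfun.subspace_scale[OF sV] by blast
    then show "u = v" by (auto simp: cscale_def fun_eq_iff)
  qed
  define h where "h = inv_into V f"
  have hf: "h (f v) = v" if "v \<in> V" for v using inj that by (simp add: h_def)
  have fh: "f (h w) = w" "h w \<in> V" if "w \<in> W" for w
    using that onto by (simp_all add: h_def f_inv_into_f inv_into_into)
  have "linear_on W V h"
    unfolding linear_on_def
  proof (intro conjI ballI allI)
    fix u v assume uv: "u \<in> W" "v \<in> W"
    have "f (h u + h v) = u + v" using uv by (simp add: add fh)
    then show "h (u + v) = h u + h v" using hf uv fh cfun.subspace_add[OF sV] by metis
  next
    fix c u assume u: "u \<in> W"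
    have "f (cscale c (h u)) = cscale c u" using u by (simp add: scale fh)
    then show "h (cscale c u) = cscale c (h u)" using hf u fh cfun.subspace_scale[OF sV] by metis
  qed (rule fh)
  then have "trace_on V (\<rho> g) = trace_on W (\<sigma> g)" if "g \<in> carrier G" for g
    using that by (intro trace_on_iso[OF B rep_on_linear[OF rV] rep_on_linear[OF rW] lin _ _ _ _ C]) (auto simp: hf comm fh)
  then show ?thesis by simp
qed

context diagram begin

lemma irr_char_eq_rep_char: "irr_char \<mu> = rep_char (sym_group n) (specht_module \<mu>) perm_act"
  using sorted by (simp add: irr_char_def)

text \<open>The finitely many tabloids of the shape are enumerated by natural numbers, and pulling
  functions back along the enumeration is the map used for the transport.\<close>

lemma irr_char_in_irr_chars: "irr_char \<mu> \<in> irr_chars (sym_group n)"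
proof -
  obtain e :: "nat \<Rightarrow> nat set list" and d where e: "bij_betw e {..<d} (tabloids l shape {1..n})"
    using ex_bij_betw_nat_finite[OF finite_tabloids[of "{1..n}" l shape]] by (auto simp: atLeast0LessThan)
  define T :: "(nat set list \<Rightarrow> complex) \<Rightarrow> nat \<Rightarrow> complex" where "T u = (\<lambda>i. if i < d then u (e i) else 0)" for u
  define T' :: "(nat \<Rightarrow> complex) \<Rightarrow> nat set list \<Rightarrow> complex"
    where "T' w = (\<lambda>t. if t \<in> tabloids l shape {1..n} then w (inv_into {..<d} e t) else 0)" for w
  have "linear_on UNIV UNIV T" "linear_on UNIV UNIV T'"
    by (auto simp: linear_on_def T_def T'_def cscale_def fun_eq_iff)
  moreover have "T' (T v) = v" if "v \<in> specht_module \<mu>" for v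
  proof
    fix t
    have "v \<in> tabloid_space l shape n" using that specht_subset by blast
    then have "v t = 0" if "t \<notin> tabloids l shape {1..n}" using that by (auto simp: tabloid_space_def)
    moreover have "e (inv_into {..<d} e t) = t" "inv_into {..<d} e t \<in> {..<d}" if "t \<in> tabloids l shape {1..n}"
    proof -
      have "t \<in> e ` {..<d}" using that e unfolding bij_betw_def by blast
      then show "e (inv_into {..<d} e t) = t" "inv_into {..<d} e t \<in> {..<d}"
        by (rule f_inv_into_f, rule inv_into_into)
    qed
    ultimately show "T' (T v) t = v t" by (auto simp: T_def T'_def)
  qed
  ultimately have T: "irreducible_rep_on (sym_group n) (T ` specht_module \<mu>) (\<lambda>g w. T (perm_act g (T' w)))"
    "rep_char (sym_group n) (T ` specht_module \<mu>) (\<lambda>g w. T (perm_act g (T' w))) = irr_char \<mu>"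
    using irreducible_transport[OF specht_irreducible] unfolding irr_char_eq_rep_char by blast+
  show ?thesis unfolding irr_chars_def by (intro CollectI exI conjI) (rule T(2)[symmetric], rule T(1))
qed

lemma irr_chars_dichotomy:
  assumes "\<phi> \<in> irr_chars (sym_group n)"
  shows "\<phi> = irr_char \<mu> \<or> (\<Sum>g | g permutes {1..n}. \<phi> g * irr_char \<mu> g) = 0"
proof -
  obtain W :: "(nat \<Rightarrow> complex) set" and \<sigma> where W: "irreducible_rep_on (sym_group n) W \<sigma>" "\<phi> = rep_char (sym_group n) W \<sigma>"
    using assms unfolding irr_chars_def by blast
  have "(\<forall>g\<in>carrier (sym_group n). trace_on W (\<sigma> g) = trace_on (specht_module \<mu>) (perm_act g)) \<or>
    (\<Sum>g\<in>carrier (sym_group n). trace_on W (\<sigma> g) * trace_on (specht_module \<mu>) (perm_act (inv\<^bsub>sym_group n\<^esub> g))) = 0"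
    by (rule schur_dichotomy[OF sym_group_is_group finite_sym_group specht_irreducible W(1)])
  then show ?thesis
  proof
    assume "\<forall>g\<in>carrier (sym_group n). trace_on W (\<sigma> g) = trace_on (specht_module \<mu>) (perm_act g)"
    then show ?thesis unfolding W(2) irr_char_eq_rep_char by (auto simp: rep_char_def)
  next
    assume "(\<Sum>g\<in>carrier (sym_group n). trace_on W (\<sigma> g) * trace_on (specht_module \<mu>) (perm_act (inv\<^bsub>sym_group n\<^esub> g))) = 0"
    then have "(\<Sum>g | g permutes {1..n}. trace_on W (\<sigma> g) * trace_on (specht_module \<mu>) (perm_act g)) = 0"
      using sum_inv_carrier by simp
    moreover have "\<phi> g * irr_char \<mu> g = trace_on W (\<sigma> g) * trace_on (specht_module \<mu>) (perm_act g)" if "g permutes {1..n}" for g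
      using that unfolding W(2) irr_char_eq_rep_char by (simp add: rep_char_def sym_group_carrier)
    ultimately show ?thesis by simp
  qed
qed

end

section \<open>Multiplicities as overlaps of boundary words\<close>

lemma pairing_nonzero_sum:
  assumes "pairing l v w \<noteq> 0" shows "(\<Sum>i<l. v i) = (\<Sum>i<l. w i)"
proof -
  obtain \<pi> where pi: "\<pi> permutes {..<l}" "\<forall>i<l. v i = w (\<pi> i)"
  proof (rule ccontr)
    assume "\<not> thesis"
    then have "pairing l v w = 0" unfolding pairing_def using that by (intro sum.neutral) auto
    then show False using assms by simp
  qed
  have "(\<Sum>i<l. v i) = (\<Sum>i<l. w (\<pi> i))" using pi by (intro sum.cong) auto
  then show ?thesis using sum.permute[OF pi(1), of w] by (simp add: o_def)
qed

lemma xchar_nonzero_sum: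
  "xchar l rs v \<noteq> 0 \<Longrightarrow> 2 * (\<Sum>i<l. v i) = 2 * int (sum_list rs) + int l * (int l - 1)"
proof (induction rs arbitrary: v)
  case Nil
  then show ?case using pairing_nonzero_sum[of l v "staircase l"] sum_staircase[of l] by simp
next
  case (Cons r rs)
  have "\<exists>j<l. xchar l rs (shift v j (- int r)) \<noteq> 0"
  proof (rule ccontr)
    assume "\<not> ?thesis"
    then have "xchar l (r # rs) v = 0" by simp
    then show False using Cons.prems by blast
  qed
  then obtain j where j: "j < l" "xchar l rs (shift v j (- int r)) \<noteq> 0" by blast
  have "(\<Sum>i<l. shift v j (- int r) i) = (\<Sum>i<l. v i - (if i = j then int r else 0))"
    by (intro sum.cong) (auto simp: shift_def)
  also have "\<dots> = (\<Sum>i<l. v i) - int r" using j(1) by (simp add: sum_subtractf)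
  finally show ?case using Cons.IH[OF j(2)] by simp
qed

text \<open>Extends orthonormality to arbitrary \<open>v\<close>: a negative entry or a wrong sum
  makes both sides 0.\<close>

lemma xchar_pairing:
  assumes w: "\<And>j. j < l \<Longrightarrow> 0 \<le> w j" and sum: "2 * (\<Sum>i<l. w i) = 2 * int n + int l * (int l - 1)"
  shows "(\<Sum>g | g permutes {1..n}. xchar l (cycle_type g {1..n}) w * xchar l (cycle_type g {1..n}) v) = fact n * pairing l v w"
proof (cases "(\<forall>j<l. 0 \<le> v j) \<and> (\<Sum>i<l. v i) = (\<Sum>i<l. w i)")
  case True
  then have v: "\<And>j. j < l \<Longrightarrow> 0 \<le> v j" "(\<Sum>i<l. v i) = (\<Sum>i<l. w i)" by auto
  have "2 * (\<Sum>i<l. v i) = 2 * int (card {1..n}) + int l * (int l - 1)" using v(2) sum by simp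
  from xchar_orthonormal[OF finite_atLeastAtMost v(1) w this]
  show ?thesis by (simp add: mult.commute del: One_nat_def)
next
  case False
  have "xchar l (cycle_type g {1..n}) v = 0" if "g permutes {1..n}" for g
  proof (rule ccontr)
    assume nz: "xchar l (cycle_type g {1..n}) v \<noteq> 0"
    then have "(\<Sum>i<l. v i) = (\<Sum>i<l. w i)"
      using xchar_nonzero_sum[OF nz] cycle_type_permutes(2)[OF that] sum by simp
    then show False using False xchar_negative[of _ l v] nz by (meson not_le)
  qed
  moreover have "pairing l v w = 0"
  proof (cases "\<forall>j<l. 0 \<le> v j")
    case True
    then show ?thesis using pairing_nonzero_sum False by blast
  next
    case False
    then show ?thesis using pairing_negative[of _ l v w] w by (metis not_le pairing_commute)
  qed
  ultimately show ?thesis by simp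
qed

lemma shifts_sum: "shifts l i (\<lambda>v. \<Sum>g\<in>A. c g * f g v) v = (\<Sum>g\<in>A. c g * shifts l i (f g) v)" for c :: "'a \<Rightarrow> int"
  unfolding shifts_def by (subst sum.swap) (simp only: sum_distrib_left)

lemma ups_sum: "ups l is (\<lambda>v. \<Sum>g\<in>A. c g * f g v) v = (\<Sum>g\<in>A. c g * ups l is (f g) v)" for c :: "'a \<Rightarrow> int"
proof (induction "is" arbitrary: v)
  case (Cons i "is")
  then have "ups l is (\<lambda>v. \<Sum>g\<in>A. c g * f g v) = (\<lambda>v. \<Sum>g\<in>A. c g * ups l is (f g) v)" by blast
  then show ?case by (simp only: ups.simps shifts_sum)
qed simp

lemma downs_sum: "downs l is (\<lambda>v. \<Sum>g\<in>A. c g * f g v) v = (\<Sum>g\<in>A. c g * downs l is (f g) v)" for c :: "'a \<Rightarrow> int"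
proof (induction "is" arbitrary: v)
  case (Cons i "is")
  then have "downs l is (\<lambda>v. \<Sum>g\<in>A. c g * f g v) = (\<lambda>v. \<Sum>g\<in>A. c g * downs l is (f g) v)" by blast
  then show ?case by (simp only: downs.simps shifts_sum)
qed simp

lemma nonneg_part_sum:
  "nonneg_part l (\<lambda>v. \<Sum>g\<in>A. c g * f g v) v = (\<Sum>g\<in>A. c g * nonneg_part l (f g) v)" for c :: "'a \<Rightarrow> int"
proof (cases "\<forall>j<l. 0 \<le> v j")
  case True
  show ?thesis unfolding nonneg_part_def if_P[OF True] by (rule refl)
next
  case False
  then show ?thesis unfolding nonneg_part_def if_not_P[OF False] by simp
qed

lemma downs_snoc: "downs l (is @ [i]) f = downs l is (shifts l (- int i) f)"
  by (induction "is") simp_all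

lemma shifts_finite_sum: "shifts l i (\<lambda>v. \<Sum>k<m. h k v) v = (\<Sum>k<m. shifts l i (h k) v)"
  unfolding shifts_def by (rule sum.swap)

lemma downs_finite_sum: "downs l is (\<lambda>v. \<Sum>k<m. h k v) v = (\<Sum>k<m. downs l is (h k) v)"
proof (induction "is" arbitrary: v)
  case (Cons i "is")
  then have "downs l is (\<lambda>v. \<Sum>k<m. h k v) = (\<lambda>v. \<Sum>k<m. downs l is (h k) v)" by blast
  then show ?case by (simp only: downs.simps shifts_finite_sum)
qed simp

text \<open>Raising \<open>v\<close> is adjoint to lowering \<open>w\<close>; moving the operators
  across one at a time reverses their order.\<close>

lemma ups_pairing: "ups l is (\<lambda>v. pairing l v w) v = downs l (rev is) (pairing l v) w"
proof (induction "is" arbitrary: v)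
  case (Cons i "is")
  have "shifts l (- int i) (pairing l v) = (\<lambda>w. \<Sum>k<l. pairing l (shift v k (int i)) w)"
    unfolding shifts_def using pairing_adjoint[of l v "int i"] by simp
  then have "downs l (rev (i # is)) (pairing l v) w = (\<Sum>k<l. downs l (rev is) (pairing l (shift v k (int i))) w)"
    by (simp only: rev.simps downs_snoc downs_finite_sum)
  also have "\<dots> = ups l (i # is) (\<lambda>v. pairing l v w) v"
    by (simp only: ups.simps shifts_def Cons.IH)
  finally show ?case by simp
qed simp

definition at_values :: "((nat \<Rightarrow> int) \<Rightarrow> int) \<Rightarrow> int list \<Rightarrow> int"
  where "at_values f vs = f (\<lambda>i. vs ! i)"

text \<open>
  A boundary word records a beta set from its highest position down to position 0. The first argument
  \<open>j\<close> of \<open>put\<close> and \<open>ribbons\<close> stands for a ribbon of length \<open>j + 1\<close>.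
\<close>

fun positions :: "bool list \<Rightarrow> int list" where
  "positions [] = []"
| "positions (b # w) = (if b then int (length w) # positions w else positions w)"

text \<open>Places a bead at index \<open>j\<close> of the word, counted from its high end. It fails
  at an occupied position, and every bead passed on the way changes the sign; this is the leg-length
  sign of the ribbon.\<close>

fun put :: "nat \<Rightarrow> bool list \<Rightarrow> (int \<times> bool list) option" where
  "put j [] = None"
| "put 0 (b # w) = (if b then None else Some (1, True # w))"
| "put (Suc j) (b # w) = (case put j w of None \<Rightarrow> None | Some (s, u) \<Rightarrow> Some (if b then - s else s, b # u))"

fun ribbons :: "nat \<Rightarrow> bool list \<Rightarrow> (int \<times> bool list) list" where
  "ribbons j [] = []"
| "ribbons j (b # w) = (if b then case put j w of None \<Rightarrow> [] | Some (s, u) \<Rightarrow> [(s, False # u)] else [])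
     @ map (\<lambda>(c, u). (c, b # u)) (ribbons j w)"

lemma put_length: "put j w = Some (s, u) \<Longrightarrow> length u = length w \<and> length (positions u) = Suc (length (positions w))"
proof (induction j w arbitrary: s u rule: put.induct)
  case (2 b w)
  then have "\<not> b" "u = True # w" by (cases b; simp)+
  then show ?case by simp
next
  case (3 j b w)
  then obtain t x where "put j w = Some (t, x)" "u = b # x" by (auto split: option.splits)
  then show ?case using 3(1)[of t x] by simp
qed simp

lemma put_None: "length w \<le> j \<Longrightarrow> put j w = None"
proof (induction j w rule: put.induct)
  case (3 j b w)
  then have "put j w = None" by simp
  then show ?case by simp
qed simp_all

lemma at_values_swap:
  assumes "alternating l f" "length pre + length post + 2 = l"
  shows "at_values f (pre @ x # y # post) = - at_values f (pre @ y # x # post)"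
  unfolding at_values_def
proof (rule alternating_swap'[OF assms(1), of "length pre" "Suc (length pre)"])
  fix i assume "i < l" "i \<noteq> length pre" "i \<noteq> Suc (length pre)"
  then show "(pre @ x # y # post) ! i = (pre @ y # x # post) ! i"
    by (auto simp: nth_append nth_Cons split: nat.splits)
qed (use assms in \<open>auto simp: nth_append\<close>)

text \<open>The new value stands in front of a decreasing list and is moved to its place by adjacent
  swaps, each of them past a larger value and at the cost of one sign.\<close>

lemma put_sound:
  assumes f: "alternating l f" and "length pre + length (positions w) + 1 = l" "j < length w"
  shows "at_values f (pre @ (int (length w) - 1 - int j) # positions w)
    = (case put j w of None \<Rightarrow> 0 | Some (s, u) \<Rightarrow> s * at_values f (pre @ positions u))"
  using assms(2,3)
proof (induction j w arbitrary: pre rule: put.induct)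
  case (2 b w)
  show ?case
  proof (cases b)
    case True
    then have "at_values f (pre @ int (length w) # int (length w) # positions w) = 0"
      using at_values_swap[OF f, of pre "positions w" "int (length w)" "int (length w)"] 2 by simp
    then show ?thesis using True by simp
  qed simp
next
  case (3 j b w)
  let ?x = "int (length w) - 1 - int j"
  have x: "int (length (b # w)) - 1 - int (Suc j) = ?x" by simp
  show ?case
  proof (cases b)
    case True
    have "at_values f (pre @ ?x # int (length w) # positions w) = - at_values f ((pre @ [int (length w)]) @ ?x # positions w)"
      using at_values_swap[OF f, of pre "positions w" ?x "int (length w)"] 3(2) True by simp
    note swapped = this
    have IH: "at_values f ((pre @ [int (length w)]) @ ?x # positions w)
      = (case put j w of None \<Rightarrow> 0 | Some (s, u) \<Rightarrow> s * at_values f ((pre @ [int (length w)]) @ positions u))"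
      by (rule 3(1)) (use 3(2,3) True in auto)
    show ?thesis
    proof (cases "put j w")
      case None
      then show ?thesis using True swapped IH unfolding x by simp
    next
      case (Some p)
      obtain s u where p: "p = (s, u)" by (cases p)
      then show ?thesis using True swapped IH Some put_length[of j w s u] unfolding x by simp
    qed
  next
    case False
    have "at_values f (pre @ ?x # positions w) = (case put j w of None \<Rightarrow> 0 | Some (s, u) \<Rightarrow> s * at_values f (pre @ positions u))"
      by (rule 3(1)) (use 3(2,3) False in auto)
    then show ?thesis using False unfolding x by (auto split: option.splits)
  qed
qed simp

lemma ribbons_length:
  "(c, u) \<in> set (ribbons j w) \<Longrightarrow> length u = length w \<and> length (positions u) = length (positions w)"
proof (induction w arbitrary: c u)
  case (Cons b w)
  have "(\<exists>s x. b \<and> put j w = Some (s, x) \<and> u = False # x) \<or> (\<exists>x. (c, x) \<in> set (ribbons j w) \<and> u = b # x)"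
    using Cons.prems by (cases b; cases "put j w") auto
  then consider s x where "b" "put j w = Some (s, x)" "u = False # x" | x where "(c, x) \<in> set (ribbons j w)" "u = b # x"
    by blast
  then show ?case
  proof cases
    case 1
    then show ?thesis using put_length[of j w s x] by simp
  next
    case 2
    then show ?thesis using Cons.IH[of c x] by simp
  qed
qed simp

text \<open>Each removal lowers one bead. A bead that would drop below position 0 is not listed by
  \<open>ribbons\<close>, and the corresponding term is 0 because \<open>f\<close> vanishes on
  negative entries.\<close>

lemma ribbons_sound:
  assumes f: "alternating l f" "vanishes_negative l f" and "length pre + length (positions w) = l"
  shows "eval_terms (\<lambda>u. at_values f (pre @ positions u)) (ribbons j w)
    = (\<Sum>k<length (positions w). at_values f (pre @ (positions w)[k := positions w ! k - int (Suc j)]))"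
  using assms(3)
proof (induction w arbitrary: pre)
  case Nil
  then show ?case by simp
next
  case (Cons b w)
  show ?case
  proof (cases b)
    case True
    let ?pre = "pre @ [int (length w)]"
    have IH: "eval_terms (\<lambda>u. at_values f (?pre @ positions u)) (ribbons j w)
      = (\<Sum>k<length (positions w). at_values f (?pre @ (positions w)[k := positions w ! k - int (Suc j)]))"
      by (rule Cons.IH) (use Cons.prems True in auto)
    have "eval_terms (\<lambda>u. at_values f (pre @ positions u)) (map (\<lambda>(c, u). (c, True # u)) (ribbons j w))
      = eval_terms (\<lambda>u. at_values f (pre @ positions (True # u))) (ribbons j w)"
      using eval_terms_map[of "\<lambda>u. at_values f (pre @ positions u)" 1 "\<lambda>u. True # u" "ribbons j w"] by simp
    also have "\<dots> = eval_terms (\<lambda>u. at_values f (?pre @ positions u)) (ribbons j w)"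
      by (rule eval_terms_cong) (auto dest: ribbons_length)
    finally have rest: "eval_terms (\<lambda>u. at_values f (pre @ positions u)) (map (\<lambda>(c, u). (c, True # u)) (ribbons j w))
      = eval_terms (\<lambda>u. at_values f (?pre @ positions u)) (ribbons j w)" .
    have first: "at_values f (pre @ (int (length w) - int (Suc j)) # positions w)
      = eval_terms (\<lambda>u. at_values f (pre @ positions u)) (case put j w of None \<Rightarrow> [] | Some (s, u) \<Rightarrow> [(s, False # u)])"
    proof (cases "j < length w")
      case True
      have "at_values f (pre @ (int (length w) - 1 - int j) # positions w)
        = (case put j w of None \<Rightarrow> 0 | Some (s, u) \<Rightarrow> s * at_values f (pre @ positions u))"
        by (rule put_sound[OF f(1) _ True]) (use Cons.prems \<open>b\<close> in simp)
      then show ?thesis by (auto split: option.splits simp: algebra_simps)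
    next
      case False
      have "at_values f (pre @ (int (length w) - int (Suc j)) # positions w) = 0"
        unfolding at_values_def by (rule vanishes_negativeD[OF f(2), of "length pre"])
          (use False Cons.prems \<open>b\<close> in \<open>auto simp: nth_append\<close>)
      then show ?thesis using False by (simp add: put_None)
    qed
    have sum: "(\<Sum>k<length (positions (b # w)). at_values f (pre @ (positions (b # w))[k := positions (b # w) ! k - int (Suc j)]))
      = at_values f (pre @ (int (length w) - int (Suc j)) # positions w)
        + (\<Sum>k<length (positions w). at_values f (?pre @ (positions w)[k := positions w ! k - int (Suc j)]))"
      using True by (simp add: sum.lessThan_Suc_shift del: sum.lessThan_Suc)
    show ?thesis unfolding sum first IH[symmetric] rest[symmetric] using True by simp
  next
    case False
    have IH: "eval_terms (\<lambda>u. at_values f (pre @ positions u)) (ribbons j w)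
      = (\<Sum>k<length (positions w). at_values f (pre @ (positions w)[k := positions w ! k - int (Suc j)]))"
      by (rule Cons.IH) (use Cons.prems False in auto)
    have "eval_terms (\<lambda>u. at_values f (pre @ positions u)) (map (\<lambda>(c, u). (c, False # u)) (ribbons j w))
      = eval_terms (\<lambda>u. at_values f (pre @ positions (False # u))) (ribbons j w)"
      using eval_terms_map[of "\<lambda>u. at_values f (pre @ positions u)" 1 "\<lambda>u. False # u" "ribbons j w"] by simp
    then show ?thesis using IH False by simp
  qed
qed

lemma at_values_shifts:
  assumes "alternating l f" "length vs = l"
  shows "at_values (shifts l (- i) f) vs = (\<Sum>k<l. at_values f (vs[k := vs ! k - i]))"
  unfolding at_values_def shifts_def
proof (rule sum.cong[OF refl])
  fix k assume "k \<in> {..<l}"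
  then show "f (shift (\<lambda>i. vs ! i) k (- i)) = f (\<lambda>j. vs[k := vs ! k - i] ! j)"
    using assms(2) by (intro alternating_cong[OF assms(1)]) (auto simp: shift_def nth_list_update)
qed

fun removals :: "nat list \<Rightarrow> bool list \<Rightarrow> (int \<times> bool list) list" where
  "removals [] w = [(1, w)]"
| "removals (j # js) w = concat (map (\<lambda>(c, u). map (\<lambda>(d, x). (c * d, x)) (removals js u)) (ribbons j w))"

lemma removals_length:
  "(c, u) \<in> set (removals js w) \<Longrightarrow> length u = length w \<and> length (positions u) = length (positions w)"
proof (induction js arbitrary: c u w)
  case (Cons j js)
  then obtain d e x where "(d, x) \<in> set (ribbons j w)" "(e, u) \<in> set (removals js x)" by auto
  then show ?case using ribbons_length[of d x j w] Cons.IH[of e u x] by simp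
qed simp

lemma eval_terms_concat:
  "eval_terms G (concat (map (\<lambda>(c, u). map (\<lambda>(d, x). (c * d, x)) (h u)) ts)) = eval_terms (\<lambda>u. eval_terms G (h u)) ts"
proof (induction ts)
  case (Cons t ts)
  have "eval_terms G (map (\<lambda>(d, x). (c * d, x)) ts) = c * eval_terms G ts" for c ts
    using eval_terms_map[of G c "\<lambda>x. x" ts] by simp
  then show ?case using Cons by (cases t) simp
qed simp

lemma removals_sound:
  assumes f: "alternating l f" "vanishes_negative l f" and "length (positions w) = l"
  shows "eval_terms (\<lambda>u. at_values f (positions u)) (removals js w) = at_values (downs l (map Suc js) f) (positions w)"
  using assms(3)
proof (induction js arbitrary: w)
  case (Cons j js)
  let ?f = "downs l (map Suc js) f"
  have "eval_terms (\<lambda>u. at_values f (positions u)) (removals (j # js) w)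
    = eval_terms (\<lambda>u. eval_terms (\<lambda>u. at_values f (positions u)) (removals js u)) (ribbons j w)"
    by (simp only: removals.simps eval_terms_concat)
  also have "\<dots> = eval_terms (\<lambda>u. at_values ?f (positions u)) (ribbons j w)"
    using Cons.prems by (intro eval_terms_cong Cons.IH) (auto dest: ribbons_length)
  also have "\<dots> = at_values (shifts l (- int (Suc j)) ?f) (positions w)"
    using ribbons_sound[OF alternating_downs[OF f(1)] vanishes_negative_downs[OF f(2)], of "[]" w "map Suc js" j]
      at_values_shifts[OF alternating_downs[OF f(1)] Cons.prems, of "int (Suc j)" "map Suc js"] Cons.prems
    by simp
  finally show ?case by simp
qed simp

section \<open>Counting common removals\<close>

fun tails :: "bool \<Rightarrow> (int \<times> bool list) list \<Rightarrow> (int \<times> bool list) list" where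
  "tails b [] = []"
| "tails b ((c, w) # ts) = (case w of [] \<Rightarrow> tails b ts | x # u \<Rightarrow> if x = b then (c, u) # tails b ts else tails b ts)"

fun coeff_sum :: "(int \<times> bool list) list \<Rightarrow> int" where
  "coeff_sum [] = 0"
| "coeff_sum ((c, w) # ts) = c + coeff_sum ts"

text \<open>Sums the products of coefficients over all pairs of equal words. Splitting both lists by
  the first letter descends a common tree of prefixes and stops as soon as one side is empty; the
  first argument supplies the common word length.\<close>

fun overlap :: "bool list \<Rightarrow> (int \<times> bool list) list \<Rightarrow> (int \<times> bool list) list \<Rightarrow> int" where
  "overlap [] ts us = coeff_sum ts * coeff_sum us"
| "overlap (b # w) ts us = (case ts of [] \<Rightarrow> 0 | _ # _ \<Rightarrow> (case us of [] \<Rightarrow> 0 | _ # _ \<Rightarrow>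
     overlap w (tails True ts) (tails True us) + overlap w (tails False ts) (tails False us)))"

lemma tails_length: "\<forall>t\<in>set ts. length (snd t) = Suc k \<Longrightarrow> \<forall>t\<in>set (tails b ts). length (snd t) = k"
  by (induction b ts rule: tails.induct) (auto split: list.splits)

lemma eval_terms_tails:
  assumes "\<forall>t\<in>set ts. length (snd t) = Suc k"
  shows "eval_terms G ts = eval_terms (\<lambda>u. G (True # u)) (tails True ts) + eval_terms (\<lambda>u. G (False # u)) (tails False ts)"
  using assms by (induction ts) (auto split: list.splits)

lemma coeff_sum_eval: "eval_terms (\<lambda>_. d) ts = coeff_sum ts * d"
  by (induction ts rule: coeff_sum.induct) (auto simp: algebra_simps)

lemma overlap_sound:
  assumes "\<forall>t\<in>set ts. length (snd t) = length w" "\<forall>t\<in>set us. length (snd t) = length w"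
  shows "overlap w ts us = eval_terms (\<lambda>x. eval_terms (\<lambda>y. of_bool (x = y)) us) ts"
  using assms
proof (induction w arbitrary: ts us)
  case Nil
  have "eval_terms (\<lambda>x. eval_terms (\<lambda>y. of_bool (x = y)) us) ts = eval_terms (\<lambda>x. eval_terms (\<lambda>y. 1) us) ts"
    using Nil by (intro eval_terms_cong) fastforce
  then show ?case by (simp add: coeff_sum_eval)
next
  case (Cons b w)
  have len: "\<forall>t\<in>set ts. length (snd t) = Suc (length w)" "\<forall>t\<in>set us. length (snd t) = Suc (length w)"
    using Cons.prems by simp_all
  have zero: "eval_terms (\<lambda>y. of_bool False) vs = 0" for vs :: "(int \<times> bool list) list"
    using coeff_sum_eval[of 0 vs] by simp
  have "overlap w (tails True ts) (tails True us) + overlap w (tails False ts) (tails False us)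
    = eval_terms (\<lambda>x. eval_terms (\<lambda>y. of_bool (x = y)) us) ts"
    unfolding Cons.IH[OF tails_length[OF len(1)] tails_length[OF len(2)]] eval_terms_tails[OF len(1)] eval_terms_tails[OF len(2)]
    by (simp add: zero del: of_bool_eq)
  moreover have "overlap (b # w) ts us = overlap w (tails True ts) (tails True us) + overlap w (tails False ts) (tails False us)"
    if "ts \<noteq> []" "us \<noteq> []" using that by (auto split: list.splits)
  moreover have "eval_terms (\<lambda>x. eval_terms (\<lambda>y. of_bool (x = y)) us) ts = 0" "overlap (b # w) ts us = 0" if "us = []"
    using that coeff_sum_eval[of 0 ts] by (simp_all split: list.splits)
  ultimately show ?case by (cases "ts = [] \<or> us = []") auto
qed

lemma positions_less: "x \<in> set (positions w) \<Longrightarrow> 0 \<le> x \<and> x < int (length w)"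
  by (induction w) (auto split: if_splits)

lemma positions_decreasing: "sorted_wrt (>) (positions w)"
  by (induction w) (auto dest: positions_less)

lemma positions_inject: "length w = length u \<Longrightarrow> positions w = positions u \<longleftrightarrow> w = u"
proof (induction w u rule: list_induct2)
  case (Cons b w c u)
  have "int (length w) \<notin> set (positions w)" "int (length w) \<notin> set (positions u)"
    using positions_less[of "int (length w)" w] positions_less[of "int (length w)" u] Cons(1) by auto
  then have "positions w \<noteq> int (length w) # vs" "positions u \<noteq> int (length w) # vs" for vs by auto
  then show ?case using Cons by (cases b; cases c) (auto dest: sym)
qed simp

lemma pairing_positions:
  assumes "length w = length u" "length (positions w) = l" "length (positions u) = l"
  shows "pairing l (\<lambda>i. positions w ! i) (\<lambda>i. positions u ! i) = of_bool (w = u)"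
proof -
  have "pairing l (\<lambda>i. positions w ! i) (\<lambda>i. positions u ! i) = of_bool (\<forall>i<l. positions w ! i = positions u ! i)"
    using sorted_wrt_nth_less[OF positions_decreasing] assms by (intro pairing_decreasing) auto
  also have "(\<forall>i<l. positions w ! i = positions u ! i) \<longleftrightarrow> w = u"
    using assms positions_inject[OF assms(1)] by (auto simp: list_eq_iff_nth_eq)
  finally show ?thesis .
qed

text \<open>Lowering acts on \<open>w\<close>, and raising passes over to \<open>u\<close> as
  lowering in the reverse order. Words stand for nonnegative vectors, so the truncation between them
  keeps every term, and two words pair to 1 exactly when they are equal.\<close>

lemma downs_ups_pairing:
  assumes "length w = length u" "length (positions w) = l" "length (positions u) = l"
  shows "at_values (downs l (map Suc js) (nonneg_part l (ups l (map Suc js) (\<lambda>v. pairing l v (\<lambda>i. positions u ! i))))) (positions w)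
    = overlap w (removals js w) (removals (rev js) u)"
proof -
  let ?U = "\<lambda>v. downs l (rev (map Suc js)) (pairing l v) (\<lambda>i. positions u ! i)"
  have alt: "alternating l (pairing l v)" for v
  proof -
    have "pairing l v = (\<lambda>w. pairing l w v)" by (rule ext) (rule pairing_commute)
    then show ?thesis using alternating_pairing[of l v] by (simp only:)
  qed
  have "(\<lambda>v. ups l (map Suc js) (\<lambda>v. pairing l v (\<lambda>i. positions u ! i)) v) = ?U" by (rule ext, rule ups_pairing)
  then have eq: "ups l (map Suc js) (\<lambda>v. pairing l v (\<lambda>i. positions u ! i)) = ?U" by simp
  have altU: "alternating l ?U"
    unfolding eq[symmetric] by (intro alternating_ups alternating_pairing)
  have "at_values (downs l (map Suc js) (nonneg_part l ?U)) (positions w)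
    = eval_terms (\<lambda>x. at_values (nonneg_part l ?U) (positions x)) (removals js w)"
    using assms(2) by (rule removals_sound[OF alternating_nonneg_part[OF altU] vanishes_negative_nonneg_part, symmetric])
  also have "\<dots> = eval_terms (\<lambda>x. eval_terms (\<lambda>y. of_bool (x = y)) (removals (rev js) u)) (removals js w)"
  proof (rule eval_terms_cong)
    fix c x assume x: "(c, x) \<in> set (removals js w)"
    then have lx: "length x = length w" "length (positions x) = l"
      using removals_length[of c x js w] assms(2) by simp_all
    have nonneg: "0 \<le> positions x ! j" if "j < l" for j
      using positions_less[of "positions x ! j" x] nth_mem that lx(2) by blast
    let ?p = "pairing l (\<lambda>i. positions x ! i)"
    have part: "eval_terms (\<lambda>y. at_values (nonneg_part l ?p) (positions y)) (removals (rev js) u)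
      = at_values (downs l (map Suc (rev js)) (nonneg_part l ?p)) (positions u)"
      using assms(3) by (rule removals_sound[OF alternating_nonneg_part[OF alt] vanishes_negative_nonneg_part])
    have "nonneg_part l ?p = ?p"
      using pairing_negative[where v = "\<lambda>i. positions x ! i"] nonneg by (auto simp: nonneg_part_def fun_eq_iff not_le)
    then have "?U (\<lambda>i. positions x ! i) = eval_terms (\<lambda>y. ?p (\<lambda>i. positions y ! i)) (removals (rev js) u)"
      using part by (simp add: at_values_def rev_map)
    also have "\<dots> = eval_terms (\<lambda>y. of_bool (x = y)) (removals (rev js) u)"
    proof (rule eval_terms_cong)
      fix d y assume "(d, y) \<in> set (removals (rev js) u)"
      then have "length y = length u" "length (positions y) = l"
        using removals_length[of d y "rev js" u] assms(3) by simp_all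
      then show "?p (\<lambda>i. positions y ! i) = of_bool (x = y)" using lx assms(1) by (intro pairing_positions) auto
    qed
    finally show "at_values (nonneg_part l ?U) (positions x) = eval_terms (\<lambda>y. of_bool (x = y)) (removals (rev js) u)"
      using nonneg by (simp add: at_values_def nonneg_part_def)
  qed
  also have "\<dots> = overlap w (removals js w) (removals (rev js) u)"
    using assms(1) by (intro overlap_sound[symmetric]) (auto dest: removals_length)
  finally show ?thesis unfolding eq .
qed

section \<open>Partitions as boundary words and the decision procedure\<close>

fun first_row :: "nat list \<Rightarrow> nat" where
  "first_row [] = 0"
| "first_row (x # xs) = x"

text \<open>The rim of the diagram as a sequence of beads and gaps read from the top row; the bead
  positions are the beta numbers, by \<open>positions_boundary\<close>.\<close>

fun boundary :: "nat list \<Rightarrow> bool list" where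
  "boundary [] = []"
| "boundary (x # xs) = True # replicate (x - first_row xs) False @ boundary xs"

text \<open>Gaps in front and zero rows at the end give all words the length \<open>h + l\<close>,
  so that the words of two partitions can be compared letter by letter.\<close>

definition boundary_word :: "nat \<Rightarrow> nat \<Rightarrow> nat list \<Rightarrow> bool list"
  where "boundary_word h l \<mu> = replicate (h - first_row \<mu>) False @ boundary (\<mu> @ replicate (l - length \<mu>) 0)"

text \<open>The coefficients are those of \<open>three_three_ops\<close>, with each ribbon length
  reduced by one. Adjointness reverses the order of removals from the second word, which shows only
  in \<open>[1, 0]\<close>.\<close>

definition overlap_count :: "bool list \<Rightarrow> bool list \<Rightarrow> int"
  where "overlap_count w u = overlap w (removals [0, 0, 0] w) (removals [0, 0, 0] u)
    + 3 * overlap w (removals [0, 1] w) (removals [1, 0] u) + 2 * overlap w (removals [2] w) (removals [2] u)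
    - 3 * overlap w (removals [0, 0] w) (removals [0, 0] u) - 3 * overlap w (removals [1] w) (removals [1] u)"

text \<open>Six times the multiplicity of \<open>[\<nu>]\<close> in the product with
  \<open>[\<mu>]\<close>, by \<open>char_inner_overlap\<close>. The three extra empty rows make room
  for ribbons of total length 3.\<close>

definition overlap_partitions :: "nat list \<Rightarrow> nat list \<Rightarrow> int"
  where "overlap_partitions \<mu> \<nu> =
    overlap_count (boundary_word (max (first_row \<mu>) (first_row \<nu>)) (max (length \<mu>) (length \<nu>) + 3) \<mu>)
      (boundary_word (max (first_row \<mu>) (first_row \<nu>)) (max (length \<mu>) (length \<nu>) + 3) \<nu>)"

fun bounded_partitions :: "nat \<Rightarrow> nat \<Rightarrow> nat list list" where
  "bounded_partitions 0 n = (if n = 0 then [[]] else [])"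
| "bounded_partitions (Suc m) n =
    (if Suc m \<le> n then map ((#) (Suc m)) (bounded_partitions (Suc m) (n - Suc m)) else []) @ bounded_partitions m n"

definition move_box :: "nat \<Rightarrow> nat \<Rightarrow> nat list \<Rightarrow> nat list"
  where "move_box i j \<mu> = filter (\<lambda>x. x \<noteq> 0) (\<mu>[i := \<mu> ! i - 1, j := \<mu> ! j + 1])"

text \<open>An overlap of 12 is twice 6 and thus signals multiplicity at least 2. Candidates that
  are not weakly decreasing lists of sum \<open>n\<close> are passed over.\<close>

fun some_repeated :: "nat \<Rightarrow> nat list \<Rightarrow> nat list list \<Rightarrow> bool" where
  "some_repeated n \<mu> [] = False"
| "some_repeated n \<mu> (\<nu> # \<nu>s) = (if (if sorted_wrt (\<ge>) \<nu> then sum_list \<nu> = n else False) then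
     if 12 \<le> overlap_partitions \<mu> \<nu> then True else some_repeated n \<mu> \<nu>s else some_repeated n \<mu> \<nu>s)"

text \<open>An empty row is appended so that index \<open>length \<mu>\<close> opens a new row. Some
  moves are invalid for short or special \<open>\<mu>\<close>, for instance when source and target
  coincide; \<open>some_repeated\<close> passes them over because of the wrong sum or order.\<close>

definition neighbours :: "nat list \<Rightarrow> nat list list"
  where "neighbours \<mu> = map (\<lambda>(i, j). move_box i j (\<mu> @ [0]))
    [(length \<mu> - 1, 0), (length \<mu> - 1, length \<mu>), (0, length \<mu>), (0, 1), (length \<mu> - 1, 1), (length \<mu> - 2, 0)]"

definition is_excluded :: "nat \<Rightarrow> nat list \<Rightarrow> bool"
  where "is_excluded n \<mu> \<longleftrightarrow> \<mu> = [n] \<or> \<mu> = [n - 1, 1] \<or> (case \<mu> of [a, b] \<Rightarrow> a = b | _ \<Rightarrow> False)"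

text \<open>The single test at \<open>\<nu> = \<mu>\<close> comes before all others. Only for
  partitions listed in \<open>ps\<close> are all multiplicities computed; any other partition that
  passes the first test must be excluded by the statement or have a neighbour of multiplicity at
  least 2.\<close>

definition check_partition :: "nat \<Rightarrow> nat list list \<Rightarrow> nat list \<Rightarrow> bool"
  where "check_partition n ps \<mu> \<longleftrightarrow>
    (if some_repeated n \<mu> [\<mu>] then \<mu> \<notin> set ps \<and> conjugate \<mu> \<notin> set ps
     else if \<mu> \<in> set ps \<or> conjugate \<mu> \<in> set ps then
       list_all (\<lambda>\<nu>. overlap_partitions \<mu> \<nu> = 0 \<or> overlap_partitions \<mu> \<nu> = 6) (bounded_partitions n n)
     else is_excluded n \<mu> \<or> is_excluded n (conjugate \<mu>) \<or> some_repeated n \<mu> (neighbours \<mu>))"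

definition check_partitions :: "nat \<Rightarrow> bool"
  where "check_partitions n \<longleftrightarrow> list_all (check_partition n [[4, 2], [4, 1, 1], [4, 3], [3, 3, 3]]) (bounded_partitions n n)"

lemma positions_replicate_False [simp]: "positions (replicate k False @ w) = positions w"
  by (induction k) auto

lemma first_row_le: "sorted_wrt (\<ge>) (x # xs) \<Longrightarrow> first_row xs \<le> x"
  by (cases xs) auto

lemma length_boundary: "sorted_wrt (\<ge>) xs \<Longrightarrow> length (boundary xs) = first_row xs + length xs"
proof (induction xs)
  case (Cons x xs)
  then show ?case using first_row_le[OF Cons.prems] by simp
qed simp

lemma positions_boundary:
  "sorted_wrt (\<ge>) xs \<Longrightarrow> length (positions (boundary xs)) = length xs \<and> (\<forall>i<length xs. positions (boundary xs) ! i = beta xs i)"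
proof (induction xs)
  case (Cons x xs)
  have "int (length (replicate (x - first_row xs) False @ boundary xs)) = int x + int (length xs)"
    using length_boundary[of xs] first_row_le[OF Cons.prems] Cons.prems by simp
  then have eq: "positions (boundary (x # xs)) = (int x + int (length xs)) # positions (boundary xs)" by simp
  have IH: "length (positions (boundary xs)) = length xs" "\<forall>i<length xs. positions (boundary xs) ! i = beta xs i"
    using Cons by auto
  have "positions (boundary (x # xs)) ! i = beta (x # xs) i" if "i < length (x # xs)" for i
    using that IH(2) unfolding eq by (cases i) (auto simp: beta_def staircase_def)
  then show ?case using IH(1) unfolding eq by simp
qed simp

lemma sorted_pad:
  assumes "sorted_wrt (\<ge>) \<mu>" shows "sorted_wrt (\<ge>) (\<mu> @ replicate k (0 :: nat))"
proof -
  have "sorted_wrt (\<ge>) (replicate k (0 :: nat))" by (induction k) auto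
  then show ?thesis using assms by (auto simp: sorted_wrt_append)
qed

lemma boundary_word_positions:
  assumes "sorted_wrt (\<ge>) \<mu>" "length \<mu> \<le> l" "first_row \<mu> \<le> h"
  shows "length (boundary_word h l \<mu>) = h + l" "length (positions (boundary_word h l \<mu>)) = l"
    "i < l \<Longrightarrow> positions (boundary_word h l \<mu>) ! i = beta (\<mu> @ replicate (l - length \<mu>) 0) i"
proof -
  let ?xs = "\<mu> @ replicate (l - length \<mu>) 0"
  have xs: "sorted_wrt (\<ge>) ?xs" "length ?xs = l" using sorted_pad[OF assms(1)] assms(2) by simp_all
  have "first_row ?xs = first_row \<mu>" by (cases \<mu>; cases "l - length \<mu>") simp_all
  then show "length (boundary_word h l \<mu>) = h + l"
    using length_boundary[OF xs(1)] xs(2) assms(3) by (simp add: boundary_word_def)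
  show "length (positions (boundary_word h l \<mu>)) = l"
    using positions_boundary[OF xs(1)] xs(2) by (simp add: boundary_word_def)
  show "positions (boundary_word h l \<mu>) ! i = beta ?xs i" if "i < l"
    using positions_boundary[OF xs(1)] xs(2) that by (simp add: boundary_word_def)
qed

section \<open>Group sums as overlap counts\<close>

lemma down_up_sum:
  fixes c :: "'a \<Rightarrow> int"
  shows "downs l is (nonneg_part l (ups l js (\<lambda>v. \<Sum>g\<in>A. c g * f g v))) v
    = (\<Sum>g\<in>A. c g * downs l is (nonneg_part l (ups l js (f g))) v)"
proof -
  have "ups l js (\<lambda>v. \<Sum>g\<in>A. c g * f g v) = (\<lambda>v. \<Sum>g\<in>A. c g * ups l js (f g) v)" by (rule ext) (rule ups_sum)
  then have "nonneg_part l (ups l js (\<lambda>v. \<Sum>g\<in>A. c g * f g v)) = (\<lambda>v. \<Sum>g\<in>A. c g * nonneg_part l (ups l js (f g)) v)"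
    by (simp only:) (rule ext, rule nonneg_part_sum)
  then show ?thesis by (simp only: downs_sum)
qed

lemma falling_lchar_values:
  assumes "0 \<notin> set rs" "sum_list (map Suc js) \<le> z" "xs = ys @ replicate z 0" "length w = length xs"
    "\<And>i. i < length xs \<Longrightarrow> w ! i = beta xs i"
  shows "falling (map Suc js) rs * lchar rs (map int xs)
    = at_values (downs (length xs) (map Suc js) (nonneg_part (length xs) (ups (length xs) (map Suc js) (xchar (length xs) rs)))) w"
proof -
  let ?F = "downs (length xs) (map Suc js) (nonneg_part (length xs) (ups (length xs) (map Suc js) (xchar (length xs) rs)))"
  have "falling (map Suc js) rs * lchar rs (map int xs) = at_rows ?F (map int xs)"
    using falling_times_lchar[OF assms(1) _ assms(2), of "map int xs" "map int ys"] assms(3) by simp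
  also have "\<dots> = at_values ?F w"
    unfolding at_rows_def at_values_def
    by (rule alternating_cong[OF alternating_downs[OF alternating_nonneg_part[OF alternating_ups[OF alternating_xchar]]]])
      (use assms(5) in \<open>simp add: beta_def\<close>)
  finally show ?thesis .
qed

lemma lchar_values:
  assumes "length w = length xs" "\<And>i. i < length xs \<Longrightarrow> w ! i = beta xs i"
  shows "lchar rs (map int xs) = xchar (length xs) rs (\<lambda>i. w ! i)"
  unfolding lchar_def length_map
  by (rule alternating_cong[OF alternating_xchar]) (use assms in \<open>simp add: beta_def\<close>)

text \<open>Multiplication by the falling product becomes \<open>ups\<close>, truncation and
  \<open>downs\<close> acting on \<open>xchar\<close>. By linearity the group sum moves inside these
  operators, orthonormality turns it into \<open>fact n\<close> times \<open>pairing\<close>, and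
  adjointness counts the common removals.\<close>

lemma sum_falling_overlap:
  assumes xs: "xs = zs @ replicate z 0" "sum_list (map Suc js) \<le> z" "length xs = l" "length ys = l" "sum_list ys = n"
    and w: "length (positions w) = l" "\<And>i. i < l \<Longrightarrow> positions w ! i = beta xs i"
    and u: "length (positions u) = l" "\<And>i. i < l \<Longrightarrow> positions u ! i = beta ys i" "length w = length u"
  shows "(\<Sum>g | g permutes {1..n}. lchar (cycle_type g {1..n}) (map int ys) *
      (falling (map Suc js) (cycle_type g {1..n}) * lchar (cycle_type g {1..n}) (map int xs)))
    = fact n * overlap w (removals js w) (removals (rev js) u)"
proof -
  let ?P = "{g. g permutes {1..n}}" and ?u = "\<lambda>i. positions u ! i"
  let ?X = "\<lambda>g. xchar l (cycle_type g {1..n})"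
  let ?D = "\<lambda>f. downs l (map Suc js) (nonneg_part l (ups l (map Suc js) f)) (\<lambda>i. positions w ! i)"
  have sum_u: "2 * (\<Sum>i<l. ?u i) = 2 * int n + int l * (int l - 1)"
    using sum_beta[of ys] u(2) assms(4,5) by simp
  have nonneg: "0 \<le> ?u j" if "j < l" for j using that u(2)[OF that] beta_nonneg[of j ys] assms(4) by simp
  have "(\<Sum>g\<in>?P. lchar (cycle_type g {1..n}) (map int ys) *
      (falling (map Suc js) (cycle_type g {1..n}) * lchar (cycle_type g {1..n}) (map int xs)))
    = (\<Sum>g\<in>?P. ?X g ?u * ?D (?X g))"
  proof (rule sum.cong[OF refl])
    fix g assume "g \<in> ?P"
    then have "0 \<notin> set (cycle_type g {1..n})" by (intro cycle_type_permutes) simp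
    from falling_lchar_values[OF this xs(2,1), of "positions w"] lchar_values[of "positions u" ys "cycle_type g {1..n}"]
    show "lchar (cycle_type g {1..n}) (map int ys) *
        (falling (map Suc js) (cycle_type g {1..n}) * lchar (cycle_type g {1..n}) (map int xs)) = ?X g ?u * ?D (?X g)"
      using assms(3,4) w u unfolding at_values_def by (simp del: One_nat_def)
  qed
  also have "\<dots> = ?D (\<lambda>v. \<Sum>g\<in>?P. ?X g ?u * ?X g v)" by (rule down_up_sum[symmetric])
  \<comment> \<open>The sum over a one-element set brings the constant \<open>fact n\<close> into
    the form that \<open>down_up_sum\<close> can pull out.\<close>
  also have "(\<lambda>v. \<Sum>g\<in>?P. ?X g ?u * ?X g v) = (\<lambda>v. \<Sum>g\<in>{()}. fact n * pairing l v ?u)"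
    by (rule ext) (subst xchar_pairing[OF nonneg sum_u], simp_all)
  also have "?D \<dots> = fact n * ?D (\<lambda>v. pairing l v ?u)" by (subst down_up_sum) simp
  also have "?D (\<lambda>v. pairing l v ?u) = overlap w (removals js w) (removals (rev js) u)"
    using downs_ups_pairing[OF u(3) w(1) u(1), of js] by (simp add: at_values_def)
  finally show ?thesis .
qed

lemma three_three_expand:
  assumes "g permutes {1..n}" "3 \<le> n"
  shows "6 * lchar (cycle_type g {1..n}) (map int [n - 3, 3]) =
    falling (map Suc [0, 0, 0]) (cycle_type g {1..n}) + 3 * falling (map Suc [0, 1]) (cycle_type g {1..n})
    + 2 * falling (map Suc [2]) (cycle_type g {1..n}) - 3 * falling (map Suc [0, 0]) (cycle_type g {1..n})
    - 3 * falling (map Suc [1]) (cycle_type g {1..n})"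
proof -
  have "map Suc [0, 0, 0] = [1, 1, 1]" "map Suc [0, 1] = [1, 2]" "map Suc [2] = [3]" "map Suc [0, 0] = [1, 1]" "map Suc [1] = [2]"
    by simp_all
  note words = this
  show ?thesis unfolding three_three_lchar[OF assms] three_three_ops_def words by (simp del: falling.simps)
qed

lemma sum_lchar_overlap:
  assumes xs: "xs = zs @ replicate 3 0" "length xs = l" "length ys = l" "sum_list ys = n" "3 \<le> n"
    and w: "length (positions w) = l" "\<And>i. i < l \<Longrightarrow> positions w ! i = beta xs i"
    and u: "length (positions u) = l" "\<And>i. i < l \<Longrightarrow> positions u ! i = beta ys i" "length w = length u"
  shows "6 * (\<Sum>g | g permutes {1..n}. lchar (cycle_type g {1..n}) (map int [n - 3, 3]) *
      lchar (cycle_type g {1..n}) (map int xs) * lchar (cycle_type g {1..n}) (map int ys))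
    = fact n * overlap_count w u"
proof -
  let ?P = "{g. g permutes {1..n}}"
  let ?y = "\<lambda>g. lchar (cycle_type g {1..n}) (map int ys)" and ?x = "\<lambda>g. lchar (cycle_type g {1..n}) (map int xs)"
  let ?s = "\<lambda>js. \<Sum>g\<in>?P. ?y g * (falling (map Suc js) (cycle_type g {1..n}) * ?x g)"
  have s: "?s js = fact n * overlap w (removals js w) (removals (rev js) u)" if "sum_list (map Suc js) \<le> 3" for js
    by (rule sum_falling_overlap[OF xs(1) that xs(2-4) w u])
  have s': "?s [0, 0, 0] = fact n * overlap w (removals [0, 0, 0] w) (removals [0, 0, 0] u)"
    "?s [0, 1] = fact n * overlap w (removals [0, 1] w) (removals [1, 0] u)"
    "?s [2] = fact n * overlap w (removals [2] w) (removals [2] u)"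
    "?s [0, 0] = fact n * overlap w (removals [0, 0] w) (removals [0, 0] u)"
    "?s [1] = fact n * overlap w (removals [1] w) (removals [1] u)"
    by (rule trans[OF s]; simp del: removals.simps)+
  have "6 * (\<Sum>g\<in>?P. lchar (cycle_type g {1..n}) (map int [n - 3, 3]) * ?x g * ?y g)
    = (\<Sum>g\<in>?P. ?y g * ((6 * lchar (cycle_type g {1..n}) (map int [n - 3, 3])) * ?x g))"
    unfolding sum_distrib_left by (intro sum.cong refl) (simp only: mult_ac)
  also have "\<dots> = (\<Sum>g\<in>?P. ?y g * (falling (map Suc [0, 0, 0]) (cycle_type g {1..n}) * ?x g)
      + 3 * (?y g * (falling (map Suc [0, 1]) (cycle_type g {1..n}) * ?x g))
      + 2 * (?y g * (falling (map Suc [2]) (cycle_type g {1..n}) * ?x g))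
      - 3 * (?y g * (falling (map Suc [0, 0]) (cycle_type g {1..n}) * ?x g))
      - 3 * (?y g * (falling (map Suc [1]) (cycle_type g {1..n}) * ?x g)))"
  proof (rule sum.cong[OF refl])
    fix g assume "g \<in> ?P"
    then have "g permutes {1..n}" by simp
    from three_three_expand[OF this xs(5)] show "?y g * ((6 * lchar (cycle_type g {1..n}) (map int [n - 3, 3])) * ?x g)
      = ?y g * (falling (map Suc [0, 0, 0]) (cycle_type g {1..n}) * ?x g)
      + 3 * (?y g * (falling (map Suc [0, 1]) (cycle_type g {1..n}) * ?x g))
      + 2 * (?y g * (falling (map Suc [2]) (cycle_type g {1..n}) * ?x g))
      - 3 * (?y g * (falling (map Suc [0, 0]) (cycle_type g {1..n}) * ?x g))
      - 3 * (?y g * (falling (map Suc [1]) (cycle_type g {1..n}) * ?x g))"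
      by (simp only:) (simp only: algebra_simps)
  qed
  also have "\<dots> = ?s [0, 0, 0] + 3 * ?s [0, 1] + 2 * ?s [2] - 3 * ?s [0, 0] - 3 * ?s [1]"
    by (simp only: sum.distrib sum_subtractf sum_distrib_left)
  also have "\<dots> = fact n * overlap_count w u"
    unfolding s' overlap_count_def by (simp only: algebra_simps)
  finally show ?thesis .
qed

lemma sum_irr_char_overlap:
  assumes \<mu>: "sorted_wrt (\<ge>) \<mu>" "sum_list \<mu> = n" and \<nu>: "sorted_wrt (\<ge>) \<nu>" "sum_list \<nu> = n" and n: "6 \<le> n"
  shows "6 * (\<Sum>g | g permutes {1..n}. irr_char [n - 3, 3] g * irr_char \<mu> g * irr_char \<nu> g)
    = fact n * of_int (overlap_partitions \<mu> \<nu>)"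
proof -
  define l where "l = max (length \<mu>) (length \<nu>) + 3"
  define h where "h = max (first_row \<mu>) (first_row \<nu>)"
  define xs where "xs = \<mu> @ replicate (l - length \<mu>) 0"
  define ys where "ys = \<nu> @ replicate (l - length \<nu>) 0"
  let ?w = "boundary_word h l \<mu>" and ?u = "boundary_word h l \<nu>"
  note w = boundary_word_positions[of \<mu> l h] and u = boundary_word_positions[of \<nu> l h]
  have bounds: "length \<mu> \<le> l" "length \<nu> \<le> l" "first_row \<mu> \<le> h" "first_row \<nu> \<le> h"
    by (simp_all add: l_def h_def)
  have "l - length \<mu> = (l - 3 - length \<mu>) + 3" by (simp add: l_def)
  then have "xs = (\<mu> @ replicate (l - 3 - length \<mu>) 0) @ replicate 3 0"
    unfolding xs_def by (simp only: replicate_add append.assoc)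
  moreover have "length xs = l" "length ys = l" "sum_list ys = n" using bounds \<nu> by (simp_all add: xs_def ys_def sum_list_replicate)
  ultimately have "6 * (\<Sum>g | g permutes {1..n}. lchar (cycle_type g {1..n}) (map int [n - 3, 3]) *
      lchar (cycle_type g {1..n}) (map int xs) * lchar (cycle_type g {1..n}) (map int ys)) = fact n * overlap_count ?w ?u"
    using n w u bounds \<mu> \<nu> by (intro sum_lchar_overlap) (simp_all add: xs_def ys_def)
  then have eq: "6 * (\<Sum>g | g permutes {1..n}. lchar (cycle_type g {1..n}) (map int [n - 3, 3]) *
      lchar (cycle_type g {1..n}) (map int xs) * lchar (cycle_type g {1..n}) (map int ys)) = fact n * overlap_partitions \<mu> \<nu>"
    by (simp only: overlap_partitions_def l_def h_def)
  have "(\<Sum>g | g permutes {1..n}. irr_char [n - 3, 3] g * irr_char \<mu> g * irr_char \<nu> g)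
    = (\<Sum>g | g permutes {1..n}. of_int (lchar (cycle_type g {1..n}) (map int [n - 3, 3]) *
      lchar (cycle_type g {1..n}) (map int xs) * lchar (cycle_type g {1..n}) (map int ys)))"
  proof (rule sum.cong[OF refl])
    fix g assume "g \<in> {g. g permutes {1..n}}"
    then have g: "g permutes {1..n}" by simp
    note rs = cycle_type_permutes(1)[OF g]
    have "lchar (cycle_type g {1..n}) (map int xs) = lchar (cycle_type g {1..n}) (map int \<mu>)"
      by (rule lchar_pad[OF rs, of _ _ "l - length \<mu>"]) (simp add: xs_def)
    moreover have "lchar (cycle_type g {1..n}) (map int ys) = lchar (cycle_type g {1..n}) (map int \<nu>)"
      by (rule lchar_pad[OF rs, of _ _ "l - length \<nu>"]) (simp add: ys_def)
    moreover have "irr_char [n - 3, 3] g = of_int (lchar (cycle_type g {1..n}) (map int [n - 3, 3]))"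
      using irr_char_lchar[of "[n - 3, 3]" g] n g by simp
    ultimately show "irr_char [n - 3, 3] g * irr_char \<mu> g * irr_char \<nu> g
      = of_int (lchar (cycle_type g {1..n}) (map int [n - 3, 3]) *
      lchar (cycle_type g {1..n}) (map int xs) * lchar (cycle_type g {1..n}) (map int ys))"
      using irr_char_lchar[OF \<mu>(1)] irr_char_lchar[OF \<nu>(1)] \<mu>(2) \<nu>(2) g by simp
  qed
  then have "6 * (\<Sum>g | g permutes {1..n}. irr_char [n - 3, 3] g * irr_char \<mu> g * irr_char \<nu> g)
    = of_int (6 * (\<Sum>g | g permutes {1..n}. lchar (cycle_type g {1..n}) (map int [n - 3, 3]) *
      lchar (cycle_type g {1..n}) (map int xs) * lchar (cycle_type g {1..n}) (map int ys)))"
    by (simp only: of_int_mult of_int_sum of_int_numeral)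
  then show ?thesis unfolding eq by simp
qed

section \<open>Characters orthogonal to all \<open>[\<nu>]\<close>\<close>

lemma straighten:
  assumes "\<forall>v\<in>set vs. 0 \<le> v \<and> v < int L"
  shows "\<exists>s w. length w = L \<and> (s \<noteq> 0 \<longrightarrow> length (positions w) = length vs) \<and>
    (\<forall>l f pre. alternating l f \<longrightarrow> length pre + length vs = l \<longrightarrow> at_values f (pre @ vs) = s * at_values f (pre @ positions w))"
  using assms
proof (induction vs)
  case Nil
  have "positions (replicate L False) = []" using positions_replicate_False[of L "[]"] by simp
  then show ?case by (intro exI[of _ 1] exI[of _ "replicate L False"]) simp
next
  case (Cons v vs)
  then have "\<exists>s w. length w = L \<and> (s \<noteq> 0 \<longrightarrow> length (positions w) = length vs) \<and>
    (\<forall>l f pre. alternating l f \<longrightarrow> length pre + length vs = l \<longrightarrow> at_values f (pre @ vs) = s * at_values f (pre @ positions w))"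
    by simp
  then obtain s w where "length w = L \<and> (s \<noteq> 0 \<longrightarrow> length (positions w) = length vs) \<and>
    (\<forall>l f pre. alternating l f \<longrightarrow> length pre + length vs = l \<longrightarrow> at_values f (pre @ vs) = s * at_values f (pre @ positions w))"
    by (elim exE)
  then have w: "length w = L" "s \<noteq> 0 \<Longrightarrow> length (positions w) = length vs"
    and val: "\<And>l f pre. alternating l f \<Longrightarrow> length pre + length vs = l \<Longrightarrow> at_values f (pre @ vs) = s * at_values f (pre @ positions w)"
    by blast+
  have val': "at_values f (pre @ v # vs) = s * at_values f (pre @ v # positions w)"
    if "alternating l f" "length pre + length (v # vs) = l" for l f pre
    using val[of l f "pre @ [v]"] that by simp
  \<comment> \<open>The index of position \<open>v\<close> in a word of length \<open>L\<close>,
    whose first letter stands for position \<open>L - 1\<close>.\<close>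
  define j where "j = nat (int L - 1 - v)"
  have j: "j < length w" "v = int (length w) - 1 - int j" using Cons.prems w(1) by (auto simp: j_def)
  show ?case
  proof (cases "s = 0 \<or> put j w = None")
    case True
    have "at_values f (pre @ v # vs) = 0" if "alternating l f" "length pre + length (v # vs) = l" for l f pre
    proof (cases "s = 0")
      case False
      then show ?thesis using val'[OF that] put_sound[OF that(1) _ j(1), of pre] True that(2) w(2) j(2) by simp
    qed (use val'[OF that] in simp)
    \<comment> \<open>A collision of entries makes every alternating function vanish, so the sign is
      0 and any word of the right length may accompany it.\<close>
    then show ?thesis using w(1) by (intro exI[of _ 0] exI[of _ w]) simp
  next
    case False
    then obtain t x where x: "put j w = Some (t, x)" by auto
    have "at_values f (pre @ v # vs) = (s * t) * at_values f (pre @ positions x)"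
      if "alternating l f" "length pre + length (v # vs) = l" for l f pre
      using val'[OF that] put_sound[OF that(1) _ j(1), of pre] x False that(2) w(2) j(2) by simp
    then show ?thesis using put_length[OF x] w False by (intro exI[of _ "s * t"] exI[of _ x]) simp
  qed
qed

lemma length_positions_le: "length (positions w) \<le> length w"
  by (induction w) auto

lemma positions_ge: "i < length (positions w) \<Longrightarrow> int (length (positions w)) - 1 - int i \<le> positions w ! i"
proof (induction w arbitrary: i)
  case (Cons b w)
  show ?case
  proof (cases b)
    case True
    show ?thesis
    proof (cases i)
      case 0
      then show ?thesis using True length_positions_le[of w] by simp
    next
      case (Suc k)
      then show ?thesis using True Cons.IH[of k] Cons.prems by simp
    qed
  next
    case False
    then show ?thesis using Cons by simp
  qed
qed simp

text \<open>Subtracting the staircase from strictly decreasing positions leaves a weakly decreasing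
  list; it is nonnegative because below the entry with index \<open>i\<close> there are
  \<open>l - 1 - i\<close> further distinct nonnegative positions.\<close>

lemma positions_beta:
  assumes "length (positions w) = l"
  obtains \<nu> where "sorted_wrt (\<ge>) \<nu>" "length \<nu> = l" "\<And>i. i < l \<Longrightarrow> beta \<nu> i = positions w ! i"
proof
  let ?\<nu> = "map (\<lambda>i. nat (positions w ! i - staircase l i)) [0..<l]"
  show "length ?\<nu> = l" by simp
  have ge: "0 \<le> positions w ! i - staircase l i" if "i < l" for i
    using positions_ge[of i w] that assms by (simp add: staircase_def)
  show "beta ?\<nu> i = positions w ! i" if "i < l" for i using ge[OF that] that by (simp add: beta_def)
  have "transp (\<lambda>x y :: nat. x \<ge> y)" by (auto simp: transp_def)
  moreover have "?\<nu> ! i \<ge> ?\<nu> ! Suc i" if "Suc i < l" for i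
  proof -
    have "positions w ! Suc i < positions w ! i"
      using sorted_wrt_nth_less[OF positions_decreasing, of i "Suc i" w] that assms by simp
    then show ?thesis using that by (auto simp: staircase_def intro!: nat_mono)
  qed
  ultimately show "sorted_wrt (\<ge>) ?\<nu>" by (simp add: sorted_wrt_iff_nth_Suc_transp)
qed

text \<open>Parts of \<open>\<nu>\<close> may be 0, the form in which straightening delivers
  partitions.\<close>

definition orthogonal_to_all :: "nat \<Rightarrow> ((nat \<Rightarrow> nat) \<Rightarrow> complex) \<Rightarrow> bool"
  where "orthogonal_to_all n \<phi> \<longleftrightarrow> (\<forall>\<nu>. sorted_wrt (\<ge>) \<nu> \<and> sum_list \<nu> = n \<longrightarrow>
    (\<Sum>g | g permutes {1..n}. \<phi> g * irr_char \<nu> g) = 0)"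

text \<open>Uniformly in the cycle type, \<open>xchar\<close> at \<open>v\<close> is 0 or a multiple
  of \<open>xchar\<close> at a beta sequence. If that sequence has size \<open>n\<close> it belongs
  to some \<open>[\<nu>]\<close>; otherwise its values at permutations of \<open>{1..n}\<close> are
  0.\<close>

lemma orthogonal_xchar:
  assumes "orthogonal_to_all n \<phi>"
  shows "(\<Sum>g | g permutes {1..n}. \<phi> g * of_int (xchar l (cycle_type g {1..n}) v)) = 0"
proof (cases "\<forall>j<l. 0 \<le> v j")
  case False
  then obtain j where "j < l" "v j < 0" by (meson not_le)
  then show ?thesis by (simp add: xchar_negative)
next
  case True
  define vs where "vs = map v [0..<l]"
  define L where "L = Suc (nat (\<Sum>j<l. v j))"
  have "\<forall>x\<in>set vs. 0 \<le> x \<and> x < int L"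
  proof
    fix x assume "x \<in> set vs"
    then obtain i where i: "i < l" "x = v i" by (auto simp: vs_def)
    have "v i \<le> (\<Sum>j<l. v j)" using True i by (intro member_le_sum) auto
    then show "0 \<le> x \<and> x < int L" using True i by (simp add: L_def)
  qed
  from straighten[OF this] obtain s w where w: "s \<noteq> 0 \<longrightarrow> length (positions w) = length vs"
    and "\<forall>l f pre. alternating l f \<longrightarrow> length pre + length vs = l \<longrightarrow> at_values f (pre @ vs) = s * at_values f (pre @ positions w)"
    by blast
  then have "at_values (xchar l rs) vs = s * at_values (xchar l rs) (positions w)" for rs
    using alternating_xchar[of l rs] by (metis append_Nil add_0 list.size(3) length_map length_upt minus_nat.diff_0 vs_def)
  moreover have "at_values (xchar l rs) vs = xchar l rs v" for rs
    unfolding at_values_def by (rule alternating_cong[OF alternating_xchar]) (simp add: vs_def)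
  ultimately have eq: "xchar l rs v = s * at_values (xchar l rs) (positions w)" for rs by simp
  show ?thesis
  proof (cases "s = 0")
    case False
    then have "length (positions w) = l" using w by (simp add: vs_def)
    then obtain \<nu> where \<nu>: "sorted_wrt (\<ge>) \<nu>" "length \<nu> = l" "\<And>i. i < l \<Longrightarrow> beta \<nu> i = positions w ! i"
      by (rule positions_beta) blast
    have eq': "xchar l rs v = s * xchar l rs (beta \<nu>)" for rs
      unfolding eq at_values_def using \<nu>(3) by (simp add: alternating_cong[OF alternating_xchar, of l "beta \<nu>"])
    show ?thesis
    proof (cases "sum_list \<nu> = n")
      case True
      have "(\<Sum>g | g permutes {1..n}. \<phi> g * of_int (xchar l (cycle_type g {1..n}) v))
        = (\<Sum>g | g permutes {1..n}. of_int s * (\<phi> g * irr_char \<nu> g))"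
        using irr_char_xchar[OF \<nu>(1)] True \<nu>(2) by (intro sum.cong refl) (simp add: eq' del: One_nat_def)
      also have "\<dots> = 0" using assms \<nu>(1) True unfolding orthogonal_to_all_def by (simp add: sum_distrib_left[symmetric])
      finally show ?thesis .
    next
      case False
      have "xchar l (cycle_type g {1..n}) (beta \<nu>) = 0" if "g permutes {1..n}" for g
        using xchar_nonzero_sum[of l "cycle_type g {1..n}" "beta \<nu>"] sum_beta[of \<nu>] \<nu>(2) False cycle_type_permutes(2)[OF that]
        by auto
      then show ?thesis by (simp add: eq' del: One_nat_def)
    qed
  qed (simp add: eq)
qed

lemma eval_terms_concat_map: "eval_terms G (concat (map h ks)) = (\<Sum>k\<leftarrow>ks. eval_terms G (h k))"
  by (induction ks) auto

text \<open>The vectors and coefficients in \<open>ts\<close> are the same for all cycle types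
  \<open>rs\<close>. This uniformity allows the group sum to be taken term by term.\<close>

lemma shifts_combination:
  assumes "\<And>v. \<exists>ts. \<forall>rs. h rs v = eval_terms (xchar l rs) ts"
  shows "\<exists>ts. \<forall>rs. shifts l i (h rs) v = eval_terms (xchar l rs) ts"
proof -
  obtain T where T: "\<And>v rs. h rs v = eval_terms (xchar l rs) (T v)" using assms by metis
  have "shifts l i (h rs) v = eval_terms (xchar l rs) (concat (map (\<lambda>k. T (shift v k i)) [0..<l]))" for rs
    by (simp add: shifts_def T eval_terms_concat_map interv_sum_list_conv_sum_set_nat atLeast0LessThan)
  then show ?thesis by blast
qed

lemma ups_combination: "\<exists>ts. \<forall>rs. ups l is (xchar l rs) v = eval_terms (xchar l rs) ts"
proof (induction "is" arbitrary: v)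
  case Nil
  show ?case by (intro exI[of _ "[(1, v)]"]) simp
next
  case (Cons i "is")
  then show ?case using shifts_combination[of "\<lambda>rs. ups l is (xchar l rs)" l "int i" v] by simp
qed

lemma downs_combination:
  assumes "\<And>v. \<exists>ts. \<forall>rs. h rs v = eval_terms (xchar l rs) ts"
  shows "\<exists>ts. \<forall>rs. downs l is (h rs) v = eval_terms (xchar l rs) ts"
proof (induction "is" arbitrary: v)
  case Nil
  show ?case using assms by simp
next
  case (Cons i "is")
  then show ?case using shifts_combination[of "\<lambda>rs. downs l is (h rs)" l "- int i" v] by simp
qed

lemma nonneg_ups_combination: "\<exists>ts. \<forall>rs. nonneg_part l (ups l is (xchar l rs)) v = eval_terms (xchar l rs) ts"
proof (cases "\<forall>j<l. 0 \<le> v j")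
  case True
  show ?thesis unfolding nonneg_part_def if_P[OF True] by (rule ups_combination)
next
  case False
  show ?thesis unfolding nonneg_part_def if_not_P[OF False] by (intro exI[of _ "[]"]) simp
qed

lemma orthogonal_falling:
  assumes \<phi>: "orthogonal_to_all n \<phi>" and "sum_list (map Suc js) \<le> z" "xs = ys @ replicate z 0"
  shows "(\<Sum>g | g permutes {1..n}. \<phi> g * of_int (falling (map Suc js) (cycle_type g {1..n}) * lchar (cycle_type g {1..n}) (map int xs))) = 0"
proof -
  let ?l = "length xs"
  obtain ts where ts: "\<And>rs. downs ?l (map Suc js) (nonneg_part ?l (ups ?l (map Suc js) (xchar ?l rs))) (\<lambda>i. map (beta xs) [0..<?l] ! i)
      = eval_terms (xchar ?l rs) ts"
    using downs_combination[of "\<lambda>rs. nonneg_part ?l (ups ?l (map Suc js) (xchar ?l rs))" ?l "map Suc js", OF nonneg_ups_combination]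
    by blast
  have "(\<Sum>g | g permutes {1..n}. \<phi> g * of_int (falling (map Suc js) (cycle_type g {1..n}) * lchar (cycle_type g {1..n}) (map int xs)))
    = (\<Sum>g | g permutes {1..n}. \<phi> g * of_int (eval_terms (xchar ?l (cycle_type g {1..n})) ts))"
  proof (rule sum.cong[OF refl])
    fix g assume "g \<in> {g. g permutes {1..n}}"
    then have "0 \<notin> set (cycle_type g {1..n})" by (intro cycle_type_permutes) simp
    from falling_lchar_values[OF this assms(2,3), of "map (beta xs) [0..<?l]"]
    show "\<phi> g * of_int (falling (map Suc js) (cycle_type g {1..n}) * lchar (cycle_type g {1..n}) (map int xs))
      = \<phi> g * of_int (eval_terms (xchar ?l (cycle_type g {1..n})) ts)"
      by (simp add: at_values_def ts del: One_nat_def)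
  qed
  also have "\<dots> = 0"
  proof (induction ts)
    case (Cons t ts)
    obtain c v where t: "t = (c, v)" by (cases t)
    have "(\<Sum>g | g permutes {1..n}. \<phi> g * of_int (eval_terms (xchar ?l (cycle_type g {1..n})) (t # ts)))
      = of_int c * (\<Sum>g | g permutes {1..n}. \<phi> g * of_int (xchar ?l (cycle_type g {1..n}) v))
        + (\<Sum>g | g permutes {1..n}. \<phi> g * of_int (eval_terms (xchar ?l (cycle_type g {1..n})) ts))"
      unfolding t sum_distrib_left sum.distrib[symmetric] by (intro sum.cong refl) (simp add: algebra_simps)
    then show ?case using Cons orthogonal_xchar[OF \<phi>] by simp
  qed simp
  finally show ?thesis .
qed

text \<open>Six times the product is a combination of falling products times the character of
  \<open>\<mu>\<close>, and each of these is a combination of \<open>xchar\<close>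
  functions.\<close>

lemma orthogonal_product:
  assumes \<phi>: "orthogonal_to_all n \<phi>" and \<mu>: "sorted_wrt (\<ge>) \<mu>" "sum_list \<mu> = n" and n: "6 \<le> n"
  shows "(\<Sum>g | g permutes {1..n}. \<phi> g * (irr_char [n - 3, 3] g * irr_char \<mu> g)) = 0"
proof -
  let ?P = "{g. g permutes {1..n}}"
  let ?x = "\<lambda>g. lchar (cycle_type g {1..n}) (map int (\<mu> @ replicate 3 0))"
  let ?F = "\<lambda>js g. \<phi> g * of_int (falling (map Suc js) (cycle_type g {1..n}) * ?x g)"
  have F: "sum (?F js) ?P = 0" if "sum_list (map Suc js) \<le> 3" for js
    by (rule orthogonal_falling[OF \<phi> that refl])
  have "6 * (\<Sum>g\<in>?P. \<phi> g * (irr_char [n - 3, 3] g * irr_char \<mu> g))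
    = (\<Sum>g\<in>?P. ?F [0, 0, 0] g + 3 * ?F [0, 1] g + 2 * ?F [2] g - 3 * ?F [0, 0] g - 3 * ?F [1] g)"
    unfolding sum_distrib_left
  proof (rule sum.cong[OF refl])
    fix g assume "g \<in> ?P"
    then have g: "g permutes {1..n}" by simp
    have "?x g = lchar (cycle_type g {1..n}) (map int \<mu>)"
      by (rule lchar_pad[OF cycle_type_permutes(1)[OF g], of _ _ 3]) simp
    then have mu: "irr_char \<mu> g = of_int (?x g)" using irr_char_lchar[OF \<mu>(1)] \<mu>(2) g by simp
    have three: "irr_char [n - 3, 3] g = of_int (lchar (cycle_type g {1..n}) (map int [n - 3, 3]))"
      using irr_char_lchar[of "[n - 3, 3]" g] n g by simp
    have "6 * (\<phi> g * (irr_char [n - 3, 3] g * irr_char \<mu> g))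
      = \<phi> g * of_int ((6 * lchar (cycle_type g {1..n}) (map int [n - 3, 3])) * ?x g)"
      unfolding mu three by (simp only: of_int_mult of_int_numeral mult_ac)
    also have "\<dots> = ?F [0, 0, 0] g + 3 * ?F [0, 1] g + 2 * ?F [2] g - 3 * ?F [0, 0] g - 3 * ?F [1] g"
    proof -
      have "3 \<le> n" using n by simp
      show ?thesis unfolding three_three_expand[OF g \<open>3 \<le> n\<close>]
        by (simp only: of_int_mult of_int_add of_int_diff of_int_numeral algebra_simps)
    qed
    finally show "6 * (\<phi> g * (irr_char [n - 3, 3] g * irr_char \<mu> g)) = \<dots>" .
  qed
  also have "\<dots> = sum (?F [0, 0, 0]) ?P + 3 * sum (?F [0, 1]) ?P + 2 * sum (?F [2]) ?P - 3 * sum (?F [0, 0]) ?P - 3 * sum (?F [1]) ?P"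
    by (simp only: sum.distrib sum_subtractf sum_distrib_left)
  also have "\<dots> = 0"
  proof -
    have "sum_list (map Suc [0, 0, 0]) \<le> 3" "sum_list (map Suc [0, 1]) \<le> 3" "sum_list (map Suc [2]) \<le> 3"
      "sum_list (map Suc [0, 0]) \<le> 3" "sum_list (map Suc [1]) \<le> 3" by simp_all
    from this[THEN F] show ?thesis by (simp only:) simp
  qed
  finally show ?thesis by simp
qed

lemma irr_char_nonzero_rows:
  assumes "sorted_wrt (\<ge>) \<nu>"
  shows "irr_char (filter (\<lambda>x. x \<noteq> 0) \<nu>) = irr_char \<nu>"
proof
  fix g
  let ?\<mu> = "filter (\<lambda>x. x \<noteq> 0) \<nu>"
  have "\<exists>k. \<nu> = ?\<mu> @ replicate k 0" using assms
  proof (induction \<nu>)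
    case (Cons x \<nu>)
    show ?case
    proof (cases "x = 0")
      case True
      then have "\<forall>y\<in>set \<nu>. y = 0" using Cons.prems by auto
      then have "filter (\<lambda>x. x \<noteq> 0) (x # \<nu>) = []" "x # \<nu> = replicate (Suc (length \<nu>)) 0"
        using True by (auto simp: replicate_length_same)
      then show ?thesis by (metis append_Nil)
    qed (use Cons in auto)
  qed simp
  then obtain k where k: "\<nu> = ?\<mu> @ replicate k 0" by blast
  have sum: "sum_list ?\<mu> = sum_list \<nu>" by (induction \<nu>) auto
  have "pchar (sum_list \<nu>) ?\<mu> g = pchar (sum_list \<nu>) \<nu> g"
  proof (cases "g permutes {1..sum_list \<nu>}")
    case True
    have "lchar (cycle_type g {1..sum_list \<nu>}) (map int \<nu>) = lchar (cycle_type g {1..sum_list \<nu>}) (map int ?\<mu>)"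
      by (rule lchar_pad[OF cycle_type_permutes(1)[OF True], of _ _ k]) (subst k, simp)
    then show ?thesis by (simp add: pchar_def)
  qed (simp add: pchar_def)
  then show "irr_char ?\<mu> g = irr_char \<nu> g"
    using irr_char_pchar[of \<nu> "sum_list \<nu>" g] irr_char_pchar[of ?\<mu> "sum_list \<nu>" g] assms sum sorted_wrt_filter by metis
qed

section \<open>Multiplicity-free products\<close>

lemma char_inner_cnj:
  assumes "\<And>g. cnj (\<chi> g) = \<chi> g"
  shows "char_inner (sym_group n) \<chi> \<phi> = cnj (\<Sum>g | g permutes {1..n}. \<phi> g * \<chi> g) / fact n"
proof -
  have "carrier (sym_group n) = {g. g permutes {1..n}}" by (simp add: sym_group_def)
  then show ?thesis using assms by (simp add: char_inner_def order_sym_group mult.commute del: One_nat_def)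
qed

lemma irr_char_cnj: "sorted_wrt (\<ge>) \<mu> \<Longrightarrow> cnj (irr_char \<mu> g) = irr_char \<mu> g"
  using irr_char_pchar[of \<mu> "sum_list \<mu>" g] by simp

lemma char_inner_overlap:
  assumes "sorted_wrt (\<ge>) \<mu>" "sum_list \<mu> = n" "sorted_wrt (\<ge>) \<nu>" "sum_list \<nu> = n" "6 \<le> n"
  shows "char_inner (sym_group n) (irr_char [n - 3, 3] * irr_char \<mu>) (irr_char \<nu>) = of_int (overlap_partitions \<mu> \<nu>) / 6"
proof -
  have "sorted_wrt (\<ge>) [n - 3, 3]" using assms(5) by simp
  then have inner: "char_inner (sym_group n) (irr_char [n - 3, 3] * irr_char \<mu>) (irr_char \<nu>)
    = cnj (\<Sum>g | g permutes {1..n}. irr_char \<nu> g * (irr_char [n - 3, 3] * irr_char \<mu>) g) / fact n"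
    by (intro char_inner_cnj) (simp add: irr_char_cnj assms)
  have "(\<Sum>g | g permutes {1..n}. irr_char \<nu> g * (irr_char [n - 3, 3] * irr_char \<mu>) g)
    = (\<Sum>g | g permutes {1..n}. irr_char [n - 3, 3] g * irr_char \<mu> g * irr_char \<nu> g)"
    by (simp only: times_fun_apply mult_ac)
  also have "\<dots> = fact n * of_int (overlap_partitions \<mu> \<nu>) / 6"
    using sum_irr_char_overlap[OF assms] by (simp add: field_simps)
  finally have S: "(\<Sum>g | g permutes {1..n}. irr_char \<nu> g * (irr_char [n - 3, 3] * irr_char \<mu>) g)
    = fact n * of_int (overlap_partitions \<mu> \<nu>) / 6" .
  show ?thesis unfolding inner S by simp
qed

text \<open>An irreducible character of the form \<open>[\<nu>]\<close> has a sixth of the overlap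
  as multiplicity, hence 0 or 1. Any other irreducible character is orthogonal to every
  \<open>[\<nu>]\<close> by \<open>irr_chars_dichotomy\<close>, hence to the product.\<close>

lemma multiplicity_free_overlap:
  assumes \<mu>: "\<mu> \<turnstile> n" and n: "6 \<le> n"
    and small: "\<And>\<nu>. \<nu> \<turnstile> n \<Longrightarrow> overlap_partitions \<mu> \<nu> = 0 \<or> overlap_partitions \<mu> \<nu> = 6"
  shows "multiplicity_free (sym_group n) (irr_char [n - 3, 3] * irr_char \<mu>)"
  unfolding multiplicity_free_def
proof
  fix \<phi> assume \<phi>: "\<phi> \<in> irr_chars (sym_group n)"
  let ?c = "char_inner (sym_group n) (irr_char [n - 3, 3] * irr_char \<mu>) \<phi>"
  have mu: "sorted_wrt (\<ge>) \<mu>" "sum_list \<mu> = n" using \<mu> by (simp_all add: partition_of_def)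
  show "\<exists>m::nat\<le>1. ?c = of_nat m"
  proof (cases "\<exists>\<nu>. \<nu> \<turnstile> n \<and> \<phi> = irr_char \<nu>")
    case True
    then obtain \<nu> where \<nu>: "\<nu> \<turnstile> n" "\<phi> = irr_char \<nu>" by blast
    then have "?c = of_int (overlap_partitions \<mu> \<nu>) / 6"
      using char_inner_overlap[OF mu _ _ n] by (simp add: partition_of_def)
    then have "?c = of_nat 0 \<or> ?c = of_nat 1" using small[OF \<nu>(1)] by auto
    then show ?thesis by (metis le_refl zero_le_one)
  next
    case False
    have "orthogonal_to_all n \<phi>"
      unfolding orthogonal_to_all_def
    proof (intro allI impI)
      fix \<nu> assume \<nu>: "sorted_wrt (\<ge>) \<nu> \<and> sum_list \<nu> = n"
      interpret diagram \<nu> by unfold_locales (use \<nu> in blast)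
      \<comment> \<open>Dropping zero rows does not change the character, so a weakly decreasing
        list reduces to an honest partition.\<close>
      have "sum_list (filter (\<lambda>x. x \<noteq> 0) \<nu>) = sum_list \<nu>" by (induction \<nu>) auto
      then have "filter (\<lambda>x. x \<noteq> 0) \<nu> \<turnstile> n" using \<nu> by (simp add: partition_of_def sorted_wrt_filter)
      then have "\<phi> \<noteq> irr_char \<nu>" using False irr_char_nonzero_rows \<nu> by metis
      then show "(\<Sum>g | g permutes {1..n}. \<phi> g * irr_char \<nu> g) = 0"
        using irr_chars_dichotomy \<phi> \<nu> by blast
    qed
    from orthogonal_product[OF this mu n]
    have "(\<Sum>g | g permutes {1..n}. \<phi> g * (irr_char [n - 3, 3] * irr_char \<mu>) g) = 0" by (simp only: times_fun_apply)
    moreover have "sorted_wrt (\<ge>) [n - 3, 3]" using n by simp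
    then have "?c = cnj (\<Sum>g | g permutes {1..n}. \<phi> g * (irr_char [n - 3, 3] * irr_char \<mu>) g) / fact n"
      by (intro char_inner_cnj) (simp add: irr_char_cnj mu)
    ultimately have "?c = of_nat 0" by simp
    then show ?thesis by blast
  qed
qed

lemma not_multiplicity_free_overlap:
  assumes \<mu>: "\<mu> \<turnstile> n" and n: "6 \<le> n" and \<nu>: "sorted_wrt (\<ge>) \<nu>" "sum_list \<nu> = n" and "12 \<le> overlap_partitions \<mu> \<nu>"
  shows "\<not> multiplicity_free (sym_group n) (irr_char [n - 3, 3] * irr_char \<mu>)"
proof
  assume free: "multiplicity_free (sym_group n) (irr_char [n - 3, 3] * irr_char \<mu>)"
  interpret diagram \<nu> by unfold_locales (rule \<nu>(1))
  have mu: "sorted_wrt (\<ge>) \<mu>" "sum_list \<mu> = n" using \<mu> by (simp_all add: partition_of_def)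
  have "irr_char \<nu> \<in> irr_chars (sym_group n)" using irr_char_in_irr_chars \<nu>(2) by simp
  with free have "\<exists>m::nat\<le>1. char_inner (sym_group n) (irr_char [n - 3, 3] * irr_char \<mu>) (irr_char \<nu>) = of_nat m"
    unfolding multiplicity_free_def by (rule bspec)
  then obtain m :: nat where m: "m \<le> 1" "of_int (overlap_partitions \<mu> \<nu>) / 6 = (of_nat m :: complex)"
    unfolding char_inner_overlap[OF mu \<nu> n] by (elim exE conjE)
  have "complex_of_int (overlap_partitions \<mu> \<nu>) = of_int (6 * int m)" using m(2) by (simp add: field_simps)
  then have "overlap_partitions \<mu> \<nu> = 6 * int m" by (simp only: of_int_eq_iff)
  then show False using m(1) assms(5) by simp
qed

section \<open>The finite check\<close>

lemma bounded_partitions_complete: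
  "sorted_wrt (\<ge>) \<mu> \<Longrightarrow> 0 \<notin> set \<mu> \<Longrightarrow> sum_list \<mu> = n \<Longrightarrow> \<forall>x\<in>set \<mu>. x \<le> m \<Longrightarrow> \<mu> \<in> set (bounded_partitions m n)"
proof (induction m n arbitrary: \<mu> rule: bounded_partitions.induct)
  case (1 n)
  then have "\<mu> = []" by (cases \<mu>) auto
  then show ?case using 1 by simp
next
  case (2 m n)
  show ?case
  proof (cases "\<exists>\<nu>. \<mu> = Suc m # \<nu>")
    case True
    then obtain \<nu> where \<nu>: "\<mu> = Suc m # \<nu>" by blast
    then have "Suc m \<le> n" using 2(5) by simp
    moreover have "\<nu> \<in> set (bounded_partitions (Suc m) (n - Suc m))"
      by (rule 2(1)[OF calculation]) (use 2(3-6) \<nu> in auto)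
    ultimately show ?thesis using \<nu> by (subst bounded_partitions.simps) (simp del: bounded_partitions.simps)
  next
    case False
    have "\<forall>x\<in>set \<mu>. x \<le> m"
    proof (cases \<mu>)
      case (Cons y \<nu>)
      have "y \<le> Suc m" "y \<noteq> Suc m" using 2(6) False Cons by auto
      then have "y \<le> m" by simp
      then show ?thesis using 2(3) Cons by fastforce
    qed simp
    then have "\<mu> \<in> set (bounded_partitions m n)" by (rule 2(2)[OF 2(3-5)])
    then show ?thesis by (subst bounded_partitions.simps) (simp del: bounded_partitions.simps)
  qed
qed

lemma partition_in_bounded_partitions: "\<mu> \<turnstile> n \<Longrightarrow> \<mu> \<in> set (bounded_partitions n n)"
  by (intro bounded_partitions_complete) (auto simp: partition_of_def member_le_sum_list)

lemma some_repeated_sound: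
  "some_repeated n \<mu> \<nu>s \<Longrightarrow> \<exists>\<nu>. sorted_wrt (\<ge>) \<nu> \<and> sum_list \<nu> = n \<and> 12 \<le> overlap_partitions \<mu> \<nu>"
  by (induction n \<mu> \<nu>s rule: some_repeated.induct) (auto split: if_splits)

lemma check_partitions_sound:
  assumes "check_partitions n" "6 \<le> n" "\<mu> \<turnstile> n"
    and "\<not> up_to_conjugation \<mu> ({[n], [n - 1, 1]} \<union> {[k, k] | k. n = 2 * k})" "sum_list (conjugate \<mu>) = n"
  shows "multiplicity_free (sym_group n) (irr_char [n - 3, 3] * irr_char \<mu>) \<longleftrightarrow>
    up_to_conjugation \<mu> {[4, 2], [4, 1, 1], [4, 3], [3, 3, 3]}"
proof -
  let ?ps = "[[4, 2], [4, 1, 1], [4, 3], [3, 3, 3]] :: nat list list"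
  have check: "check_partition n ?ps \<mu>"
    using assms(1) partition_in_bounded_partitions[OF assms(3)] by (auto simp: check_partitions_def list_all_iff)
  have ps: "up_to_conjugation \<mu> {[4, 2], [4, 1, 1], [4, 3], [3, 3, 3]} \<longleftrightarrow> \<mu> \<in> set ?ps \<or> conjugate \<mu> \<in> set ?ps"
    by (simp add: up_to_conjugation_def)
  \<comment> \<open>\<open>is_excluded\<close> accepts any two equal rows; together with the size
    \<open>n\<close> this means \<open>[k, k]\<close> with \<open>n = 2 * k\<close>, for the
    conjugate partition as well.\<close>
  have excl: "\<nu> \<in> {[n], [n - 1, 1]} \<union> {[k, k] | k. n = 2 * k}" if "is_excluded n \<nu>" "sum_list \<nu> = n" for \<nu>
    using that by (auto simp: is_excluded_def split: list.splits)
  have repeated: "\<not> multiplicity_free (sym_group n) (irr_char [n - 3, 3] * irr_char \<mu>)" if "some_repeated n \<mu> \<nu>s" for \<nu>s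
    using some_repeated_sound[OF that] not_multiplicity_free_overlap[OF assms(3,2)] by blast
  have not_excluded: "\<not> is_excluded n \<mu>" "\<not> is_excluded n (conjugate \<mu>)"
    using excl assms(3-5) unfolding up_to_conjugation_def partition_of_def by blast+
  show ?thesis
  proof (cases "some_repeated n \<mu> [\<mu>]")
    case True
    have "\<not> (\<mu> \<in> set ?ps \<or> conjugate \<mu> \<in> set ?ps)" using check unfolding check_partition_def if_P[OF True] by blast
    then show ?thesis using repeated[OF True] unfolding ps by blast
  next
    case self: False
    show ?thesis
    proof (cases "\<mu> \<in> set ?ps \<or> conjugate \<mu> \<in> set ?ps")
      case True
      have "overlap_partitions \<mu> \<nu> = 0 \<or> overlap_partitions \<mu> \<nu> = 6" if "\<nu> \<turnstile> n" for \<nu>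
        using check partition_in_bounded_partitions[OF that]
        unfolding check_partition_def if_not_P[OF self] if_P[OF True] list_all_iff by blast
      then show ?thesis using multiplicity_free_overlap[OF assms(3,2)] True unfolding ps by blast
    next
      case False
      have "some_repeated n \<mu> (neighbours \<mu>)"
        using check not_excluded unfolding check_partition_def if_not_P[OF self] if_not_P[OF False] by blast
      then show ?thesis using repeated False unfolding ps by blast
    qed
  qed
qed

text \<open>Double counting of the cells, by columns and by rows.\<close>

lemma sum_conjugate:
  assumes "\<mu> \<turnstile> n" shows "sum_list (conjugate \<mu>) = n"
proof (cases \<mu>)
  case Nil
  then show ?thesis using assms by (simp add: conjugate_def partition_of_def)
next
  case (Cons y \<nu>)
  have le: "p \<le> y" if "p \<in> set \<mu>" for p using assms that Cons by (auto simp: partition_of_def)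
  have "sum_list (conjugate \<mu>) = (\<Sum>c<y. length (filter (\<lambda>p. c < p) \<mu>))"
    using Cons by (simp add: conjugate_def interv_sum_list_conv_sum_set_nat atLeast0LessThan)
  also have "\<dots> = (\<Sum>c<y. \<Sum>p\<leftarrow>\<mu>. of_bool (c < p))"
    by (intro sum.cong refl) (induction \<mu>, auto)
  also have "\<dots> = (\<Sum>p\<leftarrow>\<mu>. \<Sum>c<y. of_bool (c < p))"
    by (induction \<mu>) (auto simp: sum.distrib)
  also have "\<dots> = (\<Sum>p\<leftarrow>\<mu>. p)"
  proof (intro arg_cong[where f = sum_list] map_cong refl)
    fix p assume "p \<in> set \<mu>"
    then have "p \<le> y" by (rule le)
    then have "{..<y} \<inter> {c. c < p} = {..<p}" by auto
    then show "(\<Sum>c<y. of_bool (c < p)) = p" by (simp add: sum.If_cases of_bool_def)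
  qed
  finally show ?thesis using assms by (simp add: partition_of_def)
qed

lemma check_partitions_6: "check_partitions 6"
  by code_simp

lemma check_partitions_7: "check_partitions 7"
  by code_simp

lemma check_partitions_8: "check_partitions 8"
  by code_simp

lemma check_partitions_9: "check_partitions 9"
  by code_simp

lemma check_partitions_10: "check_partitions 10"
  by code_simp

lemma check_partitions_11: "check_partitions 11"
  by code_simp

lemma check_partitions_12: "check_partitions 12"
  by code_simp

lemma check_partitions_13: "check_partitions 13"
  by code_simp

lemma check_partitions_14: "check_partitions 14"
  by code_simp

lemma check_partitions_15: "check_partitions 15"
  by code_simp

lemma check_partitions_16: "check_partitions 16"
  by code_simp

lemma check_partitions_upto:
  assumes "6 \<le> n" "n \<le> 16" shows "check_partitions n"
proof -
  have "n \<in> {6, 7, 8, 9, 10, 11, 12, 13, 14, 15, 16}" using assms by simp presburger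
  then show ?thesis
    using check_partitions_6 check_partitions_7 check_partitions_8 check_partitions_9 check_partitions_10 check_partitions_11 check_partitions_12 check_partitions_13 check_partitions_14 check_partitions_15 check_partitions_16 by blast
qed

theorem proposition3p6:
  shows
  "(\<forall>n a b :: nat. n = a * b \<and> n \<ge> 6 \<and> a > 1 \<and> b > 1 \<longrightarrow>
      irr_char [n - 2, 2] * irr_char (replicate b a) =
        irr_char (replicate b a)
      + (if a > 2 then irr_char (replicate (b - 1) a @ [a - 1, 1]) else 0)
      + irr_char (replicate (b - 2) a @ [a - 1, a - 1, 1, 1])
      + (if b > 3 then irr_char ([a + 1, a + 1] @ replicate (b - 4) a @ [a - 1, a - 1]) else 0)
      + (if b > 2 then irr_char ([a + 1] @ replicate (b - 2) a @ [a - 1]) else 0)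
      + (if b > 2 then irr_char ([a + 1] @ replicate (b - 3) a @ [a - 1, a - 1, 1]) else 0)
      + irr_char ([a + 2] @ replicate (b - 2) a @ [a - 2])
      + (if a > 2 then irr_char ([a + 1] @ replicate (b - 2) a @ [a - 2, 1]) else 0)
      + (if a > 3 then irr_char (replicate (b - 1) a @ [a - 2, 2]) else 0))
 \<and> (\<forall>n a b :: nat. n = a * b \<and> a \<ge> b \<and> b > 1 \<longrightarrow>
      irr_char [n - 2, 1, 1] * irr_char (replicate b a) =
        (if b > 2 then irr_char ([a + 2] @ replicate (b - 3) a @ [a - 1, a - 1]) else 0)
      + irr_char ([a + 1] @ replicate (b - 2) a @ [a - 1])
      + irr_char ([a + 1] @ replicate (b - 2) a @ [a - 2, 1])
      + irr_char (replicate (b - 2) a @ [a - 1, a - 1, 2])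
      + (if b > 2 then irr_char ([a + 1] @ replicate (b - 3) a @ [a - 1, a - 1, 1]) else 0)
      + (if b > 2 then irr_char ([a + 1, a + 1] @ replicate (b - 3) a @ [a - 2]) else 0)
      + irr_char (replicate (b - 1) a @ [a - 2, 1, 1])
      + irr_char (replicate (b - 1) a @ [a - 1, 1]))
 \<and> (\<forall>n k :: nat. n = 2 * k \<and> n > 16 \<longrightarrow>
      irr_char [n - 3, 3] * irr_char [k, k] =
        irr_char [k + 1, k - 1] + irr_char [k + 1, k - 2, 1] + irr_char [k, k - 1, 1]
      + irr_char [k, k - 2, 1, 1] + irr_char [k, k - 2, 2] + irr_char [k, k - 3, 3]
      + irr_char [k - 1, k - 1, 2] + irr_char [k - 1, k - 2, 2, 1] + irr_char [k + 3, k - 3]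
      + irr_char [k + 2, k - 3, 1] + irr_char [k + 1, k - 3, 2])
 \<and> (\<forall>n :: nat. \<forall>\<mu>. 6 \<le> n \<and> n \<le> 16 \<and> \<mu> \<turnstile> n
      \<and> \<not> up_to_conjugation \<mu> ({[n], [n - 1, 1]} \<union> {[k, k] | k. n = 2 * k}) \<longrightarrow>
        (multiplicity_free (sym_group n) (irr_char [n - 3, 3] * irr_char \<mu>) \<longleftrightarrow>
         up_to_conjugation \<mu> {[4, 2], [4, 1, 1], [4, 3], [3, 3, 3]}))"
proof (intro conjI allI impI, goal_cases)
  case (1 n a b)
  show ?case by (rule two_two_times_rectangle) (use 1 in blast)+
next
  case (2 n a b)
  show ?case by (rule two_one_one_times_rectangle) (use 2 in blast)+
next
  case (3 n k)
  show ?case by (rule three_three_times_two_rows) (use 3 in blast)+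
next
  case (4 n \<mu>)
  then have n: "6 \<le> n" "n \<le> 16" and \<mu>: "\<mu> \<turnstile> n"
    and excl: "\<not> up_to_conjugation \<mu> ({[n], [n - 1, 1]} \<union> {[k, k] | k. n = 2 * k})" by blast+
  show ?case by (rule check_partitions_sound[OF check_partitions_upto[OF n] n(1) \<mu> excl sum_conjugate[OF \<mu>]])
qed

end
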